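(* Let $G$ be a non-trivial finite group of order $n$, let $\Gamma=\mathcal G(\mathcal C(G))$ be the group generated by the Cayley machine of $G$, let $S=\{\mathcal C(G)_g,\ \mathcal C(G)_g^{-1}\mid g\in G\}$, and let $P$ be a parabolic subgroup of $\Gamma$. Then the KNS spectral measure $\mu$ for the Schreier graph $\mathrm{Sch}(\Gamma,P,S)$ is the discrete measure $$\mu=(n-1)^2\sum_{q=2}^{\infty}\ \sum_{1\le p<q,\ (p,q)=1}\frac{1}{n^q-1}\,\delta_{\cos\frac pq\pi}.$$ Moreover, the following equalities of spectra of Hecke-type operators hold: $$[-1,1]=\mathrm{Sp}(H_\pi)=\mathrm{Sp}(H_{\lambda_{\Gamma/P}})=\mathrm{Sp}(H_{\lambda_\Gamma}),$$ so the Markov operator for the simple random walk on the Cayley graph of $\Gamma$ (with respect to $S$) has spectrum $[-1,1]$. If $G$ is abelian, then $\Gamma\cong G\,\mathrm{wr}\,\mathbb Z$, and the measure $(n-1)^2\sum_{q=2}^{\infty}\ \sum_{1\le p<q,\ (p,q)=1}\frac{1}{n^q-1}\,\delta_{\cos\frac pq\pi}$ is the Kesten spectral measure of the Markov operator for the simple random walk on the Cayley graph of $G\,\mathrm{wr}\,\mathbb Z$ with respect to the automaton generators $S$.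
   Context: The Cayley machine $\mathcal C(G)$ is the Mealy automaton with state set and alphabet $G$ which, in state $g$ on input $a$, outputs $ga$ and moves to state $ga$. Thus state $g$ computes the length-preserving, prefix-preserving bijection $\mathcal C(G)_g(a_0,a_1,\dots,a_m)=(ga_0,ga_0a_1,\dots,ga_0a_1\cdots a_m)$ of words over $G$, extended by the same formula to the set $G^\omega$ of right-infinite words. $\Gamma=\mathcal G(\mathcal C(G))$ is the group of transformations generated by the $\mathcal C(G)_g$, $g\in G$; it acts transitively on the words of each fixed length. $|S|=2n$. A parabolic subgroup is the stabilizer $P=\mathrm{St}_\Gamma(w)$ of some $w\in G^\omega$; for $k\ge0$ let $P_k$ be the stabilizer of the length-$k$ prefix of $w$ (of index $n^k$). For $Q\le\Gamma$, the Schreier graph $\mathrm{Sch}(\Gamma,Q,S)$ has vertices the left cosets $\Gamma/Q$ and, for each $s\in S$, an edge from $gQ$ to $sgQ$; its Markov operator on $\ell^2(\Gamma/Q)$ is $f\mapsto\big(gQ\mapsto\frac1{|S|}\sum_{s\in S}f(sgQ)\big)$. The KNS (Kesten--von Neumann--Serre) spectral measure of $\mathrm{Sch}(\Gamma,P,S)$ is taken with respect to the approximating sequence $\mathrm{Sch}(\Gamma,P_k,S)$: it is the weak limit as $k\to\infty$ of $\mu_k=\sum_{\lambda}\frac{\#_k(\lambda)}{n^k}\delta_\lambda$, where $\lambda$ runs over the eigenvalues of the Markov operator $M_k$ of $\mathrm{Sch}(\Gamma,P_k,S)$, $\#_k(\lambda)$ is the multiplicity of $\lambda$, and $\delta_\lambda$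 is the Dirac measure. For a unitary representation $\rho$ of $\Gamma$, the Hecke-type operator is $H_\rho=\frac1{|S|}\sum_{s\in S}\rho(s)$. Here $\pi$ is the representation on $L^2(G^\omega,\nu)$ given by $\pi(\gamma)f(x)=f(\gamma^{-1}x)$, with $\nu$ the uniform product probability measure on $G^\omega$; $\lambda_{\Gamma/P}$ is the quasi-regular representation on $\ell^2(\Gamma/P)$; $\lambda_\Gamma$ is the left regular representation on $\ell^2(\Gamma)$. $\mathrm{Sp}$ denotes the spectrum. $G\,\mathrm{wr}\,\mathbb Z=\left(\bigoplus_{\mathbb Z}G\right)\rtimes\mathbb Z$ with $\mathbb Z$ acting by the shift. The Kesten spectral measure of the random walk on the Cayley graph of a group $\Lambda$ is $B\mapsto\langle E(B)\delta_1,\delta_1\rangle$, where $E$ is the projection-valued spectral measure of the (self-adjoint) Markov operator on $\ell^2(\Lambda)$ and $\delta_1$ is the characteristic function of the identity. *)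

theory Defs
  imports
    "HOL-Algebra.Bij"
    "HOL-Algebra.Group_Action"
    "HOL-Algebra.Left_Coset"
    "HOL-Algebra.Product_Groups"
    "HOL-Probability.Probability"
    "HOL-Library.Function_Algebras"
begin

section \<open>Mealy automata and the Cayley machine\<close>

record ('q, 'a) mealy =
  states :: "'q set"
  alphabet :: "'a set"
  next_state :: "'q \<Rightarrow> 'a \<Rightarrow> 'q"
  output_letter :: "'q \<Rightarrow> 'a \<Rightarrow> 'a"

fun run :: "('q, 'a) mealy \<Rightarrow> 'q \<Rightarrow> 'a list \<Rightarrow> 'a list" where
  "run A q [] = []"
| "run A q (a # u) = output_letter A q a # run A (next_state A q a) u"

text \<open>
  The functions are made extensional on the set of finite words, because \<^const>\<open>BijGroup\<close>
  consists of extensional bijections.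
\<close>

definition state_map :: "('q, 'a) mealy \<Rightarrow> 'q \<Rightarrow> 'a list \<Rightarrow> 'a list" where
  "state_map A q = restrict (run A q) (lists (alphabet A))"

definition automaton_group :: "('q, 'a) mealy \<Rightarrow> ('a list \<Rightarrow> 'a list) monoid" where
  "automaton_group A =
     subgroup_generated (BijGroup (lists (alphabet A))) (state_map A ` states A)"

definition automaton_gens :: "('q, 'a) mealy \<Rightarrow> ('a list \<Rightarrow> 'a list) set" where
  "automaton_gens A =
     state_map A ` states A \<union> (\<lambda>q. inv\<^bsub>automaton_group A\<^esub> (state_map A q)) ` states A"

definition cayley_machine :: "('g, 'm) monoid_scheme \<Rightarrow> ('g, 'g) mealy" where
  "cayley_machine G =
     \<lparr>states = carrier G, alphabet = carrier G,
      next_state = (\<lambda>g a. g \<otimes>\<^bsub>G\<^esub> a), output_letter = (\<lambda>g a. g \<otimes>\<^bsub>G\<^esub> a)\<rparr>"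

section \<open>The action on infinite words\<close>

definition prefix_word :: "nat \<Rightarrow> (nat \<Rightarrow> 'a) \<Rightarrow> 'a list" where
  "prefix_word k x = map x [0..<k]"

text \<open>
  Extension of a length- and prefix-preserving map on finite words to infinite words:
  the letter of the image at position \<open>i\<close> is read off from the image of any longer prefix.
\<close>

definition act_inf :: "('a list \<Rightarrow> 'a list) \<Rightarrow> (nat \<Rightarrow> 'a) \<Rightarrow> nat \<Rightarrow> 'a" where
  "act_inf \<gamma> x = (\<lambda>i. \<gamma> (prefix_word (Suc i) x) ! i)"

text \<open>
  Check against the closed formula: state \<open>g\<close> of the Cayley machine sends
  \<open>(a\<^sub>0, a\<^sub>1, \<dots>)\<close> to \<open>(g a\<^sub>0, g a\<^sub>0 a\<^sub>1, \<dots>)\<close>.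
\<close>

lemma run_cayley_machine_nth:
  assumes "i < length u"
  shows "run (cayley_machine G) g u ! i = foldl (monoid.mult G) g (take (Suc i) u)"
  using assms
proof (induction u arbitrary: g i)
  case (Cons a u)
  then show ?case by (cases i) (auto simp: cayley_machine_def)
qed simp

lemma act_inf_cayley_machine:
  assumes "\<And>i. x i \<in> carrier G"
  shows "act_inf (state_map (cayley_machine G) g) x i
       = foldl (monoid.mult G) g (prefix_word (Suc i) x)"
proof -
  have "prefix_word (Suc i) x \<in> lists (alphabet (cayley_machine G))"
    using assms by (auto simp: prefix_word_def cayley_machine_def)
  then show ?thesis
    unfolding act_inf_def state_map_def
    by (simp add: run_cayley_machine_nth prefix_word_def del: upt_Suc)
qed

definition parabolic :: "('a list \<Rightarrow> 'a list) monoid \<Rightarrow> (nat \<Rightarrow> 'a) \<Rightarrow> ('a list \<Rightarrow> 'a list) set" where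
  "parabolic \<Gamma> w = stabilizer \<Gamma> act_inf w"

definition prefix_stabilizer ::
  "('a list \<Rightarrow> 'a list) monoid \<Rightarrow> (nat \<Rightarrow> 'a) \<Rightarrow> nat \<Rightarrow> ('a list \<Rightarrow> 'a list) set" where
  "prefix_stabilizer \<Gamma> w k = stabilizer \<Gamma> (\<lambda>\<gamma>. \<gamma>) (prefix_word k w)"

definition uniform_word_measure :: "'a set \<Rightarrow> (nat \<Rightarrow> 'a) measure" where
  "uniform_word_measure A = PiM UNIV (\<lambda>_. uniform_count_measure A)"

section \<open>Bounded operators and spectra on complex \<open>L\<^sup>2\<close> spaces\<close>

text \<open>
  Elements of \<open>L\<^sup>2(M)\<close> are represented by square-integrable functions, and equality in
  \<open>L\<^sup>2(M)\<close> is equality almost everywhere. For \<open>M = count_space X\<close> this is \<open>\<ell>\<^sup>2(X)\<close>, with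
  equality of functions on \<open>X\<close>.
\<close>

definition L2 :: "'x measure \<Rightarrow> ('x \<Rightarrow> complex) set" where
  "L2 M = {f \<in> borel_measurable M. integrable M (\<lambda>x. (cmod (f x))\<^sup>2)}"

definition L2_inner :: "'x measure \<Rightarrow> ('x \<Rightarrow> complex) \<Rightarrow> ('x \<Rightarrow> complex) \<Rightarrow> complex" where
  "L2_inner M f g = (LINT x|M. f x * cnj (g x))"

definition L2_norm :: "'x measure \<Rightarrow> ('x \<Rightarrow> complex) \<Rightarrow> real" where
  "L2_norm M f = sqrt (LINT x|M. (cmod (f x))\<^sup>2)"

text \<open>
  Linearity together with boundedness implies that such a map sends functions that are equal
  almost everywhere to functions that are equal almost everywhere.
\<close>

definition L2_bounded_operator ::
  "'x measure \<Rightarrow> (('x \<Rightarrow> complex) \<Rightarrow> ('x \<Rightarrow> complex)) \<Rightarrow> bool" where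
  "L2_bounded_operator M T \<longleftrightarrow>
     (\<forall>f\<in>L2 M. T f \<in> L2 M) \<and>
     (\<forall>f\<in>L2 M. \<forall>g\<in>L2 M. AE x in M. T (\<lambda>y. f y + g y) x = T f x + T g x) \<and>
     (\<forall>f\<in>L2 M. \<forall>c. AE x in M. T (\<lambda>y. c * f y) x = c * T f x) \<and>
     (\<exists>K. \<forall>f\<in>L2 M. L2_norm M (T f) \<le> K * L2_norm M f)"

definition L2_spectrum :: "'x measure \<Rightarrow> (('x \<Rightarrow> complex) \<Rightarrow> ('x \<Rightarrow> complex)) \<Rightarrow> complex set" where
  "L2_spectrum M T =
     {z. \<not> (\<exists>R. L2_bounded_operator M R \<and>
              (\<forall>f\<in>L2 M. AE x in M. R (\<lambda>y. T f y - z * f y) x = f x) \<and>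
              (\<forall>f\<in>L2 M. AE x in M. T (R f) x - z * R f x = f x))}"

text \<open>
  \<open>E\<close> is the projection-valued spectral measure of the bounded self-adjoint operator \<open>T\<close>:
  every \<open>E B\<close> is an orthogonal projection (idempotent by the intersection law with
  \<open>A = B\<close>), every \<open>B \<mapsto> \<langle>E B f, f\<rangle>\<close> is a finite Borel measure \<open>m\<close> (hence, by polarization,
  \<open>E\<close> is countably additive in the strong operator topology), and \<open>T = \<integral> t dE(t)\<close>.
\<close>

definition is_spectral_measure ::
  "'x measure \<Rightarrow> (('x \<Rightarrow> complex) \<Rightarrow> ('x \<Rightarrow> complex)) \<Rightarrow>
   (real set \<Rightarrow> ('x \<Rightarrow> complex) \<Rightarrow> ('x \<Rightarrow> complex)) \<Rightarrow> bool" where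
  "is_spectral_measure M T E \<longleftrightarrow>
     (\<forall>B\<in>sets borel. L2_bounded_operator M (E B)) \<and>
     (\<forall>B\<in>sets borel. \<forall>f\<in>L2 M. \<forall>g\<in>L2 M. L2_inner M (E B f) g = L2_inner M f (E B g)) \<and>
     (\<forall>A\<in>sets borel. \<forall>B\<in>sets borel. \<forall>f\<in>L2 M. AE x in M. E (A \<inter> B) f x = E A (E B f) x) \<and>
     (\<forall>f\<in>L2 M. AE x in M. E UNIV f x = f x) \<and>
     (\<forall>f\<in>L2 M. \<exists>m. finite_measure m \<and> sets m = sets borel \<and>
        (\<forall>B\<in>sets borel. L2_inner M (E B f) f = complex_of_real (measure m B)) \<and>
        integrable m (\<lambda>t. t) \<and>
        L2_inner M (T f) f = complex_of_real (LINT t|m. t))"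

section \<open>Representations, Hecke-type operators and Markov operators\<close>

definition hecke :: "'s set \<Rightarrow> ('s \<Rightarrow> ('x \<Rightarrow> complex) \<Rightarrow> ('x \<Rightarrow> complex)) \<Rightarrow>
    ('x \<Rightarrow> complex) \<Rightarrow> ('x \<Rightarrow> complex)" where
  "hecke S \<rho> f = (\<lambda>x. (\<Sum>s\<in>S. \<rho> s f x) / of_nat (card S))"

definition word_rep :: "('a list \<Rightarrow> 'a list) monoid \<Rightarrow> ('a list \<Rightarrow> 'a list) \<Rightarrow>
    ((nat \<Rightarrow> 'a) \<Rightarrow> complex) \<Rightarrow> ((nat \<Rightarrow> 'a) \<Rightarrow> complex)" where
  "word_rep \<Gamma> \<gamma> f = (\<lambda>x. f (act_inf (inv\<^bsub>\<Gamma>\<^esub> \<gamma>) x))"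

definition quasi_regular_rep :: "('s, 'm) monoid_scheme \<Rightarrow> 's \<Rightarrow>
    ('s set \<Rightarrow> complex) \<Rightarrow> ('s set \<Rightarrow> complex)" where
  "quasi_regular_rep \<Gamma> \<gamma> f = (\<lambda>C. f ((inv\<^bsub>\<Gamma>\<^esub> \<gamma>) <#\<^bsub>\<Gamma>\<^esub> C))"

definition left_regular_rep :: "('s, 'm) monoid_scheme \<Rightarrow> 's \<Rightarrow>
    ('s \<Rightarrow> complex) \<Rightarrow> ('s \<Rightarrow> complex)" where
  "left_regular_rep \<Gamma> \<gamma> f = (\<lambda>x. f ((inv\<^bsub>\<Gamma>\<^esub> \<gamma>) \<otimes>\<^bsub>\<Gamma>\<^esub> x))"

text \<open>
  The Markov operator of the Schreier graph, whose vertices are the left cosets \<open>lcosets\<^bsub>\<Gamma>\<^esub> Q\<close>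
  and whose edges go from \<open>C\<close> to \<open>s <#\<^bsub>\<Gamma>\<^esub> C\<close>, one for each \<open>s \<in> S\<close>. The subgroup \<open>Q\<close> only
  enters through the vertex set.
\<close>

definition schreier_markov :: "('s, 'm) monoid_scheme \<Rightarrow> 's set \<Rightarrow>
    ('s set \<Rightarrow> complex) \<Rightarrow> ('s set \<Rightarrow> complex)" where
  "schreier_markov \<Gamma> S f = (\<lambda>C. (\<Sum>s\<in>S. f (s <#\<^bsub>\<Gamma>\<^esub> C)) / of_nat (card S))"

text \<open>The Cayley graph is the Schreier graph of the trivial subgroup: \<open>x\<close> is joined to \<open>s x\<close>.\<close>

definition cayley_markov :: "('s, 'm) monoid_scheme \<Rightarrow> 's set \<Rightarrow>
    ('s \<Rightarrow> complex) \<Rightarrow> ('s \<Rightarrow> complex)" where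
  "cayley_markov \<Lambda> S f = (\<lambda>x. (\<Sum>s\<in>S. f (s \<otimes>\<^bsub>\<Lambda>\<^esub> x)) / of_nat (card S))"

section \<open>Spectral measures\<close>

text \<open>The measure \<open>\<Sum>i\<in>I. w i \<cdot> \<delta>\<^bsub>x i\<^esub>\<close> on the real line.\<close>

definition dirac_sum :: "'i set \<Rightarrow> ('i \<Rightarrow> real) \<Rightarrow> ('i \<Rightarrow> real) \<Rightarrow> real measure" where
  "dirac_sum I w x = distr (point_measure I (\<lambda>i. ennreal (w i))) borel x"

lemma emeasure_dirac_sum:
  assumes "B \<in> sets borel"
  shows "emeasure (dirac_sum I w x) B =
    (\<integral>\<^sup>+ i. ennreal (w i) * emeasure (return borel (x i)) B \<partial>count_space I)"
proof -
  have "emeasure (dirac_sum I w x) B = (\<integral>\<^sup>+ t. indicator B t \<partial>dirac_sum I w x)"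
    using assms by (simp add: dirac_sum_def)
  also have "\<dots> = (\<integral>\<^sup>+ i. indicator B (x i) \<partial>point_measure I (\<lambda>i. ennreal (w i)))"
    unfolding dirac_sum_def using assms by (subst nn_integral_distr) auto
  also have "\<dots> = (\<integral>\<^sup>+ i. ennreal (w i) * emeasure (return borel (x i)) B \<partial>count_space I)"
    unfolding point_measure_def using assms by (subst nn_integral_density) auto
  finally show ?thesis .
qed

text \<open>Functions on \<open>X\<close> are represented by functions vanishing outside \<open>X\<close>.\<close>

definition eigenspace ::
  "'x set \<Rightarrow> (('x \<Rightarrow> complex) \<Rightarrow> ('x \<Rightarrow> complex)) \<Rightarrow> complex \<Rightarrow> ('x \<Rightarrow> complex) set" where
  "eigenspace X T c = {f. (\<forall>x. x \<notin> X \<longrightarrow> f x = 0) \<and> (\<forall>x\<in>X. T f x = c * f x)}"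

definition multiplicity_on ::
  "'x set \<Rightarrow> (('x \<Rightarrow> complex) \<Rightarrow> ('x \<Rightarrow> complex)) \<Rightarrow> complex \<Rightarrow> nat" where
  "multiplicity_on X T c = vector_space.dim (\<lambda>a f x. a * f x) (eigenspace X T c)"

text \<open>
  The normalized eigenvalue counting measure \<open>\<mu>\<^sub>k\<close> for the subgroups \<open>Q k\<close> of index \<open>n ^ k\<close>.
  Only real eigenvalues are listed: \<open>S\<close> is closed under inverses in all uses, so the Markov
  operator is self-adjoint.
\<close>

definition eigenvalue_measure ::
  "nat \<Rightarrow> ('s, 'm) monoid_scheme \<Rightarrow> (nat \<Rightarrow> 's set) \<Rightarrow> 's set \<Rightarrow> nat \<Rightarrow> real measure" where
  "eigenvalue_measure n \<Gamma> Q S k =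
     dirac_sum
       {r. \<exists>f\<in>eigenspace (lcosets\<^bsub>\<Gamma>\<^esub> (Q k)) (schreier_markov \<Gamma> S) (complex_of_real r). f \<noteq> (\<lambda>_. 0)}
       (\<lambda>r. real (multiplicity_on (lcosets\<^bsub>\<Gamma>\<^esub> (Q k)) (schreier_markov \<Gamma> S) (complex_of_real r))
              / real n ^ k)
       (\<lambda>r. r)"

definition is_KNS_spectral_measure ::
  "nat \<Rightarrow> ('s, 'm) monoid_scheme \<Rightarrow> (nat \<Rightarrow> 's set) \<Rightarrow> 's set \<Rightarrow> real measure \<Rightarrow> bool" where
  "is_KNS_spectral_measure n \<Gamma> Q S \<mu> \<longleftrightarrow>
     real_distribution \<mu> \<and> (\<forall>k. real_distribution (eigenvalue_measure n \<Gamma> Q S k)) \<and>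
     weak_conv_m (eigenvalue_measure n \<Gamma> Q S) \<mu>"

definition is_Kesten_spectral_measure ::
  "('s, 'm) monoid_scheme \<Rightarrow> 's set \<Rightarrow> real measure \<Rightarrow> bool" where
  "is_Kesten_spectral_measure \<Lambda> S \<mu> \<longleftrightarrow>
     finite_measure \<mu> \<and> sets \<mu> = sets borel \<and>
     (\<exists>E. is_spectral_measure (count_space (carrier \<Lambda>)) (cayley_markov \<Lambda> S) E \<and>
        (let \<delta> = (\<lambda>x. if x = \<one>\<^bsub>\<Lambda>\<^esub> then 1 else 0) in
         \<forall>B\<in>sets borel.
           complex_of_real (measure \<mu> B) = L2_inner (count_space (carrier \<Lambda>)) (E B \<delta>) \<delta>))"

definition cayley_machine_measure :: "nat \<Rightarrow> real measure" where
  "cayley_machine_measure n =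
     dirac_sum {(q, p). 2 \<le> q \<and> 1 \<le> p \<and> p < q \<and> coprime p q}
       (\<lambda>(q, p). (real n - 1)\<^sup>2 * (1 / (real n ^ q - 1)))
       (\<lambda>(q, p). cos (real p / real q * pi))"

section \<open>The restricted wreath product with the integers\<close>

definition wreath_int :: "('g, 'm) monoid_scheme \<Rightarrow> ((int \<Rightarrow> 'g) \<times> int) monoid" where
  "wreath_int G =
     \<lparr>carrier = carrier (sum_group UNIV (\<lambda>_::int. G)) \<times> UNIV,
      monoid.mult = (\<lambda>(f, k) (h, l). (f \<otimes>\<^bsub>sum_group UNIV (\<lambda>_::int. G)\<^esub> (\<lambda>i. h (i - k)), k + l)),
      one = (\<one>\<^bsub>sum_group UNIV (\<lambda>_::int. G)\<^esub>, 0)\<rparr>"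

end

theory Submission
  imports Defs "HOL-Algebra.FiniteProduct"
begin

text \<open>
  Let \<open>X\<close> be the generator belonging to the unit of \<open>G\<close>. Every other generator is \<open>X\<close> preceded by a
  change of the first letter, so that the Hecke-type operator is the half sum of \<open>E \<circ> U\<close> and its
  adjoint, where \<open>U\<close> is the operator of \<open>X\<close> and \<open>E\<close> averages over the first letter. Therefore a
  function \<open>v\<close> of the letters from position \<open>t\<close> on, with mean zero over the letter at position \<open>t\<close> and
  over the diagonal action of \<open>G\<close>, travels along a path \<open>v, v \<circ> X\<^sup>-\<^sup>1, \<dots>, v \<circ> X\<^sup>-\<^sup>t\<close> on which the
  operator acts as half the adjacency matrix, with eigenvalues \<open>cos (p \<pi> / (t + 2))\<close>. On the words of
  length \<open>k\<close> these paths and the constants exhaust the space, and counting them gives the limiting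
  measure. In the wreath product the same paths arise from the projections
  \<open>(1 - E\<^sub>0) E\<^sub>1 \<dots> E\<^sub>t (1 - E\<^bsub>t+1\<^esub>)\<close>, where \<open>E\<^sub>i\<close> averages over the lamp \<open>i\<close>; their diagonal
  coefficients are \<open>(n - 1)\<^sup>2 / n ^ (t + 2)\<close>.

  The spectra lie in \<open>[-1, 1]\<close> because the Chebyshev polynomials of the operator grow
  subexponentially, which makes the Joukowski expansion of the resolvent converge. Conversely,
  the inverse of \<open>X\<close> moves the last non-trivial letter of a word one place to the right; this yields
  long towers of disjoint sets such that every generator maps each set to the next, and hence
  approximate eigenvectors for every \<open>cos \<theta>\<close>.

  When \<open>G\<close> is abelian, the elements that act as pointwise multiplication by a sequence form an abelian
  normal subgroup. It contains the quotients of the generators by \<open>X\<close>, whose conjugates under the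
  powers of \<open>X\<close> are the lamps.
\<close>

section \<open>Square-integrable functions\<close>

text \<open>Why the paths stop: each half of the walk averages over one letter, and a path goes on
  as long as this average leaves its last function alone. Mean zero over the diagonal action
  annihilates the step back from \<open>v\<close>, mean zero over the letter at position t
  annihilates the step beyond the last function; each condition contributes a factor n - 1 to the
  number of starters, whence (n - 1)^2. A path with t + 1 vertices has the eigenvectors sin((i + 1)
  \<theta>), which must vanish at the virtual vertices on both sides, whence \<theta> = p pi / (t +
  2). Their weight does not depend on the level, and collecting the fractions p / (t + 2) of equal
  value turns the powers of n into 1 / (n^q - 1).

  No spectral theorem is invoked. As elements of \<open>L2\<close> are functions up to null sets,
  the resolvent is summed pointwise almost everywhere, and the projection-valued measure on the
  wreath product is built from explicit projections, whose completeness is read off from the fact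
  that their diagonal coefficients add up to 1.\<close>

lemma L2_I:
  "f \<in> borel_measurable M \<Longrightarrow> integrable M (\<lambda>x. (cmod (f x))\<^sup>2) \<Longrightarrow> f \<in> L2 M"
  by (simp add: L2_def)

lemma L2_measurable [measurable_dest]: "f \<in> L2 M \<Longrightarrow> f \<in> borel_measurable M"
  and L2_integrable: "f \<in> L2 M \<Longrightarrow> integrable M (\<lambda>x. (cmod (f x))\<^sup>2)"
  by (simp_all add: L2_def)

lemma borel_measurable_cnj [measurable (raw)]:
  "f \<in> borel_measurable M \<Longrightarrow> (\<lambda>x. cnj (f x)) \<in> borel_measurable M"
  by (rule borel_measurable_continuous_onI[THEN measurable_compose[rotated]])
     (intro continuous_intros)

lemma norm_add_sq_le: "(cmod (a + b))\<^sup>2 \<le> 2 * (cmod a)\<^sup>2 + 2 * (cmod b)\<^sup>2"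
proof -
  have "(cmod (a + b))\<^sup>2 \<le> (cmod a + cmod b)\<^sup>2"
    by (intro power_mono norm_triangle_ineq) auto
  also have "\<dots> \<le> 2 * (cmod a)\<^sup>2 + 2 * (cmod b)\<^sup>2"
    using sum_squares_bound[of "cmod a" "cmod b"] by (simp add: power2_sum)
  finally show ?thesis .
qed

lemma L2_add:
  assumes [measurable]: "f \<in> L2 M" "g \<in> L2 M" shows "(\<lambda>x. f x + g x) \<in> L2 M"
proof (rule L2_I)
  have "integrable M (\<lambda>x. 2 * (cmod (f x))\<^sup>2 + 2 * (cmod (g x))\<^sup>2)"
    using assms by (intro Bochner_Integration.integrable_add integrable_mult_right L2_integrable)
  then show "integrable M (\<lambda>x. (cmod (f x + g x))\<^sup>2)"
    by (rule Bochner_Integration.integrable_bound) (auto intro!: AE_I2 norm_add_sq_le)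
qed measurable

lemma L2_cmult:
  assumes [measurable]: "f \<in> L2 M" shows "(\<lambda>x. a * f x) \<in> L2 M"
  using L2_integrable[OF assms] by (intro L2_I) (auto simp: norm_mult power_mult_distrib)

lemma L2_zero: "(\<lambda>x. 0) \<in> L2 M"
  by (rule L2_I) auto

lemma L2_diff: "f \<in> L2 M \<Longrightarrow> g \<in> L2 M \<Longrightarrow> (\<lambda>x. f x - g x) \<in> L2 M"
  using L2_add[OF _ L2_cmult[of g M "-1"], of f] by simp

lemma L2_divide: "f \<in> L2 M \<Longrightarrow> (\<lambda>x. f x / a) \<in> L2 M"
  using L2_cmult[of f M "1 / a"] by simp

lemma L2_sum: "(\<And>i. i \<in> A \<Longrightarrow> f i \<in> L2 M) \<Longrightarrow> (\<lambda>x. \<Sum>i\<in>A. f i x) \<in> L2 M"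
  by (induction A rule: infinite_finite_induct) (auto intro: L2_zero L2_add)

lemma L2_mult_integrable:
  assumes [measurable]: "f \<in> L2 M" "g \<in> L2 M"
  shows "integrable M (\<lambda>x. f x * cnj (g x))"
proof -
  have "integrable M (\<lambda>x. (cmod (f x))\<^sup>2 + (cmod (g x))\<^sup>2)"
    using assms by (intro Bochner_Integration.integrable_add L2_integrable)
  then show ?thesis
  proof (rule Bochner_Integration.integrable_bound, goal_cases)
    case 2
    have "cmod (f x) * cmod (g x) \<le> (cmod (f x))\<^sup>2 + (cmod (g x))\<^sup>2" for x
    proof -
      have "2 * (cmod (f x) * cmod (g x)) \<le> (cmod (f x))\<^sup>2 + (cmod (g x))\<^sup>2"
        using sum_squares_bound[of "cmod (f x)" "cmod (g x)"] by simp
      moreover have "0 \<le> cmod (f x) * cmod (g x)" by simp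
      ultimately show ?thesis by linarith
    qed
    then show ?case by (auto intro!: AE_I2 simp: norm_mult)
  qed measurable
qed

lemma L2_inner_add_left:
  "f \<in> L2 M \<Longrightarrow> g \<in> L2 M \<Longrightarrow> h \<in> L2 M \<Longrightarrow>
   L2_inner M (\<lambda>x. f x + g x) h = L2_inner M f h + L2_inner M g h"
  by (simp add: L2_inner_def distrib_right L2_mult_integrable)

lemma L2_inner_diff_left:
  "f \<in> L2 M \<Longrightarrow> g \<in> L2 M \<Longrightarrow> h \<in> L2 M \<Longrightarrow>
   L2_inner M (\<lambda>x. f x - g x) h = L2_inner M f h - L2_inner M g h"
  by (simp add: L2_inner_def left_diff_distrib L2_mult_integrable)

lemma L2_inner_cmult_left: "L2_inner M (\<lambda>x. a * f x) h = a * L2_inner M f h"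
  by (simp add: L2_inner_def mult.assoc)

lemma L2_inner_sum_left:
  assumes "\<And>i. i \<in> A \<Longrightarrow> f i \<in> L2 M" "h \<in> L2 M"
  shows "L2_inner M (\<lambda>x. \<Sum>i\<in>A. f i x) h = (\<Sum>i\<in>A. L2_inner M (f i) h)"
  using assms
  by (induction A rule: infinite_finite_induct)
     (auto simp: L2_inner_add_left L2_sum, auto simp: L2_inner_def)

lemma L2_inner_commute: "L2_inner M g f = cnj (L2_inner M f g)"
  unfolding L2_inner_def by (subst Bochner_Integration.integral_cnj[symmetric]) (simp add: mult.commute)

lemma L2_inner_self: "L2_inner M f f = complex_of_real ((L2_norm M f)\<^sup>2)"
proof -
  have "L2_inner M f f = (LINT x|M. complex_of_real ((cmod (f x))\<^sup>2))"
    unfolding L2_inner_def by (simp only: complex_norm_square)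
  also have "\<dots> = complex_of_real (LINT x|M. (cmod (f x))\<^sup>2)"
    by (rule integral_complex_of_real)
  also have "(LINT x|M. (cmod (f x))\<^sup>2) = (L2_norm M f)\<^sup>2"
    by (simp add: L2_norm_def)
  finally show ?thesis .
qed

lemma L2_norm_sq: "(L2_norm M f)\<^sup>2 = (LINT x|M. (cmod (f x))\<^sup>2)"
  by (simp add: L2_norm_def)

lemma L2_norm_nonneg [simp]: "0 \<le> L2_norm M f"
  by (simp add: L2_norm_def)

lemma L2_norm_cmult: "L2_norm M (\<lambda>x. a * f x) = cmod a * L2_norm M f"
  by (simp add: L2_norm_def norm_mult power_mult_distrib real_sqrt_mult)

lemma L2_Cauchy_Schwarz:
  assumes "f \<in> L2 M" "g \<in> L2 M"
  shows "cmod (L2_inner M f g) \<le> L2_norm M f * L2_norm M g"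
proof -
  define a b c where "a = (LINT x|M. (cmod (f x))\<^sup>2)" and "b = (LINT x|M. (cmod (g x))\<^sup>2)"
    and "c = (LINT x|M. cmod (f x) * cmod (g x))"
  have int: "integrable M (\<lambda>x. cmod (f x) * cmod (g x))"
    using integrable_norm[OF L2_mult_integrable[OF assms]] by (simp add: norm_mult)
  have quad: "0 \<le> t\<^sup>2 * a - 2 * t * c + b" for t
  proof -
    have "0 \<le> (LINT x|M. (t * cmod (f x) - cmod (g x))\<^sup>2)" by simp
    also have "\<dots> = (LINT x|M. t\<^sup>2 * (cmod (f x))\<^sup>2 - 2 * t * (cmod (f x) * cmod (g x)) + (cmod (g x))\<^sup>2)"
      by (intro Bochner_Integration.integral_cong) (auto simp: power2_eq_square algebra_simps)
    also have "\<dots> = t\<^sup>2 * a - 2 * t * c + b"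
      using assms int by (simp add: a_def b_def c_def L2_integrable)
    finally show ?thesis .
  qed
  have nn: "a \<ge> 0" "b \<ge> 0" "c \<ge> 0" by (simp_all add: a_def b_def c_def)
  have "c\<^sup>2 \<le> a * b"
  proof (cases "a = 0")
    case True
    have "c = 0"
    proof (rule ccontr)
      assume "c \<noteq> 0"
      \<comment> \<open>With \<open>a = 0\<close> the quadratic is linear in t, and this value of t
        would make it equal to -1.\<close>
      then have "2 * ((b + 1) / (2 * c)) * c = b + 1" by simp
      with quad[of "(b + 1) / (2 * c)"] True show False by simp
    qed
    then show ?thesis using nn by simp
  next
    case False
    then have "a > 0" using nn by simp
    have "(c / a)\<^sup>2 * a - 2 * (c / a) * c + b = b - c\<^sup>2 / a"
      using \<open>a > 0\<close> by (simp add: power2_eq_square field_simps)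
    then have "c\<^sup>2 / a \<le> b" using quad[of "c / a"] by simp
    then show ?thesis using \<open>a > 0\<close> by (simp add: field_simps)
  qed
  then have "c \<le> sqrt a * sqrt b"
    by (metis real_le_rsqrt real_sqrt_mult)
  moreover have "cmod (L2_inner M f g) \<le> c"
    unfolding L2_inner_def c_def using integral_norm_bound[of M "\<lambda>x. f x * cnj (g x)"]
    by (simp add: norm_mult)
  ultimately show ?thesis by (simp add: L2_norm_def a_def b_def)
qed

lemma L2_norm_add_sq:
  assumes "f \<in> L2 M" "g \<in> L2 M"
  shows "(L2_norm M (\<lambda>x. f x + g x))\<^sup>2 = (L2_norm M f)\<^sup>2 + (L2_norm M g)\<^sup>2 + 2 * Re (L2_inner M f g)"
proof -
  let ?s = "\<lambda>x. f x + g x"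
  have s: "?s \<in> L2 M" using assms by (rule L2_add)
  have right: "L2_inner M h ?s = L2_inner M h f + L2_inner M h g" if "h \<in> L2 M" for h
    using L2_inner_add_left[OF assms that] L2_inner_commute[of M h ?s] L2_inner_commute[of M h f]
      L2_inner_commute[of M h g] by simp
  have "complex_of_real ((L2_norm M ?s)\<^sup>2) = L2_inner M f ?s + L2_inner M g ?s"
    using assms s by (simp only: L2_inner_self[symmetric] L2_inner_add_left)
  also have "\<dots> = L2_inner M f f + L2_inner M g g + (L2_inner M f g + cnj (L2_inner M f g))"
    using assms by (simp add: right L2_inner_commute[of M f g])
  finally have "complex_of_real ((L2_norm M ?s)\<^sup>2) =
      L2_inner M f f + L2_inner M g g + (L2_inner M f g + cnj (L2_inner M f g))" .
  then show ?thesis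
    by (simp add: L2_inner_self complex_add_cnj complex_eq_iff flip: of_real_power)
qed

section \<open>Symmetric averages of measure-preserving bijections\<close>

section \<open>Reversible walks and their spectrum\<close>

lemma L2_comp_preserving:
  assumes [measurable]: "\<tau> \<in> measurable M M" and "distr M M \<tau> = M" and [measurable]: "f \<in> L2 M"
  shows "(\<lambda>x. f (\<tau> x)) \<in> L2 M" and "L2_norm M (\<lambda>x. f (\<tau> x)) = L2_norm M f"
proof -
  have [measurable]: "f \<in> borel_measurable M" using assms(3) by (rule L2_measurable)
  have "integrable (distr M M \<tau>) (\<lambda>x. (cmod (f x))\<^sup>2)"
    unfolding assms(2) using assms(3) by (rule L2_integrable)
  then have "integrable M (\<lambda>x. (cmod (f (\<tau> x)))\<^sup>2)"
    by (subst (asm) integrable_distr_eq) measurable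
  then show "(\<lambda>x. f (\<tau> x)) \<in> L2 M"
    by (intro L2_I) measurable
  have "(LINT x|distr M M \<tau>. (cmod (f x))\<^sup>2) = (LINT x|M. (cmod (f (\<tau> x)))\<^sup>2)"
    by (intro integral_distr) measurable
  then show "L2_norm M (\<lambda>x. f (\<tau> x)) = L2_norm M f"
    using assms(2) by (simp add: L2_norm_def)
qed

text \<open>A change of variables: composition with a measure-preserving bijection is unitary, so
  its adjoint is composition with the inverse.\<close>

lemma L2_inner_comp_preserving:
  assumes [measurable]: "\<tau> \<in> measurable M M" "\<sigma> \<in> measurable M M" and "distr M M \<tau> = M"
    and [measurable]: "f \<in> L2 M" "g \<in> L2 M"
    and inv: "\<And>x. x \<in> space M \<Longrightarrow> \<sigma> (\<tau> x) = x"
  shows "L2_inner M (\<lambda>x. f (\<tau> x)) g = L2_inner M f (\<lambda>x. g (\<sigma> x))"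
proof -
  have [measurable]: "f \<in> borel_measurable M" "g \<in> borel_measurable M"
    using assms by (auto dest: L2_measurable)
  have "(LINT x|distr M M \<tau>. f x * cnj (g (\<sigma> x))) = (LINT x|M. f (\<tau> x) * cnj (g (\<sigma> (\<tau> x))))"
    by (intro integral_distr) measurable
  also have "\<dots> = (LINT x|M. f (\<tau> x) * cnj (g x))"
    by (intro Bochner_Integration.integral_cong) (auto simp: inv)
  finally show ?thesis using assms(3) by (simp add: L2_inner_def)
qed

lemma AE_comp_preserving:
  assumes "\<tau> \<in> measurable M M" "distr M M \<tau> = M" "AE x in M. P x"
  shows "AE x in M. P (\<tau> x)"
proof -
  have "AE x in distr M M \<tau>. P x" by (simp only: assms)
  with assms(1) show ?thesis by (rule AE_distrD)
qed

text \<open>One setting for all the operators whose spectrum is computed: \<open>M\<close> is the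
  measure on infinite words, or counting measure on cosets or on the group; \<open>c\<close> gives
  the states of the machine and \<open>d\<close> their inverses. Since each generator is paired with
  its inverse, Hecke-type and Markov operators, which differ by inverting s, become the same
  operator.\<close>

locale reversible_walk =
  fixes M :: "'x measure" and I :: "'i set" and c d :: "'i \<Rightarrow> 'x \<Rightarrow> 'x"
  assumes finite_I: "finite I" and nonempty_I: "I \<noteq> {}"
    and c_measurable [measurable]: "\<And>i. i \<in> I \<Longrightarrow> c i \<in> measurable M M"
    and d_measurable [measurable]: "\<And>i. i \<in> I \<Longrightarrow> d i \<in> measurable M M"
    and dc: "\<And>i x. i \<in> I \<Longrightarrow> x \<in> space M \<Longrightarrow> d i (c i x) = x"
    and cd: "\<And>i x. i \<in> I \<Longrightarrow> x \<in> space M \<Longrightarrow> c i (d i x) = x"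
    and c_preserving: "\<And>i. i \<in> I \<Longrightarrow> distr M M (c i) = M"
begin

definition walk :: "('x \<Rightarrow> complex) \<Rightarrow> 'x \<Rightarrow> complex" where
  "walk f x = (\<Sum>i\<in>I. f (c i x) + f (d i x)) / of_nat (2 * card I)"

lemma d_preserving: assumes i: "i \<in> I" shows "distr M M (d i) = M"
proof -
  have "distr M M (d i) = distr (distr M M (c i)) M (d i)"
    using c_preserving[OF i] by simp
  also have "\<dots> = distr M M (d i \<circ> c i)"
    using i by (subst distr_distr) measurable
  also have "\<dots> = distr M M (\<lambda>x. x)"
    using i by (intro distr_cong) (auto simp: dc)
  finally show ?thesis by simp
qed

lemma card_I: "card I > 0"
  using finite_I nonempty_I by (simp add: card_gt_0_iff)

lemma comp_L2:
  assumes "i \<in> I" "f \<in> L2 M"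
  shows "(\<lambda>x. f (c i x)) \<in> L2 M" "(\<lambda>x. f (d i x)) \<in> L2 M"
  using L2_comp_preserving(1)[OF c_measurable c_preserving] L2_comp_preserving(1)[OF d_measurable d_preserving]
    assms by auto

lemma walk_L2: assumes "f \<in> L2 M" shows "walk f \<in> L2 M"
proof -
  have "(\<lambda>x. \<Sum>i\<in>I. f (c i x) + f (d i x)) \<in> L2 M"
    using assms by (intro L2_sum) (rule L2_add; simp add: comp_L2)
  then show ?thesis unfolding walk_def[abs_def] by (rule L2_divide)
qed

lemma walk_add: "walk (\<lambda>x. f x + g x) = (\<lambda>x. walk f x + walk g x)"
  by (simp add: walk_def fun_eq_iff sum.distrib add_divide_distrib)

lemma walk_diff: "walk (\<lambda>x. f x - g x) = (\<lambda>x. walk f x - walk g x)"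
  by (simp add: walk_def fun_eq_iff sum.distrib sum_subtractf add_divide_distrib diff_divide_distrib)

lemma walk_cmult: "walk (\<lambda>x. a * f x) = (\<lambda>x. a * walk f x)"
proof
  fix x
  have "(\<Sum>i\<in>I. a * f (c i x) + a * f (d i x)) = a * (\<Sum>i\<in>I. f (c i x) + f (d i x))"
    by (simp add: sum_distrib_left distrib_left)
  then show "walk (\<lambda>x. a * f x) x = a * walk f x" by (simp add: walk_def)
qed

lemma walk_inner:
  assumes f: "f \<in> L2 M" and g: "g \<in> L2 M"
  shows "L2_inner M (walk f) g =
    (\<Sum>i\<in>I. L2_inner M (\<lambda>x. f (c i x)) g + L2_inner M (\<lambda>x. f (d i x)) g) / of_nat (2 * card I)"
proof -
  note L = comp_L2[OF _ f]
  have "L2_inner M (walk f) g =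
      L2_inner M (\<lambda>x. (1 / of_nat (2 * card I)) * (\<Sum>i\<in>I. f (c i x) + f (d i x))) g"
    by (simp add: walk_def[abs_def])
  also have "\<dots> = (1 / of_nat (2 * card I)) * L2_inner M (\<lambda>x. \<Sum>i\<in>I. f (c i x) + f (d i x)) g"
    by (rule L2_inner_cmult_left)
  also have "L2_inner M (\<lambda>x. \<Sum>i\<in>I. f (c i x) + f (d i x)) g =
      (\<Sum>i\<in>I. L2_inner M (\<lambda>x. f (c i x)) g + L2_inner M (\<lambda>x. f (d i x)) g)"
    using L g by (subst L2_inner_sum_left) (auto intro: L2_add simp: L2_inner_add_left)
  finally show ?thesis by simp
qed

lemma walk_symmetric:
  assumes f: "f \<in> L2 M" and g: "g \<in> L2 M"
  shows "L2_inner M (walk f) g = L2_inner M f (walk g)"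
proof -
  have "L2_inner M f (walk g) = cnj (L2_inner M (walk g) f)"
    by (rule L2_inner_commute)
  also have "\<dots> = (\<Sum>i\<in>I. L2_inner M f (\<lambda>x. g (c i x)) + L2_inner M f (\<lambda>x. g (d i x))) / of_nat (2 * card I)"
    by (simp add: walk_inner[OF g f] flip: L2_inner_commute)
  also have "\<dots> = L2_inner M (walk f) g"
  proof -
    have "L2_inner M (\<lambda>x. f (c i x)) g + L2_inner M (\<lambda>x. f (d i x)) g =
        L2_inner M f (\<lambda>x. g (c i x)) + L2_inner M f (\<lambda>x. g (d i x))" if i: "i \<in> I" for i
      using L2_inner_comp_preserving[OF c_measurable[OF i] d_measurable[OF i] c_preserving[OF i] f g dc[OF i]]
        L2_inner_comp_preserving[OF d_measurable[OF i] c_measurable[OF i] d_preserving[OF i] f g cd[OF i]]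
      by simp
    then show ?thesis unfolding walk_inner[OF f g] by simp
  qed
  finally show ?thesis by simp
qed

text \<open>Each of the terms is an isometry, so Cauchy-Schwarz applies term by term. The norm bound
  is stated for the sesquilinear form because this is the shape of the cross term in the energy of
  the wave equation.\<close>

lemma walk_inner_bound:
  assumes f: "f \<in> L2 M" and g: "g \<in> L2 M"
  shows "cmod (L2_inner M (walk f) g) \<le> L2_norm M f * L2_norm M g"
proof -
  let ?B = "L2_norm M f * L2_norm M g"
  have "cmod (L2_inner M (\<lambda>x. f (c i x)) g + L2_inner M (\<lambda>x. f (d i x)) g) \<le> 2 * ?B" if i: "i \<in> I" for i
  proof -
    note C = L2_comp_preserving[OF c_measurable[OF i] c_preserving[OF i] f]
      and D = L2_comp_preserving[OF d_measurable[OF i] d_preserving[OF i] f]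
    show ?thesis
      using norm_triangle_ineq[of "L2_inner M (\<lambda>x. f (c i x)) g" "L2_inner M (\<lambda>x. f (d i x)) g"]
        L2_Cauchy_Schwarz[OF C(1) g] L2_Cauchy_Schwarz[OF D(1) g] C(2) D(2) by simp
  qed
  then have "cmod (\<Sum>i\<in>I. L2_inner M (\<lambda>x. f (c i x)) g + L2_inner M (\<lambda>x. f (d i x)) g) \<le> of_nat (card I) * (2 * ?B)"
    by (intro sum_norm_bound)
  then show ?thesis
    using card_I by (simp add: walk_inner[OF f g] norm_divide norm_mult field_simps)
qed

text \<open>Chebyshev polynomials of the second kind, applied to the walk. Their generating function
  is 1 / (1 - 2 x \<zeta> + \<zeta>^2), which makes them the coefficients of the resolvent.\<close>

fun cheb :: "nat \<Rightarrow> ('x \<Rightarrow> complex) \<Rightarrow> 'x \<Rightarrow> complex" where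
  "cheb 0 f = f"
| "cheb (Suc 0) f = (\<lambda>x. 2 * walk f x)"
| "cheb (Suc (Suc k)) f = (\<lambda>x. 2 * walk (cheb (Suc k) f) x - cheb k f x)"

lemma cheb_L2: "f \<in> L2 M \<Longrightarrow> cheb k f \<in> L2 M"
  by (induction k f rule: cheb.induct) (simp_all add: L2_diff L2_cmult walk_L2)

lemma cheb_add: "cheb k (\<lambda>x. f x + g x) = (\<lambda>x. cheb k f x + cheb k g x)"
  by (induction k f rule: cheb.induct) (simp_all add: walk_add distrib_left add_diff_add)

lemma cheb_diff: "cheb k (\<lambda>x. f x - g x) = (\<lambda>x. cheb k f x - cheb k g x)"
  by (induction k f rule: cheb.induct) (simp_all add: walk_diff right_diff_distrib, simp add: algebra_simps)

lemma cheb_cmult: "cheb k (\<lambda>x. a * f x) = (\<lambda>x. a * cheb k f x)"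
  by (induction k f rule: cheb.induct) (simp_all add: walk_cmult right_diff_distrib mult.left_commute)

lemma cheb_walk: "cheb k (walk f) = walk (cheb k f)"
  by (induction k f rule: cheb.induct) (auto simp: walk_cmult walk_diff)

text \<open>
  The sequence \<open>u\<^sub>k = cheb k f\<close> solves the discrete wave equation
  \<open>u\<^sub>k\<^sub>+\<^sub>1 + u\<^sub>k\<^sub>-\<^sub>1 = 2 walk u\<^sub>k\<close>; its conserved energy bounds the growth of \<open>\<parallel>u\<^sub>k\<parallel>\<close>.
\<close>

lemma cheb_energy:
  assumes f: "f \<in> L2 M"
  shows "L2_inner M (cheb (Suc k) f) (cheb (Suc k) f) + L2_inner M (cheb k f) (cheb k f)
     - L2_inner M (walk (cheb k f)) (cheb (Suc k) f) - L2_inner M (cheb (Suc k) f) (walk (cheb k f))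
   = L2_inner M f f"
proof (induction k)
  case 0
  have "L2_inner M u (\<lambda>x. 2 * v x) = 2 * L2_inner M u v" for u v :: "'x \<Rightarrow> complex"
    by (subst (1 2) L2_inner_commute) (simp add: L2_inner_cmult_left)
  then show ?case by (simp add: L2_inner_cmult_left)
next
  case (Suc k)
  define u v w where "u = cheb k f" and "v = cheb (Suc k) f" and "w = walk v"
  have L: "u \<in> L2 M" "v \<in> L2 M" "w \<in> L2 M"
    using f by (auto simp: u_def v_def w_def intro: cheb_L2 walk_L2)
  let ?i = "L2_inner M"
  define v' where "v' = cheb (Suc (Suc k)) f"
  have v': "v' = (\<lambda>x. 2 * w x - u x)" by (simp add: v'_def w_def u_def v_def)
  have left: "?i v' h = 2 * ?i w h - ?i u h" if "h \<in> L2 M" for h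
    using L that by (simp add: v' L2_inner_diff_left L2_cmult L2_inner_cmult_left)
  have v'L: "v' \<in> L2 M" using L by (simp add: v' L2_diff L2_cmult)
  have right: "?i h v' = 2 * ?i h w - ?i h u" if "h \<in> L2 M" for h
    using arg_cong[OF left[OF that], of cnj] by (simp flip: L2_inner_commute)
  have "?i v' v' + ?i v v - ?i w v' - ?i v' w = ?i v v + ?i u u - ?i w u - ?i u w"
    using L v'L by (simp add: left right)
  also have "?i w u = ?i v (walk u)" using L by (simp add: w_def walk_symmetric)
  also have "?i u w = ?i (walk u) v" using L by (simp add: w_def walk_symmetric)
  finally have "?i v' v' + ?i v v - ?i w v' - ?i v' w = ?i v v + ?i u u - ?i (walk u) v - ?i v (walk u)"
    by (simp add: algebra_simps)
  also have "\<dots> = ?i f f" using Suc.IH by (simp only: u_def v_def)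
  finally show ?case by (simp only: u_def v_def w_def v'_def)
qed

text \<open>With the cross term bounded by the product of the two norms, the conserved energy
  dominates the squared difference of consecutive norms. So the norms grow at most linearly, as the
  inequality |U_k| <= k + 1 on [-1, 1] would give through the spectral theorem.\<close>

lemma cheb_norm_Suc:
  assumes f: "f \<in> L2 M"
  shows "L2_norm M (cheb (Suc k) f) \<le> L2_norm M (cheb k f) + L2_norm M f"
proof -
  let ?a = "L2_norm M (cheb (Suc k) f)" and ?b = "L2_norm M (cheb k f)"
  define z where "z = L2_inner M (walk (cheb k f)) (cheb (Suc k) f)"
  have "complex_of_real (?a\<^sup>2 + ?b\<^sup>2) - (z + cnj z) = complex_of_real ((L2_norm M f)\<^sup>2)"
    using cheb_energy[OF f, of k]
    by (simp add: z_def L2_inner_self diff_diff_add flip: L2_inner_commute)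
  then have "?a\<^sup>2 + ?b\<^sup>2 - 2 * Re z = (L2_norm M f)\<^sup>2"
    unfolding complex_add_cnj by (metis of_real_diff of_real_eq_iff)
  moreover have "Re z \<le> ?b * ?a"
    using walk_inner_bound[OF cheb_L2[OF f] cheb_L2[OF f], of k "Suc k"] complex_Re_le_cmod[of z]
    by (simp add: z_def)
  ultimately have "(?a - ?b)\<^sup>2 \<le> (L2_norm M f)\<^sup>2"
    by (simp add: power2_diff mult.commute)
  then have "\<bar>?a - ?b\<bar> \<le> L2_norm M f"
    by (subst abs_le_square_iff[of _ "L2_norm M f", simplified]) simp_all
  then show ?thesis by simp
qed

lemma cheb_norm: "f \<in> L2 M \<Longrightarrow> L2_norm M (cheb k f) \<le> real (Suc k) * L2_norm M f"
proof (induction k)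
  case (Suc k)
  then show ?case using cheb_norm_Suc[of f k] by (simp add: algebra_simps)
qed simp

end

section \<open>The resolvent outside [-1, 1]\<close>

lemma joukowski_inverse:
  assumes "z \<notin> complex_of_real ` {-1..1}"
  obtains \<zeta> where "cmod \<zeta> < 1" "\<zeta>\<^sup>2 + 1 = 2 * z * \<zeta>"
proof -
  define s where "s = csqrt (z\<^sup>2 - 1)"
  have s2: "s\<^sup>2 = z\<^sup>2 - 1" by (simp add: s_def)
  have prod: "(z + s) * (z - s) = 1"
    using s2 by (simp add: power2_eq_square algebra_simps)
  have eq: "a\<^sup>2 + 1 = 2 * z * a" if "a = z + s \<or> a = z - s" for a
    using that s2 by (auto simp: power2_eq_square algebra_simps)
  consider "cmod (z + s) < 1" | "cmod (z - s) < 1" | "1 \<le> cmod (z + s)" "1 \<le> cmod (z - s)"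
    by linarith
  then show thesis
  proof cases
    \<comment> \<open>The two roots are reciprocal, so if neither is inside the unit disc, both lie
      on the circle. Then they are complex conjugates, and z, half their sum, is a real number in
      [-1, 1].\<close>
    case 3
    have "cmod (z + s) * cmod (z - s) = 1" using prod by (metis norm_mult norm_one)
    moreover have "cmod (z + s) * 1 \<le> cmod (z + s) * cmod (z - s)"
      using 3 by (intro mult_left_mono) auto
    ultimately have n1: "cmod (z + s) = 1" using 3 by linarith
    have "(z + s) * cnj (z + s) = (z + s) * (z - s)"
      by (simp only: complex_norm_square[symmetric] n1 prod) simp
    moreover have "z + s \<noteq> 0" using prod by auto
    ultimately have "cnj (z + s) = z - s" using mult_left_cancel by blast
    then have "2 * z = (z + s) + cnj (z + s)" by simp
    also have "\<dots> = complex_of_real (2 * Re (z + s))" by (rule complex_add_cnj)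
    finally have "2 * z = 2 * complex_of_real (Re (z + s))" by (simp only: of_real_mult of_real_numeral)
    then have "z = complex_of_real (Re (z + s))" by (simp only: mult_cancel_left) simp
    moreover have "\<bar>Re (z + s)\<bar> \<le> 1" using abs_Re_le_cmod[of "z + s"] n1 by simp
    then have "Re (z + s) \<in> {-1..1}" by (simp add: abs_le_iff)
    ultimately have "z \<in> complex_of_real ` {-1..1}" by (rule image_eqI)
    then show ?thesis using assms by contradiction
  qed (use eq that in blast)+
qed

lemma summable_power_times_Suc_sq:
  fixes r :: real assumes "0 \<le> r" "r < 1"
  shows "summable (\<lambda>k. r ^ k * (real (Suc k))\<^sup>2)"
proof -
  have 1: "summable (\<lambda>n. diffs (\<lambda>_. 1) n * x ^ n)" if "norm x < 1" for x :: real
    using that by (intro termdiff_converges[where K = 1]) (auto intro: summable_geometric)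
  \<comment> \<open>The second derivative of the geometric series has the coefficients (k + 1)(k +
    2), which dominate the squares.\<close>
  have "summable (\<lambda>n. diffs (diffs (\<lambda>_. 1)) n * r ^ n)"
    using assms by (intro termdiff_converges[where K = 1]) (auto intro: 1)
  then show ?thesis
  proof (rule summable_comparison_test'[where N = 0])
    fix k
    have "(real (Suc k))\<^sup>2 * r ^ k \<le> (real (Suc k) * real (Suc (Suc k))) * r ^ k"
      unfolding power2_eq_square using assms by (intro mult_right_mono mult_left_mono) auto
    then show "norm (r ^ k * (real (Suc k))\<^sup>2) \<le> diffs (diffs (\<lambda>_. 1)) k * r ^ k"
      using assms by (simp add: diffs_def mult.commute)
  qed
qed

context reversible_walk
begin

context
  fixes \<zeta> :: complex
  assumes zeta: "cmod \<zeta> < 1"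
begin

text \<open>Splitting |\<zeta>|^k evenly between two factors bounds the resolvent series, by
  Cauchy-Schwarz, through a geometric series and the sum of these terms. The latter is integrable
  because the norms of \<open>cheb k f\<close> grow linearly, hence finite almost
  everywhere.\<close>

definition weighted :: "('x \<Rightarrow> complex) \<Rightarrow> nat \<Rightarrow> 'x \<Rightarrow> real" where
  "weighted f k x = cmod \<zeta> ^ k * (cmod (cheb k f x))\<^sup>2"

text \<open>The generating function, summed at each point. Where the series diverges the value is
  unspecified, but for \<open>f\<close> in \<open>L2\<close> this concerns a null set only.\<close>

definition geom_sum :: "('x \<Rightarrow> complex) \<Rightarrow> 'x \<Rightarrow> complex" where
  "geom_sum f x = (\<Sum>k. \<zeta> ^ k * cheb k f x)"

lemma weighted_nonneg [simp]: "0 \<le> weighted f k x"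
  by (simp add: weighted_def)

definition geom_const :: real where
  "geom_const = (\<Sum>k. cmod \<zeta> ^ k * (real (Suc k))\<^sup>2)"

lemma weighted_integral:
  assumes f: "f \<in> L2 M"
  shows "(\<integral>\<^sup>+ x. (\<Sum>k. ennreal (weighted f k x)) \<partial>M) \<le> ennreal (geom_const * (L2_norm M f)\<^sup>2)"
proof -
  have [measurable]: "cheb k f \<in> borel_measurable M" for k
    using cheb_L2[OF f] by (rule L2_measurable)
  have int: "integrable M (weighted f k)" for k
    unfolding weighted_def[abs_def] by (intro integrable_mult_right L2_integrable cheb_L2 f)
  have "(\<integral>\<^sup>+ x. (\<Sum>k. ennreal (weighted f k x)) \<partial>M) = (\<Sum>k. \<integral>\<^sup>+ x. ennreal (weighted f k x) \<partial>M)"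
    by (rule nn_integral_suminf) (simp add: weighted_def)
  also have "\<dots> = (\<Sum>k. ennreal (cmod \<zeta> ^ k * (L2_norm M (cheb k f))\<^sup>2))"
    by (subst nn_integral_eq_integral[OF int]) (auto simp: weighted_def[abs_def] L2_norm_sq)
  also have "\<dots> \<le> (\<Sum>k. ennreal (cmod \<zeta> ^ k * (real (Suc k))\<^sup>2 * (L2_norm M f)\<^sup>2))"
  proof (intro suminf_le ennreal_leI)
    fix k
    have "(L2_norm M (cheb k f))\<^sup>2 \<le> (real (Suc k) * L2_norm M f)\<^sup>2"
      by (intro power_mono cheb_norm f) simp
    then show "cmod \<zeta> ^ k * (L2_norm M (cheb k f))\<^sup>2 \<le> cmod \<zeta> ^ k * (real (Suc k))\<^sup>2 * (L2_norm M f)\<^sup>2"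
      by (simp add: power_mult_distrib mult.assoc mult_left_mono del: of_nat_Suc)
  qed auto
  also have "\<dots> = ennreal (\<Sum>k. cmod \<zeta> ^ k * (real (Suc k))\<^sup>2 * (L2_norm M f)\<^sup>2)"
    using zeta by (intro suminf_ennreal2 summable_mult2 summable_power_times_Suc_sq) auto
  also have "(\<Sum>k. cmod \<zeta> ^ k * (real (Suc k))\<^sup>2 * (L2_norm M f)\<^sup>2) = geom_const * (L2_norm M f)\<^sup>2"
    unfolding geom_const_def using zeta by (intro suminf_mult2[symmetric] summable_power_times_Suc_sq) auto
  finally show ?thesis .
qed

lemma weighted_summable_AE:
  assumes f: "f \<in> L2 M"
  shows "AE x in M. summable (\<lambda>k. weighted f k x)"
proof -
  have [measurable]: "cheb k f \<in> borel_measurable M" for k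
    using cheb_L2[OF f] by (rule L2_measurable)
  have "AE x in M. (\<Sum>k. ennreal (weighted f k x)) \<noteq> \<infinity>"
  proof (rule nn_integral_PInf_AE)
    show "(\<lambda>x. \<Sum>k. ennreal (weighted f k x)) \<in> borel_measurable M"
      unfolding weighted_def by measurable
    show "(\<integral>\<^sup>+ x. (\<Sum>k. ennreal (weighted f k x)) \<partial>M) \<noteq> \<infinity>"
      using weighted_integral[OF f] by (auto simp: top_unique)
  qed
  then show ?thesis
    by eventually_elim (auto intro: summable_suminf_not_top)
qed

lemma summable_if_weighted:
  assumes "summable (\<lambda>k. weighted f k x)"
  shows "summable (\<lambda>k. \<zeta> ^ k * cheb k f x)"
proof (rule summable_norm_cancel, rule summable_comparison_test')
  show "summable (\<lambda>k. cmod \<zeta> ^ k + weighted f k x)"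
    using zeta assms by (intro summable_add summable_geometric) auto
  fix k
  have "cmod (cheb k f x) \<le> 1 + (cmod (cheb k f x))\<^sup>2"
  proof -
    have "2 * cmod (cheb k f x) \<le> (cmod (cheb k f x))\<^sup>2 + 1"
      using zero_le_power2[of "cmod (cheb k f x) - 1"] by (simp add: power2_diff)
    moreover have "0 \<le> cmod (cheb k f x)" by simp
    ultimately show ?thesis by linarith
  qed
  then have "cmod \<zeta> ^ k * cmod (cheb k f x) \<le> cmod \<zeta> ^ k * (1 + (cmod (cheb k f x))\<^sup>2)"
    by (intro mult_left_mono) auto
  then show "norm (norm (\<zeta> ^ k * cheb k f x)) \<le> cmod \<zeta> ^ k + weighted f k x"
    by (simp add: weighted_def norm_mult norm_power distrib_left)
qed

lemma geom_sum_bound: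
  assumes s: "summable (\<lambda>k. weighted f k x)"
  shows "(cmod (geom_sum f x))\<^sup>2 \<le> (1 / (1 - cmod \<zeta>)) * (\<Sum>k. weighted f k x)"
proof -
  let ?p = "\<lambda>N. \<Sum>k<N. \<zeta> ^ k * cheb k f x"
  have "?p \<longlonglongrightarrow> geom_sum f x"
    unfolding geom_sum_def using summable_if_weighted[OF s] by (rule summable_LIMSEQ)
  then have lim: "(\<lambda>N. (cmod (?p N))\<^sup>2) \<longlonglongrightarrow> (cmod (geom_sum f x))\<^sup>2"
    by (intro tendsto_intros)
  have "(cmod (?p N))\<^sup>2 \<le> (1 / (1 - cmod \<zeta>)) * (\<Sum>k. weighted f k x)" for N
  proof -
    have "(cmod (?p N))\<^sup>2 \<le> (\<Sum>k<N. sqrt (cmod \<zeta> ^ k) * (sqrt (cmod \<zeta> ^ k) * cmod (cheb k f x)))\<^sup>2"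
      by (intro power_mono sum_norm_le) (auto simp: norm_mult norm_power mult.assoc[symmetric])
    also have "\<dots> \<le> (\<Sum>k<N. (sqrt (cmod \<zeta> ^ k))\<^sup>2) * (\<Sum>k<N. (sqrt (cmod \<zeta> ^ k) * cmod (cheb k f x))\<^sup>2)"
      by (rule Cauchy_Schwarz_ineq_sum)
    also have "\<dots> = (\<Sum>k<N. cmod \<zeta> ^ k) * (\<Sum>k<N. weighted f k x)"
      by (simp add: weighted_def power_mult_distrib)
    also have "\<dots> \<le> (1 / (1 - cmod \<zeta>)) * (\<Sum>k. weighted f k x)"
    proof (intro mult_mono)
      have "(\<Sum>k<N. cmod \<zeta> ^ k) \<le> (\<Sum>k. cmod \<zeta> ^ k)"
        using zeta by (intro sum_le_suminf summable_geometric) auto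
      then show "(\<Sum>k<N. cmod \<zeta> ^ k) \<le> 1 / (1 - cmod \<zeta>)"
        using zeta by (simp add: suminf_geometric)
      show "(\<Sum>k<N. weighted f k x) \<le> (\<Sum>k. weighted f k x)"
        using s by (intro sum_le_suminf) auto
    qed (use zeta in \<open>auto intro!: sum_nonneg\<close>)
    finally show ?thesis .
  qed
  then show ?thesis by (intro LIMSEQ_le_const2[OF lim]) auto
qed

lemma geom_sum_L2:
  assumes f: "f \<in> L2 M"
  shows "geom_sum f \<in> L2 M"
    and "(L2_norm M (geom_sum f))\<^sup>2 \<le> (1 / (1 - cmod \<zeta>)) * (geom_const * (L2_norm M f)\<^sup>2)"
proof -
  have [measurable]: "cheb k f \<in> borel_measurable M" for k
    using cheb_L2[OF f] by (rule L2_measurable)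
  have meas [measurable]: "geom_sum f \<in> borel_measurable M"
    unfolding geom_sum_def[abs_def] by measurable
  have gc: "0 \<le> geom_const" unfolding geom_const_def
    using zeta by (intro suminf_nonneg summable_power_times_Suc_sq) auto
  have "(\<integral>\<^sup>+ x. ennreal ((cmod (geom_sum f x))\<^sup>2) \<partial>M) \<le>
      (\<integral>\<^sup>+ x. ennreal (1 / (1 - cmod \<zeta>)) * (\<Sum>k. ennreal (weighted f k x)) \<partial>M)"
  proof (rule nn_integral_mono_AE)
    show "AE x in M. ennreal ((cmod (geom_sum f x))\<^sup>2) \<le> ennreal (1 / (1 - cmod \<zeta>)) * (\<Sum>k. ennreal (weighted f k x))"
      using weighted_summable_AE[OF f]
    proof eventually_elim
      case (elim x)
      have "(\<Sum>k. ennreal (weighted f k x)) = ennreal (\<Sum>k. weighted f k x)"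
        using elim by (intro suminf_ennreal2) auto
      then show ?case
        using geom_sum_bound[OF elim] zeta
        by (simp add: ennreal_mult[symmetric] suminf_nonneg elim ennreal_leI del: times_divide_eq_left)
    qed
  qed
  also have "\<dots> = ennreal (1 / (1 - cmod \<zeta>)) * (\<integral>\<^sup>+ x. (\<Sum>k. ennreal (weighted f k x)) \<partial>M)"
    by (rule nn_integral_cmult) (simp add: weighted_def)
  also have "\<dots> \<le> ennreal (1 / (1 - cmod \<zeta>)) * ennreal (geom_const * (L2_norm M f)\<^sup>2)"
    by (intro mult_left_mono weighted_integral f) auto
  also have "\<dots> = ennreal ((1 / (1 - cmod \<zeta>)) * (geom_const * (L2_norm M f)\<^sup>2))"
    using zeta gc by (intro ennreal_mult[symmetric]) auto
  finally have le: "(\<integral>\<^sup>+ x. ennreal ((cmod (geom_sum f x))\<^sup>2) \<partial>M) \<le>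
      ennreal ((1 / (1 - cmod \<zeta>)) * (geom_const * (L2_norm M f)\<^sup>2))" .
  have int: "integrable M (\<lambda>x. (cmod (geom_sum f x))\<^sup>2)"
    using le by (intro integrableI_bounded) (auto intro: le_less_trans)
  then show "geom_sum f \<in> L2 M" by (intro L2_I meas)
  have "ennreal ((L2_norm M (geom_sum f))\<^sup>2) \<le> ennreal ((1 / (1 - cmod \<zeta>)) * (geom_const * (L2_norm M f)\<^sup>2))"
    using le unfolding L2_norm_sq by (subst (asm) nn_integral_eq_integral[OF int]) auto
  then show "(L2_norm M (geom_sum f))\<^sup>2 \<le> (1 / (1 - cmod \<zeta>)) * (geom_const * (L2_norm M f)\<^sup>2)"
    using zeta gc by (subst (asm) ennreal_le_iff) auto
qed

text \<open>If \<open>\<zeta>\<^sup>2 + 1 = 2 * z * \<zeta>\<close>, then 1 - 2 \<zeta> T +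
  \<zeta>^2 = -2 \<zeta> (T - z), so the inverse of T - z is the generating function times -2
  \<zeta>. This is the origin of the factor.\<close>

lemma geom_sum_operator: "L2_bounded_operator M (\<lambda>f x. - 2 * \<zeta> * geom_sum f x)"
  unfolding L2_bounded_operator_def
proof (intro conjI ballI allI)
  fix f assume f: "f \<in> L2 M"
  show "(\<lambda>x. - 2 * \<zeta> * geom_sum f x) \<in> L2 M"
    by (intro L2_cmult geom_sum_L2 f)
  show "AE x in M. - 2 * \<zeta> * geom_sum (\<lambda>y. a * f y) x = a * (- 2 * \<zeta> * geom_sum f x)" for a
    using weighted_summable_AE[OF f]
  proof eventually_elim
    case (elim x)
    then show ?case
      using suminf_mult[OF summable_if_weighted[OF elim], of a]
      by (simp add: geom_sum_def cheb_cmult mult.left_commute)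
  qed
  fix g assume g: "g \<in> L2 M"
  show "AE x in M. - 2 * \<zeta> * geom_sum (\<lambda>y. f y + g y) x = - 2 * \<zeta> * geom_sum f x + - 2 * \<zeta> * geom_sum g x"
    using weighted_summable_AE[OF f] weighted_summable_AE[OF g]
  proof eventually_elim
    case (elim x)
    then have "geom_sum (\<lambda>y. f y + g y) x = geom_sum f x + geom_sum g x"
      using suminf_add[OF summable_if_weighted[OF elim(1)] summable_if_weighted[OF elim(2)]]
      by (simp add: geom_sum_def cheb_add distrib_left)
    then show ?case by (simp add: distrib_left)
  qed
next
  define C where "C = (1 / (1 - cmod \<zeta>)) * geom_const"
  have "L2_norm M (\<lambda>x. - 2 * \<zeta> * geom_sum f x) \<le> (cmod (- 2 * \<zeta>) * sqrt C) * L2_norm M f"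
    if f: "f \<in> L2 M" for f
  proof -
    have "sqrt ((L2_norm M (geom_sum f))\<^sup>2) \<le> sqrt (C * (L2_norm M f)\<^sup>2)"
      using geom_sum_L2(2)[OF f] unfolding C_def mult.assoc by (rule real_sqrt_le_mono)
    then have "L2_norm M (geom_sum f) \<le> sqrt C * L2_norm M f"
      by (simp add: real_sqrt_mult)
    then have "cmod (- 2 * \<zeta>) * L2_norm M (geom_sum f) \<le> cmod (- 2 * \<zeta>) * (sqrt C * L2_norm M f)"
      by (rule mult_left_mono) simp
    then show ?thesis unfolding L2_norm_cmult[where a = "- 2 * \<zeta>"] by (simp only: mult.assoc)
  qed
  then show "\<exists>K. \<forall>f\<in>L2 M. L2_norm M (\<lambda>x. - 2 * \<zeta> * geom_sum f x) \<le> K * L2_norm M f"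
    by blast
qed

lemma geom_sum_recursion:
  assumes "summable (\<lambda>k. \<zeta> ^ k * cheb k f x)"
  shows "(\<lambda>k. 2 * \<zeta> * (\<zeta> ^ k * walk (cheb k f) x)) sums (geom_sum f x - f x + \<zeta>\<^sup>2 * geom_sum f x)"
proof -
  let ?u = "\<lambda>k. \<zeta> ^ k * cheb k f x"
  have s: "?u sums geom_sum f x" unfolding geom_sum_def using assms by (rule summable_sums)
  have s1: "(\<lambda>k. ?u (Suc k)) sums (geom_sum f x - f x)"
    using s by (subst sums_Suc_iff) simp
  \<comment> \<open>The entry 0 stands for the polynomial with index -1, which is zero; with it the
    three-term recursion also covers k = 0.\<close>
  have "(\<lambda>k. if k = 0 then 0 else \<zeta>\<^sup>2 * ?u (k - 1)) sums (\<zeta>\<^sup>2 * geom_sum f x)"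
    using sums_Suc[of "\<lambda>k. if k = 0 then 0 else \<zeta>\<^sup>2 * ?u (k - 1)"] sums_mult[OF s, of "\<zeta>\<^sup>2"] by simp
  from sums_add[OF s1 this] show ?thesis
  proof (rule sums_cong[THEN iffD1, rotated])
    fix k show "?u (Suc k) + (if k = 0 then 0 else \<zeta>\<^sup>2 * ?u (k - 1)) = 2 * \<zeta> * (\<zeta> ^ k * walk (cheb k f) x)"
      by (cases k) (auto simp: power2_eq_square algebra_simps)
  qed
qed

end

lemma spectrum_subset: "L2_spectrum M walk \<subseteq> complex_of_real ` {-1..1}"
proof (rule subsetI, rule ccontr)
  fix z assume z: "z \<in> L2_spectrum M walk" "z \<notin> complex_of_real ` {-1..1}"
  obtain \<zeta> where zeta: "cmod \<zeta> < 1" and eq: "\<zeta>\<^sup>2 + 1 = 2 * z * \<zeta>"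
    using joukowski_inverse[OF z(2)] .
  have nz: "\<zeta> \<noteq> 0" using eq by auto
  define R where "R = (\<lambda>f x. - 2 * \<zeta> * geom_sum \<zeta> f x)"
  have left: "AE x in M. R (\<lambda>y. walk f y - z * f y) x = f x"
    and right: "AE x in M. walk (R f) x - z * R f x = f x" if f: "f \<in> L2 M" for f
  proof -
    \<comment> \<open>The walk at x reads the series at the neighbours of x, so convergence has to
      hold there too. The exceptional set stays null because the maps preserve the measure and are
      finite in number.\<close>
    have c: "AE x in M. \<forall>i\<in>I. summable (\<lambda>k. weighted \<zeta> f k (c i x)) \<and> summable (\<lambda>k. weighted \<zeta> f k (d i x))"
      unfolding AE_ball_countable[OF countable_finite[OF finite_I]]
      using AE_comp_preserving[OF c_measurable c_preserving weighted_summable_AE[OF zeta f]]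
        AE_comp_preserving[OF d_measurable d_preserving weighted_summable_AE[OF zeta f]]
      by auto
    have key: "(\<lambda>k. \<zeta> ^ k * walk (cheb k f) x) sums walk (geom_sum \<zeta> f) x"
      and val: "2 * \<zeta> * walk (geom_sum \<zeta> f) x = 2 * z * \<zeta> * geom_sum \<zeta> f x - f x"
      if s: "summable (\<lambda>k. weighted \<zeta> f k x)"
       and si: "\<forall>i\<in>I. summable (\<lambda>k. weighted \<zeta> f k (c i x)) \<and> summable (\<lambda>k. weighted \<zeta> f k (d i x))" for x
    proof -
      have "(\<lambda>k. (\<Sum>i\<in>I. \<zeta> ^ k * cheb k f (c i x) + \<zeta> ^ k * cheb k f (d i x)) / of_nat (2 * card I))
        sums ((\<Sum>i\<in>I. geom_sum \<zeta> f (c i x) + geom_sum \<zeta> f (d i x)) / of_nat (2 * card I))"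
        unfolding geom_sum_def[OF zeta]
        using si by (intro sums_divide sums_sum sums_add summable_sums summable_if_weighted[OF zeta]) auto
      then show key: "(\<lambda>k. \<zeta> ^ k * walk (cheb k f) x) sums walk (geom_sum \<zeta> f) x"
        by (simp add: walk_def sum_distrib_left distrib_left)
      have "2 * \<zeta> * walk (geom_sum \<zeta> f) x = geom_sum \<zeta> f x - f x + \<zeta>\<^sup>2 * geom_sum \<zeta> f x"
        using sums_mult[OF key, of "2 * \<zeta>"] geom_sum_recursion[OF zeta summable_if_weighted[OF zeta s]]
        by (rule sums_unique2)
      also have "\<dots> = (\<zeta>\<^sup>2 + 1) * geom_sum \<zeta> f x - f x" by (simp add: algebra_simps)
      finally show "2 * \<zeta> * walk (geom_sum \<zeta> f) x = 2 * z * \<zeta> * geom_sum \<zeta> f x - f x"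
        by (simp add: eq)
    qed
    show "AE x in M. walk (R f) x - z * R f x = f x"
      using weighted_summable_AE[OF zeta f] c
    proof eventually_elim
      case (elim x)
      have "walk (R f) x = - 2 * \<zeta> * walk (geom_sum \<zeta> f) x"
        unfolding R_def by (rule fun_cong[OF walk_cmult])
      also have "\<dots> = - (2 * \<zeta> * walk (geom_sum \<zeta> f) x)" by simp
      also have "\<dots> = f x - 2 * z * \<zeta> * geom_sum \<zeta> f x" by (simp only: val[OF elim] minus_diff_eq)
      finally show ?case by (simp add: R_def)
    qed
    show "AE x in M. R (\<lambda>y. walk f y - z * f y) x = f x"
      using weighted_summable_AE[OF zeta f] c
    proof eventually_elim
      case (elim x)
      \<comment> \<open>Polynomials in the walk commute with the walk, which reduces the left
        inverse to the identity that also gives the right inverse.\<close>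
      have "(\<lambda>k. \<zeta> ^ k * cheb k (\<lambda>y. walk f y - z * f y) x) sums (walk (geom_sum \<zeta> f) x - z * geom_sum \<zeta> f x)"
        using sums_diff[OF key[OF elim] sums_mult[OF summable_sums[OF summable_if_weighted[OF zeta elim(1)]], of z]]
        by (simp add: cheb_diff cheb_cmult cheb_walk geom_sum_def[OF zeta] right_diff_distrib mult.left_commute)
      then have "geom_sum \<zeta> (\<lambda>y. walk f y - z * f y) x = walk (geom_sum \<zeta> f) x - z * geom_sum \<zeta> f x"
        unfolding geom_sum_def[OF zeta] by (rule sums_unique[symmetric])
      then have "R (\<lambda>y. walk f y - z * f y) x = - 2 * \<zeta> * (walk (geom_sum \<zeta> f) x - z * geom_sum \<zeta> f x)"
        by (simp add: R_def)
      also have "\<dots> = 2 * z * \<zeta> * geom_sum \<zeta> f x - 2 * \<zeta> * walk (geom_sum \<zeta> f) x"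
        by (simp add: algebra_simps)
      finally show ?case by (simp add: val[OF elim])
    qed
  qed
  have "L2_bounded_operator M R" unfolding R_def by (rule geom_sum_operator[OF zeta])
  with left right z(1) show False unfolding L2_spectrum_def by blast
qed

text \<open>On a tower all generators act as one shift, so the walk acts on the indicators of the
  floors as half the adjacency matrix of a path. The wave with coefficients e^(i j \<theta>) then
  satisfies the eigenvalue equation for cos \<theta> except at the two ends: its error stays bounded
  while its norm grows with the height, which excludes a bounded inverse.\<close>

lemma spectrum_superset:
  assumes tower: "\<And>m::nat. \<exists>A. (\<forall>j\<le>m. A j \<in> sets M) \<and> disjoint_family_on A {..m} \<and>
    emeasure M (A 0) \<noteq> 0 \<and> emeasure M (A 0) \<noteq> \<infinity> \<and>
    (\<forall>j<m. \<forall>i\<in>I. \<forall>x\<in>space M. c i x \<in> A (Suc j) \<longleftrightarrow> x \<in> A j)"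
  shows "complex_of_real ` {-1..1} \<subseteq> L2_spectrum M walk"
proof (rule subsetI, rule ccontr)
  fix z assume "z \<in> complex_of_real ` {-1..1}" "z \<notin> L2_spectrum M walk"
  then obtain t R where t: "-1 \<le> t" "t \<le> 1" "z = complex_of_real t"
    and R: "L2_bounded_operator M R" "\<And>f. f \<in> L2 M \<Longrightarrow> AE x in M. R (\<lambda>y. walk f y - z * f y) x = f x"
    unfolding L2_spectrum_def by auto
  obtain K where K: "\<And>f. f \<in> L2 M \<Longrightarrow> L2_norm M (R f) \<le> K * L2_norm M f"
    using R(1) unfolding L2_bounded_operator_def by blast
  define \<theta> where "\<theta> = arccos t"
  have z: "2 * z = cis \<theta> + cis (- \<theta>)"
    using t by (simp add: \<theta>_def complex_eq_iff cos_arccos)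
  \<comment> \<open>The wave lives on the floors 1 to N, with the floors 0 and N + 1 left as
    neighbours. Its squared norm is N a and its squared error at most 4 a, where a is the measure of
    a floor, so N > 4 K^2 contradicts the bound K.\<close>
  obtain N :: nat where N: "real N > 4 * K\<^sup>2" using reals_Archimedean2 by blast
  obtain A where A_sets: "\<And>j. j \<le> Suc N \<Longrightarrow> A j \<in> sets M" and disj: "disjoint_family_on A {..Suc N}"
    and A0: "emeasure M (A 0) \<noteq> 0" "emeasure M (A 0) \<noteq> \<infinity>"
    and step: "\<And>j i x. j < Suc N \<Longrightarrow> i \<in> I \<Longrightarrow> x \<in> space M \<Longrightarrow> c i x \<in> A (Suc j) \<longleftrightarrow> x \<in> A j"
    using tower[of "Suc N"] by blast
  define a where "a = measure M (A 0)"
  have emeas: "emeasure M (A j) = emeasure M (A 0)" if "j \<le> Suc N" for j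
    using that
  proof (induction j)
    case (Suc j)
    obtain i where i: "i \<in> I" using nonempty_I by blast
    have "emeasure M (A (Suc j)) = emeasure (distr M M (c i)) (A (Suc j))"
      by (simp only: c_preserving[OF i])
    also have "\<dots> = emeasure M (c i -` A (Suc j) \<inter> space M)"
      using i Suc.prems A_sets by (intro emeasure_distr) auto
    also have "c i -` A (Suc j) \<inter> space M = A j"
      using step[OF _ i, of j] Suc.prems sets.sets_into_space[OF A_sets, of j] by auto
    finally show ?case using Suc by simp
  qed simp
  have meas: "measure M (A j) = a" if "j \<le> Suc N" for j
    using emeas[OF that] by (simp add: measure_def a_def)
  have a: "a > 0" using A0 by (simp add: a_def measure_def enn2real_positive_iff less_top zero_less_iff_neq_zero)
  define b where "b = (\<lambda>j x. of_bool (x \<in> A j) :: complex)"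
  have b_sq: "(cmod (b j x))\<^sup>2 = indicator (A j) x" for j x by (simp add: b_def indicator_def)
  have int_b: "integrable M (indicator (A j) :: _ \<Rightarrow> real)" if "j \<le> Suc N" for j
    using that A_sets[OF that] emeas[OF that] A0 by (intro integrable_real_indicator) (auto simp: less_top)
  have b_L2: "b j \<in> L2 M" if "j \<le> Suc N" for j
  proof (rule L2_I)
    have [measurable]: "A j \<in> sets M" using A_sets that by simp
    show "b j \<in> borel_measurable M" unfolding b_def by measurable
    show "integrable M (\<lambda>x. (cmod (b j x))\<^sup>2)" unfolding b_sq using int_b[OF that] by simp
  qed
  have walk_b: "2 * walk (b j) x = b (j - 1) x + b (Suc j) x" if "x \<in> space M" "0 < j" "j < Suc N" for j x
  proof -
    have c: "b j (c i x) = b (j - 1) x" if "i \<in> I" for i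
      using step[of "j - 1" i x] that \<open>x \<in> space M\<close> \<open>0 < j\<close> \<open>j < Suc N\<close> by (simp add: b_def)
    have d: "b j (d i x) = b (Suc j) x" if "i \<in> I" for i
      using step[of j i "d i x"] measurable_space[OF d_measurable[OF that] \<open>x \<in> space M\<close>]
        that \<open>x \<in> space M\<close> \<open>j < Suc N\<close> by (simp add: b_def cd)
    have "walk (b j) x = of_nat (card I) * (b (j - 1) x + b (Suc j) x) / of_nat (2 * card I)"
      by (simp add: walk_def c d)
    also have "\<dots> = (b (j - 1) x + b (Suc j) x) / 2" using card_I by simp
    finally show ?thesis by (simp only:) simp
  qed
  define e where "e = (\<lambda>j::nat. cis (real j * \<theta>))"
  have e_norm: "cmod (e j) = 1" for j by (simp add: e_def)
  have e_Suc: "e (Suc j) = e j * cis \<theta>" "e j = e (Suc j) * cis (- \<theta>)" for j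
    by (simp_all add: e_def cis_mult distrib_right add.commute)
  define f where "f = (\<lambda>x. \<Sum>j\<in>{1..N}. e j * b j x)"
  have f_L2: "f \<in> L2 M" unfolding f_def by (intro L2_sum L2_cmult b_L2) auto
  have walk_f: "2 * (walk f x - z * f x) = e N * b (Suc N) x - e 0 * b 1 x - e (Suc N) * b N x + e 1 * b 0 x"
    if x: "x \<in> space M" for x
  proof -
    have "walk f x = (\<Sum>j\<in>{1..N}. e j * walk (b j) x)"
    proof -
      have "walk (\<lambda>x. \<Sum>j\<in>F. e j * b j x) x = (\<Sum>j\<in>F. e j * walk (b j) x)" if "finite F" for F
        using that by induction (auto simp: walk_add walk_cmult, simp add: walk_def)
      then show ?thesis by (simp add: f_def)
    qed
    then have "2 * (walk f x - z * f x) = (\<Sum>j\<in>{1..N}. e j * (2 * walk (b j) x - 2 * z * b j x))"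
      by (simp add: f_def sum_distrib_left sum_subtractf algebra_simps)
    also have "\<dots> = (\<Sum>j\<in>{1..N}. e j * (b (j - 1) x + b (Suc j) x - 2 * z * b j x))"
      using walk_b[OF x] by (intro sum.cong) auto
    also have "\<dots> = e N * b (Suc N) x - e 0 * b 1 x - e (Suc N) * b N x + e 1 * b 0 x"
    proof (induction N)
      case (Suc N)
      have "e (Suc N) * (b N x + b (Suc (Suc N)) x - 2 * z * b (Suc N) x) =
         e (Suc N) * b N x + e (Suc N) * b (Suc (Suc N)) x - e (Suc (Suc N)) * b (Suc N) x - e N * b (Suc N) x"
        unfolding z e_Suc(1)[of "Suc N"] e_Suc(2)[of N] by (simp add: algebra_simps)
      then show ?case using Suc.IH by simp
    qed simp
    finally show ?thesis .
  qed
  let ?h = "\<lambda>x. walk f x - z * f x"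
  have h_L2: "?h \<in> L2 M" by (intro L2_diff walk_L2 L2_cmult f_L2)
  have "(L2_norm M ?h)\<^sup>2 \<le> (LINT x|M. indicator (A (Suc N)) x + indicator (A 1) x + indicator (A N) x + indicator (A 0) x)"
    unfolding L2_norm_sq
  proof (rule integral_mono[OF L2_integrable[OF h_L2]])
    show "integrable M (\<lambda>x. indicator (A (Suc N)) x + indicator (A 1) x + indicator (A N) x + indicator (A 0) x :: real)"
      by (intro Bochner_Integration.integrable_add int_b) auto
    fix x assume x: "x \<in> space M"
    let ?p = "e N * b (Suc N) x" and ?q = "- (e 0 * b 1 x)" and ?r = "- (e (Suc N) * b N x)" and ?s = "e 1 * b 0 x"
    have "4 * (cmod (?h x))\<^sup>2 = (cmod (2 * ?h x))\<^sup>2" unfolding norm_mult power_mult_distrib by simp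
    also have "\<dots> = (cmod ((?p + ?q) + (?r + ?s)))\<^sup>2" unfolding walk_f[OF x] by (simp add: algebra_simps)
    also have "\<dots> \<le> 2 * (cmod (?p + ?q))\<^sup>2 + 2 * (cmod (?r + ?s))\<^sup>2" by (rule norm_add_sq_le)
    also have "\<dots> \<le> 4 * (cmod ?p)\<^sup>2 + 4 * (cmod ?q)\<^sup>2 + 4 * (cmod ?r)\<^sup>2 + 4 * (cmod ?s)\<^sup>2"
      using norm_add_sq_le[of ?p ?q] norm_add_sq_le[of ?r ?s] by simp
    also have "\<dots> = 4 * (indicator (A (Suc N)) x + indicator (A 1) x + indicator (A N) x + indicator (A 0) x)"
      by (simp add: norm_mult e_norm b_sq)
    finally show "(cmod (?h x))\<^sup>2 \<le> indicator (A (Suc N)) x + indicator (A 1) x + indicator (A N) x + indicator (A 0) x"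
      by simp
  qed
  also have "\<dots> = 4 * a"
    using int_b[of "Suc N"] int_b[of 1] int_b[of N] int_b[of 0] meas[of "Suc N"] meas[of 1] meas[of N] meas[of 0]
      A_sets[THEN sets.sets_into_space]
    by (simp add: Int_absorb2)
  finally have h_norm: "(L2_norm M ?h)\<^sup>2 \<le> 4 * a" .
  have "(cmod (f x))\<^sup>2 = (\<Sum>j\<in>{1..N}. indicator (A j) x)" for x
  proof (cases "\<exists>k\<in>{1..N}. x \<in> A k")
    case True
    then obtain k where k: "k \<in> {1..N}" "x \<in> A k" by blast
    have iff: "x \<in> A j \<longleftrightarrow> j = k" if "j \<in> {1..N}" for j
      using disjoint_family_onD[OF disj, of j k] that k by auto
    have "f x = (\<Sum>j\<in>{1..N}. if j = k then e k else 0)"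
      unfolding f_def b_def using iff by (intro sum.cong) auto
    moreover have "(\<Sum>j\<in>{1..N}. indicator (A j) x) = (\<Sum>j\<in>{1..N}. if j = k then 1 else 0 :: real)"
      using iff by (intro sum.cong) (auto simp: indicator_def)
    ultimately show ?thesis using k by (simp add: e_norm)
  next
    case False
    then have "f x = 0" "(\<Sum>j\<in>{1..N}. indicator (A j) x) = (0::real)"
      by (auto simp: f_def b_def indicator_def intro!: sum.neutral)
    then show ?thesis by simp
  qed
  then have "(L2_norm M f)\<^sup>2 = (LINT x|M. (\<Sum>j\<in>{1..N}. indicator (A j) x))"
    by (simp add: L2_norm_sq)
  also have "\<dots> = (\<Sum>j\<in>{1..N}. LINT x|M. indicator (A j) x)"
    using int_b by (intro Bochner_Integration.integral_sum) auto
  also have "\<dots> = (\<Sum>j\<in>{1..N}. a)"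
    using meas A_sets[THEN sets.sets_into_space] by (intro sum.cong) (auto simp: Int_absorb2)
  finally have f_norm: "(L2_norm M f)\<^sup>2 = real N * a" by simp
  have "(L2_norm M f)\<^sup>2 = (L2_norm M (R ?h))\<^sup>2"
    unfolding L2_norm_sq
  proof (rule integral_cong_AE)
    have "R ?h \<in> L2 M" using R(1) h_L2 unfolding L2_bounded_operator_def by blast
    then show "(\<lambda>x. (cmod (R ?h x))\<^sup>2) \<in> borel_measurable M" by (auto dest: L2_integrable)
    show "(\<lambda>x. (cmod (f x))\<^sup>2) \<in> borel_measurable M" using f_L2 by (auto dest: L2_integrable)
    show "AE x in M. (cmod (f x))\<^sup>2 = (cmod (R ?h x))\<^sup>2" using R(2)[OF f_L2] by eventually_elim simp
  qed
  also have "\<dots> \<le> (K * L2_norm M ?h)\<^sup>2"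
    using K[OF h_L2] by (intro power_mono) auto
  also have "\<dots> \<le> K\<^sup>2 * (4 * a)"
    using h_norm by (simp add: power_mult_distrib mult_left_mono)
  finally have "real N * a \<le> (4 * K\<^sup>2) * a" using f_norm by simp
  then show False using a N by simp
qed

lemmas spectrum_eq = equalityI[OF spectrum_subset spectrum_superset]

end

section \<open>Action of the automaton group on words, elements of bounded depth, towers\<close>

section \<open>The group of the Cayley machine\<close>

locale cayley_group = group G for G (structure) +
  assumes finite_carrier: "finite (carrier G)" and nontrivial: "carrier G \<noteq> {\<one>}"
begin

declare in_listsD [rule del] in_listsI [rule del]

abbreviation words :: "'a list set" where "words \<equiv> lists (carrier G)"

abbreviation \<Gamma> :: "('a list \<Rightarrow> 'a list) monoid" where
  "\<Gamma> \<equiv> automaton_group (cayley_machine G)"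

abbreviation cay :: "'a \<Rightarrow> 'a list \<Rightarrow> 'a list" where
  "cay \<equiv> state_map (cayley_machine G)"

abbreviation fwd :: "'a \<Rightarrow> 'a list \<Rightarrow> 'a list" where
  "fwd \<equiv> run (cayley_machine G)"

text \<open>Partial products are undone by quotients of successive letters, with \<open>g\<close> in
  the place of the letter before the first. Each output letter depends on two neighbouring input
  letters only, a locality that \<open>fwd\<close> does not have.\<close>

fun bwd :: "'a \<Rightarrow> 'a list \<Rightarrow> 'a list" where
  "bwd g [] = []"
| "bwd g (b # u) = (inv g \<otimes> b) # bwd b u"

lemma fwd_simps [simp]: "fwd g [] = []" "fwd g (a # u) = (g \<otimes> a) # fwd (g \<otimes> a) u"
  by (simp_all add: cayley_machine_def)

declare run.simps [simp del]

lemma fwd_words: "g \<in> carrier G \<Longrightarrow> u \<in> words \<Longrightarrow> fwd g u \<in> words"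
  by (induction u arbitrary: g) auto

lemma bwd_words: "g \<in> carrier G \<Longrightarrow> u \<in> words \<Longrightarrow> bwd g u \<in> words"
  by (induction u arbitrary: g) auto

lemma length_fwd [simp]: "length (fwd g u) = length u"
  by (induction u arbitrary: g) auto

lemma length_bwd [simp]: "length (bwd g u) = length u"
  by (induction u arbitrary: g) auto

lemma bwd_fwd: "g \<in> carrier G \<Longrightarrow> u \<in> words \<Longrightarrow> bwd g (fwd g u) = u"
  by (induction u arbitrary: g) (auto simp: m_assoc[symmetric])

lemma fwd_bwd: "g \<in> carrier G \<Longrightarrow> u \<in> words \<Longrightarrow> fwd g (bwd g u) = u"
  by (induction u arbitrary: g) (auto simp: m_assoc[symmetric])

lemma fwd_append: "fwd g (u @ v) = fwd g u @ fwd (last (g # fwd g u)) v"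
  by (induction u arbitrary: g) auto

lemma bwd_append: "bwd g (u @ v) = bwd g u @ bwd (last (g # u)) v"
  by (induction u arbitrary: g) auto

lemma take_fwd: "take k (fwd g u) = fwd g (take k u)"
proof (induction u arbitrary: g k)
  case (Cons a u) then show ?case by (cases k) auto
qed simp

lemma take_bwd: "take k (bwd g u) = bwd g (take k u)"
proof (induction u arbitrary: g k)
  case (Cons a u) then show ?case by (cases k) auto
qed simp

lemma nth_bwd:
  "i < length u \<Longrightarrow> bwd g u ! i = inv (case i of 0 \<Rightarrow> g | Suc j \<Rightarrow> u ! j) \<otimes> u ! i"
proof (induction u arbitrary: g i)
  case (Cons a u) then show ?case by (cases i) (auto split: nat.split)
qed simp

lemma machine_simps [simp]:
  "states (cayley_machine G) = carrier G" "alphabet (cayley_machine G) = carrier G"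
  by (simp_all add: cayley_machine_def)

lemma cay_apply: "u \<in> words \<Longrightarrow> cay g u = fwd g u"
  by (simp add: state_map_def)

lemma cay_Bij: assumes "g \<in> carrier G" shows "cay g \<in> Bij words"
proof -
  have "bij_betw (cay g) words words"
    using assms by (intro bij_betwI[where g = "bwd g"]) (auto simp: cay_apply fwd_words bwd_words bwd_fwd fwd_bwd)
  then show ?thesis by (simp add: Bij_def state_map_def)
qed

sublocale B: group "BijGroup words" by (rule group_BijGroup)

lemma \<Gamma>_def': "\<Gamma> = subgroup_generated (BijGroup words) (cay ` carrier G)"
  by (simp add: automaton_group_def)

sublocale \<Gamma>: group \<Gamma>
  unfolding \<Gamma>_def' by (rule B.group_subgroup_generated)

lemma carrier_BijGroup [simp]: "carrier (BijGroup S) = Bij S"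
  by (simp add: BijGroup_def)

lemma carrier_\<Gamma>: "carrier \<Gamma> = generate (BijGroup words) (cay ` carrier G)"
proof -
  have "Bij words \<inter> cay ` carrier G = cay ` carrier G" using cay_Bij by auto
  then show ?thesis unfolding \<Gamma>_def' by (simp add: carrier_subgroup_generated)
qed

lemma \<Gamma>_Bij: "\<gamma> \<in> carrier \<Gamma> \<Longrightarrow> \<gamma> \<in> Bij words"
  using B.generate_in_carrier[of "cay ` carrier G" \<gamma>] cay_Bij by (auto simp: carrier_\<Gamma>)

lemma cay_\<Gamma> [simp]: "g \<in> carrier G \<Longrightarrow> cay g \<in> carrier \<Gamma>"
  by (simp add: carrier_\<Gamma> generate.incl)

lemma \<Gamma>_mult:
  assumes "\<gamma> \<in> carrier \<Gamma>" "\<delta> \<in> carrier \<Gamma>"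
  shows "\<gamma> \<otimes>\<^bsub>\<Gamma>\<^esub> \<delta> = compose words \<gamma> \<delta>"
proof -
  have "\<gamma> \<otimes>\<^bsub>\<Gamma>\<^esub> \<delta> = \<gamma> \<otimes>\<^bsub>BijGroup words\<^esub> \<delta>" unfolding \<Gamma>_def' by simp
  then show ?thesis using \<Gamma>_Bij[OF assms(1)] \<Gamma>_Bij[OF assms(2)] by (simp add: BijGroup_def)
qed

lemma \<Gamma>_mult_apply:
  "\<gamma> \<in> carrier \<Gamma> \<Longrightarrow> \<delta> \<in> carrier \<Gamma> \<Longrightarrow> u \<in> words \<Longrightarrow> (\<gamma> \<otimes>\<^bsub>\<Gamma>\<^esub> \<delta>) u = \<gamma> (\<delta> u)"
  by (simp add: \<Gamma>_mult compose_def)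

lemma \<Gamma>_one_apply: "u \<in> words \<Longrightarrow> \<one>\<^bsub>\<Gamma>\<^esub> u = u"
  unfolding \<Gamma>_def' by (simp add: BijGroup_def)

lemma \<Gamma>_words: "\<gamma> \<in> carrier \<Gamma> \<Longrightarrow> u \<in> words \<Longrightarrow> \<gamma> u \<in> words"
  using \<Gamma>_Bij Bij_imp_funcset by blast

lemma \<Gamma>_inv_apply [simp]: "\<gamma> \<in> carrier \<Gamma> \<Longrightarrow> u \<in> words \<Longrightarrow> (inv\<^bsub>\<Gamma>\<^esub> \<gamma>) (\<gamma> u) = u"
  using \<Gamma>_mult_apply[of "inv\<^bsub>\<Gamma>\<^esub> \<gamma>" \<gamma> u] by (simp add: \<Gamma>_one_apply)

lemma \<Gamma>_apply_inv [simp]: "\<gamma> \<in> carrier \<Gamma> \<Longrightarrow> u \<in> words \<Longrightarrow> \<gamma> ((inv\<^bsub>\<Gamma>\<^esub> \<gamma>) u) = u"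
  using \<Gamma>_mult_apply[of \<gamma> "inv\<^bsub>\<Gamma>\<^esub> \<gamma>" u] by (simp add: \<Gamma>_one_apply)

lemma \<Gamma>_eqI:
  assumes "\<gamma> \<in> carrier \<Gamma>" "\<delta> \<in> carrier \<Gamma>" "\<And>u. u \<in> words \<Longrightarrow> \<gamma> u = \<delta> u"
  shows "\<gamma> = \<delta>"
  using assms \<Gamma>_Bij[THEN Bij_imp_extensional] by (intro extensionalityI[of \<gamma> words \<delta>]) auto

lemma inv_cay_apply:
  assumes "g \<in> carrier G" "u \<in> words" shows "(inv\<^bsub>\<Gamma>\<^esub> (cay g)) u = bwd g u"
proof -
  have "(inv\<^bsub>\<Gamma>\<^esub> (cay g)) (cay g (bwd g u)) = bwd g u"
    using assms by (intro \<Gamma>_inv_apply) (auto simp: bwd_words)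
  then show ?thesis using assms by (simp add: cay_apply bwd_words fwd_bwd)
qed

definition tree_like :: "('a list \<Rightarrow> 'a list) \<Rightarrow> bool" where
  "tree_like \<gamma> \<longleftrightarrow> (\<forall>u\<in>words. length (\<gamma> u) = length u \<and> (\<forall>k. take k (\<gamma> u) = \<gamma> (take k u)))"

lemma take_words: "u \<in> words \<Longrightarrow> take k u \<in> words"
  by (auto simp: in_lists_conv_set dest: in_set_takeD)

lemma drop_words: "u \<in> words \<Longrightarrow> drop k u \<in> words"
  by (auto simp: in_lists_conv_set dest: in_set_dropD)

lemma replicate_words: "a \<in> carrier G \<Longrightarrow> replicate m a \<in> words"
  by (auto simp: in_lists_conv_set)

lemma tree_like_\<Gamma>:
  assumes "\<gamma> \<in> carrier \<Gamma>" shows "tree_like \<gamma>"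
proof -
  have "\<gamma> \<in> generate (BijGroup words) (cay ` carrier G)" using assms by (simp add: carrier_\<Gamma>)
  then have "\<gamma> \<in> carrier \<Gamma> \<and> tree_like \<gamma>"
  proof induction
    case one
    have "\<one>\<^bsub>\<Gamma>\<^esub> = \<one>\<^bsub>BijGroup words\<^esub>" by (simp add: \<Gamma>_def')
    then show ?case
      using \<Gamma>.one_closed by (metis \<Gamma>_one_apply take_words tree_like_def)
  next
    case (incl h)
    then show ?case by (auto simp: tree_like_def cay_apply take_words take_fwd)
  next
    case (inv h)
    then obtain g where g: "g \<in> carrier G" "h = cay g" by auto
    then have "inv\<^bsub>BijGroup words\<^esub> h = inv\<^bsub>\<Gamma>\<^esub> (cay g)"
      using cay_\<Gamma>[OF g(1)] unfolding \<Gamma>_def' by (simp add: B.inv_subgroup_generated)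
    then show ?case using g by (auto simp: tree_like_def inv_cay_apply take_words take_bwd)
  next
    case (eng h1 h2)
    then have "h1 \<otimes>\<^bsub>BijGroup words\<^esub> h2 = h1 \<otimes>\<^bsub>\<Gamma>\<^esub> h2" by (simp add: \<Gamma>_def')
    then show ?case using eng
      by (auto simp: tree_like_def \<Gamma>_mult_apply \<Gamma>_words take_words)
  qed
  then show ?thesis by simp
qed

lemma length_\<Gamma> [simp]: "\<gamma> \<in> carrier \<Gamma> \<Longrightarrow> u \<in> words \<Longrightarrow> length (\<gamma> u) = length u"
  and take_\<Gamma>: "\<gamma> \<in> carrier \<Gamma> \<Longrightarrow> u \<in> words \<Longrightarrow> take k (\<gamma> u) = \<gamma> (take k u)"
  using tree_like_\<Gamma> by (auto simp: tree_like_def)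

subsection \<open>Elements that change only a bounded number of letters\<close>

definition finitary :: "nat \<Rightarrow> ('a list \<Rightarrow> 'a list) set" where
  "finitary m = {\<gamma>\<in>carrier \<Gamma>. \<forall>u\<in>words. \<forall>v\<in>words. length u = m \<longrightarrow> \<gamma> (u @ v) = \<gamma> u @ v}"

lemma finitary_\<Gamma>: "\<gamma> \<in> finitary m \<Longrightarrow> \<gamma> \<in> carrier \<Gamma>"
  by (simp add: finitary_def)

lemma finitary_append:
  "\<gamma> \<in> finitary m \<Longrightarrow> u \<in> words \<Longrightarrow> v \<in> words \<Longrightarrow> length u = m \<Longrightarrow> \<gamma> (u @ v) = \<gamma> u @ v"
  by (simp add: finitary_def)

lemma finitary_mono:
  assumes "\<gamma> \<in> finitary m" "m \<le> k" shows "\<gamma> \<in> finitary k"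
  unfolding finitary_def
proof (intro CollectI conjI ballI impI)
  fix u v assume u: "u \<in> words" "length u = k" and v: "v \<in> words"
  have eq: "\<gamma> (u @ w) = \<gamma> (take m u) @ drop m u @ w" if "w \<in> words" for w
  proof -
    have "\<gamma> (take m u @ (drop m u @ w)) = \<gamma> (take m u) @ (drop m u @ w)"
      using that u assms(2) take_words[OF u(1)] drop_words[OF u(1)]
      by (intro finitary_append[OF assms(1)]) auto
    moreover have "take m u @ drop m u @ w = u @ w" by (metis append_assoc append_take_drop_id)
    ultimately show ?thesis by simp
  qed
  from eq[OF v] eq[of "[]"] show "\<gamma> (u @ v) = \<gamma> u @ v" by simp
qed (use assms in \<open>simp add: finitary_\<Gamma>\<close>)

lemma subgroup_finitary: "subgroup (finitary m) \<Gamma>"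
proof (rule \<Gamma>.subgroupI)
  show "finitary m \<noteq> {}"
  proof -
    have "\<one>\<^bsub>\<Gamma>\<^esub> \<in> finitary m" unfolding finitary_def by (auto simp: \<Gamma>_one_apply append_in_lists_conv)
    then show ?thesis by blast
  qed
  fix \<gamma> assume \<gamma>: "\<gamma> \<in> finitary m"
  show "inv\<^bsub>\<Gamma>\<^esub> \<gamma> \<in> finitary m"
    unfolding finitary_def
  proof (intro CollectI conjI ballI impI)
    show "inv\<^bsub>\<Gamma>\<^esub> \<gamma> \<in> carrier \<Gamma>" using \<gamma> finitary_\<Gamma> by simp
    fix u v assume uv: "u \<in> words" "v \<in> words" "length u = m"
    note \<gamma>\<Gamma> = finitary_\<Gamma>[OF \<gamma>]
    define u' where "u' = (inv\<^bsub>\<Gamma>\<^esub> \<gamma>) u"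
    have u': "u' \<in> words" "length u' = m" "\<gamma> u' = u"
      using uv \<gamma>\<Gamma> by (auto simp: u'_def \<Gamma>_words)
    have "\<gamma> (u' @ v) = u @ v" using finitary_append[OF \<gamma> u'(1) uv(2) u'(2)] u'(3) by simp
    then have "(inv\<^bsub>\<Gamma>\<^esub> \<gamma>) (u @ v) = (inv\<^bsub>\<Gamma>\<^esub> \<gamma>) (\<gamma> (u' @ v))" by simp
    also have "\<dots> = u' @ v" using \<gamma>\<Gamma> u'(1) uv(2) by (intro \<Gamma>_inv_apply) auto
    finally show "(inv\<^bsub>\<Gamma>\<^esub> \<gamma>) (u @ v) = (inv\<^bsub>\<Gamma>\<^esub> \<gamma>) u @ v" by (simp add: u'_def)
  qed
  fix \<delta> assume \<delta>: "\<delta> \<in> finitary m"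
  show "\<gamma> \<otimes>\<^bsub>\<Gamma>\<^esub> \<delta> \<in> finitary m"
    unfolding finitary_def
  proof (intro CollectI conjI ballI impI)
    show "\<gamma> \<otimes>\<^bsub>\<Gamma>\<^esub> \<delta> \<in> carrier \<Gamma>" using \<gamma> \<delta> finitary_\<Gamma> by simp
    fix u v assume uv: "u \<in> words" "v \<in> words" "length u = m"
    note G = finitary_\<Gamma>[OF \<gamma>] finitary_\<Gamma>[OF \<delta>]
    have "(\<gamma> \<otimes>\<^bsub>\<Gamma>\<^esub> \<delta>) (u @ v) = \<gamma> (\<delta> (u @ v))" using uv G by (intro \<Gamma>_mult_apply) auto
    also have "\<dots> = \<gamma> (\<delta> u) @ v"
      using uv G by (simp add: finitary_append[OF \<delta>] finitary_append[OF \<gamma>] \<Gamma>_words)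
    also have "\<gamma> (\<delta> u) = (\<gamma> \<otimes>\<^bsub>\<Gamma>\<^esub> \<delta>) u" using uv G by (simp add: \<Gamma>_mult_apply)
    finally show "(\<gamma> \<otimes>\<^bsub>\<Gamma>\<^esub> \<delta>) (u @ v) = (\<gamma> \<otimes>\<^bsub>\<Gamma>\<^esub> \<delta>) u @ v" .
  qed
qed (auto simp: finitary_\<Gamma>)

lemma finitary_eqI:
  assumes \<gamma>: "\<gamma> \<in> finitary m" and \<delta>: "\<delta> \<in> finitary m"
    and eq: "\<And>u. u \<in> words \<Longrightarrow> length u = m \<Longrightarrow> \<gamma> u = \<delta> u"
  shows "\<gamma> = \<delta>"
proof (rule \<Gamma>_eqI)
  fix u assume u: "u \<in> words"
  \<comment> \<open>Words shorter than \<open>m\<close> are padded, compared there, and cut back, as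
    group elements commute with taking prefixes.\<close>
  define v where "v = u @ replicate m \<one>"
  have v: "v \<in> words" using u by (auto simp: v_def replicate_words)
  have tv: "take m v \<in> words" "length (take m v) = m" using u by (simp_all add: v_def take_words replicate_words)
  have "\<gamma> v = \<gamma> (take m v) @ drop m v" "\<delta> v = \<delta> (take m v) @ drop m v"
    using finitary_append[OF \<gamma> tv(1) drop_words[OF v] tv(2), of m]
      finitary_append[OF \<delta> tv(1) drop_words[OF v] tv(2), of m] by auto
  then have "\<gamma> v = \<delta> v" using eq[OF tv] by simp
  then have "take (length u) (\<gamma> v) = take (length u) (\<delta> v)" by simp
  then show "\<gamma> u = \<delta> u"
    using v \<gamma> \<delta> by (simp add: take_\<Gamma> finitary_\<Gamma>) (simp add: v_def)
qed (use assms finitary_\<Gamma> in auto)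

text \<open>Such an element is determined by the permutation it induces on the words of length m.
  Finiteness lets \<open>finitary m\<close> serve as the ground floor of a tower in the group
  itself, where the measure is counting measure.\<close>

lemma finite_finitary: "finite (finitary m)"
proof -
  let ?L = "{u\<in>words. length u = m}"
  have L: "finite ?L" using finite_lists_length_eq[OF finite_carrier, of m] by (simp add: in_lists_conv_set subset_eq)
  have "inj_on (\<lambda>\<gamma>. restrict \<gamma> ?L) (finitary m)"
  proof (rule inj_onI)
    fix \<gamma> \<delta> assume *: "\<gamma> \<in> finitary m" "\<delta> \<in> finitary m" "restrict \<gamma> ?L = restrict \<delta> ?L"
    show "\<gamma> = \<delta>"
    proof (rule finitary_eqI[OF *(1,2)])
      fix u assume "u \<in> words" "length u = m"
      then show "\<gamma> u = \<delta> u" using fun_cong[OF *(3), of u] by simp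
    qed
  qed
  moreover have "(\<lambda>\<gamma>. restrict \<gamma> ?L) ` finitary m \<subseteq> ?L \<rightarrow>\<^sub>E ?L"
    by (auto simp: PiE_def \<Gamma>_words finitary_\<Gamma>)
  ultimately show ?thesis using L finite_PiE[OF L, of "\<lambda>_. ?L"] by (meson finite_imageD finite_subset)
qed

abbreviation X :: "'a list \<Rightarrow> 'a list" where "X \<equiv> cay \<one>"

text \<open>The change made by \<open>\<gamma>\<close> stays within the first m letters, and taking
  successive quotients spreads it to one letter more. From there on the quotients recover the
  original word.\<close>

lemma finitary_conj:
  assumes \<gamma>: "\<gamma> \<in> finitary m" shows "inv\<^bsub>\<Gamma>\<^esub> X \<otimes>\<^bsub>\<Gamma>\<^esub> \<gamma> \<otimes>\<^bsub>\<Gamma>\<^esub> X \<in> finitary (Suc m)"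
  unfolding finitary_def
proof (intro CollectI conjI ballI impI)
  let ?c = "inv\<^bsub>\<Gamma>\<^esub> X \<otimes>\<^bsub>\<Gamma>\<^esub> \<gamma> \<otimes>\<^bsub>\<Gamma>\<^esub> X"
  note G = finitary_\<Gamma>[OF \<gamma>]
  show "?c \<in> carrier \<Gamma>" using G by simp
  fix u v assume uv: "u \<in> words" "v \<in> words" "length u = Suc m"
  have app: "?c w = bwd \<one> (\<gamma> (fwd \<one> w))" if "w \<in> words" for w
    using that G by (simp add: \<Gamma>_mult_apply \<Gamma>_words inv_cay_apply cay_apply fwd_words)
  define b1 b where "b1 = butlast (fwd \<one> u)" and "b = last (fwd \<one> u)"
  have ne: "fwd \<one> u \<noteq> []" using uv(3) by (metis length_0_conv length_fwd nat.distinct(1))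
  have fu: "fwd \<one> u = b1 @ [b]" using ne by (simp add: b1_def b_def)
  have lb: "length b1 = m" using uv(3) by (simp add: b1_def)
  have "b1 @ [b] \<in> words" using fwd_words[OF one_closed uv(1)] fu by simp
  then have b: "b1 \<in> words" "b \<in> carrier G" by auto
  have fuv: "fwd \<one> (u @ v) = b1 @ (b # fwd b v)" using fu by (simp add: fwd_append)
  have "?c (u @ v) = bwd \<one> (\<gamma> (b1 @ (b # fwd b v)))" using uv by (simp add: app fuv)
  also have "\<gamma> (b1 @ (b # fwd b v)) = (\<gamma> b1 @ [b]) @ fwd b v"
    using b uv lb fwd_words[OF b(2) uv(2)] by (subst finitary_append[OF \<gamma>]) auto
  also have "bwd \<one> \<dots> = bwd \<one> (\<gamma> b1 @ [b]) @ v"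
    using b uv by (subst bwd_append) (simp add: bwd_fwd)
  also have "\<gamma> b1 @ [b] = \<gamma> (fwd \<one> u)" using b lb finitary_append[OF \<gamma> b(1), of "[b]"] by (simp add: fu)
  finally show "?c (u @ v) = ?c u @ v" using uv by (simp add: app)
qed

text \<open>Up to conjugation by the j-th power of \<open>X\<close>, this is the quotient of
  \<open>cay g\<close> by \<open>X\<close>, the error made when the one replaces the other. For j =
  0 it multiplies the first letter by \<open>g\<close> and nothing else; each conjugation lets it
  reach one letter further.\<close>

definition defect :: "nat \<Rightarrow> 'a \<Rightarrow> 'a list \<Rightarrow> 'a list" where
  "defect j g = (inv\<^bsub>\<Gamma>\<^esub> X) [^]\<^bsub>\<Gamma>\<^esub> Suc j \<otimes>\<^bsub>\<Gamma>\<^esub> (cay g \<otimes>\<^bsub>\<Gamma>\<^esub> X [^]\<^bsub>\<Gamma>\<^esub> j)"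

lemma defect_finitary: assumes g: "g \<in> carrier G" shows "defect j g \<in> finitary (Suc j)"
proof (induction j)
  case 0
  show ?case unfolding finitary_def
  proof (intro CollectI conjI ballI impI)
    show "defect 0 g \<in> carrier \<Gamma>" using g by (simp add: defect_def)
    fix u v assume uv: "u \<in> words" "v \<in> words" "length u = Suc 0"
    then obtain a where a: "u = [a]" "a \<in> carrier G" by (auto simp: length_Suc_conv)
    have "defect 0 g w = bwd \<one> (fwd g w)" if "w \<in> words" for w
      using that g by (simp add: defect_def \<Gamma>_mult_apply cay_apply fwd_words inv_cay_apply)
    then show "defect 0 g (u @ v) = defect 0 g u @ v"
      using a uv g by (simp add: bwd_fwd)
  qed
next
  case (Suc j)
  have "defect (Suc j) g = inv\<^bsub>\<Gamma>\<^esub> X \<otimes>\<^bsub>\<Gamma>\<^esub> defect j g \<otimes>\<^bsub>\<Gamma>\<^esub> X"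
    unfolding defect_def \<Gamma>.nat_pow_Suc2[OF \<Gamma>.inv_closed[OF cay_\<Gamma>[OF one_closed]], of "Suc j"]
    using g by (simp add: \<Gamma>.m_assoc)
  then show ?case using finitary_conj[OF Suc.IH] by simp
qed

lemma cay_conj:
  assumes g: "g \<in> carrier G"
  shows "(inv\<^bsub>\<Gamma>\<^esub> X) [^]\<^bsub>\<Gamma>\<^esub> Suc j \<otimes>\<^bsub>\<Gamma>\<^esub> cay g = defect j g \<otimes>\<^bsub>\<Gamma>\<^esub> (inv\<^bsub>\<Gamma>\<^esub> X) [^]\<^bsub>\<Gamma>\<^esub> j"
proof -
  have "X [^]\<^bsub>\<Gamma>\<^esub> j \<otimes>\<^bsub>\<Gamma>\<^esub> (inv\<^bsub>\<Gamma>\<^esub> X) [^]\<^bsub>\<Gamma>\<^esub> j = \<one>\<^bsub>\<Gamma>\<^esub>"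
    by (simp add: \<Gamma>.nat_pow_inv)
  then show ?thesis using g by (simp add: defect_def \<Gamma>.m_assoc del: \<Gamma>.nat_pow_Suc)
qed

text \<open>The last letter is corrected first, by an element that may disturb all the letters
  before it; these are then repaired by an element of smaller depth, which leaves the last letter
  alone. Moving prefixes by finitary elements has the advantage that the tails of infinite words are
  kept.\<close>

lemma finitary_transitive:
  assumes "u \<in> words" "v \<in> words" "length u = m" "length v = m"
  shows "\<exists>\<gamma>\<in>finitary m. \<gamma> u = v"
  using assms
proof (induction m arbitrary: u v)
  case 0
  have "\<one>\<^bsub>\<Gamma>\<^esub> \<in> finitary 0" by (rule subgroup.one_closed[OF subgroup_finitary])
  then show ?case using 0 by (intro bexI[of _ "\<one>\<^bsub>\<Gamma>\<^esub>"]) (auto simp: \<Gamma>_one_apply)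
next
  case (Suc m)
  obtain v1 a' where v: "v = v1 @ [a']" using Suc.prems(4) by (metis append_butlast_last_id length_0_conv nat.distinct(1))
  have v': "v1 \<in> words" "a' \<in> carrier G" "length v1 = m" using Suc.prems v by auto
  have "\<exists>\<gamma>\<in>finitary (Suc m). last (\<gamma> u) = a'"
  proof (cases m)
    case 0
    then obtain a where a: "u = [a]" "a \<in> carrier G" using Suc.prems by (auto simp: length_Suc_conv)
    have "defect 0 (a' \<otimes> inv a) u = bwd \<one> (fwd (a' \<otimes> inv a) u)"
      using a v' by (simp add: defect_def \<Gamma>_mult_apply cay_apply fwd_words inv_cay_apply)
    then have "last (defect 0 (a' \<otimes> inv a) u) = a'" using a v' by (simp add: m_assoc)
    then show ?thesis using defect_finitary[of "a' \<otimes> inv a" 0] a v' 0 by auto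
  next
    case (Suc m')
    define b1 b where "b1 = butlast (fwd \<one> u)" and "b = last (fwd \<one> u)"
    have ne: "fwd \<one> u \<noteq> []" using Suc.prems(3) by (metis length_0_conv length_fwd nat.distinct(1))
    have fu: "fwd \<one> u = b1 @ [b]" using ne by (simp add: b1_def b_def)
    have lb: "length b1 = m" using Suc.prems(3) by (simp add: b1_def)
    have "b1 @ [b] \<in> words" using fwd_words[OF one_closed Suc.prems(1)] fu by simp
    then have b: "b1 \<in> words" "b \<in> carrier G" by auto
    \<comment> \<open>After conjugation the last letter is the quotient of \<open>b\<close> by the
      letter before it, so that letter is steered to \<open>c\<close>, chosen with
      \<open>inv c \<otimes> b = a'\<close>. A word of length one has no such letter, hence the
      separate case above.\<close>
    define c where "c = b \<otimes> inv a'"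
    have c: "c \<in> carrier G" using b v' by (simp add: c_def)
    obtain \<gamma> where \<gamma>: "\<gamma> \<in> finitary m" "\<gamma> b1 = replicate m c"
      using Suc.IH[of b1 "replicate m c"] b lb c replicate_words by auto
    let ?c = "inv\<^bsub>\<Gamma>\<^esub> X \<otimes>\<^bsub>\<Gamma>\<^esub> \<gamma> \<otimes>\<^bsub>\<Gamma>\<^esub> X"
    have "?c u = bwd \<one> (\<gamma> (b1 @ [b]))"
      using Suc.prems finitary_\<Gamma>[OF \<gamma>(1)]
      by (simp add: \<Gamma>_mult_apply \<Gamma>_words inv_cay_apply cay_apply fwd_words flip: fu)
    also have "\<gamma> (b1 @ [b]) = replicate m c @ [b]"
      using b lb by (simp add: finitary_append[OF \<gamma>(1)] \<gamma>(2))
    also have "bwd \<one> (replicate m c @ [b]) = bwd \<one> (replicate m c) @ [inv c \<otimes> b]"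
      using \<open>m = Suc m'\<close> by (simp add: bwd_append)
    finally have "last (?c u) = inv c \<otimes> b" by simp
    also have "\<dots> = a'" using b v' by (simp add: c_def inv_mult_group m_assoc)
    finally show ?thesis using finitary_conj[OF \<gamma>(1)] by blast
  qed
  then obtain \<gamma> where \<gamma>: "\<gamma> \<in> finitary (Suc m)" "last (\<gamma> u) = a'" by blast
  define s where "s = butlast (\<gamma> u)"
  have gu: "\<gamma> u = s @ [a']" "s \<in> words" "length s = m"
  proof -
    have l: "length (\<gamma> u) = Suc m" using Suc.prems \<gamma> finitary_\<Gamma> by simp
    then have "\<gamma> u \<noteq> []" by auto
    then show "\<gamma> u = s @ [a']" using \<gamma>(2) unfolding s_def by (metis append_butlast_last_id)
    moreover have "\<gamma> u \<in> words" using Suc.prems \<gamma> finitary_\<Gamma> \<Gamma>_words by blast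
    ultimately show "s \<in> words" by simp
    show "length s = m" using l by (simp add: s_def)
  qed
  obtain \<delta> where \<delta>: "\<delta> \<in> finitary m" "\<delta> s = v1" using Suc.IH[OF gu(2) v'(1) gu(3) v'(3)] by blast
  have "(\<delta> \<otimes>\<^bsub>\<Gamma>\<^esub> \<gamma>) u = \<delta> (s @ [a'])"
    using Suc.prems \<delta> \<gamma> by (simp add: \<Gamma>_mult_apply finitary_\<Gamma> gu(1))
  also have "\<dots> = v" using gu v' by (simp add: finitary_append[OF \<delta>(1)] \<delta>(2) v)
  finally have "(\<delta> \<otimes>\<^bsub>\<Gamma>\<^esub> \<gamma>) u = v" .
  moreover have "\<delta> \<otimes>\<^bsub>\<Gamma>\<^esub> \<gamma> \<in> finitary (Suc m)"
    using subgroup.m_closed[OF subgroup_finitary finitary_mono[OF \<delta>(1)] \<gamma>(1)] by simp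
  ultimately show ?case by blast
qed

subsection \<open>Powers of the inverse generator\<close>

lemma inv_X_pow_apply:
  "u \<in> words \<Longrightarrow> ((inv\<^bsub>\<Gamma>\<^esub> X) [^]\<^bsub>\<Gamma>\<^esub> (d::nat)) u = (bwd \<one> ^^ d) u"
proof (induction d arbitrary: u)
  case 0 then show ?case by (simp add: \<Gamma>_one_apply)
next
  case (Suc d)
  then show ?case
    by (simp add: \<Gamma>_mult_apply inv_cay_apply bwd_words funpow_Suc_right del: funpow.simps)
qed

text \<open>Just behind the last non-trivial letter, at s + 1, the quotient is
  \<open>inv (u ! s)\<close>, which is again non-trivial, and all later quotients are quotients of
  units. The index bound keeps the moving letter inside the word.\<close>

lemma bwd_pow_support:
  assumes "u \<in> words" "s + d < length u" "u ! s \<noteq> \<one>" "\<And>i. s < i \<Longrightarrow> i < length u \<Longrightarrow> u ! i = \<one>"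
  shows "(bwd \<one> ^^ d) u ! (s + d) \<noteq> \<one> \<and> (\<forall>i. s + d < i \<longrightarrow> i < length u \<longrightarrow> (bwd \<one> ^^ d) u ! i = \<one>) \<and>
     length ((bwd \<one> ^^ d) u) = length u \<and> (bwd \<one> ^^ d) u \<in> words"
  using assms(2)
proof (induction d)
  case 0
  then show ?case using assms by auto
next
  case (Suc d)
  define v where "v = (bwd \<one> ^^ d) u"
  have v: "v ! (s + d) \<noteq> \<one>" "\<And>i. s + d < i \<Longrightarrow> i < length u \<Longrightarrow> v ! i = \<one>" "length v = length u" "v \<in> words"
    using Suc unfolding v_def by auto
  have vc: "v ! i \<in> carrier G" if "i < length u" for i using v(3,4) that by (auto simp: in_lists_conv_set)
  have "bwd \<one> v ! (s + Suc d) = inv (v ! (s + d)) \<otimes> v ! (s + Suc d)"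
    using v(3) Suc.prems by (subst nth_bwd) auto
  also have "\<dots> = inv (v ! (s + d))" using v(2)[of "s + Suc d"] vc Suc.prems by simp
  also have "\<dots> \<noteq> \<one>" using v(1) vc[of "s + d"] Suc.prems by (metis inv_eq_1_iff Suc_lessD add_Suc_right)
  finally have 1: "bwd \<one> v ! (s + Suc d) \<noteq> \<one>" .
  have 2: "bwd \<one> v ! i = \<one>" if i: "s + Suc d < i" "i < length u" for i
  proof -
    obtain i' where i': "i = Suc i'" using i(1) by (cases i) auto
    have "v ! i' = \<one>" "v ! i = \<one>" using v(2) i i' by auto
    then show ?thesis using v(3) i i' by (subst nth_bwd) auto
  qed
  have "(bwd \<one> ^^ Suc d) u = bwd \<one> v" by (simp add: v_def)
  then show ?case using 1 2 v bwd_words by auto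
qed

subsection \<open>The generating set\<close>

abbreviation S :: "('a list \<Rightarrow> 'a list) set" where
  "S \<equiv> automaton_gens (cayley_machine G)"

lemma obtain_nontrivial: obtains h where "h \<in> carrier G" "h \<noteq> \<one>"
  using nontrivial one_closed by blast

lemma inj_cay: "inj_on cay (carrier G)"
proof (rule inj_onI)
  fix g h assume g: "g \<in> carrier G" and h: "h \<in> carrier G" and "cay g = cay h"
  then have "cay g [\<one>] = cay h [\<one>]" by simp
  then show "g = h" using g h by (simp add: cay_apply)
qed

text \<open>The partial products of k, 1, 1 are constant, whereas the successive quotients end with
  the inverse of k and the unit. This makes the 2 n generators distinct, so that sums over
  \<open>S\<close> split into two sums over \<open>G\<close>.\<close>

lemma cay_neq_inv_cay:
  assumes "g \<in> carrier G" "h \<in> carrier G" shows "cay g \<noteq> inv\<^bsub>\<Gamma>\<^esub> (cay h)"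
proof
  assume eq: "cay g = inv\<^bsub>\<Gamma>\<^esub> (cay h)"
  obtain k where k: "k \<in> carrier G" "k \<noteq> \<one>" by (rule obtain_nontrivial)
  have "fwd g [k, \<one>, \<one>] = bwd h [k, \<one>, \<one>]"
    using fun_cong[OF eq, of "[k, \<one>, \<one>]"] assms k
    by (simp add: cay_apply inv_cay_apply del: fwd_simps bwd.simps)
  from arg_cong[OF this, of "\<lambda>u. u ! 1"] arg_cong[OF this, of "\<lambda>u. u ! 2"]
  have "g \<otimes> k = inv k" "g \<otimes> k = \<one>" using assms k by (simp_all add: numeral_2_eq_2)
  then have "inv k = \<one>" by simp
  then show False using k by simp
qed

lemma sum_gens: "(\<Sum>s\<in>S. F s) = (\<Sum>g\<in>carrier G. F (cay g) + F (inv\<^bsub>\<Gamma>\<^esub> (cay g)))"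
proof -
  have inj: "inj_on (\<lambda>q. inv\<^bsub>\<Gamma>\<^esub> (cay q)) (carrier G)"
    using inj_cay cay_\<Gamma> by (metis (no_types, lifting) \<Gamma>.inv_inv inj_on_def)
  have "(\<Sum>s\<in>S. F s) = (\<Sum>s\<in>cay ` carrier G. F s) + (\<Sum>s\<in>(\<lambda>q. inv\<^bsub>\<Gamma>\<^esub> (cay q)) ` carrier G. F s)"
    unfolding automaton_gens_def machine_simps using finite_carrier cay_neq_inv_cay
    by (intro sum.union_disjoint) auto
  also have "\<dots> = (\<Sum>g\<in>carrier G. F (cay g)) + (\<Sum>g\<in>carrier G. F (inv\<^bsub>\<Gamma>\<^esub> (cay g)))"
    using inj_cay inj by (simp add: sum.reindex)
  finally show ?thesis by (simp add: sum.distrib)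
qed

lemma card_gens: "card S = 2 * card (carrier G)"
  using sum_gens[of "\<lambda>_. 1 :: nat"] by simp

subsection \<open>The action on infinite words\<close>

abbreviation seqs :: "(nat \<Rightarrow> 'a) set" where "seqs \<equiv> UNIV \<rightarrow> carrier G"

lemma seqs_nth: "y \<in> seqs \<Longrightarrow> y i \<in> carrier G"
  by auto

lemma length_prefix_word [simp]: "length (prefix_word k y) = k"
  by (simp add: prefix_word_def)

lemma nth_prefix_word [simp]: "i < k \<Longrightarrow> prefix_word k y ! i = y i"
  by (simp add: prefix_word_def)

lemma prefix_word_words: "y \<in> seqs \<Longrightarrow> prefix_word k y \<in> words"
  by (auto simp: prefix_word_def in_lists_conv_set)

lemma take_prefix_word: "take j (prefix_word k y) = prefix_word (min j k) y"
  by (rule nth_equalityI) auto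

lemma act_inf_nth:
  assumes \<gamma>: "\<gamma> \<in> carrier \<Gamma>" and y: "y \<in> seqs" and i: "i < k"
  shows "act_inf \<gamma> y i = \<gamma> (prefix_word k y) ! i"
proof -
  have "\<gamma> (prefix_word (Suc i) y) = take (Suc i) (\<gamma> (prefix_word k y))"
    using i by (simp add: take_\<Gamma>[OF \<gamma> prefix_word_words[OF y]] take_prefix_word min_def)
  then show ?thesis by (simp add: act_inf_def)
qed

lemma prefix_act_inf:
  assumes \<gamma>: "\<gamma> \<in> carrier \<Gamma>" and y: "y \<in> seqs"
  shows "prefix_word k (act_inf \<gamma> y) = \<gamma> (prefix_word k y)"
  using assms by (intro nth_equalityI) (auto simp: act_inf_nth prefix_word_words)

lemma act_inf_seqs:
  assumes \<gamma>: "\<gamma> \<in> carrier \<Gamma>" and y: "y \<in> seqs" shows "act_inf \<gamma> y \<in> seqs"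
proof
  fix i
  have "\<gamma> (prefix_word (Suc i) y) \<in> words" by (rule \<Gamma>_words[OF \<gamma> prefix_word_words[OF y]])
  moreover have "length (\<gamma> (prefix_word (Suc i) y)) = Suc i"
    using assms by (simp add: prefix_word_words)
  ultimately show "act_inf \<gamma> y i \<in> carrier G"
    unfolding act_inf_def by (metis in_lists_conv_set lessI nth_mem)
qed

lemma seqs_eqI:
  assumes "\<And>k. prefix_word k x = prefix_word k y" shows "x = y"
proof
  fix i show "x i = y i" using arg_cong[OF assms[of "Suc i"], of "\<lambda>u. u ! i"] by simp
qed

lemma act_inf_mult:
  assumes "\<gamma> \<in> carrier \<Gamma>" "\<delta> \<in> carrier \<Gamma>" "y \<in> seqs"
  shows "act_inf (\<gamma> \<otimes>\<^bsub>\<Gamma>\<^esub> \<delta>) y = act_inf \<gamma> (act_inf \<delta> y)"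
  using assms by (intro seqs_eqI) (simp add: prefix_act_inf act_inf_seqs \<Gamma>_mult_apply prefix_word_words)

lemma act_inf_one: "y \<in> seqs \<Longrightarrow> act_inf \<one>\<^bsub>\<Gamma>\<^esub> y = y"
  by (intro seqs_eqI) (simp add: prefix_act_inf \<Gamma>_one_apply prefix_word_words)

lemma act_inf_inv:
  assumes "\<gamma> \<in> carrier \<Gamma>" "y \<in> seqs"
  shows "act_inf (inv\<^bsub>\<Gamma>\<^esub> \<gamma>) (act_inf \<gamma> y) = y" "act_inf \<gamma> (act_inf (inv\<^bsub>\<Gamma>\<^esub> \<gamma>) y) = y"
  using assms act_inf_mult[of "inv\<^bsub>\<Gamma>\<^esub> \<gamma>" \<gamma> y] act_inf_mult[of \<gamma> "inv\<^bsub>\<Gamma>\<^esub> \<gamma>" y]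
  by (simp_all add: act_inf_one)

lemma act_inf_finitary:
  assumes \<gamma>: "\<gamma> \<in> finitary m" and y: "y \<in> seqs" and i: "m \<le> i"
  shows "act_inf \<gamma> y i = y i"
proof -
  let ?u = "prefix_word (Suc i) y"
  have w: "?u \<in> words" by (rule prefix_word_words[OF y])
  have l: "length (take m ?u) = m" using i by simp
  have "\<gamma> (take m ?u @ drop m ?u) = \<gamma> (take m ?u) @ drop m ?u"
    by (rule finitary_append[OF \<gamma> take_words[OF w] drop_words[OF w] l])
  then have "\<gamma> ?u = \<gamma> (take m ?u) @ drop m ?u" by simp
  moreover have "length (\<gamma> (take m ?u)) = m" using l finitary_\<Gamma>[OF \<gamma>] take_words[OF w] by simp
  ultimately show ?thesis using i by (simp add: act_inf_def nth_append)
qed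

subsection \<open>Towers of sets\<close>

abbreviation X_inv_pow :: "nat \<Rightarrow> 'a list \<Rightarrow> 'a list" where
  "X_inv_pow j \<equiv> (inv\<^bsub>\<Gamma>\<^esub> X) [^]\<^bsub>\<Gamma>\<^esub> j"

lemma X_inv_pow_closed: "X_inv_pow j \<in> carrier \<Gamma>"
  by simp

text \<open>The trivial letters after position m are the room into which powers of the inverse of
  \<open>X\<close>, up to the m-th, push the non-trivial letter; this separates the floors.
  Invariance under \<open>finitary m\<close> absorbs the defects; this makes all generators act
  alike.\<close>

definition tower_base :: "nat \<Rightarrow> (nat \<Rightarrow> 'a) set \<Rightarrow> bool" where
  "tower_base m B \<longleftrightarrow> (\<forall>y\<in>B. y \<in> seqs \<and> y m \<noteq> \<one> \<and> (\<forall>i. m < i \<longrightarrow> i \<le> 2 * m \<longrightarrow> y i = \<one>)) \<and>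
     (\<forall>\<gamma>\<in>finitary m. \<forall>y\<in>B. act_inf \<gamma> y \<in> B)"

definition tower :: "(nat \<Rightarrow> 'a) set \<Rightarrow> nat \<Rightarrow> (nat \<Rightarrow> 'a) set" where
  "tower B j = {y\<in>seqs. act_inf (X_inv_pow j) y \<in> B}"

lemma X_inv_pow_shift:
  assumes y: "y \<in> seqs" "y m \<noteq> \<one>" "\<And>i. m < i \<Longrightarrow> i \<le> 2 * m \<Longrightarrow> y i = \<one>" and d: "d \<le> m"
  shows "act_inf (X_inv_pow d) y (m + d) \<noteq> \<one>"
proof -
  let ?u = "prefix_word (Suc (2 * m)) y"
  have w: "?u \<in> words" by (rule prefix_word_words[OF y(1)])
  have "(bwd \<one> ^^ d) ?u ! (m + d) \<noteq> \<one>"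
    using bwd_pow_support[OF w, of m d] y(2,3) d by auto
  moreover have "act_inf (X_inv_pow d) y (m + d) = X_inv_pow d ?u ! (m + d)"
    using d y(1) by (intro act_inf_nth) auto
  ultimately show ?thesis by (simp add: inv_X_pow_apply[OF w])
qed

text \<open>Passing the power of the inverse of \<open>X\<close> over \<open>cay g\<close> costs the
  defect, which changes the first j + 1 letters at most and therefore preserves \<open>B\<close>.
  Hence it does not matter which generator is applied.\<close>

lemma tower_step:
  assumes B: "tower_base m B" and j: "j < m" and g: "g \<in> carrier G" and y: "y \<in> seqs"
  shows "act_inf (cay g) y \<in> tower B (Suc j) \<longleftrightarrow> y \<in> tower B j"
proof -
  have D: "defect j g \<in> finitary m" using finitary_mono[OF defect_finitary[OF g]] j by simp
  have iD: "inv\<^bsub>\<Gamma>\<^esub> (defect j g) \<in> finitary m" by (rule subgroup.m_inv_closed[OF subgroup_finitary D])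
  let ?z = "act_inf (X_inv_pow j) y"
  have z: "?z \<in> seqs" by (rule act_inf_seqs[OF X_inv_pow_closed y])
  have "act_inf (X_inv_pow (Suc j)) (act_inf (cay g) y) = act_inf (X_inv_pow (Suc j) \<otimes>\<^bsub>\<Gamma>\<^esub> cay g) y"
    using g y by (intro act_inf_mult[symmetric]) auto
  also have "\<dots> = act_inf (defect j g) ?z"
    unfolding cay_conj[OF g] using y by (intro act_inf_mult finitary_\<Gamma>[OF D]) auto
  finally have eq: "act_inf (X_inv_pow (Suc j)) (act_inf (cay g) y) = act_inf (defect j g) ?z" .
  have "act_inf (defect j g) ?z \<in> B \<longleftrightarrow> ?z \<in> B"
  proof
    assume "act_inf (defect j g) ?z \<in> B"
    then have "act_inf (inv\<^bsub>\<Gamma>\<^esub> (defect j g)) (act_inf (defect j g) ?z) \<in> B"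
      using B iD unfolding tower_base_def by blast
    then show "?z \<in> B" using act_inf_inv(1)[OF finitary_\<Gamma>[OF D] z] by simp
  qed (use B D in \<open>auto simp: tower_base_def\<close>)
  then show ?thesis using y act_inf_seqs[OF cay_\<Gamma>[OF g] y] by (simp only: tower_def mem_Collect_eq eq simp_thms)
qed

text \<open>If a word lay on the floors i < j, an element of \<open>B\<close> would be carried into
  \<open>B\<close> by the (j - i)-th power of the inverse of \<open>X\<close>, although this puts a
  non-trivial letter at m + (j - i), where the words of \<open>B\<close> have the unit.\<close>

lemma tower_disjoint:
  assumes B: "tower_base m B" shows "disjoint_family_on (tower B) {..m}"
proof -
  have False if ij: "i < j" "j \<le> m" and y: "y \<in> tower B i" "y \<in> tower B j" for i j y
  proof -
    define b where "b = act_inf (X_inv_pow i) y"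
    have yS: "y \<in> seqs" and b: "b \<in> B" using y by (auto simp: tower_def b_def)
    have "X_inv_pow j = X_inv_pow (j - i) \<otimes>\<^bsub>\<Gamma>\<^esub> X_inv_pow i"
      using ij by (subst \<Gamma>.nat_pow_mult) auto
    then have "act_inf (X_inv_pow j) y = act_inf (X_inv_pow (j - i)) b"
      unfolding b_def using yS by (simp add: act_inf_mult)
    then have "act_inf (X_inv_pow (j - i)) b \<in> B" using y by (simp add: tower_def)
    then have "act_inf (X_inv_pow (j - i)) b (m + (j - i)) = \<one>"
      using B ij by (auto simp: tower_base_def)
    moreover have "act_inf (X_inv_pow (j - i)) b (m + (j - i)) \<noteq> \<one>"
      using B b ij by (intro X_inv_pow_shift) (auto simp: tower_base_def)
    ultimately show False by simp
  qed
  then show ?thesis unfolding disjoint_family_on_def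
    by (metis (no_types, lifting) atMost_iff disjoint_iff linorder_neqE_nat)
qed

subsection \<open>The left regular representation\<close>

lemma finitary_mult_iff:
  assumes \<gamma>: "\<gamma> \<in> finitary m" and y: "y \<in> carrier \<Gamma>"
  shows "\<gamma> \<otimes>\<^bsub>\<Gamma>\<^esub> y \<in> finitary m \<longleftrightarrow> y \<in> finitary m"
proof
  assume "\<gamma> \<otimes>\<^bsub>\<Gamma>\<^esub> y \<in> finitary m"
  then have "inv\<^bsub>\<Gamma>\<^esub> \<gamma> \<otimes>\<^bsub>\<Gamma>\<^esub> (\<gamma> \<otimes>\<^bsub>\<Gamma>\<^esub> y) \<in> finitary m"
    using \<gamma> subgroup_finitary subgroup.m_closed subgroup.m_inv_closed by metis
  then show "y \<in> finitary m" using y finitary_\<Gamma>[OF \<gamma>] by (simp add: \<Gamma>.m_assoc[symmetric])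
qed (use \<gamma> subgroup.m_closed[OF subgroup_finitary] in blast)

lemma group_walk: "reversible_walk (count_space (carrier \<Gamma>)) (carrier G)
    (\<lambda>g y. cay g \<otimes>\<^bsub>\<Gamma>\<^esub> y) (\<lambda>g y. inv\<^bsub>\<Gamma>\<^esub> (cay g) \<otimes>\<^bsub>\<Gamma>\<^esub> y)"
proof
  fix g assume g: "g \<in> carrier G"
  have "bij_betw (\<lambda>y. cay g \<otimes>\<^bsub>\<Gamma>\<^esub> y) (carrier \<Gamma>) (carrier \<Gamma>)"
    using g by (intro bij_betwI[where g = "\<lambda>y. inv\<^bsub>\<Gamma>\<^esub> (cay g) \<otimes>\<^bsub>\<Gamma>\<^esub> y"])
      (auto simp: \<Gamma>.m_assoc[symmetric])
  then show "distr (count_space (carrier \<Gamma>)) (count_space (carrier \<Gamma>)) (\<lambda>y. cay g \<otimes>\<^bsub>\<Gamma>\<^esub> y) = count_space (carrier \<Gamma>)"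
    by (rule distr_bij_count_space)
qed (use finite_carrier in \<open>auto simp: \<Gamma>.m_assoc[symmetric]\<close>)

lemma hecke_left_regular: "hecke S (left_regular_rep \<Gamma>) =
    reversible_walk.walk (carrier G) (\<lambda>g y. cay g \<otimes>\<^bsub>\<Gamma>\<^esub> y) (\<lambda>g y. inv\<^bsub>\<Gamma>\<^esub> (cay g) \<otimes>\<^bsub>\<Gamma>\<^esub> y)"
  by (intro ext) (simp add: hecke_def sum_gens card_gens left_regular_rep_def
      reversible_walk.walk_def[OF group_walk] add.commute cong: sum.cong)

lemma cayley_markov_walk: "cayley_markov \<Gamma> S =
    reversible_walk.walk (carrier G) (\<lambda>g y. cay g \<otimes>\<^bsub>\<Gamma>\<^esub> y) (\<lambda>g y. inv\<^bsub>\<Gamma>\<^esub> (cay g) \<otimes>\<^bsub>\<Gamma>\<^esub> y)"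
  by (intro ext) (simp add: cayley_markov_def sum_gens card_gens
      reversible_walk.walk_def[OF group_walk])

lemma group_walk_spectrum:
  "L2_spectrum (count_space (carrier \<Gamma>)) (reversible_walk.walk (carrier G) (\<lambda>g y. cay g \<otimes>\<^bsub>\<Gamma>\<^esub> y) (\<lambda>g y. inv\<^bsub>\<Gamma>\<^esub> (cay g) \<otimes>\<^bsub>\<Gamma>\<^esub> y))
   = complex_of_real ` {-1..1}"
proof (rule reversible_walk.spectrum_eq[OF group_walk])
  fix m :: nat
  \<comment> \<open>The floors are the translates of the finite subgroup \<open>finitary m\<close>
    by the powers of \<open>X\<close>.\<close>
  define A where "A = (\<lambda>j. {y\<in>carrier \<Gamma>. X_inv_pow j \<otimes>\<^bsub>\<Gamma>\<^esub> y \<in> finitary m})"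
  have A0: "A 0 = finitary m" by (auto simp: A_def finitary_\<Gamma>)
  have step: "cay g \<otimes>\<^bsub>\<Gamma>\<^esub> y \<in> A (Suc j) \<longleftrightarrow> y \<in> A j"
    if j: "j < m" and g: "g \<in> carrier G" and y: "y \<in> carrier \<Gamma>" for j g y
  proof -
    have D: "defect j g \<in> finitary m" using finitary_mono[OF defect_finitary[OF g]] j by simp
    have "X_inv_pow (Suc j) \<otimes>\<^bsub>\<Gamma>\<^esub> (cay g \<otimes>\<^bsub>\<Gamma>\<^esub> y) = (X_inv_pow (Suc j) \<otimes>\<^bsub>\<Gamma>\<^esub> cay g) \<otimes>\<^bsub>\<Gamma>\<^esub> y"
      using g y by (intro \<Gamma>.m_assoc[symmetric]) auto
    also have "\<dots> = defect j g \<otimes>\<^bsub>\<Gamma>\<^esub> (X_inv_pow j \<otimes>\<^bsub>\<Gamma>\<^esub> y)"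
      unfolding cay_conj[OF g] using y finitary_\<Gamma>[OF D] by (intro \<Gamma>.m_assoc) auto
    finally have "X_inv_pow (Suc j) \<otimes>\<^bsub>\<Gamma>\<^esub> (cay g \<otimes>\<^bsub>\<Gamma>\<^esub> y) \<in> finitary m \<longleftrightarrow> X_inv_pow j \<otimes>\<^bsub>\<Gamma>\<^esub> y \<in> finitary m"
      using finitary_mult_iff[OF D] y by simp
    then show ?thesis using y \<Gamma>.m_closed[OF cay_\<Gamma>[OF g] y] by (simp only: A_def mem_Collect_eq simp_thms)
  qed
  have False if ij: "i < j" "j \<le> m" and y: "y \<in> A i" "y \<in> A j" for i j y
  proof -
    have yG: "y \<in> carrier \<Gamma>" using y by (simp add: A_def)
    obtain h where h: "h \<in> carrier G" "h \<noteq> \<one>" by (rule obtain_nontrivial)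
    \<comment> \<open>Elements of \<open>finitary m\<close> fix every letter from position m on,
      whereas the power of the inverse of \<open>X\<close> creates a non-trivial letter in this word
      at m + (j - i).\<close>
    define s where "s = (\<lambda>i. if i = m then h else \<one>)"
    have s: "s \<in> seqs" using h by (auto simp: s_def)
    have "X_inv_pow j = X_inv_pow (j - i) \<otimes>\<^bsub>\<Gamma>\<^esub> X_inv_pow i"
      using ij by (subst \<Gamma>.nat_pow_mult) auto
    then have "X_inv_pow j \<otimes>\<^bsub>\<Gamma>\<^esub> y = X_inv_pow (j - i) \<otimes>\<^bsub>\<Gamma>\<^esub> (X_inv_pow i \<otimes>\<^bsub>\<Gamma>\<^esub> y)"
      using yG by (simp add: \<Gamma>.m_assoc)
    then have "X_inv_pow (j - i) = (X_inv_pow j \<otimes>\<^bsub>\<Gamma>\<^esub> y) \<otimes>\<^bsub>\<Gamma>\<^esub> inv\<^bsub>\<Gamma>\<^esub> (X_inv_pow i \<otimes>\<^bsub>\<Gamma>\<^esub> y)"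
      using yG by (simp add: \<Gamma>.m_assoc)
    then have "X_inv_pow (j - i) \<in> finitary m"
      using y subgroup.m_closed[OF subgroup_finitary] subgroup.m_inv_closed[OF subgroup_finitary]
      by (auto simp: A_def)
    then have "act_inf (X_inv_pow (j - i)) s (m + (j - i)) = s (m + (j - i))"
      using s by (intro act_inf_finitary) auto
    moreover have "act_inf (X_inv_pow (j - i)) s (m + (j - i)) \<noteq> \<one>"
      using s h ij by (intro X_inv_pow_shift) (auto simp: s_def)
    ultimately show False using ij by (simp add: s_def split: if_splits)
  qed
  then have disj: "disjoint_family_on A {..m}" unfolding disjoint_family_on_def
    by (metis (no_types, lifting) atMost_iff disjoint_iff linorder_neqE_nat)
  have "finitary m \<noteq> {}" using subgroup.one_closed[OF subgroup_finitary] by blast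
  then have "card (finitary m) > 0" using finite_finitary by (simp add: card_gt_0_iff)
  then have "emeasure (count_space (carrier \<Gamma>)) (A 0) \<noteq> 0" "emeasure (count_space (carrier \<Gamma>)) (A 0) \<noteq> \<infinity>"
    using finite_finitary finitary_\<Gamma> by (auto simp: A0 emeasure_count_space_eq_0 subset_eq)
  then show "\<exists>A. (\<forall>j\<le>m. A j \<in> sets (count_space (carrier \<Gamma>))) \<and> disjoint_family_on A {..m} \<and>
      emeasure (count_space (carrier \<Gamma>)) (A 0) \<noteq> 0 \<and> emeasure (count_space (carrier \<Gamma>)) (A 0) \<noteq> \<infinity> \<and>
      (\<forall>j<m. \<forall>i\<in>carrier G. \<forall>x\<in>space (count_space (carrier \<Gamma>)). cay i \<otimes>\<^bsub>\<Gamma>\<^esub> x \<in> A (Suc j) \<longleftrightarrow> x \<in> A j)"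
    using disj step by (intro exI[of _ A]) (auto simp: A_def)
qed

subsection \<open>Cosets of point stabilizers\<close>

definition acts_on :: "(('a list \<Rightarrow> 'a list) \<Rightarrow> 'p \<Rightarrow> 'p) \<Rightarrow> 'p set \<Rightarrow> bool" where
  "acts_on \<phi> D \<longleftrightarrow> (\<forall>\<gamma>\<in>carrier \<Gamma>. \<forall>p\<in>D. \<phi> \<gamma> p \<in> D) \<and> (\<forall>p\<in>D. \<phi> \<one>\<^bsub>\<Gamma>\<^esub> p = p) \<and>
     (\<forall>\<gamma>\<in>carrier \<Gamma>. \<forall>\<delta>\<in>carrier \<Gamma>. \<forall>p\<in>D. \<phi> (\<gamma> \<otimes>\<^bsub>\<Gamma>\<^esub> \<delta>) p = \<phi> \<gamma> (\<phi> \<delta> p))"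

lemma acts_on_seqs: "acts_on act_inf seqs"
  using act_inf_seqs act_inf_one act_inf_mult unfolding acts_on_def by blast

lemma acts_on_words: "acts_on (\<lambda>\<gamma>. \<gamma>) words"
  by (simp add: acts_on_def \<Gamma>_words \<Gamma>_one_apply \<Gamma>_mult_apply)

text \<open>The orbit map, which identifies the cosets of the stabilizer with the orbit of
  \<open>p\<close>; for these the choice of a representative is immaterial. It transfers towers and
  eigenfunctions from words to Schreier graphs.\<close>

definition coset_point :: "(('a list \<Rightarrow> 'a list) \<Rightarrow> 'p \<Rightarrow> 'p) \<Rightarrow> 'p \<Rightarrow> ('a list \<Rightarrow> 'a list) set \<Rightarrow> 'p" where
  "coset_point \<phi> p C = \<phi> (SOME \<gamma>. \<gamma> \<in> C) p"

context
  fixes \<phi> :: "('a list \<Rightarrow> 'a list) \<Rightarrow> 'p \<Rightarrow> 'p" and D :: "'p set" and p :: 'p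
  assumes acts: "acts_on \<phi> D" and p: "p \<in> D"
begin

lemma act_closed: "\<gamma> \<in> carrier \<Gamma> \<Longrightarrow> q \<in> D \<Longrightarrow> \<phi> \<gamma> q \<in> D"
  and act_one: "q \<in> D \<Longrightarrow> \<phi> \<one>\<^bsub>\<Gamma>\<^esub> q = q"
  and act_mult: "\<gamma> \<in> carrier \<Gamma> \<Longrightarrow> \<delta> \<in> carrier \<Gamma> \<Longrightarrow> q \<in> D \<Longrightarrow> \<phi> (\<gamma> \<otimes>\<^bsub>\<Gamma>\<^esub> \<delta>) q = \<phi> \<gamma> (\<phi> \<delta> q)"
  using acts unfolding acts_on_def by blast+

lemma act_inv: "\<gamma> \<in> carrier \<Gamma> \<Longrightarrow> q \<in> D \<Longrightarrow> \<phi> (inv\<^bsub>\<Gamma>\<^esub> \<gamma>) (\<phi> \<gamma> q) = q"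
  using act_mult[of "inv\<^bsub>\<Gamma>\<^esub> \<gamma>" \<gamma> q] by (simp add: act_one)

lemma stabilizer_subgroup: "subgroup (stabilizer \<Gamma> \<phi> p) \<Gamma>"
proof (rule \<Gamma>.subgroupI)
  show "stabilizer \<Gamma> \<phi> p \<noteq> {}" using act_one[OF p] by (auto simp: stabilizer_def)
  show "inv\<^bsub>\<Gamma>\<^esub> \<gamma> \<in> stabilizer \<Gamma> \<phi> p" if "\<gamma> \<in> stabilizer \<Gamma> \<phi> p" for \<gamma>
    using that act_inv[of \<gamma> p] p by (auto simp: stabilizer_def)
qed (use p in \<open>auto simp: stabilizer_def act_mult\<close>)

lemma stabilizer_coset:
  assumes \<gamma>: "\<gamma> \<in> carrier \<Gamma>"
  shows "\<gamma> <#\<^bsub>\<Gamma>\<^esub> stabilizer \<Gamma> \<phi> p = {\<delta>\<in>carrier \<Gamma>. \<phi> \<delta> p = \<phi> \<gamma> p}"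
proof (intro equalityI subsetI)
  fix \<delta> assume "\<delta> \<in> \<gamma> <#\<^bsub>\<Gamma>\<^esub> stabilizer \<Gamma> \<phi> p"
  then obtain \<eta> where "\<eta> \<in> carrier \<Gamma>" "\<phi> \<eta> p = p" "\<delta> = \<gamma> \<otimes>\<^bsub>\<Gamma>\<^esub> \<eta>"
    by (auto simp: l_coset_def stabilizer_def)
  then show "\<delta> \<in> {\<delta>\<in>carrier \<Gamma>. \<phi> \<delta> p = \<phi> \<gamma> p}" using \<gamma> p by (simp add: act_mult)
next
  fix \<delta> assume "\<delta> \<in> {\<delta>\<in>carrier \<Gamma>. \<phi> \<delta> p = \<phi> \<gamma> p}"
  then have \<delta>: "\<delta> \<in> carrier \<Gamma>" "\<phi> \<delta> p = \<phi> \<gamma> p" by auto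
  have "\<phi> (inv\<^bsub>\<Gamma>\<^esub> \<gamma> \<otimes>\<^bsub>\<Gamma>\<^esub> \<delta>) p = \<phi> (inv\<^bsub>\<Gamma>\<^esub> \<gamma>) (\<phi> \<gamma> p)"
    using \<gamma> \<delta> p by (simp add: act_mult)
  then have "inv\<^bsub>\<Gamma>\<^esub> \<gamma> \<otimes>\<^bsub>\<Gamma>\<^esub> \<delta> \<in> stabilizer \<Gamma> \<phi> p"
    using \<gamma> \<delta> p by (simp add: stabilizer_def act_inv)
  moreover have "\<delta> = \<gamma> \<otimes>\<^bsub>\<Gamma>\<^esub> (inv\<^bsub>\<Gamma>\<^esub> \<gamma> \<otimes>\<^bsub>\<Gamma>\<^esub> \<delta>)" using \<gamma> \<delta> by (simp add: \<Gamma>.m_assoc[symmetric])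
  ultimately show "\<delta> \<in> \<gamma> <#\<^bsub>\<Gamma>\<^esub> stabilizer \<Gamma> \<phi> p" unfolding l_coset_def by blast
qed

lemma coset_point_eq:
  assumes \<gamma>: "\<gamma> \<in> carrier \<Gamma>" shows "coset_point \<phi> p (\<gamma> <#\<^bsub>\<Gamma>\<^esub> stabilizer \<Gamma> \<phi> p) = \<phi> \<gamma> p"
proof -
  have "\<gamma> \<in> {\<delta>\<in>carrier \<Gamma>. \<phi> \<delta> p = \<phi> \<gamma> p}" using \<gamma> by simp
  then have "(SOME \<delta>. \<delta> \<in> {\<delta>\<in>carrier \<Gamma>. \<phi> \<delta> p = \<phi> \<gamma> p}) \<in> {\<delta>\<in>carrier \<Gamma>. \<phi> \<delta> p = \<phi> \<gamma> p}"
    by (rule someI[where P = "\<lambda>\<delta>. \<delta> \<in> {\<delta>\<in>carrier \<Gamma>. \<phi> \<delta> p = \<phi> \<gamma> p}"])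
  then show ?thesis unfolding coset_point_def stabilizer_coset[OF \<gamma>] by simp
qed

lemma inj_coset_point: "inj_on (coset_point \<phi> p) (lcosets\<^bsub>\<Gamma>\<^esub> stabilizer \<Gamma> \<phi> p)"
proof (rule inj_onI)
  fix C C' assume C: "C \<in> lcosets\<^bsub>\<Gamma>\<^esub> stabilizer \<Gamma> \<phi> p" "C' \<in> lcosets\<^bsub>\<Gamma>\<^esub> stabilizer \<Gamma> \<phi> p"
    and eq: "coset_point \<phi> p C = coset_point \<phi> p C'"
  then obtain \<gamma> \<gamma>' where *: "\<gamma> \<in> carrier \<Gamma>" "C = \<gamma> <#\<^bsub>\<Gamma>\<^esub> stabilizer \<Gamma> \<phi> p"
      "\<gamma>' \<in> carrier \<Gamma>" "C' = \<gamma>' <#\<^bsub>\<Gamma>\<^esub> stabilizer \<Gamma> \<phi> p"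
    unfolding LCOSETS_def by blast
  then have "\<phi> \<gamma> p = \<phi> \<gamma>' p" using eq by (simp add: coset_point_eq)
  then show "C = C'" using * by (simp add: stabilizer_coset)
qed

lemma coset_point_act:
  assumes \<gamma>: "\<gamma> \<in> carrier \<Gamma>" and C: "C \<in> lcosets\<^bsub>\<Gamma>\<^esub> stabilizer \<Gamma> \<phi> p"
  shows "\<gamma> <#\<^bsub>\<Gamma>\<^esub> C \<in> lcosets\<^bsub>\<Gamma>\<^esub> stabilizer \<Gamma> \<phi> p"
    and "coset_point \<phi> p (\<gamma> <#\<^bsub>\<Gamma>\<^esub> C) = \<phi> \<gamma> (coset_point \<phi> p C)"
    and "coset_point \<phi> p C \<in> D"
proof -
  obtain \<delta> where \<delta>: "\<delta> \<in> carrier \<Gamma>" "C = \<delta> <#\<^bsub>\<Gamma>\<^esub> stabilizer \<Gamma> \<phi> p"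
    using C unfolding LCOSETS_def by blast
  have sub: "stabilizer \<Gamma> \<phi> p \<subseteq> carrier \<Gamma>" by (auto simp: stabilizer_def)
  have eq: "\<gamma> <#\<^bsub>\<Gamma>\<^esub> C = (\<gamma> \<otimes>\<^bsub>\<Gamma>\<^esub> \<delta>) <#\<^bsub>\<Gamma>\<^esub> stabilizer \<Gamma> \<phi> p"
    using \<gamma> \<delta> sub by (simp add: \<Gamma>.lcos_m_assoc)
  then show "\<gamma> <#\<^bsub>\<Gamma>\<^esub> C \<in> lcosets\<^bsub>\<Gamma>\<^esub> stabilizer \<Gamma> \<phi> p" using \<gamma> \<delta> unfolding LCOSETS_def by blast
  show "coset_point \<phi> p (\<gamma> <#\<^bsub>\<Gamma>\<^esub> C) = \<phi> \<gamma> (coset_point \<phi> p C)"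
    unfolding eq using \<gamma> \<delta> p by (simp add: coset_point_eq act_mult)
  show "coset_point \<phi> p C \<in> D" using \<delta> p by (simp add: coset_point_eq act_closed)
qed

lemma coset_inv:
  assumes \<gamma>: "\<gamma> \<in> carrier \<Gamma>" and C: "C \<in> lcosets\<^bsub>\<Gamma>\<^esub> stabilizer \<Gamma> \<phi> p"
  shows "inv\<^bsub>\<Gamma>\<^esub> \<gamma> <#\<^bsub>\<Gamma>\<^esub> (\<gamma> <#\<^bsub>\<Gamma>\<^esub> C) = C" "\<gamma> <#\<^bsub>\<Gamma>\<^esub> (inv\<^bsub>\<Gamma>\<^esub> \<gamma> <#\<^bsub>\<Gamma>\<^esub> C) = C"
proof -
  have "C \<subseteq> carrier \<Gamma>" using subgroup.lcosets_carrier[OF stabilizer_subgroup \<Gamma>.is_group C] .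
  then show "inv\<^bsub>\<Gamma>\<^esub> \<gamma> <#\<^bsub>\<Gamma>\<^esub> (\<gamma> <#\<^bsub>\<Gamma>\<^esub> C) = C" "\<gamma> <#\<^bsub>\<Gamma>\<^esub> (inv\<^bsub>\<Gamma>\<^esub> \<gamma> <#\<^bsub>\<Gamma>\<^esub> C) = C"
    using \<gamma> by (simp_all add: \<Gamma>.lcos_m_assoc \<Gamma>.lcos_mult_one)
qed

end

subsection \<open>The quasi-regular representation\<close>

lemma coset_walk:
  assumes w: "w \<in> seqs"
  shows "reversible_walk (count_space (lcosets\<^bsub>\<Gamma>\<^esub> parabolic \<Gamma> w)) (carrier G)
    (\<lambda>g C. cay g <#\<^bsub>\<Gamma>\<^esub> C) (\<lambda>g C. inv\<^bsub>\<Gamma>\<^esub> (cay g) <#\<^bsub>\<Gamma>\<^esub> C)"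
proof
  note closed = coset_point_act(1)[OF acts_on_seqs w, folded parabolic_def]
  note inv = coset_inv[OF acts_on_seqs w, folded parabolic_def]
  fix g assume g: "g \<in> carrier G"
  have "bij_betw (\<lambda>C. cay g <#\<^bsub>\<Gamma>\<^esub> C) (lcosets\<^bsub>\<Gamma>\<^esub> parabolic \<Gamma> w) (lcosets\<^bsub>\<Gamma>\<^esub> parabolic \<Gamma> w)"
    using g by (intro bij_betwI[where g = "\<lambda>C. inv\<^bsub>\<Gamma>\<^esub> (cay g) <#\<^bsub>\<Gamma>\<^esub> C"]) (auto simp: closed inv)
  then show "distr (count_space (lcosets\<^bsub>\<Gamma>\<^esub> parabolic \<Gamma> w)) (count_space (lcosets\<^bsub>\<Gamma>\<^esub> parabolic \<Gamma> w))
      (\<lambda>C. cay g <#\<^bsub>\<Gamma>\<^esub> C) = count_space (lcosets\<^bsub>\<Gamma>\<^esub> parabolic \<Gamma> w)"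
    by (rule distr_bij_count_space)
  show "(\<lambda>C. cay g <#\<^bsub>\<Gamma>\<^esub> C) \<in> count_space (lcosets\<^bsub>\<Gamma>\<^esub> parabolic \<Gamma> w) \<rightarrow>\<^sub>M count_space (lcosets\<^bsub>\<Gamma>\<^esub> parabolic \<Gamma> w)"
    "(\<lambda>C. inv\<^bsub>\<Gamma>\<^esub> (cay g) <#\<^bsub>\<Gamma>\<^esub> C) \<in> count_space (lcosets\<^bsub>\<Gamma>\<^esub> parabolic \<Gamma> w) \<rightarrow>\<^sub>M count_space (lcosets\<^bsub>\<Gamma>\<^esub> parabolic \<Gamma> w)"
    using g by (auto simp: closed)
  fix C assume "C \<in> space (count_space (lcosets\<^bsub>\<Gamma>\<^esub> parabolic \<Gamma> w))"
  then show "inv\<^bsub>\<Gamma>\<^esub> (cay g) <#\<^bsub>\<Gamma>\<^esub> (cay g <#\<^bsub>\<Gamma>\<^esub> C) = C" "cay g <#\<^bsub>\<Gamma>\<^esub> (inv\<^bsub>\<Gamma>\<^esub> (cay g) <#\<^bsub>\<Gamma>\<^esub> C) = C"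
    using g by (simp_all add: inv)
qed (use finite_carrier in auto)

lemma hecke_quasi_regular:
  assumes w: "w \<in> seqs"
  shows "hecke S (quasi_regular_rep \<Gamma>) =
    reversible_walk.walk (carrier G) (\<lambda>g C. cay g <#\<^bsub>\<Gamma>\<^esub> C) (\<lambda>g C. inv\<^bsub>\<Gamma>\<^esub> (cay g) <#\<^bsub>\<Gamma>\<^esub> C)"
  by (intro ext) (simp add: hecke_def sum_gens card_gens quasi_regular_rep_def
      reversible_walk.walk_def[OF coset_walk[OF w]] add.commute cong: sum.cong)

lemma quasi_regular_spectrum:
  assumes w: "w \<in> seqs"
  shows "L2_spectrum (count_space (lcosets\<^bsub>\<Gamma>\<^esub> parabolic \<Gamma> w)) (hecke S (quasi_regular_rep \<Gamma>)) = complex_of_real ` {-1..1}"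
  unfolding hecke_quasi_regular[OF w]
proof (rule reversible_walk.spectrum_eq[OF coset_walk[OF w]])
  fix m :: nat
  let ?V = "lcosets\<^bsub>\<Gamma>\<^esub> parabolic \<Gamma> w"
  obtain h where h: "h \<in> carrier G" "h \<noteq> \<one>" by (rule obtain_nontrivial)
  \<comment> \<open>Cosets carry counting measure, so the ground floor must be finite, and the tail
    is fixed to be that of \<open>w\<close>. It meets the orbit of \<open>w\<close> because finitary
    elements are transitive on prefixes and leave the tail alone.\<close>
  define B where "B = {y\<in>seqs. y m = h \<and> (\<forall>i. m < i \<longrightarrow> i \<le> 2 * m \<longrightarrow> y i = \<one>) \<and> (\<forall>i>2 * m. y i = w i)}"
  have B: "tower_base m B"
    unfolding tower_base_def using h act_inf_seqs[OF finitary_\<Gamma>] by (auto simp: B_def act_inf_finitary seqs_nth)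
  have inj: "inj_on (prefix_word m) B"
  proof (rule inj_onI)
    fix x y assume xy: "x \<in> B" "y \<in> B" "prefix_word m x = prefix_word m y"
    show "x = y"
    proof
      fix i
      consider "i < m" | "i = m" | "m < i" "i \<le> 2 * m" | "2 * m < i" by linarith
      then show "x i = y i"
      proof cases
        case 1 then show ?thesis using xy(3) nth_prefix_word by metis
      qed (use xy in \<open>auto simp: B_def\<close>)
    qed
  qed
  have "prefix_word m ` B \<subseteq> {u. set u \<subseteq> carrier G \<and> length u = m}"
    by (auto simp: B_def prefix_word_def seqs_nth)
  then have "finite B"
    using finite_lists_length_eq[OF finite_carrier, of m] inj by (meson finite_imageD finite_subset)
  define A where "A = (\<lambda>j. {C\<in>?V. coset_point act_inf w C \<in> tower B j})"
  note pt = coset_point_act[OF acts_on_seqs w, folded parabolic_def]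
  have "coset_point act_inf w ` A 0 \<subseteq> B"
    by (auto simp: A_def tower_def act_inf_one)
  moreover have "inj_on (coset_point act_inf w) (A 0)"
    by (rule inj_on_subset[OF inj_coset_point[OF acts_on_seqs w, folded parabolic_def]]) (auto simp: A_def)
  ultimately have fin: "finite (A 0)" using \<open>finite B\<close> by (meson finite_imageD finite_subset)
  define y where "y = (\<lambda>i. if i = m then h else if i \<le> 2 * m then \<one> else w i)"
  have y: "y \<in> seqs" using h w by (auto simp: y_def)
  obtain \<gamma> where \<gamma>: "\<gamma> \<in> finitary (Suc (2 * m))" "\<gamma> (prefix_word (Suc (2 * m)) w) = prefix_word (Suc (2 * m)) y"
    using finitary_transitive[of "prefix_word (Suc (2 * m)) w" "prefix_word (Suc (2 * m)) y"]
      prefix_word_words[OF w] prefix_word_words[OF y] by auto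
  have "act_inf \<gamma> w = y"
  proof
    fix i show "act_inf \<gamma> w i = y i"
    proof (cases "i < Suc (2 * m)")
      case True
      then show ?thesis using act_inf_nth[OF finitary_\<Gamma>[OF \<gamma>(1)] w True] \<gamma>(2) by simp
    next
      case False
      then show ?thesis using act_inf_finitary[OF \<gamma>(1) w, of i] by (simp add: y_def)
    qed
  qed
  moreover have "y \<in> B" using y by (auto simp: B_def y_def)
  ultimately have "\<gamma> <#\<^bsub>\<Gamma>\<^esub> parabolic \<Gamma> w \<in> A 0"
    using coset_point_eq[OF acts_on_seqs w finitary_\<Gamma>[OF \<gamma>(1)], folded parabolic_def] y finitary_\<Gamma>[OF \<gamma>(1)]
    by (auto simp: A_def tower_def act_inf_one LCOSETS_def)
  then have "A 0 \<noteq> {}" by blast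
  have AV: "A j \<subseteq> ?V" for j by (auto simp: A_def)
  have step: "cay g <#\<^bsub>\<Gamma>\<^esub> C \<in> A (Suc j) \<longleftrightarrow> C \<in> A j" if "j < m" "g \<in> carrier G" "C \<in> ?V" for j g C
    using that tower_step[OF B that(1,2) pt(3)[OF cay_\<Gamma>[OF that(2)] that(3)]]
    by (simp add: A_def pt[OF cay_\<Gamma>])
  have "disjoint_family_on A {..m}"
    using tower_disjoint[OF B] unfolding disjoint_family_on_def A_def by blast
  then show "\<exists>A. (\<forall>j\<le>m. A j \<in> sets (count_space ?V)) \<and> disjoint_family_on A {..m} \<and>
      emeasure (count_space ?V) (A 0) \<noteq> 0 \<and> emeasure (count_space ?V) (A 0) \<noteq> \<infinity> \<and>
      (\<forall>j<m. \<forall>i\<in>carrier G. \<forall>x\<in>space (count_space ?V). cay i <#\<^bsub>\<Gamma>\<^esub> x \<in> A (Suc j) \<longleftrightarrow> x \<in> A j)"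
    using step AV fin \<open>A 0 \<noteq> {}\<close>
    by (intro exI[of _ A]) (auto simp: emeasure_count_space_eq_0)
qed

subsection \<open>The representation on the boundary\<close>

abbreviation \<nu> :: "(nat \<Rightarrow> 'a) measure" where
  "\<nu> \<equiv> uniform_word_measure (carrier G)"

abbreviation letter_measure :: "'a measure" where
  "letter_measure \<equiv> uniform_count_measure (carrier G)"

lemma prob_letter_measure: "prob_space letter_measure"
  using finite_carrier one_closed by (intro prob_space_uniform_count_measure) auto

lemma space_\<nu>: "space \<nu> = seqs"
  by (auto simp: uniform_word_measure_def space_PiM space_uniform_count_measure PiE_UNIV_domain)

lemma prob_space_\<nu>: "prob_space \<nu>"
  unfolding uniform_word_measure_def by (intro prob_space_PiM prob_letter_measure)

definition cylinder :: "'a list \<Rightarrow> (nat \<Rightarrow> 'a) set" where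
  "cylinder u = {y\<in>seqs. prefix_word (length u) y = u}"

lemma cylinder_emb:
  assumes u: "u \<in> words"
  shows "cylinder u = prod_emb UNIV (\<lambda>_. letter_measure) {..<length u} (\<Pi>\<^sub>E i\<in>{..<length u}. {u ! i})"
proof -
  have "prefix_word (length u) y = u \<longleftrightarrow> (\<forall>i<length u. y i = u ! i)" for y
    by (auto simp: list_eq_iff_nth_eq)
  then show ?thesis
    by (auto simp: cylinder_def prod_emb_def space_uniform_count_measure PiE_iff restrict_def extensional_def)
qed

lemma cylinder_sets: "u \<in> words \<Longrightarrow> cylinder u \<in> sets \<nu>"
  unfolding cylinder_emb uniform_word_measure_def
  by (intro sets_PiM_I) (auto simp: sets_uniform_count_measure in_lists_conv_set)

lemma emeasure_cylinder:
  assumes u: "u \<in> words"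
  shows "emeasure \<nu> (cylinder u) = ennreal ((1 / card (carrier G)) ^ length u)"
proof -
  have "emeasure \<nu> (cylinder u) = (\<Prod>i<length u. emeasure letter_measure {u ! i})"
    unfolding cylinder_emb[OF u] uniform_word_measure_def
    using u by (intro emeasure_PiM_emb prob_letter_measure) (auto simp: sets_uniform_count_measure in_lists_conv_set)
  also have "\<dots> = (\<Prod>i<length u. ennreal (1 / card (carrier G)))"
    using u finite_carrier by (intro prod.cong) (auto simp: emeasure_uniform_count_measure in_lists_conv_set)
  finally show ?thesis by (simp add: ennreal_power)
qed

definition level :: "nat \<Rightarrow> 'a list set" where
  "level k = {u\<in>words. length u = k}"

lemma finite_level: "finite (level k)"
  using finite_lists_length_eq[OF finite_carrier, of k]
  by (simp add: level_def in_lists_conv_set subset_eq)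

lemma card_level: "card (level k) = card (carrier G) ^ k"
  using card_lists_length_eq[OF finite_carrier, of k]
  by (simp add: level_def in_lists_conv_set subset_eq)

definition prefix_event :: "nat \<Rightarrow> 'a list set \<Rightarrow> (nat \<Rightarrow> 'a) set" where
  "prefix_event k U = {y\<in>seqs. prefix_word k y \<in> U}"

lemma prefix_event_UN: "U \<subseteq> level k \<Longrightarrow> prefix_event k U = (\<Union>u\<in>U. cylinder u)"
  by (auto simp: prefix_event_def cylinder_def level_def subset_eq)

lemma prefix_event_level: "prefix_event k U = prefix_event k (U \<inter> level k)"
  by (auto simp: prefix_event_def level_def prefix_word_words)

lemma prefix_event_sets: "prefix_event k U \<in> sets \<nu>"
proof -
  have "finite (U \<inter> level k)" using finite_level by blast
  then have "(\<Union>u\<in>U \<inter> level k. cylinder u) \<in> sets \<nu>"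
    by (intro sets.finite_UN) (auto simp: level_def cylinder_sets)
  then show ?thesis by (subst prefix_event_level) (simp add: prefix_event_UN)
qed

lemma emeasure_prefix_event:
  assumes U: "U \<subseteq> level k"
  shows "emeasure \<nu> (prefix_event k U) = of_nat (card U) * ennreal ((1 / card (carrier G)) ^ k)"
proof -
  have "emeasure \<nu> (prefix_event k U) = (\<Sum>u\<in>U. emeasure \<nu> (cylinder u))"
    unfolding prefix_event_UN[OF U]
  proof (rule sum_emeasure[symmetric])
    show "cylinder ` U \<subseteq> sets \<nu>" using U by (auto simp: level_def intro: cylinder_sets)
    show "disjoint_family_on cylinder U"
      unfolding disjoint_family_on_def
    proof (intro ballI impI)
      fix u v assume "u \<in> U" "v \<in> U" "u \<noteq> v"
      moreover from this have "length u = k" "length v = k" using U by (auto simp: level_def)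
      ultimately show "cylinder u \<inter> cylinder v = {}" by (auto simp: cylinder_def)
    qed
    show "finite U" using U finite_level finite_subset by blast
  qed
  also have "\<dots> = (\<Sum>u\<in>U. ennreal ((1 / card (carrier G)) ^ k))"
    using U by (intro sum.cong) (auto simp: emeasure_cylinder level_def)
  finally show ?thesis by simp
qed

lemma act_inf_vimage:
  assumes \<gamma>: "\<gamma> \<in> carrier \<Gamma>"
  shows "act_inf \<gamma> -` prefix_event k U \<inter> space \<nu> = prefix_event k ((inv\<^bsub>\<Gamma>\<^esub> \<gamma>) ` (U \<inter> level k))"
proof -
  have "\<gamma> u \<in> U \<longleftrightarrow> u \<in> (inv\<^bsub>\<Gamma>\<^esub> \<gamma>) ` (U \<inter> level k)" if "u \<in> level k" for u
  proof
    assume "\<gamma> u \<in> U"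
    then have "\<gamma> u \<in> U \<inter> level k" using that \<gamma> by (simp add: level_def \<Gamma>_words)
    then show "u \<in> (inv\<^bsub>\<Gamma>\<^esub> \<gamma>) ` (U \<inter> level k)"
      using \<Gamma>_inv_apply[OF \<gamma>, of u] that by (metis (lifting) image_eqI level_def mem_Collect_eq)
  qed (use \<gamma> in \<open>auto simp: level_def\<close>)
  note iff = this
  show ?thesis
  proof (rule Set.set_eqI)
    fix y
    have "y \<in> act_inf \<gamma> -` prefix_event k U \<inter> space \<nu> \<longleftrightarrow> y \<in> seqs \<and> \<gamma> (prefix_word k y) \<in> U"
      using act_inf_seqs[OF \<gamma>] by (auto simp: space_\<nu> prefix_event_def prefix_act_inf[OF \<gamma>] seqs_nth)
    also have "\<dots> \<longleftrightarrow> y \<in> prefix_event k ((inv\<^bsub>\<Gamma>\<^esub> \<gamma>) ` (U \<inter> level k))"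
    proof (cases "y \<in> seqs")
      case True
      then have "prefix_word k y \<in> level k" by (simp add: level_def prefix_word_words)
      from iff[OF this] True show ?thesis by (simp only: prefix_event_def mem_Collect_eq simp_thms)
    qed (simp add: prefix_event_def)
    finally show "y \<in> act_inf \<gamma> -` prefix_event k U \<inter> space \<nu> \<longleftrightarrow> y \<in> prefix_event k ((inv\<^bsub>\<Gamma>\<^esub> \<gamma>) ` (U \<inter> level k))" .
  qed
qed

lemma coordinate_event:
  assumes "finite J" "J \<subseteq> {..<k}"
  shows "{y\<in>seqs. \<forall>i\<in>J. y i \<in> A i} = prefix_event k {u. \<forall>i\<in>J. u ! i \<in> A i}"
  using assms by (auto simp: prefix_event_def subset_eq)

lemma act_inf_measurable:
  assumes \<gamma>: "\<gamma> \<in> carrier \<Gamma>" shows "act_inf \<gamma> \<in> measurable \<nu> \<nu>"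
proof -
  have "(\<lambda>y i. act_inf \<gamma> y i) \<in> measurable \<nu> (PiM UNIV (\<lambda>_. letter_measure))"
  proof (rule measurable_PiM_single')
    fix i :: nat
    show "(\<lambda>y. act_inf \<gamma> y i) \<in> measurable \<nu> letter_measure"
    proof (rule measurableI)
      fix A assume "A \<in> sets letter_measure"
      have "(\<lambda>y. act_inf \<gamma> y i) -` A \<inter> space \<nu> = act_inf \<gamma> -` {y\<in>seqs. \<forall>i'\<in>{i}. y i' \<in> A} \<inter> space \<nu>"
        using act_inf_seqs[OF \<gamma>] by (auto simp: space_\<nu>)
      also have "\<dots> = prefix_event (Suc i) ((inv\<^bsub>\<Gamma>\<^esub> \<gamma>) ` ({u. \<forall>i'\<in>{i}. u ! i' \<in> A} \<inter> level (Suc i)))"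
        by (subst coordinate_event[where k = "Suc i"]) (auto simp: act_inf_vimage[OF \<gamma>])
      finally show "(\<lambda>y. act_inf \<gamma> y i) -` A \<inter> space \<nu> \<in> sets \<nu>" using prefix_event_sets by simp
    qed (use act_inf_seqs[OF \<gamma>] in \<open>auto simp: space_\<nu> space_uniform_count_measure\<close>)
  qed (use act_inf_seqs[OF \<gamma>] in \<open>auto simp: space_\<nu> space_uniform_count_measure PiE_UNIV_domain\<close>)
  then show ?thesis by (simp add: uniform_word_measure_def)
qed

text \<open>Group elements permute the words of each length, and the measure of the cylinder over a
  word depends on its length alone. Cylinder events determine a finite measure on the product
  space.\<close>

lemma act_inf_preserving:
  assumes \<gamma>: "\<gamma> \<in> carrier \<Gamma>" shows "distr \<nu> \<nu> (act_inf \<gamma>) = \<nu>"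
proof -
  interpret prob_space \<nu> by (rule prob_space_\<nu>)
  interpret D: prob_space "distr \<nu> \<nu> (act_inf \<gamma>)" by (rule prob_space_distr[OF act_inf_measurable[OF \<gamma>]])
  show ?thesis
  proof (rule measure_eqI_PiM_infinite[where I = UNIV and M = "\<lambda>_. letter_measure"])
    show "sets (distr \<nu> \<nu> (act_inf \<gamma>)) = sets (PiM UNIV (\<lambda>_. letter_measure))"
      "sets \<nu> = sets (PiM UNIV (\<lambda>_. letter_measure))"
      by (simp_all add: uniform_word_measure_def)
    show "finite_measure (distr \<nu> \<nu> (act_inf \<gamma>))" by unfold_locales
    fix A and J :: "nat set" assume J: "finite J" "J \<subseteq> UNIV" and A: "\<And>i. i \<in> J \<Longrightarrow> A i \<in> sets letter_measure"
    obtain k where k: "J \<subseteq> {..<k}" using finite_nat_bounded[OF J(1)] by blast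
    have "prod_emb UNIV (\<lambda>_. letter_measure) J (Pi\<^sub>E J A) = {y\<in>seqs. \<forall>i\<in>J. y i \<in> A i}"
      by (auto simp: prod_emb_def space_uniform_count_measure PiE_iff)
    also have "\<dots> = prefix_event k {u. \<forall>i\<in>J. u ! i \<in> A i}" by (rule coordinate_event[OF J(1) k])
    also have "\<dots> = prefix_event k ({u. \<forall>i\<in>J. u ! i \<in> A i} \<inter> level k)" by (rule prefix_event_level)
    finally obtain U where emb: "prod_emb UNIV (\<lambda>_. letter_measure) J (Pi\<^sub>E J A) = prefix_event k U" and U: "U \<subseteq> level k"
      by blast
    have "(inv\<^bsub>\<Gamma>\<^esub> \<gamma>) ` U \<subseteq> level k" using U \<gamma> by (auto simp: level_def \<Gamma>_words)
    moreover have "card ((inv\<^bsub>\<Gamma>\<^esub> \<gamma>) ` U) = card U"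
    proof (rule card_image, rule inj_on_inverseI[where g = \<gamma>])
      fix u assume "u \<in> U" then show "\<gamma> ((inv\<^bsub>\<Gamma>\<^esub> \<gamma>) u) = u" using U \<gamma> by (auto simp: level_def)
    qed
    moreover have "U \<inter> level k = U" using U by blast
    ultimately show "emeasure (distr \<nu> \<nu> (act_inf \<gamma>)) (prod_emb UNIV (\<lambda>_. letter_measure) J (Pi\<^sub>E J A)) =
        emeasure \<nu> (prod_emb UNIV (\<lambda>_. letter_measure) J (Pi\<^sub>E J A))"
      unfolding emb using U
      by (subst emeasure_distr[OF act_inf_measurable[OF \<gamma>] prefix_event_sets])
        (simp add: act_inf_vimage[OF \<gamma>] emeasure_prefix_event)
  qed
qed

lemma boundary_walk: "reversible_walk \<nu> (carrier G) (\<lambda>g. act_inf (cay g)) (\<lambda>g. act_inf (inv\<^bsub>\<Gamma>\<^esub> (cay g)))"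
  using finite_carrier one_closed
  by unfold_locales (auto simp: act_inf_measurable act_inf_preserving act_inf_inv space_\<nu>)

lemma hecke_boundary: "hecke S (word_rep \<Gamma>) =
    reversible_walk.walk (carrier G) (\<lambda>g. act_inf (cay g)) (\<lambda>g. act_inf (inv\<^bsub>\<Gamma>\<^esub> (cay g)))"
  by (intro ext) (simp add: hecke_def sum_gens card_gens word_rep_def
      reversible_walk.walk_def[OF boundary_walk] add.commute cong: sum.cong)

lemma boundary_spectrum: "L2_spectrum \<nu> (hecke S (word_rep \<Gamma>)) = complex_of_real ` {-1..1}"
  unfolding hecke_boundary
proof (rule reversible_walk.spectrum_eq[OF boundary_walk])
  interpret prob_space \<nu> by (rule prob_space_\<nu>)
  fix m :: nat
  obtain h where h: "h \<in> carrier G" "h \<noteq> \<one>" by (rule obtain_nontrivial)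
  \<comment> \<open>Here the tail is left free, so that fixing the letters m to 2 m gives a set of
    positive measure.\<close>
  define U where "U = {u\<in>level (Suc (2 * m)). u ! m = h \<and> (\<forall>i. m < i \<longrightarrow> i \<le> 2 * m \<longrightarrow> u ! i = \<one>)}"
  define B where "B = prefix_event (Suc (2 * m)) U"
  have UL: "U \<subseteq> level (Suc (2 * m))" by (auto simp: U_def)
  have B_iff: "y \<in> B \<longleftrightarrow> y \<in> seqs \<and> y m = h \<and> (\<forall>i. m < i \<longrightarrow> i \<le> 2 * m \<longrightarrow> y i = \<one>)" for y
    by (auto simp: B_def prefix_event_def U_def level_def prefix_word_words seqs_nth)
  have B: "tower_base m B"
    unfolding tower_base_def
  proof (rule conjI; intro ballI)
    fix y assume "y \<in> B"
    then show "y \<in> seqs \<and> y m \<noteq> \<one> \<and> (\<forall>i. m < i \<longrightarrow> i \<le> 2 * m \<longrightarrow> y i = \<one>)"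
      using h by (simp only: B_iff) blast
  next
    fix \<gamma> y assume \<gamma>: "\<gamma> \<in> finitary m" and y: "y \<in> B"
    then have yS: "y \<in> seqs" by (simp only: B_iff)
    have "act_inf \<gamma> y \<in> seqs" by (rule act_inf_seqs[OF finitary_\<Gamma>[OF \<gamma>] yS])
    then show "act_inf \<gamma> y \<in> B" using y act_inf_finitary[OF \<gamma> yS] by (simp only: B_iff) simp
  qed
  have tower_sets: "tower B j \<in> sets \<nu>" for j
  proof -
    have "tower B j = act_inf (X_inv_pow j) -` B \<inter> space \<nu>" by (auto simp: tower_def space_\<nu>)
    then show ?thesis
      using measurable_sets[OF act_inf_measurable[OF X_inv_pow_closed], of B j] prefix_event_sets by (simp add: B_def)
  qed
  have "tower B 0 = B"
  proof (rule Set.set_eqI)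
    fix y show "y \<in> tower B 0 \<longleftrightarrow> y \<in> B"
      by (cases "y \<in> seqs") (simp_all add: tower_def act_inf_one B_iff)
  qed
  moreover have "replicate m \<one> @ [h] @ replicate m \<one> \<in> U"
    using h by (auto simp: U_def level_def replicate_words nth_append)
  then have "U \<noteq> {}" by blast
  then have "card U > 0" using finite_subset[OF UL finite_level] by (simp add: card_gt_0_iff)
  moreover have "card (carrier G) > 0" using finite_carrier one_closed by (auto simp: card_gt_0_iff)
  ultimately have "emeasure \<nu> (tower B 0) \<noteq> 0"
    unfolding B_def by (simp add: emeasure_prefix_event[OF UL] del: power_Suc)
  moreover have "emeasure \<nu> (tower B 0) \<noteq> \<infinity>" by simp
  ultimately show "\<exists>A. (\<forall>j\<le>m. A j \<in> sets \<nu>) \<and> disjoint_family_on A {..m} \<and>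
      emeasure \<nu> (A 0) \<noteq> 0 \<and> emeasure \<nu> (A 0) \<noteq> \<infinity> \<and>
      (\<forall>j<m. \<forall>i\<in>carrier G. \<forall>x\<in>space \<nu>. act_inf (cay i) x \<in> A (Suc j) \<longleftrightarrow> x \<in> A j)"
    using tower_disjoint[OF B] tower_step[OF B] tower_sets by (intro exI[of _ "tower B"]) (auto simp: space_\<nu>)
qed

end

section \<open>Weights of the chains, their total, and their regrouping by reduced fractions\<close>

section \<open>The limiting measure\<close>

text \<open>
  The weights before collecting equal values of \<open>p / L\<close>: a chain of length \<open>L - 1\<close> contributes
  the eigenvalues \<open>cos (p \<pi> / L)\<close>.
\<close>

definition chain_measure :: "nat \<Rightarrow> real measure" where
  "chain_measure n = dirac_sum {(L, p). 1 \<le> p \<and> p < L}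
     (\<lambda>(L, p). (real n - 1)\<^sup>2 / real n ^ L) (\<lambda>(L, p). cos (real p / real L * pi))"

definition chain_count :: "real set \<Rightarrow> nat \<Rightarrow> nat" where
  "chain_count B L = card {p. 1 \<le> p \<and> p < L \<and> cos (real p / real L * pi) \<in> B}"

lemma chain_count_le: "chain_count B L \<le> L - 1"
proof -
  have "chain_count B L \<le> card {1..<L}" unfolding chain_count_def by (intro card_mono) auto
  then show ?thesis by simp
qed

lemma sets_dirac_sum [simp]: "sets (dirac_sum I w x) = sets borel"
  by (simp add: dirac_sum_def)

lemma emeasure_chain_measure:
  assumes B: "B \<in> sets borel"
  shows "emeasure (chain_measure n) B = (\<Sum>L. ennreal ((real n - 1)\<^sup>2 / real n ^ L * real (chain_count B L)))"
proof -
  let ?I = "{(L, p). 1 \<le> p \<and> p < L} :: (nat \<times> nat) set"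
  let ?f = "\<lambda>(L, p). ennreal ((real n - 1)\<^sup>2 / real n ^ L) * indicator B (cos (real p / real L * pi))"
  have "emeasure (chain_measure n) B = (\<integral>\<^sup>+ i. ?f i \<partial>count_space ?I)"
    unfolding chain_measure_def emeasure_dirac_sum[OF B]
    by (intro nn_integral_cong) (auto simp: B)
  also have "\<dots> = (\<integral>\<^sup>+ i. ?f i * indicator ?I i \<partial>count_space UNIV)"
    by (subst nn_integral_count_space_indicator) auto
  also have "\<dots> = (\<integral>\<^sup>+ L. \<integral>\<^sup>+ p. ?f (L, p) * indicator ?I (L, p) \<partial>count_space UNIV \<partial>count_space UNIV)"
    by (rule nn_integral_fst_count_space[symmetric])
  also have "\<dots> = (\<integral>\<^sup>+ L. ennreal ((real n - 1)\<^sup>2 / real n ^ L * real (chain_count B L)) \<partial>count_space UNIV)"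
  proof (intro nn_integral_cong)
    fix L :: nat
    let ?A = "{p. 1 \<le> p \<and> p < L \<and> cos (real p / real L * pi) \<in> B}"
    have fin: "finite ?A" by (rule finite_subset[of _ "{..<L}"]) auto
    have "(\<integral>\<^sup>+ p. ?f (L, p) * indicator ?I (L, p) \<partial>count_space UNIV) =
        (\<integral>\<^sup>+ p. ennreal ((real n - 1)\<^sup>2 / real n ^ L) * indicator ?A p \<partial>count_space UNIV)"
      by (intro nn_integral_cong) (auto simp: indicator_def)
    also have "\<dots> = ennreal ((real n - 1)\<^sup>2 / real n ^ L) * of_nat (card ?A)"
      using fin by (simp add: nn_integral_cmult_indicator)
    also have "\<dots> = ennreal ((real n - 1)\<^sup>2 / real n ^ L * real (chain_count B L))"
      unfolding chain_count_def ennreal_of_nat_eq_real_of_nat by (rule ennreal_mult[symmetric]) auto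
    finally show "(\<integral>\<^sup>+ p. ?f (L, p) * indicator ?I (L, p) \<partial>count_space UNIV) =
        ennreal ((real n - 1)\<^sup>2 / real n ^ L * real (chain_count B L))" .
  qed
  also have "\<dots> = (\<Sum>L. ennreal ((real n - 1)\<^sup>2 / real n ^ L * real (chain_count B L)))"
    by (rule nn_integral_count_space_nat)
  finally show ?thesis .
qed

text \<open>The derivative of the geometric series at 1 / n. The total mass 1 serves twice: it makes
  the limit a probability measure, and later it shows that the projections on the wreath product
  exhaust the space.\<close>

lemma chain_total:
  assumes "2 \<le> n"
  shows "(\<lambda>L. (real n - 1)\<^sup>2 / real n ^ L * real (L - 1)) sums 1"
proof -
  define x where "x = 1 / real n"
  have x: "0 < x" "x < 1" using assms by (auto simp: x_def)
  have "(\<lambda>k. real (Suc k) * x ^ k) sums (1 / (1 - x)\<^sup>2)"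
    using geometric_deriv_sums[of x] x by simp
  then have "(\<lambda>k. ((real n - 1)\<^sup>2 * x\<^sup>2) * (real (Suc k) * x ^ k)) sums (((real n - 1)\<^sup>2 * x\<^sup>2) * (1 / (1 - x)\<^sup>2))"
    by (rule sums_mult)
  also have "(real n - 1) * x = 1 - x" using assms by (simp add: x_def field_simps)
  then have "((real n - 1)\<^sup>2 * x\<^sup>2) * (1 / (1 - x)\<^sup>2) = 1"
    using x by (simp flip: power_mult_distrib)
  also have "(\<lambda>k. ((real n - 1)\<^sup>2 * x\<^sup>2) * (real (Suc k) * x ^ k)) =
      (\<lambda>k. (real n - 1)\<^sup>2 / real n ^ (k + 2) * real (k + 2 - 1))"
    by (auto simp: x_def power_divide power2_eq_square field_simps)
  \<comment> \<open>The terms for L = 0 and L = 1 vanish, the former because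
    \<open>0 - 1 = 0\<close> for natural numbers.\<close>
  finally show ?thesis
    by (subst (asm) sums_iff_shift) (simp add: numeral_2_eq_2)
qed

lemma chain_summable:
  assumes "2 \<le> n"
  shows "summable (\<lambda>L. (real n - 1)\<^sup>2 / real n ^ L * real (chain_count B L))"
proof (rule summable_comparison_test'[OF sums_summable[OF chain_total[OF assms]], of 0])
  fix L :: nat
  show "norm ((real n - 1)\<^sup>2 / real n ^ L * real (chain_count B L)) \<le> (real n - 1)\<^sup>2 / real n ^ L * real (L - 1)"
  proof -
    have "(real n - 1)\<^sup>2 / real n ^ L * real (chain_count B L) \<le> (real n - 1)\<^sup>2 / real n ^ L * real (L - 1)"
      using chain_count_le[of B L] by (intro mult_left_mono) auto
    then show ?thesis by simp
  qed
qed

lemma prob_space_chain_measure: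
  assumes "2 \<le> n" shows "prob_space (chain_measure n)"
proof
  have "chain_count UNIV L = L - 1" for L
  proof -
    have "{p. 1 \<le> p \<and> p < L} = {1..<L}" by auto
    then show ?thesis by (simp add: chain_count_def)
  qed
  then have "emeasure (chain_measure n) UNIV = (\<Sum>L. ennreal ((real n - 1)\<^sup>2 / real n ^ L * real (L - 1)))"
    by (simp add: emeasure_chain_measure)
  also have "\<dots> = ennreal 1"
    using chain_total[OF assms] by (intro suminf_ennreal_eq) auto
  finally show "emeasure (chain_measure n) (space (chain_measure n)) = 1"
    by (simp add: chain_measure_def dirac_sum_def)
qed

lemma measure_chain_measure:
  assumes n: "2 \<le> n" and B: "B \<in> sets borel"
  shows "measure (chain_measure n) B = (\<Sum>L. (real n - 1)\<^sup>2 / real n ^ L * real (chain_count B L))"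
proof -
  have "emeasure (chain_measure n) B = ennreal (\<Sum>L. (real n - 1)\<^sup>2 / real n ^ L * real (chain_count B L))"
    unfolding emeasure_chain_measure[OF B] using n by (intro suminf_ennreal2 chain_summable) auto
  then show ?thesis
    unfolding measure_def using suminf_nonneg[OF chain_summable[OF n]]
    by (simp del: times_divide_eq_left)
qed

text \<open>A geometric series with ratio n^-q. The multiples of q are the parameters L of the
  chains in which a reduced fraction p / q occurs, hence the denominators n^q - 1.\<close>

lemma sums_inverse_powers:
  assumes "2 \<le> n" "1 \<le> q"
  shows "(\<lambda>m. 1 / real n ^ (Suc m * q)) sums (1 / (real n ^ q - 1))"
proof -
  define y where "y = 1 / real n ^ q"
  have "1 < real n ^ q" using assms by (intro one_less_power) auto
  moreover have "n > 0" using assms by simp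
  ultimately have y: "0 < y" "y < 1" by (auto simp: y_def divide_less_eq_1)
  have "(\<lambda>m. y * y ^ m) sums (y * (1 / (1 - y)))"
    using y by (intro sums_mult geometric_sums) auto
  moreover have "y * (1 / (1 - y)) = 1 / (real n ^ q - 1)"
    using \<open>1 < real n ^ q\<close> assms by (simp add: y_def field_simps)
  moreover have "y * y ^ m = 1 / real n ^ (Suc m * q)" for m
    by (simp add: y_def power_add power_mult power_divide mult.commute[of m q])
  ultimately show ?thesis by simp
qed

text \<open>Reducing p / L to lowest terms splits the index (L, p) into a reduced pair and the
  greatest common divisor, and the cosine depends on the reduced pair only. The divisor is written
  \<open>Suc m\<close> so that m runs over all natural numbers.\<close>

lemma chain_measure_eq:
  assumes n: "2 \<le> n" shows "chain_measure n = cayley_machine_measure n"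
proof (rule measure_eqI)
  show "sets (chain_measure n) = sets (cayley_machine_measure n)"
    by (simp add: chain_measure_def cayley_machine_measure_def)
  fix B assume "B \<in> sets (chain_measure n)"
  then have B: "B \<in> sets borel" by (simp add: chain_measure_def)
  let ?I = "{(L, p). 1 \<le> p \<and> p < L} :: (nat \<times> nat) set"
  let ?R = "{(q, p). 2 \<le> q \<and> 1 \<le> p \<and> p < q \<and> coprime p q} :: (nat \<times> nat) set"
  let ?ind = "\<lambda>(q, p). indicator B (cos (real p / real q * pi)) :: ennreal"
  let ?f = "\<lambda>(L, p). ennreal ((real n - 1)\<^sup>2 / real n ^ L) * ?ind (L, p)"
  let ?h = "\<lambda>((q, p), m). (Suc m * q, Suc m * p)"
  have bij: "bij_betw ?h (?R \<times> UNIV) ?I"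
  proof (rule bij_betwI[where g = "\<lambda>(L, p). ((L div gcd p L, p div gcd p L), gcd p L - 1)"])
    show "?h \<in> ?R \<times> UNIV \<rightarrow> ?I" by (auto simp: mult_less_cancel1 simp del: mult_Suc)
    show "(\<lambda>(L, p). ((L div gcd p L, p div gcd p L), gcd p L - 1)) \<in> ?I \<rightarrow> ?R \<times> UNIV"
    proof clarsimp
      fix L p :: nat assume p: "Suc 0 \<le> p" "p < L"
      define d where "d = gcd p L"
      have d: "d > 0" using p by (simp add: d_def)
      obtain p' L' where pl: "p = p' * d" "L = L' * d" "coprime p' L'"
        using gcd_coprime_exists[of p L] d unfolding d_def by auto
      have "p' < L'" "p' \<ge> 1" using p pl d by (auto simp: Suc_le_eq)
      then show "2 \<le> L div gcd p L \<and> Suc 0 \<le> p div gcd p L \<and> p div gcd p L < L div gcd p L \<and>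
          coprime (p div gcd p L) (L div gcd p L)"
        unfolding d_def[symmetric] using pl d by simp
    qed
  next
    fix x assume "x \<in> ?R \<times> (UNIV :: nat set)"
    then obtain q p m where x: "x = ((q, p), m)" and pq: "1 \<le> p" "p < q" "coprime p q" by auto
    have "gcd (Suc m * p) (Suc m * q) = Suc m * gcd p q" by (rule gcd_mult_distrib_nat[symmetric])
    then have "gcd (Suc m * p) (Suc m * q) = Suc m" using pq by simp
    then show "(\<lambda>(L, p). ((L div gcd p L, p div gcd p L), gcd p L - 1)) (?h x) = x"
      by (simp add: x del: mult_Suc)
  next
    fix x assume "x \<in> ?I"
    then obtain L p where x: "x = (L, p)" and p: "1 \<le> p" "p < L" by auto
    then have "Suc (gcd p L - 1) = gcd p L" by (simp add: gcd_nat.neutr_eq_iff)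
    then show "?h ((\<lambda>(L, p). ((L div gcd p L, p div gcd p L), gcd p L - 1)) x) = x"
      by (simp add: x del: mult_Suc)
  qed
  have "emeasure (chain_measure n) B = (\<integral>\<^sup>+ i. ?f i \<partial>count_space ?I)"
    unfolding chain_measure_def emeasure_dirac_sum[OF B]
    by (intro nn_integral_cong) (auto simp: B)
  also have "\<dots> = (\<integral>\<^sup>+ x. ?f (?h x) \<partial>count_space (?R \<times> UNIV))"
    by (rule nn_integral_bij_count_space[OF bij, symmetric])
  also have "\<dots> = (\<integral>\<^sup>+ x. (ennreal ((real n - 1)\<^sup>2 / real n ^ (Suc (snd x) * fst (fst x))) * ?ind (fst x)) \<partial>count_space (?R \<times> UNIV))"
  proof (intro nn_integral_cong)
    fix x assume "x \<in> space (count_space (?R \<times> (UNIV :: nat set)))"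
    then obtain q p m where x: "x = ((q, p), m)" by (metis surj_pair)
    have "real (Suc m * p) / real (Suc m * q) = real p / real q"
      by (simp only: of_nat_mult) (simp add: mult_divide_mult_cancel_left del: of_nat_Suc)
    then show "?f (?h x) = ennreal ((real n - 1)\<^sup>2 / real n ^ (Suc (snd x) * fst (fst x))) * ?ind (fst x)"
      unfolding x prod.case fst_conv snd_conv by simp
  qed
  also have "\<dots> = (\<integral>\<^sup>+ x. (ennreal ((real n - 1)\<^sup>2 / real n ^ (Suc (snd x) * fst (fst x))) * ?ind (fst x)) * indicator ?R (fst x) \<partial>count_space UNIV)"
    by (subst nn_integral_count_space_indicator) (auto intro!: nn_integral_cong simp: indicator_def)
  also have "\<dots> = (\<integral>\<^sup>+ r. \<integral>\<^sup>+ m. (ennreal ((real n - 1)\<^sup>2 / real n ^ (Suc m * fst r)) * ?ind r) * indicator ?R r \<partial>count_space UNIV \<partial>count_space UNIV)"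
    by (subst nn_integral_fst_count_space[symmetric]) simp
  also have "\<dots> = (\<integral>\<^sup>+ r. (ennreal ((real n - 1)\<^sup>2 * (1 / (real n ^ fst r - 1))) * ?ind r) * indicator ?R r \<partial>count_space UNIV)"
  proof (intro nn_integral_cong)
    fix r :: "nat \<times> nat"
    show "(\<integral>\<^sup>+ m. (ennreal ((real n - 1)\<^sup>2 / real n ^ (Suc m * fst r)) * ?ind r) * indicator ?R r \<partial>count_space UNIV) =
        (ennreal ((real n - 1)\<^sup>2 * (1 / (real n ^ fst r - 1))) * ?ind r) * indicator ?R r"
    proof (cases "r \<in> ?R")
      case True
      then have q: "1 \<le> fst r" by auto
      have "(\<integral>\<^sup>+ m. ennreal ((real n - 1)\<^sup>2 / real n ^ (Suc m * fst r)) \<partial>count_space UNIV) =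
          (\<Sum>m. ennreal ((real n - 1)\<^sup>2 / real n ^ (Suc m * fst r)))"
        by (rule nn_integral_count_space_nat)
      also have "\<dots> = ennreal ((real n - 1)\<^sup>2 * (1 / (real n ^ fst r - 1)))"
        using sums_mult[OF sums_inverse_powers[OF n q], of "(real n - 1)\<^sup>2"]
        by (intro suminf_ennreal_eq) auto
      finally show ?thesis using True by (simp add: nn_integral_multc del: mult_Suc)
    qed simp
  qed
  also have "\<dots> = (\<integral>\<^sup>+ r. ennreal ((real n - 1)\<^sup>2 * (1 / (real n ^ fst r - 1))) * ?ind r \<partial>count_space ?R)"
    by (subst nn_integral_count_space_indicator) auto
  also have "\<dots> = emeasure (cayley_machine_measure n) B"
    unfolding cayley_machine_measure_def emeasure_dirac_sum[OF B]
    by (intro nn_integral_cong) (auto simp: B)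
  finally show "emeasure (chain_measure n) B = emeasure (cayley_machine_measure n) B" .
qed

section \<open>Multiplicities from an explicit eigenbasis\<close>

section \<open>Eigenvalue counting measures\<close>

lemma vector_space_functions: "vector_space (\<lambda>(a::complex) f (x::'x). a * f x)"
  by standard (auto simp: fun_eq_iff algebra_simps)

interpretation fs: vector_space "\<lambda>(a::complex) f (x::'x). a * f x"
  by (rule vector_space_functions)

lemma sum_fun_apply: "(\<Sum>i\<in>A. f i) x = (\<Sum>i\<in>A. f i x)"
  for f :: "'i \<Rightarrow> 'x \<Rightarrow> 'b::comm_monoid_add"
  by (induction A rule: infinite_finite_induct) auto

text \<open>Multiplicities are found by exhibiting as many independent eigenvectors as there are
  vertices: the family then spans, and each eigenspace is spanned by the members with its
  eigenvalue. Measuring a set of eigenvalues thus becomes counting indices.\<close>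

locale eigenbasis =
  fixes V :: "'x set" and T :: "('x \<Rightarrow> complex) \<Rightarrow> 'x \<Rightarrow> complex"
    and J :: "'j set" and b :: "'j \<Rightarrow> 'x \<Rightarrow> complex" and ev :: "'j \<Rightarrow> real"
  assumes finite_V: "finite V" and finite_J: "finite J" and card_eq: "card J = card V"
    and vanish: "\<And>j x. j \<in> J \<Longrightarrow> x \<notin> V \<Longrightarrow> b j x = 0"
    and indep: "\<And>a. (\<And>x. x \<in> V \<Longrightarrow> (\<Sum>j\<in>J. a j * b j x) = 0) \<Longrightarrow> \<forall>j\<in>J. a j = 0"
    and eig: "\<And>j x. j \<in> J \<Longrightarrow> x \<in> V \<Longrightarrow> T (b j) x = complex_of_real (ev j) * b j x"
    and linear: "\<And>a x. x \<in> V \<Longrightarrow> T (\<lambda>y. \<Sum>j\<in>J. a j * b j y) x = (\<Sum>j\<in>J. a j * T (b j) x)"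
begin

lemma inj_b: "inj_on b J"
proof (rule inj_onI)
  fix i j assume ij: "i \<in> J" "j \<in> J" "b i = b j"
  show "i = j"
  proof (rule ccontr)
    assume "i \<noteq> j"
    let ?a = "\<lambda>k. if k = i then 1 else if k = j then -1 else 0 :: complex"
    have "(\<Sum>k\<in>J. ?a k * b k x) = (\<Sum>k\<in>{i, j}. ?a k * b k x)" for x
      using ij finite_J by (intro sum.mono_neutral_right) auto
    then have "(\<Sum>k\<in>J. ?a k * b k x) = 0" for x using ij \<open>i \<noteq> j\<close> by simp
    from indep[OF this] ij show False by auto
  qed
qed

lemma sum_image_b: "(\<Sum>v\<in>b ` J. f v) = (\<Sum>j\<in>J. f (b j))"
  using inj_b by (simp add: sum.reindex)

lemma independent_b: "fs.independent (b ` J)"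
proof -
  have "u v = 0" if "(\<Sum>v\<in>b ` J. (\<lambda>x. u v * v x)) = 0" "v \<in> b ` J" for u v
  proof -
    have "(\<Sum>j\<in>J. u (b j) * b j x) = 0" for x
      using fun_cong[OF that(1), of x] by (simp add: sum_fun_apply sum_image_b)
    from indep[OF this] that(2) show ?thesis by auto
  qed
  then show ?thesis using finite_J by (subst fs.dependent_finite) auto
qed

lemma expansion:
  assumes f: "\<And>x. x \<notin> V \<Longrightarrow> f x = 0"
  obtains a where "f = (\<lambda>x. \<Sum>j\<in>J. a j * b j x)"
proof -
  define d :: "'x \<Rightarrow> 'x \<Rightarrow> complex" where "d = (\<lambda>y x. of_bool (x = y))"
  have in_span: "h \<in> fs.span (d ` V)" if "\<And>x. x \<notin> V \<Longrightarrow> h x = 0" for h :: "'x \<Rightarrow> complex"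
  proof -
    have "h = (\<Sum>y\<in>V. (\<lambda>x. h y * d y x))"
    proof
      fix x
      have "(\<Sum>y\<in>V. (\<lambda>x. h y * d y x)) x = (\<Sum>y\<in>V. if y = x then h y else 0)"
        unfolding sum_fun_apply by (intro sum.cong) (auto simp: d_def)
      then show "h x = (\<Sum>y\<in>V. (\<lambda>x. h y * d y x)) x" using that finite_V by simp
    qed
    also have "\<dots> \<in> fs.span (d ` V)"
      by (intro fs.span_sum fs.span_scale fs.span_base) auto
    finally show ?thesis .
  qed
  have "f \<in> fs.span (b ` J)"
  proof (rule ccontr)
    \<comment> \<open>Otherwise \<open>f\<close> together with the \<open>b j\<close> would be more
      independent vectors than there are point masses spanning the functions on
      \<open>V\<close>.\<close>
    assume n: "f \<notin> fs.span (b ` J)"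
    then have "fs.independent (insert f (b ` J))" using independent_b by (simp add: fs.independent_insert)
    moreover have "insert f (b ` J) \<subseteq> fs.span (d ` V)"
      using in_span vanish f by auto
    ultimately have "card (insert f (b ` J)) \<le> card (d ` V)"
      using fs.independent_span_bound[of "d ` V"] finite_V by auto
    also have "\<dots> \<le> card V" by (rule card_image_le[OF finite_V])
    finally have "card (insert f (b ` J)) \<le> card V" .
    moreover have "f \<notin> b ` J" using n fs.span_base by blast
    then have "card (insert f (b ` J)) = Suc (card V)"
      using finite_J card_eq card_image[OF inj_b] by simp
    ultimately show False by simp
  qed
  then obtain u where "f = (\<Sum>v\<in>b ` J. (\<lambda>x. u v * v x))"
    using finite_J by (subst (asm) fs.span_finite) auto
  then have "f = (\<lambda>x. \<Sum>j\<in>J. u (b j) * b j x)"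
    by (simp add: sum_image_b) (simp add: sum_fun_apply fun_eq_iff)
  then show thesis by (rule that)
qed

definition eig_index :: "real \<Rightarrow> 'j set" where
  "eig_index c = {j\<in>J. ev j = c}"

lemma eigenspace_span: "eigenspace V T (complex_of_real c) \<subseteq> fs.span (b ` eig_index c)"
proof
  fix f assume f: "f \<in> eigenspace V T (complex_of_real c)"
  then obtain a where a: "f = (\<lambda>x. \<Sum>j\<in>J. a j * b j x)"
    using expansion[of f] unfolding eigenspace_def by blast
  have "(\<Sum>j\<in>J. (a j * complex_of_real (ev j - c)) * b j x) = 0" if x: "x \<in> V" for x
  proof -
    have "T f x = complex_of_real c * f x" using f x by (simp add: eigenspace_def)
    then have "(\<Sum>j\<in>J. a j * (complex_of_real (ev j) * b j x)) = complex_of_real c * (\<Sum>j\<in>J. a j * b j x)"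
      unfolding a linear[OF x] using eig x by simp
    then show ?thesis by (simp add: sum_distrib_left sum_subtractf algebra_simps)
  qed
  from indep[OF this] have z: "ev j = c \<or> a j = 0" if "j \<in> J" for j using that by auto
  have "f = (\<Sum>j\<in>eig_index c. (\<lambda>x. a j * b j x))"
  proof
    fix x show "f x = (\<Sum>j\<in>eig_index c. (\<lambda>x. a j * b j x)) x"
      unfolding a sum_fun_apply eig_index_def using finite_J z
      by (intro sum.mono_neutral_right) auto
  qed
  also have "\<dots> \<in> fs.span (b ` eig_index c)"
    by (intro fs.span_sum fs.span_scale fs.span_base) auto
  finally show "f \<in> fs.span (b ` eig_index c)" .
qed

lemma b_eigenspace: "j \<in> eig_index c \<Longrightarrow> b j \<in> eigenspace V T (complex_of_real c)"
  using vanish eig by (auto simp: eigenspace_def eig_index_def)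

lemma multiplicity_eq: "multiplicity_on V T (complex_of_real c) = card (eig_index c)"
  unfolding multiplicity_on_def
proof (rule fs.dim_unique[where B = "b ` eig_index c"])
  have sub: "eig_index c \<subseteq> J" by (auto simp: eig_index_def)
  show "fs.independent (b ` eig_index c)"
    using independent_b by (rule fs.independent_mono) (use sub in auto)
  show "card (b ` eig_index c) = card (eig_index c)"
    by (rule card_image[OF inj_on_subset[OF inj_b sub]])
qed (use b_eigenspace eigenspace_span in auto)

lemma b_nonzero: assumes "j \<in> J" shows "b j \<noteq> (\<lambda>_. 0)"
proof
  assume z: "b j = (\<lambda>_. 0)"
  have "(\<Sum>i\<in>J. of_bool (i = j) * b i x) = 0" for x
    using z by (intro sum.neutral) auto
  from indep[OF this] assms show False by auto
qed

lemma eigenvalue_iff: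
  "(\<exists>f\<in>eigenspace V T (complex_of_real c). f \<noteq> (\<lambda>_. 0)) \<longleftrightarrow> c \<in> ev ` J"
proof
  assume "\<exists>f\<in>eigenspace V T (complex_of_real c). f \<noteq> (\<lambda>_. 0)"
  then obtain f where f: "f \<in> eigenspace V T (complex_of_real c)" "f \<noteq> (\<lambda>_. 0)" by blast
  have "eig_index c \<noteq> {}"
  proof
    assume "eig_index c = {}"
    then have "f \<in> {0}" using f(1) eigenspace_span[of c] by auto
    then show False using f(2) by (auto simp: zero_fun_def)
  qed
  then show "c \<in> ev ` J" by (auto simp: eig_index_def)
next
  assume "c \<in> ev ` J"
  then obtain j where "j \<in> J" "ev j = c" by auto
  then show "\<exists>f\<in>eigenspace V T (complex_of_real c). f \<noteq> (\<lambda>_. 0)"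
    using b_eigenspace[of j c] b_nonzero[of j] by (auto simp: eig_index_def)
qed

lemma counting_measure:
  fixes N :: real
  assumes B: "B \<in> sets borel" and N: "N > 0"
  shows "emeasure (dirac_sum {r. \<exists>f\<in>eigenspace V T (complex_of_real r). f \<noteq> (\<lambda>_. 0)}
      (\<lambda>r. real (multiplicity_on V T (complex_of_real r)) / N) (\<lambda>r. r)) B =
    ennreal (real (card {j\<in>J. ev j \<in> B}) / N)"
proof -
  have fin: "finite (ev ` J)" using finite_J by simp
  have "emeasure (dirac_sum {r. \<exists>f\<in>eigenspace V T (complex_of_real r). f \<noteq> (\<lambda>_. 0)}
      (\<lambda>r. real (multiplicity_on V T (complex_of_real r)) / N) (\<lambda>r. r)) B =
    (\<integral>\<^sup>+ r. ennreal (real (card (eig_index r)) / N) * indicator B r \<partial>count_space (ev ` J))"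
    unfolding emeasure_dirac_sum[OF B] eigenvalue_iff multiplicity_eq Collect_mem_eq
    by (intro nn_integral_cong) (auto simp: B)
  also have "\<dots> = (\<Sum>r\<in>ev ` J. ennreal (real (card (eig_index r)) / N) * indicator B r)"
    by (rule nn_integral_count_space_finite[OF fin])
  also have "\<dots> = (\<Sum>r\<in>ev ` J. ennreal (real (card (eig_index r)) / N * indicator B r))"
    by (intro sum.cong) (auto simp: indicator_def)
  also have "\<dots> = ennreal (\<Sum>r\<in>ev ` J. real (card (eig_index r)) / N * indicator B r)"
    using N by (intro sum_ennreal) auto
  also have "(\<Sum>r\<in>ev ` J. real (card (eig_index r)) / N * indicator B r) =
      (\<Sum>r\<in>ev ` J. \<Sum>j\<in>eig_index r. indicator B (ev j) / N)"
    by (intro sum.cong) (auto simp: eig_index_def indicator_def)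
  also have "\<dots> = (\<Sum>j\<in>J. indicator B (ev j) / N)"
    unfolding eig_index_def by (rule sum.image_gen[OF finite_J, symmetric])
  also have "\<dots> = real (card {j\<in>J. ev j \<in> B}) / N"
    using finite_J by (simp add: indicator_def sum_divide_distrib[symmetric] Int_def if_distrib sum.If_cases)
  finally show ?thesis .
qed

end

section \<open>Sums along a path\<close>

text \<open>Summation by parts for the adjacency operator of a path with t + 1 vertices. The
  coefficients are shifted by one so that \<open>s 0\<close> and \<open>s (Suc (Suc t))\<close> sit
  at the virtual neighbours of the two ends. A general ring is used because the values are complex
  numbers on the levels and operators on the wreath product.\<close>

lemma path_sum:
  fixes s y :: "nat \<Rightarrow> 'r::ring_1"
  shows "(\<Sum>i\<le>t. s (Suc i) * ((if i < t then y (Suc i) else 0) + (if 0 < i then y (i - 1) else 0))) =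
    (\<Sum>i\<le>t. (s i + s (Suc (Suc i))) * y i) - s 0 * y 0 - s (Suc (Suc t)) * y t"
proof (induction t)
  case (Suc t)
  have "(\<Sum>i\<le>Suc t. s (Suc i) * ((if i < Suc t then y (Suc i) else 0) + (if 0 < i then y (i - 1) else 0))) =
     (\<Sum>i\<le>t. s (Suc i) * ((if i < t then y (Suc i) else 0) + (if 0 < i then y (i - 1) else 0)))
      + s (Suc t) * y (Suc t) + s (Suc (Suc t)) * y t"
  proof -
    have "(\<Sum>i\<le>t. s (Suc i) * ((if i < Suc t then y (Suc i) else 0) + (if 0 < i then y (i - 1) else 0))) =
      (\<Sum>i\<le>t. s (Suc i) * ((if i < t then y (Suc i) else 0) + (if 0 < i then y (i - 1) else 0)) + (if i = t then s (Suc t) * y (Suc t) else 0))"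
      by (intro sum.cong) (auto simp: algebra_simps)
    also have "\<dots> = (\<Sum>i\<le>t. s (Suc i) * ((if i < t then y (Suc i) else 0) + (if 0 < i then y (i - 1) else 0))) + s (Suc t) * y (Suc t)"
      by (simp add: sum.distrib)
    finally show ?thesis by simp
  qed
  then show ?case using Suc.IH by (simp add: algebra_simps)
qed (simp add: algebra_simps)

lemma sine_three_term: "sin (real i * \<theta>) + sin (real (Suc (Suc i)) * \<theta>) = 2 * cos \<theta> * sin (real (Suc i) * \<theta>)"
proof -
  have "real i * \<theta> = real (Suc i) * \<theta> - \<theta>" "real (Suc (Suc i)) * \<theta> = real (Suc i) * \<theta> + \<theta>"
    by (simp_all add: algebra_simps)
  then show ?thesis by (simp only: sin_add sin_diff) simp
qed

section \<open>Decomposition of the functions on words of length k into paths\<close>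

section \<open>The spectrum on the levels\<close>

context cayley_group
begin

abbreviation N :: nat where "N \<equiv> card (carrier G)"

lemma N_ge_2: "2 \<le> N"
proof -
  obtain h where h: "h \<in> carrier G" "h \<noteq> \<one>" by (rule obtain_nontrivial)
  have "card {\<one>, h} \<le> N" using h finite_carrier by (intro card_mono) auto
  then show ?thesis using h by simp
qed

abbreviation F :: "'a list \<Rightarrow> 'a list" where "F \<equiv> bwd \<one>"

abbreviation diag :: "'a \<Rightarrow> 'a list \<Rightarrow> 'a list" where "diag g \<equiv> map (\<lambda>a. g \<otimes> a)"

lemma level_words: "u \<in> level k \<Longrightarrow> u \<in> words"
  and level_length: "u \<in> level k \<Longrightarrow> length u = k"
  by (auto simp: level_def)

lemma level_nth: "u \<in> level k \<Longrightarrow> i < k \<Longrightarrow> u ! i \<in> carrier G"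
  by (auto simp: level_def in_lists_conv_set)

lemma fwd_level: "g \<in> carrier G \<Longrightarrow> u \<in> level k \<Longrightarrow> fwd g u \<in> level k"
  by (simp add: level_def fwd_words)

lemma bwd_level: "g \<in> carrier G \<Longrightarrow> u \<in> level k \<Longrightarrow> bwd g u \<in> level k"
  by (simp add: level_def bwd_words)

lemma F_pow_level: "u \<in> level k \<Longrightarrow> (F ^^ i) u \<in> level k"
  by (induction i) (auto simp: bwd_level)

lemma diag_level: "g \<in> carrier G \<Longrightarrow> u \<in> level k \<Longrightarrow> diag g u \<in> level k"
  by (auto simp: level_def in_lists_conv_set)

lemma update_level: "u \<in> level k \<Longrightarrow> a \<in> carrier G \<Longrightarrow> u[t := a] \<in> level k"
  by (auto simp: level_def in_lists_conv_set dest!: set_update_subset_insert[THEN subsetD])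

lemma bij_fwd: "g \<in> carrier G \<Longrightarrow> bij_betw (fwd g) (level k) (level k)"
  and bij_bwd: "g \<in> carrier G \<Longrightarrow> bij_betw (bwd g) (level k) (level k)"
  by (rule bij_betwI[where g = "bwd g"] bij_betwI[where g = "fwd g"];
      auto simp: fwd_level bwd_level level_words bwd_fwd fwd_bwd)+

lemma bij_F_pow: "bij_betw (F ^^ i) (level k) (level k)"
proof (induction i)
  case (Suc i)
  then show ?case using bij_betw_trans[OF Suc bij_bwd[OF one_closed]] by (simp add: comp_def)
qed (simp add: bij_betw_def)

lemma bij_diag:
  assumes "g \<in> carrier G" shows "bij_betw (diag g) (level k) (level k)"
proof (rule bij_betwI[where g = "diag (inv g)"])
  have "diag h (diag h' u) = u" if "u \<in> level k" "h \<otimes> h' = \<one>" "h \<in> carrier G" "h' \<in> carrier G" for h h' u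
    using that by (auto simp: level_def in_lists_conv_set m_assoc[symmetric] intro!: map_idI)
  then show "u \<in> level k \<Longrightarrow> diag (inv g) (diag g u) = u" "u \<in> level k \<Longrightarrow> diag g (diag (inv g) u) = u" for u
    using assms by auto
qed (use assms in \<open>auto simp: diag_level\<close>)

lemma fwd_diag:
  assumes "g \<in> carrier G" "h \<in> carrier G" "u \<in> words" shows "fwd (g \<otimes> h) u = diag g (fwd h u)"
  using assms by (induction u arbitrary: h) (auto simp: m_assoc)

subsection \<open>Words that agree from some position on\<close>

text \<open>Dependence on the letters from position t on is expressed as invariance under this
  relation. It fits the locality of \<open>F\<close>: each application carries a disturbance one
  place further.\<close>

definition agree :: "nat \<Rightarrow> 'a list \<Rightarrow> 'a list \<Rightarrow> bool" where
  "agree t u u' \<longleftrightarrow> length u = length u' \<and> (\<forall>i. t \<le> i \<longrightarrow> i < length u \<longrightarrow> u ! i = u' ! i)"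

lemma agree_refl: "agree t u u"
  by (simp add: agree_def)

lemma agree_mono: "agree t u u' \<Longrightarrow> t \<le> t' \<Longrightarrow> agree t' u u'"
  by (auto simp: agree_def)

lemma agree_bwd: "agree t u u' \<Longrightarrow> agree (Suc t) (bwd g u) (bwd h u')"
  unfolding agree_def
proof (intro conjI allI impI)
  fix i assume *: "length u = length u' \<and> (\<forall>i. t \<le> i \<longrightarrow> i < length u \<longrightarrow> u ! i = u' ! i)"
    and i: "Suc t \<le> i" "i < length (bwd g u)"
  then obtain i' where "i = Suc i'" by (cases i) auto
  then show "bwd g u ! i = bwd h u' ! i" using * i by (simp add: nth_bwd)
qed simp

lemma agree_F_pow: "agree t u u' \<Longrightarrow> agree (t + i) ((F ^^ i) u) ((F ^^ i) u')"
  by (induction i) (auto dest: agree_bwd)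

lemma agree_F_fwd: "g \<in> carrier G \<Longrightarrow> u \<in> words \<Longrightarrow> agree 1 (F (fwd g u)) u"
  by (cases u) (auto simp: agree_def bwd_fwd nth_Cons')

lemma agree_F_diag: "g \<in> carrier G \<Longrightarrow> u \<in> words \<Longrightarrow> agree 1 (F (diag g u)) (F u)"
proof (unfold agree_def, intro conjI allI impI)
  fix i assume g: "g \<in> carrier G" and u: "u \<in> words" and i: "1 \<le> i" "i < length (F (diag g u))"
  then obtain i' where i': "i = Suc i'" by (cases i) auto
  have "u ! i' \<in> carrier G" "u ! i \<in> carrier G" using u i i' by (auto simp: in_lists_conv_set)
  then have "inv (g \<otimes> u ! i') \<otimes> (g \<otimes> u ! i) = inv (u ! i') \<otimes> u ! i"
    using g by (simp add: inv_mult_group m_assoc) (simp add: m_assoc[symmetric])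
  then show "F (diag g u) ! i = F u ! i" using i i' by (simp add: nth_bwd)
qed simp

text \<open>Varying g changes the letter 0 of \<open>bwd g u\<close> only. Under \<open>F\<close>
  the letter at the front of the disturbance is divided into an undisturbed one, so the new front is
  still an injective function of g. Summing over the generators thus becomes summing over all values
  of one letter.\<close>

lemma inj_first_changed_letter:
  assumes u: "u \<in> level k" and i: "i < k"
  shows "inj_on (\<lambda>g. (F ^^ i) (bwd g u) ! i) (carrier G)"
  using i
proof (induction i)
  case 0
  show ?case
  proof (rule inj_onI)
    fix g h assume g: "g \<in> carrier G" and h: "h \<in> carrier G" and "(F ^^ 0) (bwd g u) ! 0 = (F ^^ 0) (bwd h u) ! 0"
    then have "inv g \<otimes> u ! 0 = inv h \<otimes> u ! 0" using 0 u by (simp add: nth_bwd level_length)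
    then have "inv g = inv h" using g h level_nth[OF u 0] by simp
    then show "g = h" using g h by (metis inv_inv)
  qed
next
  case (Suc i)
  show ?case
  proof (rule inj_onI)
    fix g h assume g: "g \<in> carrier G" and h: "h \<in> carrier G"
      and eq: "(F ^^ Suc i) (bwd g u) ! Suc i = (F ^^ Suc i) (bwd h u) ! Suc i"
    define y z where "y = (F ^^ i) (bwd g u)" and "z = (F ^^ i) (bwd h u)"
    have yz: "y \<in> level k" "z \<in> level k" using g h u by (auto simp: y_def z_def F_pow_level bwd_level)
    have "agree (1 + i) y z" unfolding y_def z_def
      by (intro agree_F_pow) (use agree_bwd[OF agree_refl[of 0 u], of g h] in simp)
    then have "y ! Suc i = z ! Suc i" using Suc.prems yz by (auto simp: agree_def level_length)
    moreover have "inv (y ! i) \<otimes> y ! Suc i = inv (z ! i) \<otimes> z ! Suc i"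
      using eq Suc.prems yz by (simp add: nth_bwd level_length flip: y_def z_def)
    ultimately have "inv (y ! i) = inv (z ! i)"
      using level_nth[OF yz(1)] level_nth[OF yz(2)] Suc.prems by simp
    then have "y ! i = z ! i"
      using level_nth[OF yz(1), of i] level_nth[OF yz(2), of i] Suc.prems by (metis Suc_lessD inv_inv)
    then show "g = h" using Suc.IH Suc.prems g h by (simp add: y_def z_def inj_on_def)
  qed
qed

subsection \<open>Chains\<close>

definition level_walk :: "('a list \<Rightarrow> complex) \<Rightarrow> 'a list \<Rightarrow> complex" where
  "level_walk f u = (\<Sum>g\<in>carrier G. f (fwd g u) + f (bwd g u)) / of_nat (2 * N)"

text \<open>
  A starter \<open>v\<close> of a chain of length \<open>t + 1\<close>: the functions \<open>v\<close>, \<open>v \<circ> F\<close>, \dots, \<open>v \<circ> F ^ t\<close> are moved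
  along by \<open>level_walk\<close> as by the adjacency operator of a path.
\<close>

definition starter :: "nat \<Rightarrow> nat \<Rightarrow> ('a list \<Rightarrow> complex) \<Rightarrow> bool" where
  "starter k t v \<longleftrightarrow> (\<forall>u\<in>level k. \<forall>u'\<in>level k. agree t u u' \<longrightarrow> v u = v u') \<and>
     (\<forall>u\<in>level k. (\<Sum>a\<in>carrier G. v (u[t := a])) = 0) \<and>
     (\<forall>u\<in>level k. (\<Sum>g\<in>carrier G. v (diag g u)) = 0)"

lemma starter_agree: "starter k t v \<Longrightarrow> u \<in> level k \<Longrightarrow> u' \<in> level k \<Longrightarrow> agree t u u' \<Longrightarrow> v u = v u'"
  by (auto simp: starter_def)

lemma starter_sum:
  assumes "\<And>\<beta>. \<beta> \<in> A \<Longrightarrow> starter k t (v \<beta>)"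
  shows "starter k t (\<lambda>u. \<Sum>\<beta>\<in>A. a \<beta> * v \<beta> u)"
  unfolding starter_def
proof (intro conjI ballI impI)
  fix u u' assume "u \<in> level k" "u' \<in> level k" "agree t u u'"
  then show "(\<Sum>\<beta>\<in>A. a \<beta> * v \<beta> u) = (\<Sum>\<beta>\<in>A. a \<beta> * v \<beta> u')"
    using assms by (intro sum.cong) (auto simp: starter_def)
next
  fix u assume u: "u \<in> level k"
  show "(\<Sum>b\<in>carrier G. \<Sum>\<beta>\<in>A. a \<beta> * v \<beta> (u[t := b])) = 0"
    using assms u by (subst sum.swap) (auto simp: starter_def sum_distrib_left[symmetric] intro!: sum.neutral)
  show "(\<Sum>g\<in>carrier G. \<Sum>\<beta>\<in>A. a \<beta> * v \<beta> (diag g u)) = 0"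
    using assms u by (subst sum.swap) (auto simp: starter_def sum_distrib_left[symmetric] intro!: sum.neutral)
qed

text \<open>The state g is felt in the letters 0 to i only, and \<open>v\<close> does not look below
  t; so all the backward generators act on this function as \<open>F\<close> does.\<close>

lemma starter_step_down:
  assumes v: "starter k t v" and u: "u \<in> level k" and i: "i < t" and g: "g \<in> carrier G"
  shows "v ((F ^^ i) (bwd g u)) = v ((F ^^ Suc i) u)"
proof (rule starter_agree[OF v])
  have "agree (1 + i) ((F ^^ i) (bwd g u)) ((F ^^ i) (F u))"
    by (intro agree_F_pow) (use agree_bwd[OF agree_refl[of 0 u], of g \<one>] in simp)
  then show "agree t ((F ^^ i) (bwd g u)) ((F ^^ Suc i) u)"
    using i by (auto simp: funpow_Suc_right simp del: funpow.simps elim: agree_mono)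
qed (use u g in \<open>auto intro!: F_pow_level bwd_level\<close>)

text \<open>At i = t the disturbance just reaches the first letter that \<open>v\<close> sees, and
  this letter takes every value once. The mean over it vanishes and the path ends.\<close>

lemma starter_step_end:
  assumes v: "starter k t v" and u: "u \<in> level k" and t: "t < k"
  shows "(\<Sum>g\<in>carrier G. v ((F ^^ t) (bwd g u))) = 0"
proof -
  define a where "a = (\<lambda>g. (F ^^ t) (bwd g u) ! t)"
  define u0 where "u0 = (F ^^ t) (F u)"
  have u0: "u0 \<in> level k" using u by (simp add: u0_def F_pow_level bwd_level)
  have aG: "a g \<in> carrier G" if "g \<in> carrier G" for g
    unfolding a_def using that u t by (intro level_nth[OF F_pow_level[OF bwd_level]])
  have "v ((F ^^ t) (bwd g u)) = v (u0[t := a g])" if g: "g \<in> carrier G" for g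
  proof (rule starter_agree[OF v])
    have ag: "agree (1 + t) ((F ^^ t) (bwd g u)) u0" unfolding u0_def
      by (intro agree_F_pow) (use agree_bwd[OF agree_refl[of 0 u], of g \<one>] in simp)
    show "agree t ((F ^^ t) (bwd g u)) (u0[t := a g])"
      unfolding agree_def
    proof (intro conjI allI impI)
      show "length ((F ^^ t) (bwd g u)) = length (u0[t := a g])" using ag by (simp add: agree_def)
      fix i assume "t \<le> i" "i < length ((F ^^ t) (bwd g u))"
      then show "(F ^^ t) (bwd g u) ! i = u0[t := a g] ! i"
        using ag by (cases "i = t") (auto simp: agree_def a_def)
    qed
    show "(F ^^ t) (bwd g u) \<in> level k" using u g by (simp add: F_pow_level bwd_level)
    show "u0[t := a g] \<in> level k" using u0 aG[OF g] by (rule update_level)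
  qed
  then have "(\<Sum>g\<in>carrier G. v ((F ^^ t) (bwd g u))) = (\<Sum>g\<in>carrier G. v (u0[t := a g]))" by simp
  also have "\<dots> = (\<Sum>b\<in>a ` carrier G. v (u0[t := b]))"
    using inj_first_changed_letter[OF u t] by (simp add: sum.reindex a_def)
  also have "a ` carrier G = carrier G"
    using inj_first_changed_letter[OF u t] aG finite_carrier
    by (intro endo_inj_surj) (auto simp: a_def)
  also have "(\<Sum>b\<in>carrier G. v (u0[t := b])) = 0" using v u0 by (simp add: starter_def)
  finally show ?thesis .
qed

text \<open>\<open>F\<close> after \<open>fwd g\<close> returns the word with its first letter
  changed, and the other i - 1 applications carry this change no further than to letter i - 1, below
  t.\<close>

lemma starter_step_up:
  assumes v: "starter k t v" and u: "u \<in> level k" and i: "0 < i" "i \<le> t" and g: "g \<in> carrier G"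
  shows "v ((F ^^ i) (fwd g u)) = v ((F ^^ (i - 1)) u)"
proof (rule starter_agree[OF v])
  have "agree (1 + (i - 1)) ((F ^^ (i - 1)) (F (fwd g u))) ((F ^^ (i - 1)) u)"
    by (intro agree_F_pow agree_F_fwd g level_words[OF u])
  moreover have "(F ^^ i) (fwd g u) = (F ^^ (i - 1)) (F (fwd g u))"
    using i by (metis Suc_pred' comp_apply funpow_Suc_right)
  ultimately show "agree t ((F ^^ i) (fwd g u)) ((F ^^ (i - 1)) u)"
    using i by (auto elim: agree_mono)
qed (use u g in \<open>auto intro!: F_pow_level fwd_level\<close>)

text \<open>Varying the state multiplies all partial products on the left by the same element, so
  the sum runs over a diagonal orbit. The mean over it vanishes, and the path ends on this side
  too.\<close>

lemma starter_step_start: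
  assumes v: "starter k t v" and u: "u \<in> level k"
  shows "(\<Sum>g\<in>carrier G. v (fwd g u)) = 0"
proof -
  have "(\<Sum>g\<in>carrier G. v (fwd g u)) = (\<Sum>g\<in>carrier G. v (diag g (fwd \<one> u)))"
    using u by (intro sum.cong) (auto simp: fwd_diag[of _ \<one>, symmetric] level_words)
  also have "\<dots> = 0" using v fwd_level[OF one_closed u] by (simp add: starter_def)
  finally show ?thesis .
qed

lemma level_walk_starter:
  assumes v: "starter k t v" and u: "u \<in> level k" and t: "t < k" and i: "i \<le> t"
  shows "2 * level_walk (\<lambda>u. v ((F ^^ i) u)) u =
    (if i < t then v ((F ^^ Suc i) u) else 0) + (if 0 < i then v ((F ^^ (i - 1)) u) else 0)"
proof -
  define A B where "A = (if i < t then v ((F ^^ Suc i) u) else 0)" and "B = (if 0 < i then v ((F ^^ (i - 1)) u) else 0)"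
  have "(\<Sum>g\<in>carrier G. v ((F ^^ i) (bwd g u))) = of_nat N * A"
  proof (cases "i < t")
    case True
    then show ?thesis using starter_step_down[OF v u True] by (simp add: A_def)
  next
    case False
    then show ?thesis using starter_step_end[OF v u t] i by (simp add: A_def)
  qed
  moreover have "(\<Sum>g\<in>carrier G. v ((F ^^ i) (fwd g u))) = of_nat N * B"
  proof (cases "0 < i")
    case True
    then show ?thesis using starter_step_up[OF v u True i] by (simp add: B_def)
  next
    case False
    then show ?thesis using starter_step_start[OF v u] by (simp add: B_def)
  qed
  ultimately have "level_walk (\<lambda>u. v ((F ^^ i) u)) u = of_nat N * (A + B) / of_nat (2 * N)"
    unfolding level_walk_def sum.distrib by (simp only: distrib_left add.commute)
  also have "\<dots> = (A + B) / 2" using N_ge_2 by simp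
  finally show ?thesis unfolding A_def[symmetric] B_def[symmetric] by (simp only:) simp
qed

lemma level_walk_sum: "level_walk (\<lambda>u. \<Sum>i\<in>A. a i * f i u) u = (\<Sum>i\<in>A. a i * level_walk (f i) u)"
proof -
  have "(\<Sum>g\<in>carrier G. (\<Sum>i\<in>A. a i * f i (fwd g u)) + (\<Sum>i\<in>A. a i * f i (bwd g u))) =
      (\<Sum>i\<in>A. a i * (\<Sum>g\<in>carrier G. f i (fwd g u) + f i (bwd g u)))"
    by (subst sum_distrib_left, subst sum.swap) (simp add: sum.distrib distrib_left)
  then show ?thesis
    unfolding level_walk_def by (simp only: times_divide_eq_right sum_divide_distrib[symmetric])
qed

text \<open>The eigenvector of a path with vanishing boundary values: sin((i + 1) \<theta>) is zero
  at the virtual vertex -1 for every \<theta>, and at the virtual vertex t + 1 when sin((t + 2)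
  \<theta>) = 0.\<close>

definition chain_vec :: "real \<Rightarrow> nat \<Rightarrow> ('a list \<Rightarrow> complex) \<Rightarrow> 'a list \<Rightarrow> complex" where
  "chain_vec \<theta> t v u = (\<Sum>i\<le>t. complex_of_real (sin (real (Suc i) * \<theta>)) * v ((F ^^ i) u))"

lemma level_walk_chain_vec:
  assumes v: "starter k t v" and u: "u \<in> level k" and t: "t < k"
    and \<theta>: "sin (real (t + 2) * \<theta>) = 0"
  shows "level_walk (chain_vec \<theta> t v) u = complex_of_real (cos \<theta>) * chain_vec \<theta> t v u"
proof -
  define s where "s = (\<lambda>i. complex_of_real (sin (real i * \<theta>)))"
  define y where "y = (\<lambda>i. v ((F ^^ i) u))"
  have "2 * level_walk (chain_vec \<theta> t v) u = (\<Sum>i\<le>t. s (Suc i) * (2 * level_walk (\<lambda>u. v ((F ^^ i) u)) u))"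
    by (simp add: chain_vec_def[abs_def] level_walk_sum s_def sum_distrib_left mult.left_commute)
  also have "\<dots> = (\<Sum>i\<le>t. s (Suc i) * ((if i < t then y (Suc i) else 0) + (if 0 < i then y (i - 1) else 0)))"
    by (intro sum.cong refl arg_cong[where f = "\<lambda>x. _ * x"]) (subst level_walk_starter[OF v u t], auto simp: y_def)
  also have "\<dots> = (\<Sum>i\<le>t. (s i + s (Suc (Suc i))) * y i)"
    unfolding path_sum using \<theta> by (simp add: s_def add.commute)
  also have "\<dots> = (\<Sum>i\<le>t. (2 * complex_of_real (cos \<theta>) * s (Suc i)) * y i)"
  proof (intro sum.cong refl arg_cong[where f = "\<lambda>x. x * _"])
    fix i
    show "s i + s (Suc (Suc i)) = 2 * complex_of_real (cos \<theta>) * s (Suc i)"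
      using sine_three_term[of i \<theta>] unfolding s_def by (metis of_real_add of_real_mult of_real_numeral)
  qed
  also have "\<dots> = 2 * (complex_of_real (cos \<theta>) * chain_vec \<theta> t v u)"
    by (simp add: chain_vec_def s_def y_def sum_distrib_left mult.assoc)
  finally show ?thesis by simp
qed

subsection \<open>Orthogonality\<close>

definition ip :: "nat \<Rightarrow> ('a list \<Rightarrow> complex) \<Rightarrow> ('a list \<Rightarrow> complex) \<Rightarrow> complex" where
  "ip k f h = (\<Sum>u\<in>level k. f u * cnj (h u))"

lemma ip_commute: "ip k h f = cnj (ip k f h)"
  by (simp add: ip_def mult.commute)

lemma ip_sum_left: "ip k (\<lambda>u. \<Sum>i\<in>A. a i * f i u) h = (\<Sum>i\<in>A. a i * ip k (f i) h)"
  unfolding ip_def by (simp add: sum_distrib_right sum_distrib_left mult.assoc) (rule sum.swap)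

lemma ip_sum_right: "ip k h (\<lambda>u. \<Sum>i\<in>A. a i * f i u) = (\<Sum>i\<in>A. cnj (a i) * ip k h (f i))"
  by (subst ip_commute) (simp add: ip_sum_left flip: ip_commute)

lemma ip_self_zero:
  assumes "ip k f f = 0" "u \<in> level k" shows "f u = 0"
proof -
  have "complex_of_real (\<Sum>u\<in>level k. (cmod (f u))\<^sup>2) = ip k f f"
    unfolding ip_def of_real_sum by (intro sum.cong refl complex_norm_square)
  then have "(\<Sum>u\<in>level k. (cmod (f u))\<^sup>2) = 0" using assms(1) by (metis of_real_eq_0_iff)
  then show ?thesis using assms(2) finite_level[of k] by (simp add: sum_nonneg_eq_0_iff)
qed

lemma ip_bij:
  assumes "bij_betw \<sigma> (level k) (level k)" shows "ip k (\<lambda>u. f (\<sigma> u)) (\<lambda>u. h (\<sigma> u)) = ip k f h"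
  unfolding ip_def using assms by (rule sum.reindex_bij_betw)

lemma ip_level_walk: "ip k (level_walk f) h = ip k f (level_walk h)"
proof -
  have 1: "ip k (\<lambda>u. f (fwd g u)) h = ip k f (\<lambda>u. h (bwd g u))" if g: "g \<in> carrier G" for g f h
  proof -
    have "ip k (\<lambda>u. f (fwd g u)) h = ip k (\<lambda>u. f (fwd g u)) (\<lambda>u. h (bwd g (fwd g u)))"
      unfolding ip_def using g by (intro sum.cong) (auto simp: bwd_fwd level_words)
    then show ?thesis using ip_bij[OF bij_fwd[OF g], of k f "\<lambda>u. h (bwd g u)"] by simp
  qed
  have 2: "ip k (\<lambda>u. f (bwd g u)) h = ip k f (\<lambda>u. h (fwd g u))" if g: "g \<in> carrier G" for g f h
    using 1[OF g, of h f] by (metis ip_commute)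
  have "ip k (level_walk f) h = (\<Sum>g\<in>carrier G. ip k (\<lambda>u. f (fwd g u)) h + ip k (\<lambda>u. f (bwd g u)) h) / of_nat (2 * N)"
    unfolding ip_def level_walk_def
    by (simp add: sum_distrib_right sum_divide_distrib[symmetric] sum.distrib distrib_right sum.swap[of _ "carrier G"])
  also have "\<dots> = (\<Sum>g\<in>carrier G. ip k f (\<lambda>u. h (fwd g u)) + ip k f (\<lambda>u. h (bwd g u))) / of_nat (2 * N)"
    by (simp add: 1 2 add.commute)
  also have "\<dots> = ip k f (level_walk h)"
    unfolding ip_def level_walk_def
    by (simp add: sum_distrib_left sum_divide_distrib[symmetric] sum.distrib distrib_left sum.swap[of _ "carrier G"])
  finally show ?thesis .
qed

lemma ip_eigen:
  assumes f: "\<And>u. u \<in> level k \<Longrightarrow> level_walk f u = complex_of_real a * f u"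
    and h: "\<And>u. u \<in> level k \<Longrightarrow> level_walk h u = complex_of_real b * h u" and "a \<noteq> b"
  shows "ip k f h = 0"
proof -
  have "complex_of_real a * ip k f h = ip k (level_walk f) h"
    using f by (simp add: ip_def sum_distrib_left mult.assoc)
  also have "\<dots> = ip k f (level_walk h)" by (rule ip_level_walk)
  also have "\<dots> = complex_of_real b * ip k f h"
    using h by (simp add: ip_def sum_distrib_left mult.left_commute)
  finally show ?thesis using \<open>a \<noteq> b\<close> by simp
qed

text \<open>One application of \<open>F\<close> hides the diagonal action in all letters but the
  first, and further ones keep its effect below position d <= t'. So the shifted function is
  invariant under an action over which \<open>v\<close> has mean zero.\<close>

lemma ip_starter_shift:
  assumes v: "starter k t v" and v': "starter k t' v'" and d: "0 < d" "d \<le> t'"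
  shows "ip k v (\<lambda>u. v' ((F ^^ d) u)) = 0"
proof -
  have inv: "v' ((F ^^ d) (diag g u)) = v' ((F ^^ d) u)" if g: "g \<in> carrier G" and u: "u \<in> level k" for g u
  proof (rule starter_agree[OF v'])
    have "agree (1 + (d - 1)) ((F ^^ (d - 1)) (F (diag g u))) ((F ^^ (d - 1)) (F u))"
      by (intro agree_F_pow agree_F_diag g level_words[OF u])
    moreover have "(F ^^ d) w = (F ^^ (d - 1)) (F w)" for w
      using d by (metis Suc_pred' comp_apply funpow_Suc_right)
    ultimately show "agree t' ((F ^^ d) (diag g u)) ((F ^^ d) u)"
      using d by (auto elim: agree_mono)
  qed (use u g in \<open>auto intro!: F_pow_level diag_level\<close>)
  have "ip k v (\<lambda>u. v' ((F ^^ d) u)) = ip k (\<lambda>u. v (diag g u)) (\<lambda>u. v' ((F ^^ d) u))" if g: "g \<in> carrier G" for g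
  proof -
    have "ip k v (\<lambda>u. v' ((F ^^ d) u)) = ip k (\<lambda>u. v (diag g u)) (\<lambda>u. v' ((F ^^ d) (diag g u)))"
      by (rule ip_bij[OF bij_diag[OF g], symmetric])
    also have "\<dots> = ip k (\<lambda>u. v (diag g u)) (\<lambda>u. v' ((F ^^ d) u))"
      unfolding ip_def using inv g by (intro sum.cong) auto
    finally show ?thesis .
  qed
  then have "(\<Sum>g\<in>carrier G. ip k v (\<lambda>u. v' ((F ^^ d) u))) = (\<Sum>g\<in>carrier G. ip k (\<lambda>u. v (diag g u)) (\<lambda>u. v' ((F ^^ d) u)))"
    by simp
  also have "\<dots> = (\<Sum>u\<in>level k. (\<Sum>g\<in>carrier G. v (diag g u)) * cnj (v' ((F ^^ d) u)))"
    unfolding ip_def by (subst sum.swap) (simp add: sum_distrib_right)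
  also have "\<dots> = 0" using v by (intro sum.neutral) (auto simp: starter_def)
  finally show ?thesis using N_ge_2 by simp
qed

text \<open>The starter with the larger parameter does not see the letter t, over which the other
  has mean zero. The letter is multiplied and not replaced because multiplications permute the
  level.\<close>

lemma ip_starter_length:
  assumes v: "starter k t v" and v': "starter k t' v'" and t: "t < t'" "t < k"
  shows "ip k v v' = 0"
proof -
  define \<sigma> where "\<sigma> = (\<lambda>g u. u[t := g \<otimes> u ! t])"
  have \<sigma>: "\<sigma> g u \<in> level k" if "g \<in> carrier G" "u \<in> level k" for g u
    unfolding \<sigma>_def using that t level_nth by (intro update_level) auto
  have bij: "bij_betw (\<sigma> g) (level k) (level k)" if g: "g \<in> carrier G" for g
  proof (rule bij_betwI[where g = "\<sigma> (inv g)"])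
    have "\<sigma> h (\<sigma> h' u) = u" if "u \<in> level k" "h \<otimes> h' = \<one>" "h \<in> carrier G" "h' \<in> carrier G" for h h' u
      using that t by (simp add: \<sigma>_def level_length level_nth m_assoc[symmetric])
    then show "u \<in> level k \<Longrightarrow> \<sigma> (inv g) (\<sigma> g u) = u" "u \<in> level k \<Longrightarrow> \<sigma> g (\<sigma> (inv g) u) = u" for u
      using g by auto
  qed (use g \<sigma> in auto)
  have inv: "v' (\<sigma> g u) = v' u" if g: "g \<in> carrier G" and u: "u \<in> level k" for g u
    using \<sigma>[OF g u] u t by (intro starter_agree[OF v']) (auto simp: agree_def \<sigma>_def)
  have z: "(\<Sum>g\<in>carrier G. v (\<sigma> g u)) = 0" if u: "u \<in> level k" for u
  proof -
    have b: "bij_betw (\<lambda>g. g \<otimes> u ! t) (carrier G) (carrier G)"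
      using level_nth[OF u t(2)]
      by (intro bij_betwI[where g = "\<lambda>g. g \<otimes> inv (u ! t)"]) (auto simp: m_assoc)
    have "(\<Sum>g\<in>carrier G. v (\<sigma> g u)) = (\<Sum>a\<in>carrier G. v (u[t := a]))"
      unfolding \<sigma>_def by (rule sum.reindex_bij_betw[OF b])
    then show ?thesis using v u by (simp add: starter_def)
  qed
  have "ip k v v' = ip k (\<lambda>u. v (\<sigma> g u)) v'" if g: "g \<in> carrier G" for g
  proof -
    have "ip k v v' = ip k (\<lambda>u. v (\<sigma> g u)) (\<lambda>u. v' (\<sigma> g u))"
      by (rule ip_bij[OF bij[OF g], symmetric])
    also have "\<dots> = ip k (\<lambda>u. v (\<sigma> g u)) v'"
      unfolding ip_def using inv g by (intro sum.cong) auto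
    finally show ?thesis .
  qed
  then have "(\<Sum>g\<in>carrier G. ip k v v') = (\<Sum>g\<in>carrier G. ip k (\<lambda>u. v (\<sigma> g u)) v')" by simp
  also have "\<dots> = (\<Sum>u\<in>level k. (\<Sum>g\<in>carrier G. v (\<sigma> g u)) * cnj (v' u))"
    unfolding ip_def by (subst sum.swap) (simp add: sum_distrib_right)
  also have "\<dots> = 0" using z by (intro sum.neutral) auto
  finally show ?thesis using N_ge_2 by simp
qed

lemma ip_shifted_starters:
  assumes v: "starter k t v" and v': "starter k t' v'" and t: "t < k" "t' < k" and i: "i \<le> t" "i' \<le> t'"
    and ne: "t \<noteq> t' \<or> i \<noteq> i'"
  shows "ip k (\<lambda>u. v ((F ^^ i) u)) (\<lambda>u. v' ((F ^^ i') u)) = 0"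
proof -
  have aux: "ip k (\<lambda>u. v ((F ^^ i) u)) (\<lambda>u. v' ((F ^^ (i + d)) u)) = ip k v (\<lambda>u. v' ((F ^^ d) u))" for i d v v'
  proof -
    have "(F ^^ (i + d)) u = (F ^^ d) ((F ^^ i) u)" for u by (subst add.commute) (simp add: funpow_add)
    then show ?thesis using ip_bij[OF bij_F_pow[of i], of k v "\<lambda>u. v' ((F ^^ d) u)"] by simp
  qed
  consider "i < i'" | "i' < i" | "i = i'" "t < t'" | "i = i'" "t' < t" using ne by linarith
  then show ?thesis
  proof cases
    case 1
    then show ?thesis using aux[of v i v' "i' - i"] ip_starter_shift[OF v v', of "i' - i"] i by simp
  next
    case 2
    then have "ip k (\<lambda>u. v' ((F ^^ i') u)) (\<lambda>u. v ((F ^^ i) u)) = 0"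
      using aux[of v' i' v "i - i'"] ip_starter_shift[OF v' v, of "i - i'"] i by simp
    then show ?thesis by (subst ip_commute) simp
  next
    case 3
    then show ?thesis using aux[of v i v' 0] ip_starter_length[OF v v' 3(2) t(1)] by simp
  next
    case 4
    then have "ip k (\<lambda>u. v' ((F ^^ i') u)) (\<lambda>u. v ((F ^^ i) u)) = 0"
      using aux[of v' i' v 0] ip_starter_length[OF v' v 4(2) t(2)] by simp
    then show ?thesis by (subst ip_commute) simp
  qed
qed

lemma ip_chain_vec:
  assumes v: "starter k t v" and v': "starter k t' v'" and t: "t < k" "t' < k" and ne: "t \<noteq> t'"
  shows "ip k (chain_vec \<theta> t v) (chain_vec \<theta>' t' v') = 0"
  unfolding chain_vec_def[abs_def] ip_sum_left ip_sum_right
  using ip_shifted_starters[OF v v' t] ne by (intro sum.neutral ballI) (auto intro!: sum.neutral)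

text \<open>All proper shifts of \<open>v\<close> are orthogonal to \<open>v\<close>, so the pairing
  extracts the first coefficient. As sin \<theta> is non-zero for the angles used later, a vanishing
  chain has a vanishing starter.\<close>

lemma chain_vec_starter:
  assumes v: "starter k t v" and t: "t < k"
  shows "ip k (chain_vec \<theta> t v) v = complex_of_real (sin \<theta>) * ip k v v"
proof -
  have "ip k (\<lambda>u. v ((F ^^ i) u)) v = (if i = 0 then ip k v v else 0)" if "i \<le> t" for i
    using ip_shifted_starters[OF v v t t that, of 0] by auto
  then have "ip k (chain_vec \<theta> t v) v = (\<Sum>i\<le>t. complex_of_real (sin (real (Suc i) * \<theta>)) * (if i = 0 then ip k v v else 0))"
    unfolding chain_vec_def[abs_def] ip_sum_left by (intro sum.cong) auto
  also have "\<dots> = (\<Sum>i\<le>t. if i = 0 then complex_of_real (sin \<theta>) * ip k v v else 0)"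
    by (intro sum.cong) auto
  finally show ?thesis by simp
qed

subsection \<open>A basis of starters\<close>

text \<open>For g other than the unit these differences form a basis of the functions on
  \<open>G\<close> with mean zero, and on non-trivial elements \<open>chi g\<close> is the point
  mass at g. They take the place of characters, as \<open>G\<close> may be non-abelian.\<close>

definition chi :: "'a \<Rightarrow> 'a \<Rightarrow> complex" where
  "chi g a = of_bool (a = g) - of_bool (a = \<one>)"

lemma sum_chi:
  assumes f: "bij_betw f (carrier G) (carrier G)" and g: "g \<in> carrier G"
  shows "(\<Sum>a\<in>carrier G. chi g (f a)) = 0"
proof -
  have "(\<Sum>a\<in>carrier G. chi g (f a)) = (\<Sum>a\<in>carrier G. chi g a)"
    by (rule sum.reindex_bij_betw[OF f])
  also have "\<dots> = (\<Sum>a\<in>carrier G. if a = g then 1 else 0) - (\<Sum>a\<in>carrier G. if a = \<one> then 1 else 0)"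
    by (simp add: chi_def sum_subtractf of_bool_def)
  also have "\<dots> = 0" using g finite_carrier by simp
  finally show ?thesis .
qed

text \<open>In the coordinates \<open>inv (u ! Suc t) \<otimes> u ! t\<close>,
  \<open>u ! Suc t\<close> and \<open>inv (u ! Suc t) \<otimes> u ! (t + i)\<close>, a change of the
  letter t moves only the first and the diagonal action only the second. A product with a mean-zero
  factor in each of these two satisfies both conditions. When the letter t is the last one, the two
  conditions coincide, hence the first case.\<close>

definition basic_starter :: "nat \<Rightarrow> nat \<Rightarrow> 'a list \<Rightarrow> 'a list \<Rightarrow> complex" where
  "basic_starter k t \<beta> u = (if Suc t = k then chi (\<beta> ! 0) (u ! t)
     else chi (\<beta> ! 0) (inv (u ! Suc t) \<otimes> u ! t) * chi (\<beta> ! 1) (u ! Suc t) *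
       of_bool (\<forall>i. 2 \<le> i \<longrightarrow> i < k - t \<longrightarrow> inv (u ! Suc t) \<otimes> u ! (t + i) = \<beta> ! i))"

definition starter_index :: "nat \<Rightarrow> nat \<Rightarrow> 'a list set" where
  "starter_index k t = {\<beta>\<in>level (k - t). \<beta> ! 0 \<noteq> \<one> \<and> (Suc t < k \<longrightarrow> \<beta> ! 1 \<noteq> \<one>)}"

lemma starter_basic_starter:
  assumes t: "t < k" and \<beta>: "\<beta> \<in> starter_index k t"
  shows "starter k t (basic_starter k t \<beta>)"
  unfolding starter_def
proof (intro conjI ballI impI)
  have \<beta>L: "\<beta> \<in> level (k - t)" using \<beta> by (simp add: starter_index_def)
  have \<beta>0: "\<beta> ! 0 \<in> carrier G" using level_nth[OF \<beta>L] t by simp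
  have \<beta>1: "\<beta> ! 1 \<in> carrier G" if "Suc t \<noteq> k" using level_nth[OF \<beta>L] t that by simp
  fix u assume u: "u \<in> level k"
  {
    fix u' assume "u' \<in> level k" "agree t u u'"
    then have eq: "u ! (t + i) = u' ! (t + i)" if "i < k - t" for i
      using that u t by (auto simp: agree_def level_length)
    show "basic_starter k t \<beta> u = basic_starter k t \<beta> u'"
    proof (cases "Suc t = k")
      case True then show ?thesis using eq[of 0] t by (simp add: basic_starter_def)
    next
      case False
      then have "u ! t = u' ! t" "u ! Suc t = u' ! Suc t" using eq[of 0] eq[of 1] t by auto
      then show ?thesis using eq False by (simp add: basic_starter_def cong: conj_cong imp_cong)
    qed
  }
  have len: "length u = k" using u by (rule level_length)
  show "(\<Sum>a\<in>carrier G. basic_starter k t \<beta> (u[t := a])) = 0"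
  proof (cases "Suc t = k")
    case True
    then have "(\<Sum>a\<in>carrier G. basic_starter k t \<beta> (u[t := a])) = (\<Sum>a\<in>carrier G. chi (\<beta> ! 0) a)"
      using len t by (simp add: basic_starter_def)
    also have "\<dots> = 0" using sum_chi[of "\<lambda>a. a"] \<beta>0 by (simp add: bij_betw_def)
    finally show ?thesis .
  next
    case False
    define C where "C = chi (\<beta> ! 1) (u ! Suc t) *
       of_bool (\<forall>i. 2 \<le> i \<longrightarrow> i < k - t \<longrightarrow> inv (u ! Suc t) \<otimes> u ! (t + i) = \<beta> ! i)"
    have u1: "u ! Suc t \<in> carrier G" using level_nth[OF u] t False by simp
    have bij: "bij_betw (\<lambda>a. inv (u ! Suc t) \<otimes> a) (carrier G) (carrier G)"
      using u1 by (intro bij_betwI[where g = "\<lambda>a. u ! Suc t \<otimes> a"]) (auto simp: m_assoc[symmetric])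
    have "(\<Sum>a\<in>carrier G. basic_starter k t \<beta> (u[t := a])) =
        (\<Sum>a\<in>carrier G. chi (\<beta> ! 0) (inv (u ! Suc t) \<otimes> a) * C)"
      using len t False by (intro sum.cong refl) (simp add: basic_starter_def C_def)
    also have "\<dots> = 0" using sum_chi[OF bij \<beta>0] by (simp flip: sum_distrib_right)
    finally show ?thesis .
  qed
  show "(\<Sum>g\<in>carrier G. basic_starter k t \<beta> (diag g u)) = 0"
  proof (cases "Suc t = k")
    case True
    have ut: "u ! t \<in> carrier G" using level_nth[OF u] t by simp
    have bij: "bij_betw (\<lambda>g. g \<otimes> u ! t) (carrier G) (carrier G)"
      using ut by (intro bij_betwI[where g = "\<lambda>a. a \<otimes> inv (u ! t)"]) (auto simp: m_assoc)
    have "(\<Sum>g\<in>carrier G. basic_starter k t \<beta> (diag g u)) = (\<Sum>g\<in>carrier G. chi (\<beta> ! 0) (g \<otimes> u ! t))"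
      using len t True by (simp add: basic_starter_def)
    then show ?thesis using sum_chi[OF bij \<beta>0] by simp
  next
    case False
    define C where "C = chi (\<beta> ! 0) (inv (u ! Suc t) \<otimes> u ! t) *
       of_bool (\<forall>i. 2 \<le> i \<longrightarrow> i < k - t \<longrightarrow> inv (u ! Suc t) \<otimes> u ! (t + i) = \<beta> ! i)"
    have u1: "u ! Suc t \<in> carrier G" using level_nth[OF u] t False by simp
    have bij: "bij_betw (\<lambda>g. g \<otimes> u ! Suc t) (carrier G) (carrier G)"
      using u1 by (intro bij_betwI[where g = "\<lambda>a. a \<otimes> inv (u ! Suc t)"]) (auto simp: m_assoc)
    have cancel: "inv (g \<otimes> u ! Suc t) \<otimes> (g \<otimes> u ! (t + i)) = inv (u ! Suc t) \<otimes> u ! (t + i)"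
      if "g \<in> carrier G" "i < k - t" for g i
      using that u1 level_nth[OF u, of "t + i"]
      by (simp add: inv_mult_group m_assoc) (simp add: m_assoc[symmetric])
    have "(\<Sum>g\<in>carrier G. basic_starter k t \<beta> (diag g u)) =
        (\<Sum>g\<in>carrier G. chi (\<beta> ! 1) (g \<otimes> u ! Suc t) * C)"
    proof (intro sum.cong refl)
      fix g assume g: "g \<in> carrier G"
      have "(\<forall>i. 2 \<le> i \<longrightarrow> i < k - t \<longrightarrow> inv (g \<otimes> u ! Suc t) \<otimes> diag g u ! (t + i) = \<beta> ! i) \<longleftrightarrow>
          (\<forall>i. 2 \<le> i \<longrightarrow> i < k - t \<longrightarrow> inv (u ! Suc t) \<otimes> u ! (t + i) = \<beta> ! i)"
        using cancel[OF g] len by simp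
      moreover have "inv (g \<otimes> u ! Suc t) \<otimes> (g \<otimes> u ! t) = inv (u ! Suc t) \<otimes> u ! t"
        using cancel[OF g, of 0] t by simp
      ultimately show "basic_starter k t \<beta> (diag g u) = chi (\<beta> ! 1) (g \<otimes> u ! Suc t) * C"
        using len t False by (simp add: basic_starter_def C_def)
    qed
    also have "\<dots> = 0" using sum_chi[OF bij \<beta>1[OF False]] by (simp flip: sum_distrib_right)
    finally show ?thesis .
  qed
qed

text \<open>The word with the coordinates \<open>\<beta>\<close>. Evaluation there separates the
  basic starters, because \<open>chi\<close> is a point mass on non-trivial elements; the first t
  letters are not seen by starters and are filled with units.\<close>

definition dual_point :: "nat \<Rightarrow> nat \<Rightarrow> 'a list \<Rightarrow> 'a list" where
  "dual_point k t \<beta> = replicate t \<one> @ (if Suc t = k then [\<beta> ! 0]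
     else (\<beta> ! 1 \<otimes> \<beta> ! 0) # (\<beta> ! 1) # map (\<lambda>i. \<beta> ! 1 \<otimes> \<beta> ! i) [2..<k - t])"

lemma basic_starter_dual_point:
  assumes t: "t < k" and \<beta>: "\<beta> \<in> starter_index k t" and \<beta>': "\<beta>' \<in> starter_index k t"
  shows "basic_starter k t \<beta> (dual_point k t \<beta>') = of_bool (\<beta> = \<beta>')"
    and "dual_point k t \<beta>' \<in> level k"
proof -
  have L: "\<beta> \<in> level (k - t)" "\<beta>' \<in> level (k - t)" using \<beta> \<beta>' by (auto simp: starter_index_def)
  have c: "\<beta>' ! i \<in> carrier G" if "i < k - t" for i using level_nth[OF L(2)] that by simp
  have eq_iff: "\<beta> = \<beta>' \<longleftrightarrow> (\<forall>i<k - t. \<beta> ! i = \<beta>' ! i)"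
    using L by (auto simp: list_eq_iff_nth_eq level_length)
  show "dual_point k t \<beta>' \<in> level k"
    using t c[of 0] c[of 1] c by (auto simp: dual_point_def level_def in_lists_conv_set)
  show "basic_starter k t \<beta> (dual_point k t \<beta>') = of_bool (\<beta> = \<beta>')"
  proof (cases "Suc t = k")
    case True
    then have "k - t = 1" by auto
    then have "\<beta> = \<beta>' \<longleftrightarrow> \<beta> ! 0 = \<beta>' ! 0" using eq_iff by simp
    then show ?thesis using True \<beta>' by (simp add: basic_starter_def dual_point_def nth_append chi_def starter_index_def)
  next
    case False
    then have t': "Suc t < k" using t by simp
    have n0: "dual_point k t \<beta>' ! t = \<beta>' ! 1 \<otimes> \<beta>' ! 0" and n1: "dual_point k t \<beta>' ! Suc t = \<beta>' ! 1"
      using False by (auto simp: dual_point_def nth_append)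
    have ni: "dual_point k t \<beta>' ! (t + i) = \<beta>' ! 1 \<otimes> \<beta>' ! i" if i: "2 \<le> i" "i < k - t" for i
    proof -
      obtain j where "i = Suc (Suc j)" using i by (cases i; cases "i - 1") auto
      then show ?thesis using False i by (simp add: dual_point_def nth_append)
    qed
    have inv: "inv (\<beta>' ! 1) \<otimes> (\<beta>' ! 1 \<otimes> \<beta>' ! i) = \<beta>' ! i" if "i < k - t" for i
      using c[of 1] c[OF that] t' by (simp add: m_assoc[symmetric])
    have rest: "(\<forall>i. 2 \<le> i \<longrightarrow> i < k - t \<longrightarrow> inv (dual_point k t \<beta>' ! Suc t) \<otimes> dual_point k t \<beta>' ! (t + i) = \<beta> ! i) \<longleftrightarrow>
        (\<forall>i. 2 \<le> i \<longrightarrow> i < k - t \<longrightarrow> \<beta>' ! i = \<beta> ! i)"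
      using ni inv unfolding n1 by auto
    have "basic_starter k t \<beta> (dual_point k t \<beta>') = of_bool (\<beta>' ! 0 = \<beta> ! 0) * of_bool (\<beta>' ! 1 = \<beta> ! 1) *
        of_bool (\<forall>i. 2 \<le> i \<longrightarrow> i < k - t \<longrightarrow> \<beta>' ! i = \<beta> ! i)"
      unfolding basic_starter_def rest using \<beta>' False t' inv[of 0]
      by (simp add: n0 n1 chi_def starter_index_def)
    also have "\<dots> = of_bool (\<beta> = \<beta>')"
    proof -
      have "(\<forall>i<k - t. \<beta> ! i = \<beta>' ! i) \<longleftrightarrow> \<beta>' ! 0 = \<beta> ! 0 \<and> \<beta>' ! 1 = \<beta> ! 1 \<and> (\<forall>i. 2 \<le> i \<longrightarrow> i < k - t \<longrightarrow> \<beta>' ! i = \<beta> ! i)"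
      proof (intro iffI conjI allI impI)
        fix i assume *: "\<beta>' ! 0 = \<beta> ! 0 \<and> \<beta>' ! 1 = \<beta> ! 1 \<and> (\<forall>i. 2 \<le> i \<longrightarrow> i < k - t \<longrightarrow> \<beta>' ! i = \<beta> ! i)" and i: "i < k - t"
        consider "i = 0" | "i = 1" | "2 \<le> i" by linarith
        then show "\<beta> ! i = \<beta>' ! i" using * i by cases auto
      qed (use t' in auto)
      then show ?thesis unfolding eq_iff by simp
    qed
    finally show ?thesis .
  qed
qed

lemma finite_starter_index: "finite (starter_index k t)"
  unfolding starter_index_def using finite_level by simp

lemma card_nontrivial: "card (carrier G - {\<one>}) = N - 1"
  using finite_carrier by simp

lemma card_starter_index:
  assumes "t < k"
  shows "card (starter_index k t) = (if Suc t = k then N - 1 else (N - 1)\<^sup>2 * N ^ (k - t - 2))"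
proof (cases "Suc t = k")
  case True
  then have "starter_index k t = (\<lambda>g. [g]) ` (carrier G - {\<one>})"
    by (auto simp: starter_index_def level_def length_Suc_conv image_iff Suc_diff_le)
  moreover have "card ((\<lambda>g. [g]) ` (carrier G - {\<one>})) = N - 1"
    unfolding card_nontrivial[symmetric] by (intro card_image) (simp add: inj_on_def)
  ultimately show ?thesis using True by simp
next
  case False
  let ?h = "\<lambda>(a, b, u). a # b # u"
  obtain d where d: "k - t = Suc (Suc d)" using False assms by (metis Suc_diff_Suc Suc_lessI)
  have "starter_index k t = ?h ` ((carrier G - {\<one>}) \<times> (carrier G - {\<one>}) \<times> level d)"
  proof (intro equalityI subsetI)
    fix \<beta> assume "\<beta> \<in> starter_index k t"
    then have *: "\<beta> \<in> words" "length \<beta> = Suc (Suc d)" "\<beta> ! 0 \<noteq> \<one>" "\<beta> ! 1 \<noteq> \<one>"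
      using d False assms by (auto simp: starter_index_def level_def)
    then obtain a b u where "\<beta> = a # b # u" by (auto simp: length_Suc_conv)
    with * show "\<beta> \<in> ?h ` ((carrier G - {\<one>}) \<times> (carrier G - {\<one>}) \<times> level d)"
      by (auto simp: level_def intro!: image_eqI[where x = "(a, b, u)"])
  next
    fix \<beta> assume "\<beta> \<in> ?h ` ((carrier G - {\<one>}) \<times> (carrier G - {\<one>}) \<times> level d)"
    then show "\<beta> \<in> starter_index k t" using d by (auto simp: starter_index_def level_def)
  qed
  moreover have "inj_on ?h ((carrier G - {\<one>}) \<times> (carrier G - {\<one>}) \<times> level d)"
    by (auto simp: inj_on_def)
  ultimately have "card (starter_index k t) = (N - 1) * ((N - 1) * N ^ d)"
    by (simp add: card_image card_cartesian_product card_nontrivial card_level)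
  then show ?thesis using d False by (simp add: power2_eq_square)
qed

text \<open>The dimension count by which chains and constants exhaust a level. A further letter
  multiplies the number of starters with t + 1 < k by n, turns the n - 1 starters at the last
  position into (n - 1)^2, and adds n - 1 starters of the new longest chains.\<close>

lemma sum_card_starter_index: "(\<Sum>t<k. Suc t * card (starter_index k t)) + 1 = N ^ k"
proof -
  define c where "c = (\<lambda>k t. if Suc t = k then N - 1 else (N - 1)\<^sup>2 * N ^ (k - t - 2))"
  have "(\<Sum>t<k. Suc t * c k t) + 1 = N ^ k"
  proof (induction k)
    case (Suc k)
    show ?case
    proof (cases k)
      case 0
      then show ?thesis using N_ge_2 by (simp add: c_def)
    next
      case (Suc k')
      obtain m where m: "N = Suc m" using N_ge_2 by (cases N) auto
      define A where "A = (\<Sum>t<k'. Suc t * c k t)"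
      have "c (Suc k) t = N * c k t" if "t < k'" for t
      proof -
        have "Suc k - t - 2 = Suc (k - t - 2)" using that Suc by simp
        then show ?thesis using that Suc by (simp add: c_def)
      qed
      then have "(\<Sum>t<k'. Suc t * c (Suc k) t) = N * A"
        by (simp add: A_def sum_distrib_left mult.left_commute del: mult_Suc)
      moreover have "c (Suc k) k' = m\<^sup>2" "c (Suc k) k = m" "c k k' = m"
        using Suc m by (simp_all add: c_def)
      ultimately have S1: "(\<Sum>t<Suc k. Suc t * c (Suc k) t) = N * A + k * m\<^sup>2 + Suc k * m"
        and S0: "(\<Sum>t<k. Suc t * c k t) = A + k * m"
        using Suc by (simp_all add: A_def del: mult_Suc)
      have "N ^ k = A + k * m + 1" using Suc.IH by (simp only: S0)
      then have "N ^ Suc k = N * (A + k * m + 1)" by (simp only: power_Suc)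
      also have "\<dots> = N * A + k * m\<^sup>2 + Suc k * m + 1" by (simp add: m power2_eq_square algebra_simps)
      finally show ?thesis by (simp only: S1)
    qed
  qed simp
  moreover have "(\<Sum>t<k. Suc t * card (starter_index k t)) = (\<Sum>t<k. Suc t * c k t)"
    by (intro sum.cong) (auto simp: card_starter_index c_def)
  ultimately show ?thesis by (simp only:)
qed

subsection \<open>An eigenbasis\<close>

definition angle :: "nat \<Rightarrow> nat \<Rightarrow> real" where
  "angle t p = real p / real (t + 2) * pi"

definition chain_index :: "nat \<Rightarrow> (nat \<times> nat) set" where
  "chain_index k = (SIGMA t:{..<k}. {1..Suc t})"

text \<open>\<open>None\<close> stands for the constant function, which contributes weight n^-k at
  the eigenvalue 1 and disappears in the limit. Eigenvectors with the same t and p are told apart by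
  their starters.\<close>

definition vec_index :: "nat \<Rightarrow> ((nat \<times> nat) \<times> 'a list) option set" where
  "vec_index k = insert None (Some ` (SIGMA tp:chain_index k. starter_index k (fst tp)))"

definition vec_eigenvalue :: "((nat \<times> nat) \<times> 'a list) option \<Rightarrow> real" where
  "vec_eigenvalue j = (case j of None \<Rightarrow> 1 | Some ((t, p), \<beta>) \<Rightarrow> cos (angle t p))"

definition eigen_vec :: "nat \<Rightarrow> ((nat \<times> nat) \<times> 'a list) option \<Rightarrow> 'a list \<Rightarrow> complex" where
  "eigen_vec k j u = (case j of None \<Rightarrow> 1 | Some ((t, p), \<beta>) \<Rightarrow> chain_vec (angle t p) t (basic_starter k t \<beta>) u)"

lemma finite_chain_index: "finite (chain_index k)"
  by (simp add: chain_index_def)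

lemma finite_vec_index: "finite (vec_index k)"
  unfolding vec_index_def using finite_chain_index finite_starter_index by auto

lemma sum_vec_index:
  fixes f :: "_ \<Rightarrow> 'r::comm_monoid_add"
  shows "(\<Sum>j\<in>vec_index k. f j) = f None + (\<Sum>tp\<in>chain_index k. \<Sum>\<beta>\<in>starter_index k (fst tp). f (Some (tp, \<beta>)))"
proof -
  have "(\<Sum>j\<in>vec_index k. f j) = f None + (\<Sum>x\<in>(SIGMA tp:chain_index k. starter_index k (fst tp)). f (Some x))"
    unfolding vec_index_def using finite_vec_index[of k]
    by (subst sum.insert) (auto simp: vec_index_def sum.reindex inj_on_def)
  also have "(\<Sum>x\<in>(SIGMA tp:chain_index k. starter_index k (fst tp)). f (Some x)) =
      (\<Sum>tp\<in>chain_index k. \<Sum>\<beta>\<in>starter_index k (fst tp). f (Some (tp, \<beta>)))"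
    using finite_chain_index finite_starter_index by (subst sum.Sigma) (auto simp: case_prod_beta)
  finally show ?thesis .
qed

lemma card_vec_index: "card (vec_index k) = N ^ k"
proof -
  have "card (vec_index k) = 1 + (\<Sum>tp\<in>chain_index k. card (starter_index k (fst tp)))"
    using sum_vec_index[of "\<lambda>_. 1 :: nat" k] by simp
  also have "(\<Sum>tp\<in>chain_index k. card (starter_index k (fst tp))) = (\<Sum>t<k. Suc t * card (starter_index k t))"
  proof -
    have "(\<Sum>t<k. Suc t * card (starter_index k t)) = (\<Sum>t<k. \<Sum>p\<in>{1..Suc t}. card (starter_index k t))"
      by simp
    also have "\<dots> = (\<Sum>tp\<in>chain_index k. card (starter_index k (fst tp)))"
      unfolding chain_index_def by (subst sum.Sigma) (auto simp: case_prod_beta)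
    finally show ?thesis by simp
  qed
  finally show ?thesis using sum_card_starter_index[of k] by simp
qed

lemma angle_bounds:
  assumes "(t, p) \<in> chain_index k" shows "t < k" "0 < angle t p" "angle t p < pi"
proof -
  show "t < k" using assms by (simp add: chain_index_def)
  have p: "1 \<le> p" "p \<le> Suc t" using assms by (auto simp: chain_index_def)
  then have "0 < real p / real (t + 2)" "real p / real (t + 2) < 1" by auto
  then show "0 < angle t p" "angle t p < pi"
    using p mult_strict_right_mono[of "real p / real (t + 2)" 1 pi] by (simp_all add: angle_def)
qed

lemma sin_angle: "sin (real (t + 2) * angle t p) = 0"
proof -
  have "real (t + 2) * angle t p = real p * pi" by (simp add: angle_def)
  then show ?thesis by (simp add: sin_npi)
qed

lemma level_walk_const: "level_walk (\<lambda>u. 1) u = 1"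
  using N_ge_2 by (simp add: level_walk_def)

lemma level_walk_eigen_vec:
  assumes j: "j \<in> vec_index k" and u: "u \<in> level k"
  shows "level_walk (eigen_vec k j) u = complex_of_real (vec_eigenvalue j) * eigen_vec k j u"
proof (cases j)
  case None
  then have "eigen_vec k j = (\<lambda>u. 1)" by (simp add: eigen_vec_def fun_eq_iff)
  then show ?thesis using None by (simp add: level_walk_const vec_eigenvalue_def)
next
  case (Some x)
  then obtain t p \<beta> where x: "j = Some ((t, p), \<beta>)" by (metis surj_pair)
  then have *: "(t, p) \<in> chain_index k" "\<beta> \<in> starter_index k t" using j by (auto simp: vec_index_def)
  have "eigen_vec k j = chain_vec (angle t p) t (basic_starter k t \<beta>)" by (simp add: eigen_vec_def fun_eq_iff x)
  then show ?thesis
    using level_walk_chain_vec[OF starter_basic_starter[OF angle_bounds(1)[OF *(1)] *(2)] u angle_bounds(1)[OF *(1)] sin_angle]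
    by (simp add: x vec_eigenvalue_def)
qed

text \<open>For different t all shifts of the starters are pairwise orthogonal. For equal t the
  eigenvalues differ, as the cosine is injective on [0, pi], and symmetry of the walk
  applies.\<close>

lemma ip_chains:
  assumes tp: "(t, p) \<in> chain_index k" and tp': "(t', p') \<in> chain_index k" and ne: "(t, p) \<noteq> (t', p')"
    and v: "starter k t v" and v': "starter k t' v'"
  shows "ip k (chain_vec (angle t p) t v) (chain_vec (angle t' p') t' v') = 0"
proof (cases "t = t'")
  case False
  then show ?thesis using ip_chain_vec[OF v v'] angle_bounds(1)[OF tp] angle_bounds(1)[OF tp'] by blast
next
  case True
  have "cos (angle t p) \<noteq> cos (angle t' p')"
  proof
    assume "cos (angle t p) = cos (angle t' p')"
    then have "angle t p = angle t' p'"
      using cos_inj_pi[of "angle t p" "angle t' p'"] angle_bounds[OF tp] angle_bounds[OF tp'] by simp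
    then have "p = p'" using True by (simp add: angle_def)
    then show False using ne True by simp
  qed
  then show ?thesis
    using level_walk_chain_vec[OF v _ angle_bounds(1)[OF tp] sin_angle]
      level_walk_chain_vec[OF v' _ angle_bounds(1)[OF tp'] sin_angle] by (intro ip_eigen)
qed

lemma ip_const_chain:
  assumes tp: "(t, p) \<in> chain_index k" and v: "starter k t v"
  shows "ip k (\<lambda>u. 1) (chain_vec (angle t p) t v) = 0"
proof (rule ip_eigen)
  show "level_walk (\<lambda>u. 1) u = complex_of_real 1 * 1" for u by (simp add: level_walk_const)
  show "u \<in> level k \<Longrightarrow> level_walk (chain_vec (angle t p) t v) u =
      complex_of_real (cos (angle t p)) * chain_vec (angle t p) t v u" for u
    using level_walk_chain_vec[OF v _ angle_bounds(1)[OF tp] sin_angle] by blast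
  have "cos (angle t p) < cos 0"
    using angle_bounds[OF tp] by (intro cos_monotone_0_pi) auto
  then show "1 \<noteq> cos (angle t p)" by simp
qed

text \<open>Basic starters for the same t may fail to be orthogonal, so those with the same (t, p)
  are first merged into one starter \<open>v (t, p)\<close>. Orthogonality isolates its chain,
  pairing with the starter shows that the starter vanishes, and the dual points recover the
  coefficients.\<close>

lemma eigen_vec_independent:
  assumes zero: "\<And>u. u \<in> level k \<Longrightarrow> (\<Sum>j\<in>vec_index k. a j * eigen_vec k j u) = 0"
  shows "\<forall>j\<in>vec_index k. a j = 0"
proof -
  define v where "v = (\<lambda>tp u. \<Sum>\<beta>\<in>starter_index k (fst tp). a (Some (tp, \<beta>)) * basic_starter k (fst tp) \<beta> u)"
  define \<Phi> where "\<Phi> = (\<lambda>tp. chain_vec (angle (fst tp) (snd tp)) (fst tp) (v tp))"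
  have v: "starter k t (v (t, p))" if "(t, p) \<in> chain_index k" for t p
    unfolding v_def fst_conv using angle_bounds(1)[OF that] by (intro starter_sum starter_basic_starter) auto
  have chain_lin: "(\<Sum>\<beta>\<in>starter_index k (fst tp). a (Some (tp, \<beta>)) * eigen_vec k (Some (tp, \<beta>)) u) = \<Phi> tp u" for tp u
    unfolding \<Phi>_def chain_vec_def v_def eigen_vec_def
    by (simp add: sum_distrib_left case_prod_beta mult.left_commute) (rule sum.swap)
  have total: "a None + (\<Sum>tp\<in>chain_index k. \<Phi> tp u) = 0" if "u \<in> level k" for u
    using zero[OF that] unfolding sum_vec_index chain_lin by (simp add: eigen_vec_def)
  have \<Phi>0: "\<Phi> (t, p) u = 0" if tp: "(t, p) \<in> chain_index k" and u: "u \<in> level k" for t p u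
  proof (rule ip_self_zero[OF _ u])
    have "0 = ip k (\<lambda>u. a None * 1 + (\<Sum>tp\<in>chain_index k. 1 * \<Phi> tp u)) (\<Phi> (t, p))"
      unfolding ip_def using total by (simp cong: sum.cong)
    also have "\<dots> = a None * ip k (\<lambda>u. 1) (\<Phi> (t, p)) + (\<Sum>tp'\<in>chain_index k. 1 * ip k (\<Phi> tp') (\<Phi> (t, p)))"
      unfolding ip_sum_left[symmetric] by (simp add: ip_def distrib_right sum.distrib sum_distrib_left)
    also have "ip k (\<lambda>u. 1) (\<Phi> (t, p)) = 0"
      unfolding \<Phi>_def fst_conv snd_conv by (rule ip_const_chain[OF tp v[OF tp]])
    also have "(\<Sum>tp'\<in>chain_index k. 1 * ip k (\<Phi> tp') (\<Phi> (t, p))) =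
        (\<Sum>tp'\<in>chain_index k. if tp' = (t, p) then ip k (\<Phi> (t, p)) (\<Phi> (t, p)) else 0)"
    proof (intro sum.cong refl)
      fix tp' assume tp': "tp' \<in> chain_index k"
      obtain t' p' where [simp]: "tp' = (t', p')" by (cases tp')
      show "1 * ip k (\<Phi> tp') (\<Phi> (t, p)) = (if tp' = (t, p) then ip k (\<Phi> (t, p)) (\<Phi> (t, p)) else 0)"
        using ip_chains[OF _ tp _ v v[OF tp], of t' p'] tp' by (auto simp: \<Phi>_def)
    qed
    also have "\<dots> = ip k (\<Phi> (t, p)) (\<Phi> (t, p))"
      using tp finite_chain_index by simp
    finally show "ip k (\<Phi> (t, p)) (\<Phi> (t, p)) = 0" by simp
  qed
  have a_Some: "a (Some ((t, p), \<beta>)) = 0" if tp: "(t, p) \<in> chain_index k" and \<beta>: "\<beta> \<in> starter_index k t" for t p \<beta>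
  proof -
    note tk = angle_bounds(1)[OF tp]
    have "ip k (\<Phi> (t, p)) (v (t, p)) = 0" unfolding ip_def using \<Phi>0[OF tp] by simp
    then have "complex_of_real (sin (angle t p)) * ip k (v (t, p)) (v (t, p)) = 0"
      using chain_vec_starter[OF v[OF tp] tk] by (simp add: \<Phi>_def)
    moreover have "sin (angle t p) > 0" using angle_bounds[OF tp] by (intro sin_gt_zero) auto
    ultimately have "ip k (v (t, p)) (v (t, p)) = 0" by simp
    then have "v (t, p) (dual_point k t \<beta>) = 0"
      using basic_starter_dual_point(2)[OF tk \<beta> \<beta>] by (rule ip_self_zero)
    moreover have "v (t, p) (dual_point k t \<beta>) = (\<Sum>\<beta>'\<in>starter_index k t. if \<beta>' = \<beta> then a (Some ((t, p), \<beta>)) else 0)"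
      unfolding v_def fst_conv using basic_starter_dual_point(1)[OF tk _ \<beta>] by (intro sum.cong) auto
    ultimately show ?thesis using \<beta> finite_starter_index by simp
  qed
  have "replicate k \<one> \<in> level k" by (simp add: level_def replicate_words)
  from total[OF this] \<Phi>0[OF _ this] have "a None = 0"
    by (simp add: sum.neutral case_prod_beta split_paired_all)
  then show ?thesis using a_Some by (auto simp: vec_index_def)
qed

subsection \<open>The spectral measure of the Schreier graphs\<close>

text \<open>Transitivity on the words of length k identifies the vertices of the Schreier graph with
  the level, so that its Markov operator becomes \<open>level_walk\<close>.\<close>

lemma bij_coset_point_level:
  assumes w: "w \<in> seqs"
  shows "bij_betw (coset_point (\<lambda>\<gamma>. \<gamma>) (prefix_word k w)) (lcosets\<^bsub>\<Gamma>\<^esub> prefix_stabilizer \<Gamma> w k) (level k)"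
proof -
  let ?p = "prefix_word k w"
  have p: "?p \<in> words" by (rule prefix_word_words[OF w])
  note facts = coset_point_eq[OF acts_on_words p, folded prefix_stabilizer_def]
  have "coset_point (\<lambda>\<gamma>. \<gamma>) ?p ` (lcosets\<^bsub>\<Gamma>\<^esub> prefix_stabilizer \<Gamma> w k) = level k"
  proof (intro equalityI subsetI)
    fix u assume "u \<in> coset_point (\<lambda>\<gamma>. \<gamma>) ?p ` (lcosets\<^bsub>\<Gamma>\<^esub> prefix_stabilizer \<Gamma> w k)"
    then obtain \<gamma> where "\<gamma> \<in> carrier \<Gamma>" "u = \<gamma> ?p" by (auto simp: LCOSETS_def facts)
    then show "u \<in> level k" using p by (simp add: level_def \<Gamma>_words)
  next
    fix u assume "u \<in> level k"
    then obtain \<gamma> where \<gamma>: "\<gamma> \<in> finitary k" "\<gamma> ?p = u"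
      using finitary_transitive[OF p] by (auto simp: level_def)
    then show "u \<in> coset_point (\<lambda>\<gamma>. \<gamma>) ?p ` (lcosets\<^bsub>\<Gamma>\<^esub> prefix_stabilizer \<Gamma> w k)"
      using facts[OF finitary_\<Gamma>[OF \<gamma>(1)]] finitary_\<Gamma>[OF \<gamma>(1)] by (force simp: LCOSETS_def)
  qed
  then show ?thesis
    using inj_coset_point[OF acts_on_words p, folded prefix_stabilizer_def] by (simp add: bij_betw_def)
qed

lemma schreier_eigenbasis:
  assumes w: "w \<in> seqs"
  shows "eigenbasis (lcosets\<^bsub>\<Gamma>\<^esub> prefix_stabilizer \<Gamma> w k) (schreier_markov \<Gamma> S) (vec_index k)
    (\<lambda>j C. if C \<in> lcosets\<^bsub>\<Gamma>\<^esub> prefix_stabilizer \<Gamma> w k then eigen_vec k j (coset_point (\<lambda>\<gamma>. \<gamma>) (prefix_word k w) C) else 0)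
    vec_eigenvalue"
proof
  let ?V = "lcosets\<^bsub>\<Gamma>\<^esub> prefix_stabilizer \<Gamma> w k" and ?pt = "coset_point (\<lambda>\<gamma>. \<gamma>) (prefix_word k w)"
  note bij = bij_coset_point_level[OF w, of k]
  show "finite ?V" using bij_betw_finite[OF bij] finite_level by simp
  show "card (vec_index k) = card ?V" using bij_betw_same_card[OF bij] by (simp add: card_vec_index card_level)
  show "\<forall>j\<in>vec_index k. a j = 0"
    if z: "\<And>C. C \<in> ?V \<Longrightarrow> (\<Sum>j\<in>vec_index k. a j * (if C \<in> ?V then eigen_vec k j (?pt C) else 0)) = 0" for a
  proof (rule eigen_vec_independent)
    fix u assume "u \<in> level k"
    then obtain C where "C \<in> ?V" "u = ?pt C" using bij by (auto simp: bij_betw_def)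
    then show "(\<Sum>j\<in>vec_index k. a j * eigen_vec k j u) = 0" using z by simp
  qed
  note act = coset_point_act[OF acts_on_words prefix_word_words[OF w, of k], folded prefix_stabilizer_def]
  show "schreier_markov \<Gamma> S (\<lambda>C. if C \<in> ?V then eigen_vec k j (?pt C) else 0) C =
      complex_of_real (vec_eigenvalue j) * (if C \<in> ?V then eigen_vec k j (?pt C) else 0)"
    if j: "j \<in> vec_index k" and C: "C \<in> ?V" for j C
  proof -
    have pt: "?pt C \<in> level k" using bij C by (auto simp: bij_betw_def)
    have "schreier_markov \<Gamma> S (\<lambda>C. if C \<in> ?V then eigen_vec k j (?pt C) else 0) C = level_walk (eigen_vec k j) (?pt C)"
      unfolding schreier_markov_def level_walk_def sum_gens card_gens using C pt
      by (simp add: act cay_apply inv_cay_apply level_words cong: sum.cong)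
    then show ?thesis using level_walk_eigen_vec[OF j pt] C by simp
  qed
  show "schreier_markov \<Gamma> S (\<lambda>y. \<Sum>j\<in>vec_index k. a j * (if y \<in> ?V then eigen_vec k j (?pt y) else 0)) C =
      (\<Sum>j\<in>vec_index k. a j * schreier_markov \<Gamma> S (\<lambda>C. if C \<in> ?V then eigen_vec k j (?pt C) else 0) C)" for a C
  proof -
    have "(\<Sum>s\<in>S. \<Sum>j\<in>vec_index k. a j * f j (s <#\<^bsub>\<Gamma>\<^esub> C)) = (\<Sum>j\<in>vec_index k. a j * (\<Sum>s\<in>S. f j (s <#\<^bsub>\<Gamma>\<^esub> C)))" for f
      by (subst sum.swap) (simp add: sum_distrib_left)
    from this[of "\<lambda>j C. if C \<in> ?V then eigen_vec k j (?pt C) else 0"] show ?thesis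
      unfolding schreier_markov_def by (simp only: times_divide_eq_right sum_divide_distrib[symmetric])
  qed
qed (auto simp: finite_vec_index)

lemma emeasure_eigenvalue_measure:
  assumes w: "w \<in> seqs" and B: "B \<in> sets borel"
  shows "emeasure (eigenvalue_measure N \<Gamma> (prefix_stabilizer \<Gamma> w) S k) B =
    ennreal (real (card {j\<in>vec_index k. vec_eigenvalue j \<in> B}) / real N ^ k)"
  unfolding eigenvalue_measure_def using N_ge_2
  by (intro eigenbasis.counting_measure[OF schreier_eigenbasis[OF w] B]) simp

lemma real_distribution_eigenvalue_measure:
  assumes w: "w \<in> seqs"
  shows "real_distribution (eigenvalue_measure N \<Gamma> (prefix_stabilizer \<Gamma> w) S k)"
proof -
  let ?\<mu> = "eigenvalue_measure N \<Gamma> (prefix_stabilizer \<Gamma> w) S k"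
  have sets: "sets ?\<mu> = sets borel" by (simp add: eigenvalue_measure_def)
  then have "space ?\<mu> = UNIV" using sets_eq_imp_space_eq by fastforce
  moreover have "emeasure ?\<mu> UNIV = 1"
    using N_ge_2 by (subst emeasure_eigenvalue_measure[OF w]) (auto simp: card_vec_index)
  ultimately have "prob_space ?\<mu>" by (intro prob_spaceI) simp
  with sets show ?thesis by (simp add: real_distribution_def real_distribution_axioms_def)
qed

text \<open>For t < k the proportion (n - 1)^2 n^(k - 1 - t) / n^(k + 1) is already the limiting
  weight for L = t + 2, so the level reproduces a partial sum of the limit exactly. The remainder
  comes from the constant function and from the longest chains, t = k, which have only n - 1
  starters.\<close>

lemma cdf_eigenvalue_measure:
  assumes w: "w \<in> seqs"
  shows "cdf (eigenvalue_measure N \<Gamma> (prefix_stabilizer \<Gamma> w) S (Suc k)) x =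
    (\<Sum>L<k + 2. (real N - 1)\<^sup>2 / real N ^ L * real (chain_count {..x} L)) +
    (of_bool (1 \<le> x) + real (chain_count {..x} (k + 2)) * (real N - 1)) / real N ^ Suc k"
proof -
  let ?J = "vec_index (Suc k)"
  have count: "card {p\<in>{1..Suc t}. cos (angle t p) \<le> x} = chain_count {..x} (t + 2)" for t
  proof -
    have "{p\<in>{1..Suc t}. cos (angle t p) \<le> x} = {p. 1 \<le> p \<and> p < t + 2 \<and> cos (real p / real (t + 2) * pi) \<in> {..x}}"
      by (auto simp: angle_def)
    then show ?thesis by (simp add: chain_count_def)
  qed
  have sum_of_bool: "(\<Sum>i\<in>A. of_bool (P i)) = real (card {i\<in>A. P i})" if "finite A" for A :: "nat set" and P
    using that by (simp add: of_bool_def sum.If_cases Int_def)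
  have "real (card {j\<in>?J. vec_eigenvalue j \<in> {..x}}) = (\<Sum>j\<in>?J. of_bool (vec_eigenvalue j \<le> x))"
    using finite_vec_index by (simp add: of_bool_def sum.If_cases Int_def)
  also have "\<dots> = of_bool (1 \<le> x) + (\<Sum>tp\<in>chain_index (Suc k). \<Sum>\<beta>\<in>starter_index (Suc k) (fst tp). of_bool (cos (angle (fst tp) (snd tp)) \<le> x))"
    unfolding sum_vec_index by (simp add: vec_eigenvalue_def case_prod_beta)
  also have "(\<Sum>tp\<in>chain_index (Suc k). \<Sum>\<beta>\<in>starter_index (Suc k) (fst tp). of_bool (cos (angle (fst tp) (snd tp)) \<le> x)) =
      (\<Sum>t<Suc k. \<Sum>p\<in>{1..Suc t}. real (card (starter_index (Suc k) t)) * of_bool (cos (angle t p) \<le> x))"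
    unfolding chain_index_def by (subst sum.Sigma) (auto simp: case_prod_beta)
  also have "\<dots> = (\<Sum>t<Suc k. real (card (starter_index (Suc k) t)) * real (chain_count {..x} (t + 2)))"
    by (simp only: sum_distrib_left[symmetric] sum_of_bool[OF finite_atLeastAtMost] count)
  finally have "real (card {j\<in>?J. vec_eigenvalue j \<in> {..x}}) / real N ^ Suc k =
      of_bool (1 \<le> x) / real N ^ Suc k +
      (\<Sum>t<Suc k. real (card (starter_index (Suc k) t)) / real N ^ Suc k * real (chain_count {..x} (t + 2)))"
    by (simp add: add_divide_distrib sum_divide_distrib)
  also have "(\<Sum>t<Suc k. real (card (starter_index (Suc k) t)) / real N ^ Suc k * real (chain_count {..x} (t + 2))) =
      (\<Sum>t<k. (real N - 1)\<^sup>2 / real N ^ (t + 2) * real (chain_count {..x} (t + 2))) +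
      (real N - 1) / real N ^ Suc k * real (chain_count {..x} (k + 2))"
  proof -
    have A: "real (card (starter_index (Suc k) t)) / real N ^ Suc k = (real N - 1)\<^sup>2 / real N ^ (t + 2)" if "t < k" for t
    proof -
      have "Suc k = (t + 2) + (Suc k - t - 2)" using that by simp
      then have "real N ^ Suc k = real N ^ (t + 2) * real N ^ (Suc k - t - 2)" by (metis power_add)
      moreover have "real (card (starter_index (Suc k) t)) = (real N - 1)\<^sup>2 * real N ^ (Suc k - t - 2)"
        using that N_ge_2 by (simp add: card_starter_index of_nat_diff)
      ultimately show ?thesis using N_ge_2 by (simp only:) simp
    qed
    have B: "real (card (starter_index (Suc k) k)) = real N - 1"
      using N_ge_2 by (simp add: card_starter_index of_nat_diff)
    have "(\<Sum>t<k. real (card (starter_index (Suc k) t)) / real N ^ Suc k * real (chain_count {..x} (t + 2))) =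
        (\<Sum>t<k. (real N - 1)\<^sup>2 / real N ^ (t + 2) * real (chain_count {..x} (t + 2)))"
      by (intro sum.cong refl) (simp only: A lessThan_iff)
    then show ?thesis by (simp only: sum.lessThan_Suc B)
  qed
  also have "(\<Sum>t<k. (real N - 1)\<^sup>2 / real N ^ (t + 2) * real (chain_count {..x} (t + 2))) =
      (\<Sum>L<k + 2. (real N - 1)\<^sup>2 / real N ^ L * real (chain_count {..x} L))"
  proof -
    \<comment> \<open>The sum over L may begin at 0 because the first two terms are empty.\<close>
    have "chain_count {..x} 0 = 0" "chain_count {..x} 1 = 0" using chain_count_le[of "{..x}" 0] chain_count_le[of "{..x}" 1] by auto
    then show ?thesis by (simp add: sum.lessThan_Suc_shift del: sum.lessThan_Suc)
  qed
  finally have "real (card {j\<in>?J. vec_eigenvalue j \<in> {..x}}) / real N ^ Suc k =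
      of_bool (1 \<le> x) / real N ^ Suc k + ((\<Sum>L<k + 2. (real N - 1)\<^sup>2 / real N ^ L * real (chain_count {..x} L)) +
      (real N - 1) / real N ^ Suc k * real (chain_count {..x} (k + 2)))" .
  moreover have "cdf (eigenvalue_measure N \<Gamma> (prefix_stabilizer \<Gamma> w) S (Suc k)) x =
      real (card {j\<in>?J. vec_eigenvalue j \<in> {..x}}) / real N ^ Suc k"
    unfolding cdf_def measure_def by (subst emeasure_eigenvalue_measure[OF w]) (auto simp del: power_Suc)
  moreover have "b / D + (Z + y / D * c) = Z + (b + c * y) / D" for b c y Z D :: real
    by (simp add: add_divide_distrib mult.commute)
  ultimately show ?thesis by (simp only:)
qed

lemma KNS:
  assumes w: "w \<in> seqs"
  shows "is_KNS_spectral_measure N \<Gamma> (prefix_stabilizer \<Gamma> w) S (cayley_machine_measure N)"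
  unfolding is_KNS_spectral_measure_def chain_measure_eq[OF N_ge_2, symmetric]
proof (intro conjI allI)
  show "real_distribution (chain_measure N)"
    using prob_space_chain_measure[OF N_ge_2]
    by (simp add: real_distribution_def real_distribution_axioms_def chain_measure_def)
  show "real_distribution (eigenvalue_measure N \<Gamma> (prefix_stabilizer \<Gamma> w) S k)" for k
    by (rule real_distribution_eigenvalue_measure[OF w])
  show "weak_conv_m (eigenvalue_measure N \<Gamma> (prefix_stabilizer \<Gamma> w) S) (chain_measure N)"
    unfolding weak_conv_m_def weak_conv_def
  proof (intro allI impI)
    fix x
    let ?a = "\<lambda>L. (real N - 1)\<^sup>2 / real N ^ L * real (chain_count {..x} L)"
    let ?e = "\<lambda>k. (of_bool (1 \<le> x) + real (chain_count {..x} (k + 2)) * (real N - 1)) / real N ^ Suc k"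
    define q where "q = 1 / real N"
    have q: "norm q < 1" using N_ge_2 by (simp add: q_def)
    have "(\<lambda>k. (\<Sum>L<k + 2. ?a L)) \<longlonglongrightarrow> (\<Sum>L. ?a L)"
      by (intro LIMSEQ_ignore_initial_segment summable_LIMSEQ chain_summable[OF N_ge_2])
    \<comment> \<open>At most 1 + (k + 1)(n - 1) eigenvalues out of n^(k + 1) are left over. The
      convergence therefore holds at every x, atoms of the limit included.\<close>
    moreover have "?e \<longlonglongrightarrow> 0"
    proof (rule tendsto_sandwich[OF _ _ tendsto_const])
      have l1: "(\<lambda>k. q ^ Suc k) \<longlonglongrightarrow> 0" using LIMSEQ_Suc[OF LIMSEQ_power_zero[OF q]] .
      have l2: "(\<lambda>k. real (Suc k) * q ^ Suc k) \<longlonglongrightarrow> 0"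
        using LIMSEQ_Suc[OF powser_times_n_limit_0[OF q]] by simp
      show "(\<lambda>k. q ^ Suc k + (real N - 1) * (real (Suc k) * q ^ Suc k)) \<longlonglongrightarrow> 0"
        using tendsto_add[OF l1 tendsto_mult_left[OF l2, of "real N - 1"]] by simp
      show "\<forall>\<^sub>F k in sequentially. 0 \<le> ?e k" using N_ge_2 by (intro always_eventually allI) auto
      show "\<forall>\<^sub>F k in sequentially. ?e k \<le> q ^ Suc k + (real N - 1) * (real (Suc k) * q ^ Suc k)"
      proof (intro always_eventually allI)
        fix k
        have "of_bool (1 \<le> x) + real (chain_count {..x} (k + 2)) * (real N - 1) \<le> 1 + real (Suc k) * (real N - 1)"
          using chain_count_le[of "{..x}" "k + 2"] N_ge_2 by (intro add_mono mult_right_mono) auto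
        then have "?e k \<le> (1 + real (Suc k) * (real N - 1)) / real N ^ Suc k"
          by (intro divide_right_mono) auto
        also have "\<dots> = q ^ Suc k + (real N - 1) * (real (Suc k) * q ^ Suc k)"
          by (simp add: q_def power_divide add_divide_distrib mult.commute del: power_Suc of_nat_Suc)
        finally show "?e k \<le> q ^ Suc k + (real N - 1) * (real (Suc k) * q ^ Suc k)" .
      qed
    qed
    ultimately have "(\<lambda>k. (\<Sum>L<k + 2. ?a L) + ?e k) \<longlonglongrightarrow> (\<Sum>L. ?a L) + 0" by (rule tendsto_add)
    then have "(\<lambda>k. cdf (eigenvalue_measure N \<Gamma> (prefix_stabilizer \<Gamma> w) S (Suc k)) x) \<longlonglongrightarrow> cdf (chain_measure N) x"
      unfolding cdf_eigenvalue_measure[OF w] unfolding cdf_def measure_chain_measure[OF N_ge_2 borel_closed[OF closed_atMost]] by simp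
    then show "(\<lambda>k. cdf (eigenvalue_measure N \<Gamma> (prefix_stabilizer \<Gamma> w) S k) x) \<longlonglongrightarrow> cdf (chain_measure N) x"
      by (rule LIMSEQ_imp_Suc)
  qed
qed

end

section \<open>A spectral measure from countably many orthogonal projections\<close>

section \<open>Operators with pure point spectrum\<close>

definition point_mass :: "'x \<Rightarrow> 'x \<Rightarrow> complex" where
  "point_mass y x = of_bool (x = y)"

lemma point_mass_L2: "point_mass y \<in> L2 (count_space X)"
proof (rule L2_I)
  have "integrable (count_space X) (indicator (X \<inter> {y}) :: _ \<Rightarrow> real)"
    by (intro integrable_real_indicator) (auto simp: emeasure_count_space_finite of_nat_less_top)
  then show "integrable (count_space X) (\<lambda>x. (cmod (point_mass y x))\<^sup>2)"
    by (rule Bochner_Integration.integrable_cong[THEN iffD1, rotated 2]) (auto simp: point_mass_def indicator_def)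
qed simp

lemma L2_inner_point_mass:
  assumes "y \<in> X" shows "L2_inner (count_space X) f (point_mass y) = f y"
proof -
  have "L2_inner (count_space X) f (point_mass y) = (\<Sum>x\<in>{x\<in>X. f x * cnj (point_mass y x) \<noteq> 0}. f x * cnj (point_mass y x))"
    unfolding L2_inner_def
    by (rule lebesgue_integral_count_space_finite_support, rule finite_subset[of _ "{y}"]) (auto simp: point_mass_def)
  also have "\<dots> = (\<Sum>x\<in>{y}. f x * cnj (point_mass y x))"
    using assms by (intro sum.mono_neutral_left) (auto simp: point_mass_def)
  finally show ?thesis by (simp add: point_mass_def)
qed

lemma L2_inner_cong:
  "(\<And>x. x \<in> space M \<Longrightarrow> f x = f' x) \<Longrightarrow> (\<And>x. x \<in> space M \<Longrightarrow> g x = g' x) \<Longrightarrow> L2_inner M f g = L2_inner M f' g'"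
  unfolding L2_inner_def by (intro Bochner_Integration.integral_cong) auto

lemma L2_norm_cong:
  "(\<And>x. x \<in> space M \<Longrightarrow> f x = f' x) \<Longrightarrow> L2_norm M f = L2_norm M f'"
  unfolding L2_norm_def by (intro arg_cong[where f = sqrt] Bochner_Integration.integral_cong) auto

lemma L2_cong:
  assumes "\<And>x. x \<in> X \<Longrightarrow> f x = f' x" "f \<in> L2 (count_space X)" shows "f' \<in> L2 (count_space X)"
proof (rule L2_I)
  show "integrable (count_space X) (\<lambda>x. (cmod (f' x))\<^sup>2)"
    using L2_integrable[OF assms(2)] by (rule Bochner_Integration.integrable_cong[THEN iffD1, rotated 2]) (auto simp: assms(1))
qed simp

lemma L2_norm_point_mass:
  assumes "y \<in> X" shows "L2_norm (count_space X) (point_mass y) = 1"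
proof -
  have "complex_of_real ((L2_norm (count_space X) (point_mass y))\<^sup>2) = complex_of_real 1"
    unfolding L2_inner_self[symmetric] using assms by (simp add: L2_inner_point_mass point_mass_def)
  then have "(L2_norm (count_space X) (point_mass y))\<^sup>2 = 1" by (simp only: of_real_eq_iff)
  then show ?thesis
    using L2_norm_nonneg[of "count_space X" "point_mass y"] by (simp add: power2_eq_1_iff)
qed

lemma L2_pointwise: "f \<in> L2 (count_space X) \<Longrightarrow> y \<in> X \<Longrightarrow> cmod (f y) \<le> L2_norm (count_space X) f"
  using L2_Cauchy_Schwarz[OF _ point_mass_L2, of f X y]
  by (simp add: L2_inner_point_mass L2_norm_point_mass)

lemma L2_norm_zero_imp: "f \<in> L2 (count_space X) \<Longrightarrow> L2_norm (count_space X) f = 0 \<Longrightarrow> y \<in> X \<Longrightarrow> f y = 0"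
  using L2_pointwise[of f X y] by simp

text \<open>
  Vanishing projections are allowed, so that families with any countable index set can be
  enumerated by the natural numbers.
\<close>

locale point_spectrum =
  fixes X :: "'x set" and Pr :: "nat \<Rightarrow> ('x \<Rightarrow> complex) \<Rightarrow> 'x \<Rightarrow> complex" and ev :: "nat \<Rightarrow> real"
    and T :: "('x \<Rightarrow> complex) \<Rightarrow> 'x \<Rightarrow> complex"
  assumes proj_L2: "\<And>n f. f \<in> L2 (count_space X) \<Longrightarrow> Pr n f \<in> L2 (count_space X)"
    and proj_add: "\<And>n f g x. x \<in> X \<Longrightarrow> Pr n (\<lambda>y. f y + g y) x = Pr n f x + Pr n g x"
    and proj_cmult: "\<And>n a f x. x \<in> X \<Longrightarrow> Pr n (\<lambda>y. a * f y) x = a * Pr n f x"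
    and proj_sym: "\<And>n f g. f \<in> L2 (count_space X) \<Longrightarrow> g \<in> L2 (count_space X) \<Longrightarrow>
      L2_inner (count_space X) (Pr n f) g = L2_inner (count_space X) f (Pr n g)"
    and proj_orth: "\<And>n m f x. f \<in> L2 (count_space X) \<Longrightarrow> x \<in> X \<Longrightarrow> Pr n (Pr m f) x = (if n = m then Pr n f x else 0)"
    and complete: "\<And>y. y \<in> X \<Longrightarrow> (\<lambda>n. Pr n (point_mass y) y) sums 1"
    and T_L2: "\<And>f. f \<in> L2 (count_space X) \<Longrightarrow> T f \<in> L2 (count_space X)"
    and T_sym: "\<And>f g. f \<in> L2 (count_space X) \<Longrightarrow> g \<in> L2 (count_space X) \<Longrightarrow>
      L2_inner (count_space X) (T f) g = L2_inner (count_space X) f (T g)"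
    and T_proj: "\<And>n f x. f \<in> L2 (count_space X) \<Longrightarrow> x \<in> X \<Longrightarrow> T (Pr n f) x = complex_of_real (ev n) * Pr n f x"
    and ev_bound: "\<And>n. \<bar>ev n\<bar> \<le> 1"
begin

abbreviation C :: "'x measure" where "C \<equiv> count_space X"

abbreviation inner :: "('x \<Rightarrow> complex) \<Rightarrow> ('x \<Rightarrow> complex) \<Rightarrow> complex" where "inner \<equiv> L2_inner C"

definition weight :: "('x \<Rightarrow> complex) \<Rightarrow> nat \<Rightarrow> real" where
  "weight f n = (L2_norm C (Pr n f))\<^sup>2"

lemma inner_proj:
  assumes "f \<in> L2 C" "g \<in> L2 C"
  shows "inner (Pr n f) (Pr m g) = (if n = m then inner (Pr n f) g else 0)"
proof -
  have "inner (Pr n f) (Pr m g) = inner (Pr m (Pr n f)) g"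
    using assms by (simp add: proj_sym proj_L2)
  also have "\<dots> = inner (\<lambda>x. if n = m then Pr n f x else 0) g"
    using assms by (intro L2_inner_cong) (auto simp: proj_orth)
  finally show ?thesis by (simp add: L2_inner_def)
qed

lemma inner_proj_self: "f \<in> L2 C \<Longrightarrow> inner (Pr n f) f = complex_of_real (weight f n)"
  using inner_proj[of f f n n] by (simp add: weight_def L2_inner_self)

definition part :: "nat set \<Rightarrow> ('x \<Rightarrow> complex) \<Rightarrow> 'x \<Rightarrow> complex" where
  "part F f x = (\<Sum>n\<in>F. Pr n f x)"

lemma part_L2: "f \<in> L2 C \<Longrightarrow> part F f \<in> L2 C"
  unfolding part_def[abs_def] by (intro L2_sum proj_L2)

lemma inner_part: "f \<in> L2 C \<Longrightarrow> g \<in> L2 C \<Longrightarrow> inner (part F f) g = (\<Sum>n\<in>F. inner (Pr n f) g)"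
  unfolding part_def[abs_def] by (intro L2_inner_sum_left proj_L2)

lemma norm_part: 
  assumes f: "f \<in> L2 C" and F: "finite F"
  shows "(L2_norm C (part F f))\<^sup>2 = (\<Sum>n\<in>F. weight f n)"
proof -
  have "inner (Pr n f) (part F f) = complex_of_real (weight f n)" if "n \<in> F" for n
  proof -
    have "inner (Pr n f) (part F f) = cnj (\<Sum>m\<in>F. inner (Pr m f) (Pr n f))"
      using f by (subst L2_inner_commute) (simp add: inner_part proj_L2)
    also have "(\<Sum>m\<in>F. inner (Pr m f) (Pr n f)) = (\<Sum>m\<in>F. if m = n then complex_of_real (weight f n) else 0)"
      using f by (intro sum.cong) (auto simp: inner_proj inner_proj_self)
    finally show ?thesis using F that by simp
  qed
  then have "complex_of_real ((L2_norm C (part F f))\<^sup>2) = (\<Sum>n\<in>F. complex_of_real (weight f n))"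
    unfolding L2_inner_self[symmetric] using f by (simp add: inner_part part_L2)
  then show ?thesis by (metis of_real_eq_iff of_real_sum)
qed

lemma weight_nonneg [simp]: "0 \<le> weight f n"
  by (simp add: weight_def)

text \<open>The squared norm of a partial sum is also its inner product with \<open>f\<close>;
  Cauchy-Schwarz and cancelling one factor give the bound.\<close>

lemma bessel: assumes f: "f \<in> L2 C" and F: "finite F" shows "(\<Sum>n\<in>F. weight f n) \<le> (L2_norm C f)\<^sup>2"
proof -
  let ?s = "\<Sum>n\<in>F. weight f n"
  have "complex_of_real ?s = inner (part F f) f"
    using f by (simp add: inner_part inner_proj_self)
  then have "?s \<le> L2_norm C (part F f) * L2_norm C f"
    using L2_Cauchy_Schwarz[OF part_L2[OF f] f] by (metis abs_le_D1 norm_of_real)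
  then have "(L2_norm C (part F f)) * (L2_norm C (part F f)) \<le> L2_norm C (part F f) * L2_norm C f"
    unfolding norm_part[OF f F, symmetric] by (simp add: power2_eq_square)
  then have "L2_norm C (part F f) \<le> L2_norm C f"
    by (metis L2_norm_nonneg mult_left_le_imp_le order_le_less)
  then show ?thesis unfolding norm_part[OF f F, symmetric] by (intro power_mono) auto
qed

lemma weight_summable: assumes f: "f \<in> L2 C" shows "summable (weight f)"
  by (rule summableI_nonneg_bounded[where x = "(L2_norm C f)\<^sup>2"]) (auto intro: bessel[OF f])

lemma weight_suminf: assumes f: "f \<in> L2 C" shows "(\<Sum>n. weight f n) \<le> (L2_norm C f)\<^sup>2"
  by (rule suminf_le_const[OF weight_summable[OF f]]) (auto intro: bessel[OF f])

text \<open>Symmetry and idempotence turn the value at y into an inner product of the n-th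
  components of \<open>f\<close> and of the point mass, and both sequences of norms are
  square-summable. So infinite sums of projections may be taken point by point.\<close>

lemma proj_summable:
  assumes f: "f \<in> L2 C" and y: "y \<in> X"
  shows "summable (\<lambda>n. cmod (Pr n f y))"
proof (rule summable_comparison_test'[where N = 0])
  show "summable (\<lambda>n. weight f n + weight (point_mass y) n)"
    by (intro summable_add weight_summable f point_mass_L2)
  fix n
  have "Pr n f y = inner (Pr n f) (Pr n (point_mass y))"
    using f y by (simp add: inner_proj point_mass_L2 L2_inner_point_mass)
  then have "cmod (Pr n f y) \<le> L2_norm C (Pr n f) * L2_norm C (Pr n (point_mass y))"
    using L2_Cauchy_Schwarz[OF proj_L2[OF f] proj_L2[OF point_mass_L2]] by simp
  also have "\<dots> \<le> weight f n + weight (point_mass y) n"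
    unfolding weight_def using sum_squares_bound[of "L2_norm C (Pr n f)" "L2_norm C (Pr n (point_mass y))"]
      mult_nonneg_nonneg[OF L2_norm_nonneg[of C "Pr n f"] L2_norm_nonneg[of C "Pr n (point_mass y)"]] by linarith
  finally show "norm (cmod (Pr n f y)) \<le> weight f n + weight (point_mass y) n" by simp
qed

definition Eset :: "nat set \<Rightarrow> ('x \<Rightarrow> complex) \<Rightarrow> 'x \<Rightarrow> complex" where
  "Eset A f x = (\<Sum>n. of_bool (n \<in> A) * Pr n f x)"

lemma Eset_summable:
  assumes f: "f \<in> L2 C" and y: "y \<in> X"
  shows "summable (\<lambda>n. of_bool (n \<in> A) * Pr n f y)"
  by (rule summable_comparison_test'[OF proj_summable[OF f y], where N = 0]) (simp add: norm_mult)

lemma part_tendsto: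
  assumes f: "f \<in> L2 C" and y: "y \<in> X"
  shows "(\<lambda>k. part (A \<inter> {..<k}) f y) \<longlonglongrightarrow> Eset A f y"
proof -
  have "part (A \<inter> {..<k}) f y = (\<Sum>n<k. of_bool (n \<in> A) * Pr n f y)" for k
    unfolding part_def by (simp add: of_bool_def sum.If_cases Int_commute if_distrib[of "\<lambda>c. c * _"] cong: if_cong)
  then show ?thesis
    unfolding Eset_def using summable_LIMSEQ[OF Eset_summable[OF f y]] by simp
qed

text \<open>Fatou's lemma along the partial sums, whose norms are explicit by orthogonality.\<close>

lemma Eset_norm:
  assumes f: "f \<in> L2 C"
  shows "Eset A f \<in> L2 C" and "(L2_norm C (Eset A f))\<^sup>2 \<le> (\<Sum>n. of_bool (n \<in> A) * weight f n)"
proof -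
  let ?s = "\<Sum>n. of_bool (n \<in> A) * weight f n"
  have sm: "summable (\<lambda>n. of_bool (n \<in> A) * weight f n)"
    by (rule summable_comparison_test'[OF weight_summable[OF f], where N = 0]) auto
  have part_le: "(\<integral>\<^sup>+ x. ennreal ((cmod (part (A \<inter> {..<k}) f x))\<^sup>2) \<partial>C) \<le> ennreal ?s" for k
  proof -
    have "(\<integral>\<^sup>+ x. ennreal ((cmod (part (A \<inter> {..<k}) f x))\<^sup>2) \<partial>C) = ennreal ((L2_norm C (part (A \<inter> {..<k}) f))\<^sup>2)"
      unfolding L2_norm_sq by (rule nn_integral_eq_integral[OF L2_integrable[OF part_L2[OF f]]]) simp
    also have "(L2_norm C (part (A \<inter> {..<k}) f))\<^sup>2 = (\<Sum>n<k. of_bool (n \<in> A) * weight f n)"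
      by (subst norm_part[OF f]) (auto simp: of_bool_def sum.If_cases Int_commute if_distrib[of "\<lambda>c. c * _"] cong: if_cong)
    also have "\<dots> \<le> ?s" by (rule sum_le_suminf[OF sm]) auto
    finally show ?thesis by (simp add: ennreal_leI)
  qed
  have "(\<integral>\<^sup>+ x. ennreal ((cmod (Eset A f x))\<^sup>2) \<partial>C) =
      (\<integral>\<^sup>+ x. liminf (\<lambda>k. ennreal ((cmod (part (A \<inter> {..<k}) f x))\<^sup>2)) \<partial>C)"
  proof (rule nn_integral_cong)
    fix x assume "x \<in> space C"
    then have "(\<lambda>k. part (A \<inter> {..<k}) f x) \<longlonglongrightarrow> Eset A f x" using part_tendsto[OF f] by simp
    then have "(\<lambda>k. ennreal ((cmod (part (A \<inter> {..<k}) f x))\<^sup>2)) \<longlonglongrightarrow> ennreal ((cmod (Eset A f x))\<^sup>2)"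
      by (intro tendsto_intros tendsto_ennrealI)
    then show "ennreal ((cmod (Eset A f x))\<^sup>2) = liminf (\<lambda>k. ennreal ((cmod (part (A \<inter> {..<k}) f x))\<^sup>2))"
      using lim_imp_Liminf[OF trivial_limit_sequentially] by metis
  qed
  also have "\<dots> \<le> liminf (\<lambda>k. \<integral>\<^sup>+ x. ennreal ((cmod (part (A \<inter> {..<k}) f x))\<^sup>2) \<partial>C)"
    by (rule nn_integral_liminf) simp
  also have "\<dots> \<le> liminf (\<lambda>k. ennreal ?s)"
    using part_le by (intro Liminf_mono) auto
  also have "\<dots> = ennreal ?s" by (simp add: Liminf_const)
  finally have le: "(\<integral>\<^sup>+ x. ennreal ((cmod (Eset A f x))\<^sup>2) \<partial>C) \<le> ennreal ?s" .
  then have int: "integrable C (\<lambda>x. (cmod (Eset A f x))\<^sup>2)"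
    by (intro integrableI_bounded) (auto intro: le_less_trans)
  then show "Eset A f \<in> L2 C" by (intro L2_I) auto
  have "ennreal ((L2_norm C (Eset A f))\<^sup>2) \<le> ennreal ?s"
    using le unfolding L2_norm_sq by (subst (asm) nn_integral_eq_integral[OF int]) auto
  moreover have "0 \<le> ?s" by (rule suminf_nonneg[OF sm]) auto
  ultimately show "(L2_norm C (Eset A f))\<^sup>2 \<le> ?s" by (simp add: ennreal_le_iff)
qed

lemma Eset_contraction: assumes f: "f \<in> L2 C" shows "L2_norm C (Eset A f) \<le> L2_norm C f"
proof (rule power2_le_imp_le)
  have "(\<Sum>n. of_bool (n \<in> A) * weight f n) \<le> (\<Sum>n. weight f n)"
    by (intro suminf_le weight_summable[OF f] summable_comparison_test'[OF weight_summable[OF f], where N = 0]) auto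
  then show "(L2_norm C (Eset A f))\<^sup>2 \<le> (L2_norm C f)\<^sup>2"
    using Eset_norm(2)[OF f, of A] weight_suminf[OF f] by linarith
qed simp

text \<open>The remainder after k terms is again an \<open>Eset\<close>, for the indices from k on,
  so its norm is bounded by a tail of the convergent series of weights. This strengthens pointwise
  convergence to convergence of inner products.\<close>

lemma Eset_inner:
  assumes f: "f \<in> L2 C" and g: "g \<in> L2 C"
  shows "(\<lambda>n. of_bool (n \<in> A) * inner (Pr n f) g) sums inner (Eset A f) g"
proof -
  let ?tail = "\<lambda>k. \<Sum>n. weight f (n + k)"
  have diff: "inner (Eset A f) g - (\<Sum>n<k. of_bool (n \<in> A) * inner (Pr n f) g) = inner (Eset (A - {..<k}) f) g" for k
  proof -
    have "inner (part (A \<inter> {..<k}) f) g = (\<Sum>n<k. of_bool (n \<in> A) * inner (Pr n f) g)"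
      by (subst inner_part[OF f g]) (simp add: of_bool_def sum.If_cases Int_commute if_distrib[of "\<lambda>c. c * _"] cong: if_cong)
    moreover have "inner (Eset (A - {..<k}) f) g = inner (\<lambda>x. Eset A f x - part (A \<inter> {..<k}) f x) g"
    proof (rule L2_inner_cong)
      fix x assume "x \<in> space C"
      then have x: "x \<in> X" by simp
      have "(\<lambda>n. of_bool (n \<in> A) * Pr n f x - (if n < k then of_bool (n \<in> A) * Pr n f x else 0)) sums
          (Eset A f x - (\<Sum>n<k. of_bool (n \<in> A) * Pr n f x))"
        unfolding Eset_def
        using sums_If_finite_set[of "{..<k}" "\<lambda>n. of_bool (n \<in> A) * Pr n f x"]
        by (intro sums_diff summable_sums Eset_summable[OF f x]) (simp add: lessThan_def)
      moreover have "of_bool (n \<in> A) * Pr n f x - (if n < k then of_bool (n \<in> A) * Pr n f x else 0) =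
          of_bool (n \<in> A - {..<k}) * Pr n f x" for n by auto
      ultimately have "Eset (A - {..<k}) f x = Eset A f x - (\<Sum>n<k. of_bool (n \<in> A) * Pr n f x)"
        unfolding Eset_def[of "A - {..<k}"] by (simp add: sums_unique[symmetric])
      then show "Eset (A - {..<k}) f x = Eset A f x - part (A \<inter> {..<k}) f x"
        by (simp add: part_def of_bool_def sum.If_cases Int_commute if_distrib[of "\<lambda>c. c * _"] cong: if_cong)
    qed simp
    ultimately show ?thesis
      using f g by (simp add: L2_inner_diff_left Eset_norm part_L2)
  qed
  have bound: "cmod (inner (Eset (A - {..<k}) f) g) \<le> sqrt (?tail k) * L2_norm C g" for k
  proof -
    have "(L2_norm C (Eset (A - {..<k}) f))\<^sup>2 \<le> (\<Sum>n. of_bool (n \<in> A - {..<k}) * weight f n)"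
      by (rule Eset_norm(2)[OF f])
    also have "\<dots> \<le> (\<Sum>n. if n < k then 0 else weight f n)"
      by (intro suminf_le summable_comparison_test'[OF weight_summable[OF f], where N = 0]) auto
    also have "\<dots> = ?tail k"
    proof -
      have "summable (\<lambda>n. if n < k then 0 else weight f n)"
        by (intro summable_comparison_test'[OF weight_summable[OF f], where N = 0]) auto
      from suminf_split_initial_segment[OF this, of k] show ?thesis by simp
    qed
    finally have "L2_norm C (Eset (A - {..<k}) f) \<le> sqrt (?tail k)" by (rule real_le_rsqrt)
    then show ?thesis
      using L2_Cauchy_Schwarz[OF Eset_norm(1)[OF f] g, of "A - {..<k}"]
      by (meson L2_norm_nonneg mult_right_mono order_trans)
  qed
  have "?tail \<longlonglongrightarrow> 0"
    using suminf_exist_split2[OF weight_summable[OF f]] .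
  then have "(\<lambda>k. sqrt (?tail k) * L2_norm C g) \<longlonglongrightarrow> sqrt 0 * L2_norm C g"
    by (intro tendsto_intros)
  then have tail0: "(\<lambda>k. sqrt (?tail k) * L2_norm C g) \<longlonglongrightarrow> 0" by (simp only: real_sqrt_zero mult_zero_left)
  have "(\<lambda>k. inner (Eset (A - {..<k}) f) g) \<longlonglongrightarrow> 0"
    by (rule Lim_null_comparison[OF _ tail0]) (intro always_eventually allI bound)
  then have "(\<lambda>k. inner (Eset A f) g - (\<Sum>n<k. of_bool (n \<in> A) * inner (Pr n f) g)) \<longlonglongrightarrow> 0"
    by (simp only: diff)
  then have "(\<lambda>k. inner (Eset A f) g - (inner (Eset A f) g - (\<Sum>n<k. of_bool (n \<in> A) * inner (Pr n f) g))) \<longlonglongrightarrow> inner (Eset A f) g - 0"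
    by (intro tendsto_intros)
  then show ?thesis by (simp add: sums_def)
qed

lemma Eset_sym:
  assumes f: "f \<in> L2 C" and g: "g \<in> L2 C" shows "inner (Eset A f) g = inner f (Eset A g)"
proof -
  have "(\<lambda>n. cnj (of_bool (n \<in> A) * inner (Pr n g) f)) sums cnj (inner (Eset A g) f)"
    using Eset_inner[OF g f] by (simp only: sums_cnj)
  moreover have "cnj (of_bool (n \<in> A) * inner (Pr n g) f) = of_bool (n \<in> A) * inner (Pr n f) g" for n
    using f g by (simp add: proj_sym[of f g] flip: L2_inner_commute)
  ultimately have "(\<lambda>n. of_bool (n \<in> A) * inner (Pr n f) g) sums inner f (Eset A g)"
    by (simp flip: L2_inner_commute)
  then show ?thesis using Eset_inner[OF f g, of A] by (rule sums_unique2[rotated])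
qed

lemma proj_Eset:
  assumes f: "f \<in> L2 C" and y: "y \<in> X" shows "Pr n (Eset A f) y = of_bool (n \<in> A) * Pr n f y"
proof -
  have "Pr n (Eset A f) y = inner (Eset A f) (Pr n (point_mass y))"
    using f y by (simp add: L2_inner_point_mass[symmetric] proj_sym Eset_norm point_mass_L2)
  moreover have "(\<lambda>m. of_bool (m \<in> A) * inner (Pr m f) (Pr n (point_mass y))) sums inner (Eset A f) (Pr n (point_mass y))"
    using f by (intro Eset_inner proj_L2 point_mass_L2)
  moreover have "of_bool (m \<in> A) * inner (Pr m f) (Pr n (point_mass y)) = (if m = n then of_bool (n \<in> A) * Pr n f y else 0)" for m
    using f y by (simp add: inner_proj point_mass_L2 L2_inner_point_mass)
  ultimately have "(\<lambda>m. if m = n then of_bool (n \<in> A) * Pr n f y else 0) sums Pr n (Eset A f) y" by simp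
  then show ?thesis using sums_single[of n "\<lambda>_. of_bool (n \<in> A) * Pr n f y"] by (simp add: sums_unique2)
qed

lemma Eset_mult: assumes f: "f \<in> L2 C" and y: "y \<in> X" shows "Eset A (Eset B f) y = Eset (A \<inter> B) f y"
  unfolding Eset_def[of A] Eset_def[of "A \<inter> B"] proj_Eset[OF f y]
  by (intro suminf_cong) auto

text \<open>The projected point mass e has norm at most 1 and inner product 1 with the unit vector
  d, so the squared norm of e - d is at most 1 + 1 - 2 = 0. In this way diagonal coefficients that
  add up to 1 amount to completeness.\<close>

lemma Eset_UNIV_point_mass:
  assumes y: "y \<in> X" and x: "x \<in> X" shows "Eset UNIV (point_mass y) x = point_mass y x"
proof -
  let ?d = "point_mass y" and ?e = "Eset UNIV (point_mass y)"
  have w: "weight ?d sums 1"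
  proof -
    have "complex_of_real (weight ?d n) = Pr n ?d y" for n
      using y by (simp add: inner_proj_self[symmetric] point_mass_L2 L2_inner_point_mass)
    then have "(\<lambda>n. complex_of_real (weight ?d n)) sums complex_of_real 1"
      using complete[OF y] by simp
    then show ?thesis by (simp only: sums_of_real_iff)
  qed
  have inner_e: "inner ?e ?d = 1"
    using complete[OF y] y unfolding L2_inner_point_mass[OF y] Eset_def by (simp add: sums_unique[symmetric])
  have eL: "?e \<in> L2 C" by (rule Eset_norm(1)[OF point_mass_L2])
  have "(L2_norm C ?e)\<^sup>2 \<le> 1"
    using Eset_norm(2)[OF point_mass_L2, of UNIV y] sums_unique[OF w] by simp
  moreover have "(L2_norm C (\<lambda>x. ?e x + (-1) * ?d x))\<^sup>2 = (L2_norm C ?e)\<^sup>2 + (L2_norm C (\<lambda>x. (-1) * ?d x))\<^sup>2 + 2 * Re (inner ?e (\<lambda>x. (-1) * ?d x))"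
    using eL by (intro L2_norm_add_sq L2_cmult point_mass_L2)
  moreover have "inner ?e (\<lambda>x. (-1) * ?d x) = - 1"
    by (subst L2_inner_commute, subst L2_inner_cmult_left) (simp add: inner_e flip: L2_inner_commute)
  moreover have "L2_norm C (\<lambda>x. (-1) * ?d x) = 1"
    unfolding L2_norm_cmult using y by (simp add: L2_norm_point_mass)
  ultimately have "(L2_norm C (\<lambda>x. ?e x + (-1) * ?d x))\<^sup>2 \<le> 0" by simp
  then have "L2_norm C (\<lambda>x. ?e x + (-1) * ?d x) = 0" by simp
  then have "?e x + (-1) * ?d x = 0"
    using eL x by (intro L2_norm_zero_imp[of "\<lambda>x. ?e x + (-1) * ?d x"] L2_add L2_cmult point_mass_L2)
  then show ?thesis by simp
qed

lemma Eset_UNIV: assumes f: "f \<in> L2 C" and y: "y \<in> X" shows "Eset UNIV f y = f y"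
proof -
  have "Eset UNIV f y = inner f (Eset UNIV (point_mass y))"
    using f y by (simp add: L2_inner_point_mass[symmetric] Eset_sym point_mass_L2)
  also have "\<dots> = inner f (point_mass y)"
    using y by (intro L2_inner_cong) (auto simp: Eset_UNIV_point_mass)
  finally show ?thesis using y by (simp add: L2_inner_point_mass)
qed

lemma Eset_bounded_operator: "L2_bounded_operator C (Eset A)"
  unfolding L2_bounded_operator_def
proof (intro conjI ballI allI)
  fix f assume f: "f \<in> L2 C"
  show "Eset A f \<in> L2 C" by (rule Eset_norm(1)[OF f])
  show "AE x in C. Eset A (\<lambda>y. a * f y) x = a * Eset A f x" for a
  proof (rule AE_I2)
    fix x assume "x \<in> space C"
    then show "Eset A (\<lambda>y. a * f y) x = a * Eset A f x"
      using suminf_mult[OF Eset_summable[OF f, of x A], of a]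
      by (simp add: Eset_def proj_cmult mult.left_commute)
  qed
  fix g assume g: "g \<in> L2 C"
  show "AE x in C. Eset A (\<lambda>y. f y + g y) x = Eset A f x + Eset A g x"
  proof (rule AE_I2)
    fix x assume "x \<in> space C"
    then show "Eset A (\<lambda>y. f y + g y) x = Eset A f x + Eset A g x"
      using suminf_add[OF Eset_summable[OF f, of x A] Eset_summable[OF g, of x A]]
      by (simp add: Eset_def proj_add distrib_left)
  qed
next
  show "\<exists>K. \<forall>f\<in>L2 C. L2_norm C (Eset A f) \<le> K * L2_norm C f"
    by (rule exI[of _ 1]) (simp add: Eset_contraction)
qed

definition spectral :: "real set \<Rightarrow> ('x \<Rightarrow> complex) \<Rightarrow> 'x \<Rightarrow> complex" where
  "spectral B = Eset {n. ev n \<in> B}"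

text \<open>The factor on the other side is expanded, so that \<open>T\<close>, once moved across,
  meets a single component at a time and no infinite sum has to pass through it.\<close>

lemma inner_T:
  assumes f: "f \<in> L2 C" shows "(\<lambda>n. ev n * weight f n) sums Re (inner (T f) f)" and "Im (inner (T f) f) = 0"
proof -
  have "(\<lambda>n. of_bool (n \<in> UNIV) * inner (Pr n f) (T f)) sums inner (Eset UNIV f) (T f)"
    using f by (intro Eset_inner T_L2)
  moreover have "inner (Eset UNIV f) (T f) = inner f (T f)"
    using f by (intro L2_inner_cong) (auto simp: Eset_UNIV)
  moreover have "of_bool (n \<in> UNIV) * inner (Pr n f) (T f) = complex_of_real (ev n * weight f n)" for n
  proof -
    have "inner (Pr n f) (T f) = inner (T (Pr n f)) f" using f by (simp add: T_sym proj_L2)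
    also have "\<dots> = inner (\<lambda>x. complex_of_real (ev n) * Pr n f x) f"
      using f by (intro L2_inner_cong) (auto simp: T_proj)
    finally show ?thesis using f by (simp add: L2_inner_cmult_left inner_proj_self)
  qed
  moreover have "inner f (T f) = inner (T f) f" using f by (simp add: T_sym)
  ultimately have s: "(\<lambda>n. complex_of_real (ev n * weight f n)) sums inner (T f) f" by simp
  show "(\<lambda>n. ev n * weight f n) sums Re (inner (T f) f)" using sums_Re[OF s] by simp
  show "Im (inner (T f) f) = 0" using sums_Im[OF s] sums_unique2[OF sums_zero] by fastforce
qed

lemma is_spectral_measure_spectral: "is_spectral_measure C T spectral"
  unfolding is_spectral_measure_def
proof (intro conjI ballI)
  show "L2_bounded_operator C (spectral B)" for B unfolding spectral_def by (rule Eset_bounded_operator)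
  show "f \<in> L2 C \<Longrightarrow> g \<in> L2 C \<Longrightarrow> inner (spectral B f) g = inner f (spectral B g)" for B f g
    unfolding spectral_def by (rule Eset_sym)
  show "f \<in> L2 C \<Longrightarrow> AE x in C. spectral (A \<inter> B) f x = spectral A (spectral B f) x" for A B f
    unfolding spectral_def by (rule AE_I2) (simp add: Eset_mult Int_def)
  show "f \<in> L2 C \<Longrightarrow> AE x in C. spectral UNIV f x = f x" for f
    unfolding spectral_def by (rule AE_I2) (simp add: Eset_UNIV)
next
  fix f assume f: "f \<in> L2 C"
  define m where "m = dirac_sum UNIV (weight f) ev"
  have em: "emeasure m B = ennreal (\<Sum>n. of_bool (ev n \<in> B) * weight f n)" if B: "B \<in> sets borel" for B
  proof -
    have "emeasure m B = (\<integral>\<^sup>+ n. ennreal (of_bool (ev n \<in> B) * weight f n) \<partial>count_space UNIV)"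
      unfolding m_def emeasure_dirac_sum[OF B] by (intro nn_integral_cong) (auto simp: B indicator_def)
    also have "\<dots> = (\<Sum>n. ennreal (of_bool (ev n \<in> B) * weight f n))" by (rule nn_integral_count_space_nat)
    also have "\<dots> = ennreal (\<Sum>n. of_bool (ev n \<in> B) * weight f n)"
      by (intro suminf_ennreal2 summable_comparison_test'[OF weight_summable[OF f], where N = 0]) auto
    finally show ?thesis .
  qed
  have sets_m: "sets m = sets borel" by (simp add: m_def dirac_sum_def)
  have int_w: "integrable (count_space UNIV) (\<lambda>n. weight f n * ev n)"
    unfolding integrable_count_space_nat_iff using ev_bound
    by (intro summable_comparison_test'[OF weight_summable[OF f], where N = 0]) (simp add: abs_mult mult_left_le)
  have dens: "point_measure UNIV (\<lambda>n. ennreal (weight f n)) = density (count_space UNIV) (\<lambda>n. ennreal (weight f n))"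
    by (simp add: point_measure_def)
  show "\<exists>m. finite_measure m \<and> sets m = sets borel \<and>
      (\<forall>B\<in>sets borel. inner (spectral B f) f = complex_of_real (measure m B)) \<and> integrable m (\<lambda>t. t) \<and>
      inner (T f) f = complex_of_real (LINT t|m. t)"
  proof (intro exI[of _ m] conjI ballI)
    show "finite_measure m"
    proof (rule finite_measureI)
      have "space m = UNIV" using sets_eq_imp_space_eq[OF sets_m] by simp
      then show "emeasure m (space m) \<noteq> \<infinity>" by (simp add: em)
    qed
    show "sets m = sets borel" by (rule sets_m)
    show "inner (spectral B f) f = complex_of_real (measure m B)" if B: "B \<in> sets borel" for B
    proof -
      have sm: "summable (\<lambda>n. of_bool (ev n \<in> B) * weight f n)"
        by (intro summable_comparison_test'[OF weight_summable[OF f], where N = 0]) auto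
      have "measure m B = (\<Sum>n. of_bool (ev n \<in> B) * weight f n)"
        unfolding measure_def em[OF B] using suminf_nonneg[OF sm] by simp
      then have "(\<lambda>n. of_bool (ev n \<in> B) * weight f n) sums measure m B" using summable_sums[OF sm] by simp
      then have "(\<lambda>n. complex_of_real (of_bool (ev n \<in> B) * weight f n)) sums complex_of_real (measure m B)"
        by (rule sums_of_real)
      moreover have "(\<lambda>n. of_bool (n \<in> {n. ev n \<in> B}) * inner (Pr n f) f) sums inner (spectral B f) f"
        unfolding spectral_def by (rule Eset_inner[OF f f])
      moreover have "complex_of_real (of_bool (ev n \<in> B) * weight f n) =
          of_bool (n \<in> {n. ev n \<in> B}) * inner (Pr n f) f" for n
        using f by (auto simp: inner_proj_self of_bool_def)
      ultimately show ?thesis by (simp only: sums_unique2)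
    qed
    show "integrable m (\<lambda>t. t)"
      unfolding m_def dirac_sum_def dens using int_w
      by (subst integrable_distr_eq) (auto simp: integrable_density)
    have "(LINT t|m. t) = (LINT n|count_space UNIV. weight f n * ev n)"
      unfolding m_def dirac_sum_def dens by (subst integral_distr) (auto simp: integral_density)
    also have "\<dots> = (\<Sum>n. weight f n * ev n)" using int_w by (rule integral_count_space_nat)
    also have "\<dots> = Re (inner (T f) f)"
      using inner_T(1)[OF f] by (simp add: mult.commute sums_iff)
    finally show "inner (T f) f = complex_of_real (LINT t|m. t)"
      using inner_T(2)[OF f] by (simp add: complex_eq_iff)
  qed
qed

lemma spectral_point_mass:
  assumes y: "y \<in> X"
  shows "(\<lambda>n. of_bool (ev n \<in> B) * Pr n (point_mass y) y) sums inner (spectral B (point_mass y)) (point_mass y)"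
  using Eset_inner[OF point_mass_L2 point_mass_L2, of "{n. ev n \<in> B}" y y] y
  by (simp add: spectral_def L2_inner_point_mass)

end

section \<open>The algebra behind the walk on the wreath product\<close>

section \<open>A shift and commuting projections\<close>

text \<open>\<open>U\<close> moves the walker, \<open>V\<close> is its inverse, \<open>E i\<close>
  averages over a lamp, and \<open>scal\<close> embeds the real coefficients as central elements.
  Working from these relations alone keeps the path computation free of functions and norms.\<close>

locale shift_projections =
  fixes U V :: "'r::ring_1" and E :: "int \<Rightarrow> 'r" and scal :: "real \<Rightarrow> 'r"
  assumes UV: "U * V = 1" and VU: "V * U = 1"
    and E_idem: "E i * E i = E i" and E_comm: "E i * E j = E j * E i"
    and UE: "U * E i = E (i - 1) * U"
    and scal_add: "scal (a + b) = scal a + scal b" and scal_mult: "scal (a * b) = scal a * scal b"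
    and scal_one: "scal 1 = 1" and scal_comm: "scal a * x = x * scal a"
begin

lemma scal_zero: "scal 0 = 0"
  using scal_add[of 0 0] by simp

lemma scal_sum: "scal (\<Sum>i\<in>A. f i) = (\<Sum>i\<in>A. scal (f i))"
  by (induction A rule: infinite_finite_induct) (auto simp: scal_zero scal_add)

lemma EU: "E i * U = U * E (i + 1)"
  using UE[of "i + 1"] by simp

lemma VE: "V * E i = E (i + 1) * V"
proof -
  have "V * E i = V * (E i * U) * V" by (simp add: mult.assoc UV)
  also have "\<dots> = E (i + 1) * V" by (simp add: EU VU flip: mult.assoc)
  finally show ?thesis .
qed

lemma E_U_pow: "E i * U ^ d = U ^ d * E (i + int d)"
proof (induction d arbitrary: i)
  case (Suc d)
  have "E i * U ^ Suc d = (E i * U) * U ^ d" by (simp add: mult.assoc)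
  also have "\<dots> = U * (E (i + 1) * U ^ d)" by (simp add: EU mult.assoc)
  also have "\<dots> = U ^ Suc d * E (i + int (Suc d))" by (simp add: Suc.IH mult.assoc add.assoc)
  finally show ?case .
qed simp

lemma E_V_pow: "E i * V ^ d = V ^ d * E (i - int d)"
proof (induction d arbitrary: i)
  case (Suc d)
  have "E i * V = V * E (i - 1)" using VE[of "i - 1"] by simp
  then have "E i * V ^ Suc d = V * (E (i - 1) * V ^ d)" by (simp flip: mult.assoc)
  also have "\<dots> = V ^ Suc d * E (i - int (Suc d))" by (simp add: Suc.IH mult.assoc algebra_simps)
  finally show ?case .
qed simp

lemma V_pow_U_pow: "V ^ i * U ^ k = (if i \<le> k then U ^ (k - i) else V ^ (i - k))"
proof (induction i arbitrary: k)
  case (Suc i)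
  show ?case
  proof (cases k)
    case (Suc k')
    have "V ^ Suc i * U ^ Suc k' = V ^ i * (V * U) * U ^ k'" by (simp only: power_Suc2[of V] power_Suc[of U] mult.assoc)
    then show ?thesis using Suc Suc.IH[of k'] by (simp add: VU)
  qed simp
qed simp

fun Q :: "nat \<Rightarrow> 'r" where
  "Q 0 = 1"
| "Q (Suc m) = Q m * E (int m + 1)"

lemma E_Q: "E i * Q m = Q m * E i"
proof (induction m)
  case (Suc m)
  have "E i * Q (Suc m) = Q m * (E i * E (int m + 1))" by (simp add: Suc.IH flip: mult.assoc)
  also have "\<dots> = Q m * (E (int m + 1) * E i)" by (simp only: E_comm)
  finally show ?case by (simp add: mult.assoc)
qed simp

lemma Q_E: "1 \<le> i \<Longrightarrow> i \<le> int m \<Longrightarrow> Q m * E i = Q m"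
proof (induction m)
  case (Suc m)
  show ?case
  proof (cases "i = int m + 1")
    case True then show ?thesis by (simp add: mult.assoc E_idem)
  next
    case False
    then have "Q m * E i = Q m" using Suc by simp
    moreover have "Q (Suc m) * E i = Q m * E i * E (int m + 1)" by (simp add: mult.assoc E_comm)
    ultimately show ?thesis by simp
  qed
qed simp

text \<open>Its range plays the part of the starters: fixed by the averages with indices 1 to t,
  annihilated by those on either side of them.\<close>

definition P :: "nat \<Rightarrow> 'r" where
  "P t = (1 - E 0) * Q t * (1 - E (int t + 1))"

lemma E_P: "E i * P t = P t * E i"
proof -
  have c: "E i * (1 - E j) = (1 - E j) * E i" for j by (simp add: algebra_simps E_comm)
  have "E i * P t = (1 - E 0) * (E i * Q t) * (1 - E (int t + 1))"
    unfolding P_def by (simp add: c flip: mult.assoc)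
  also have "\<dots> = (1 - E 0) * Q t * (E i * (1 - E (int t + 1)))" by (simp add: E_Q mult.assoc)
  also have "\<dots> = P t * E i" unfolding P_def by (simp add: c mult.assoc)
  finally show ?thesis .
qed

lemma P_E_end: "P t * E (int t + 1) = 0"
  unfolding P_def by (simp add: mult.assoc left_diff_distrib E_idem)

lemma P_E_start: "P t * E 0 = 0"
proof -
  have "E 0 * P t = (E 0 * (1 - E 0)) * Q t * (1 - E (int t + 1))" unfolding P_def by (simp add: mult.assoc)
  also have "E 0 * (1 - E 0) = 0" by (simp add: right_diff_distrib E_idem)
  finally show ?thesis by (simp add: E_P)
qed

lemma P_E_mid: assumes "1 \<le> i" "i \<le> int t" shows "P t * E i = P t"
proof -
  have "P t * E i = (1 - E 0) * Q t * ((1 - E (int t + 1)) * E i)" unfolding P_def by (simp add: mult.assoc)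
  also have "(1 - E (int t + 1)) * E i = E i * (1 - E (int t + 1))" by (simp add: algebra_simps E_comm)
  also have "(1 - E 0) * Q t * (E i * (1 - E (int t + 1))) = (1 - E 0) * (Q t * E i) * (1 - E (int t + 1))"
    by (simp add: mult.assoc)
  also have "\<dots> = P t" using assms by (simp add: Q_E P_def)
  finally show ?thesis .
qed

lemma P_Q: "m \<le> t \<Longrightarrow> P t * Q m = P t"
  by (induction m) (auto simp: P_E_mid simp flip: mult.assoc)

lemma P_idem: "P t * P t = P t"
proof -
  have "P t * P t = P t * (1 - E 0) * Q t * (1 - E (int t + 1))" by (simp add: P_def[of t, symmetric] mult.assoc)
      (simp add: P_def mult.assoc)
  also have "P t * (1 - E 0) = P t" by (simp add: right_diff_distrib P_E_start)
  also have "P t * Q t = P t" by (simp add: P_Q)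
  also have "P t * (1 - E (int t + 1)) = P t" by (simp add: right_diff_distrib P_E_end)
  finally show ?thesis .
qed

text \<open>\<open>E d\<close> fixes \<open>P t'\<close> and turns into \<open>E 0\<close> on its
  way to the left of \<open>U ^ d\<close>, where it is annihilated by \<open>P t\<close>.\<close>

lemma P_U_P: assumes "0 < d" "d \<le> t'" shows "P t * (U ^ d * P t') = 0"
proof -
  have "U ^ d * P t' = U ^ d * (E (int d) * P t')" using assms by (simp add: E_P P_E_mid)
  also have "\<dots> = E 0 * (U ^ d * P t')" using E_U_pow[of 0 d] by (simp flip: mult.assoc)
  finally have "P t * (U ^ d * P t') = P t * E 0 * (U ^ d * P t')" by (simp add: mult.assoc)
  then show ?thesis by (simp add: P_E_start)
qed

lemma P_V_P: assumes "0 < d" "d \<le> t" shows "P t * (V ^ d * P t') = 0"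
proof -
  have "P t * (V ^ d * P t') = P t * E (int d) * (V ^ d * P t')" using assms by (simp add: P_E_mid)
  also have "\<dots> = P t * (V ^ d * (E 0 * P t'))" using E_V_pow[of "int d" d] by (simp add: mult.assoc) (simp flip: mult.assoc)
  finally show ?thesis by (simp add: E_P P_E_start)
qed

lemma P_P: assumes "t \<noteq> t'" shows "P t * P t' = 0"
proof (cases "t < t'")
  case True
  have "P t * P t' = P t * (E (int t + 1) * P t')" using True by (simp add: E_P P_E_mid)
  then show ?thesis by (simp add: P_E_end flip: mult.assoc)
next
  case False
  then have "P t * P t' = P t * E (int t' + 1) * P t'" using assms by (simp add: P_E_mid)
  also have "\<dots> = P t * (P t' * E (int t' + 1))" by (simp add: mult.assoc E_P)
  finally show ?thesis by (simp add: P_E_end)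
qed

lemma P_cross:
  assumes "i \<le> t" "k \<le> t'" shows "P t * V ^ i * (U ^ k * P t') = (if t = t' \<and> i = k then P t else 0)"
proof -
  have eq: "P t * V ^ i * (U ^ k * P t') = P t * ((V ^ i * U ^ k) * P t')" by (simp add: mult.assoc)
  consider "i < k" | "k < i" | "i = k" by linarith
  then show ?thesis
  proof cases
    case 1
    then show ?thesis using assms P_U_P[of "k - i" t' t] by (simp add: eq V_pow_U_pow)
  next
    case 2
    then show ?thesis using assms P_V_P[of "i - k" t t'] by (simp add: eq V_pow_U_pow)
  next
    case 3
    then have "V ^ i * U ^ k = 1" by (simp add: V_pow_U_pow)
    then have "P t * V ^ i * (U ^ k * P t') = P t * P t'" by (simp only: eq mult_1_left)
    then show ?thesis using 3 P_P[of t t'] P_idem by simp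
  qed
qed

text \<open>\<open>B\<close> is a column with entries s along the path, and \<open>A\<close> below
  is the transposed row. In one order their product is the inner product of the coefficient vectors
  times \<open>P t\<close>; in the other, for a unit vector, it is a projection of rank one on the
  path combined with the range of \<open>P t\<close>.\<close>

definition B :: "nat \<Rightarrow> (nat \<Rightarrow> real) \<Rightarrow> 'r" where
  "B t s = (\<Sum>i\<le>t. scal (s i) * (U ^ i * P t))"

definition A :: "nat \<Rightarrow> (nat \<Rightarrow> real) \<Rightarrow> 'r" where
  "A t s = (\<Sum>i\<le>t. scal (s i) * (P t * V ^ i))"

lemma A_B: "A t s * B t' s' = (if t = t' then scal (\<Sum>i\<le>t. s i * s' i) * P t else 0)"
proof -
  have "(scal a * (P t * V ^ i)) * (scal b * (U ^ k * P t')) = scal (a * b) * (P t * V ^ i * (U ^ k * P t'))" for a b i k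
    by (metis (no_types, opaque_lifting) mult.assoc scal_comm scal_mult)
  then have "A t s * B t' s' = (\<Sum>i\<le>t. \<Sum>k\<le>t'. scal (s i * s' k) * (P t * V ^ i * (U ^ k * P t')))"
    unfolding A_def B_def sum_product by simp
  also have "\<dots> = (\<Sum>i\<le>t. \<Sum>k\<le>t'. if t = t' \<and> i = k then scal (s i * s' k) * P t else 0)"
    by (intro sum.cong refl) (auto simp: P_cross)
  also have "\<dots> = (if t = t' then scal (\<Sum>i\<le>t. s i * s' i) * P t else 0)"
    by (auto simp: scal_sum sum_distrib_right)
  finally show ?thesis .
qed

lemma B_P: "B t s * P t = B t s"
  unfolding B_def sum_distrib_right by (simp add: mult.assoc P_idem)

definition eigenprojection :: "nat \<Rightarrow> (nat \<Rightarrow> real) \<Rightarrow> 'r" where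
  "eigenprojection t s = B t s * A t s"

lemma eigenprojection_mult:
  assumes "t = t' \<Longrightarrow> (\<Sum>i\<le>t. s i * s' i) = of_bool (s = s')"
  shows "eigenprojection t s * eigenprojection t' s' = (if t = t' \<and> s = s' then eigenprojection t s else 0)"
proof -
  have "eigenprojection t s * eigenprojection t' s' = B t s * (A t s * B t' s') * A t' s'"
    by (simp add: eigenprojection_def mult.assoc)
  also have "\<dots> = (if t = t' \<and> s = s' then eigenprojection t s else 0)"
    using assms B_P[of t s] by (auto simp: A_B scal_one scal_zero eigenprojection_def)
  finally show ?thesis .
qed

lemma eigenprojection_expand:
  "eigenprojection t s = (\<Sum>i\<le>t. \<Sum>k\<le>t. scal (s i * s k) * (U ^ i * P t * V ^ k))"
proof -
  have "(scal a * (U ^ i * P t)) * (scal b * (P t * V ^ k)) = scal (a * b) * (U ^ i * (P t * P t) * V ^ k)" for a b i k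
    by (metis (no_types, opaque_lifting) mult.assoc scal_comm scal_mult)
  then show ?thesis unfolding eigenprojection_def A_def B_def sum_product by (simp add: P_idem)
qed

definition walk_element :: 'r where
  "walk_element = scal (1 / 2) * (E 0 * U + V * E 0)"

text \<open>On its way across the power of \<open>U\<close>, \<open>E 0\<close> becomes
  \<open>E (i + 1)\<close> in the forward step and \<open>E i\<close> in the backward step. These
  fix \<open>P t\<close> inside the path and annihilate it for i = t and for i = 0,
  respectively.\<close>

lemma walk_element_chain:
  assumes "i \<le> t"
  shows "(E 0 * U + V * E 0) * (U ^ i * P t) =
    (if i < t then U ^ Suc i * P t else 0) + (if 0 < i then U ^ (i - 1) * P t else 0)"
proof -
  have "E 0 * U * (U ^ i * P t) = E 0 * U ^ Suc i * P t" by (simp add: mult.assoc)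
  also have "\<dots> = U ^ Suc i * (P t * E (int (Suc i)))" by (simp only: E_U_pow mult.assoc add_0 E_P)
  also have "\<dots> = (if i < t then U ^ Suc i * P t else 0)"
  proof (cases "i < t")
    case True
    then show ?thesis by (simp add: P_E_mid)
  next
    case False
    then have "int (Suc i) = int t + 1" using assms by simp
    then show ?thesis using False by (simp only: P_E_end) simp
  qed
  finally have 1: "E 0 * U * (U ^ i * P t) = (if i < t then U ^ Suc i * P t else 0)" .
  have "V * E 0 * (U ^ i * P t) = V * (E 0 * U ^ i) * P t" by (simp add: mult.assoc)
  also have "\<dots> = V * U ^ i * (P t * E (int i))" by (simp only: E_U_pow mult.assoc add_0 E_P)
  also have "\<dots> = (if 0 < i then U ^ (i - 1) * P t else 0)"
    using assms V_pow_U_pow[of 1 i] by (auto simp: P_E_mid P_E_start)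
  finally show ?thesis using 1 by (simp add: distrib_right)
qed

lemma walk_element_B:
  assumes s: "\<And>i. \<sigma> i + \<sigma> (Suc (Suc i)) = 2 * c * \<sigma> (Suc i)" "\<sigma> 0 = 0" "\<sigma> (Suc (Suc t)) = 0"
  shows "walk_element * B t (\<lambda>i. \<sigma> (Suc i)) = scal c * B t (\<lambda>i. \<sigma> (Suc i))"
proof -
  let ?y = "\<lambda>i. U ^ i * P t"
  have "(E 0 * U + V * E 0) * B t (\<lambda>i. \<sigma> (Suc i)) = (\<Sum>i\<le>t. scal (\<sigma> (Suc i)) * ((E 0 * U + V * E 0) * ?y i))"
    unfolding B_def sum_distrib_left by (intro sum.cong refl) (metis (no_types, lifting) mult.assoc scal_comm)
  also have "\<dots> = (\<Sum>i\<le>t. scal (\<sigma> (Suc i)) * ((if i < t then ?y (Suc i) else 0) + (if 0 < i then ?y (i - 1) else 0)))"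
    by (intro sum.cong refl) (simp only: walk_element_chain atMost_iff)
  also have "\<dots> = (\<Sum>i\<le>t. (scal (\<sigma> i) + scal (\<sigma> (Suc (Suc i)))) * ?y i)"
    using s(2,3) by (subst path_sum) (simp add: scal_zero)
  also have "\<dots> = scal (2 * c) * B t (\<lambda>i. \<sigma> (Suc i))"
    unfolding B_def sum_distrib_left scal_add[symmetric] s(1) scal_mult by (simp add: mult.assoc)
  finally have "walk_element * B t (\<lambda>i. \<sigma> (Suc i)) = scal (1 / 2) * (scal (2 * c) * B t (\<lambda>i. \<sigma> (Suc i)))"
    by (simp add: walk_element_def mult.assoc)
  then show ?thesis by (simp add: scal_mult[symmetric] flip: mult.assoc)
qed

end

subsection \<open>Normalized sine vectors\<close>

definition sine_norm :: "nat \<Rightarrow> real \<Rightarrow> real" where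
  "sine_norm t \<theta> = sqrt (\<Sum>i\<le>t. (sin (real (Suc i) * \<theta>))\<^sup>2)"

definition sine_vec :: "nat \<Rightarrow> real \<Rightarrow> nat \<Rightarrow> real" where
  "sine_vec t \<theta> i = sin (real i * \<theta>) / sine_norm t \<theta>"

lemma sine_norm_pos:
  assumes "0 < \<theta>" "\<theta> < pi" shows "0 < sine_norm t \<theta>"
proof -
  have "0 < (sin \<theta>)\<^sup>2" using sin_gt_zero[OF assms] by simp
  also have "\<dots> \<le> (\<Sum>i\<le>t. (sin (real (Suc i) * \<theta>))\<^sup>2)"
    using member_le_sum[of 0 "{..t}" "\<lambda>i. (sin (real (Suc i) * \<theta>))\<^sup>2"] by simp
  finally show ?thesis by (simp add: sine_norm_def)
qed

lemma sine_vec_three_term: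
  "sine_vec t \<theta> i + sine_vec t \<theta> (Suc (Suc i)) = 2 * cos \<theta> * sine_vec t \<theta> (Suc i)"
  unfolding sine_vec_def add_divide_distrib[symmetric] sine_three_term by simp

lemma sine_vec_normalized:
  assumes "0 < \<theta>" "\<theta> < pi" shows "(\<Sum>i\<le>t. sine_vec t \<theta> (Suc i) * sine_vec t \<theta> (Suc i)) = 1"
proof -
  have "(\<Sum>i\<le>t. sine_vec t \<theta> (Suc i) * sine_vec t \<theta> (Suc i)) =
      (\<Sum>i\<le>t. (sin (real (Suc i) * \<theta>))\<^sup>2) / (sine_norm t \<theta>)\<^sup>2"
    by (simp add: sine_vec_def power2_eq_square sum_divide_distrib)
  also have "(\<Sum>i\<le>t. (sin (real (Suc i) * \<theta>))\<^sup>2) = (sine_norm t \<theta>)\<^sup>2"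
    by (simp add: sine_norm_def sum_nonneg)
  finally show ?thesis using sine_norm_pos[OF assms, of t] by simp
qed

text \<open>The discrete Green identity for the path, whose boundary terms vanish.\<close>

lemma sine_vec_orthogonal:
  assumes \<theta>: "sin (real (t + 2) * \<theta>) = 0" and \<theta>': "sin (real (t + 2) * \<theta>') = 0" and ne: "cos \<theta> \<noteq> cos \<theta>'"
  shows "(\<Sum>i\<le>t. sine_vec t \<theta> (Suc i) * sine_vec t \<theta>' (Suc i)) = 0"
proof -
  let ?s = "sine_vec t \<theta>" and ?r = "sine_vec t \<theta>'"
  define w where "w = (\<lambda>i. ?s i * ?r (Suc i) - ?s (Suc i) * ?r i)"
  have "2 * (cos \<theta> - cos \<theta>') * (?s (Suc i) * ?r (Suc i)) = w i - w (Suc i)" for i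
  proof -
    have "2 * (cos \<theta> - cos \<theta>') * (?s (Suc i) * ?r (Suc i)) =
        (2 * cos \<theta> * ?s (Suc i)) * ?r (Suc i) - ?s (Suc i) * (2 * cos \<theta>' * ?r (Suc i))" by (simp add: algebra_simps)
    also have "\<dots> = w i - w (Suc i)" unfolding sine_vec_three_term[symmetric] by (simp add: w_def algebra_simps)
    finally show ?thesis .
  qed
  then have "2 * (cos \<theta> - cos \<theta>') * (\<Sum>i\<le>t. ?s (Suc i) * ?r (Suc i)) = (\<Sum>i\<le>t. w i - w (Suc i))"
    by (simp add: sum_distrib_left)
  also have "\<dots> = w 0 - w (Suc t)" by (rule sum_telescope)
  also have "\<dots> = 0" using \<theta> \<theta>' by (simp add: w_def sine_vec_def add.commute)
  finally show ?thesis using ne by simp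
qed

subsection \<open>The ring of linear operators on functions\<close>

text \<open>Linear maps on all functions form a ring without questions of domain, so the identities
  of the abstract computation hold at every point. Invariance of \<open>L2\<close> and symmetry are
  recorded separately by \<open>adj\<close>.\<close>

typedef 'x endo = "{T :: ('x \<Rightarrow> complex) \<Rightarrow> 'x \<Rightarrow> complex.
    (\<forall>f g. T (\<lambda>x. f x + g x) = (\<lambda>x. T f x + T g x)) \<and> (\<forall>a f. T (\<lambda>x. a * f x) = (\<lambda>x. a * T f x))}"
  by (rule exI[of _ "\<lambda>f. f"]) simp

lemma endo_add: "Rep_endo T (\<lambda>x. f x + g x) = (\<lambda>x. Rep_endo T f x + Rep_endo T g x)"
  and endo_cmult: "Rep_endo T (\<lambda>x. a * f x) = (\<lambda>x. a * Rep_endo T f x)"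
  using Rep_endo[of T] by auto

instantiation endo :: (type) ring_1
begin

definition "0 = Abs_endo (\<lambda>f x. 0)"
definition "1 = Abs_endo (\<lambda>f. f)"
definition "S + T = Abs_endo (\<lambda>f x. Rep_endo S f x + Rep_endo T f x)"
definition "S - T = Abs_endo (\<lambda>f x. Rep_endo S f x - Rep_endo T f x)"
definition "- T = Abs_endo (\<lambda>f x. - Rep_endo T f x)"
definition "S * T = Abs_endo (\<lambda>f. Rep_endo S (Rep_endo T f))"

lemma Rep_endo_simps:
  "Rep_endo 0 f = (\<lambda>x. 0)"
  "Rep_endo 1 f = f"
  "Rep_endo (S + T) f = (\<lambda>x. Rep_endo S f x + Rep_endo T f x)"
  "Rep_endo (S - T) f = (\<lambda>x. Rep_endo S f x - Rep_endo T f x)"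
  "Rep_endo (- T) f = (\<lambda>x. - Rep_endo T f x)"
  "Rep_endo (S * T) f = Rep_endo S (Rep_endo T f)"
  unfolding zero_endo_def one_endo_def plus_endo_def minus_endo_def uminus_endo_def times_endo_def
  by (subst Abs_endo_inverse; force simp: endo_add endo_cmult algebra_simps)+

instance
proof
  fix a b c :: "'a endo"
  have ext: "S = T" if "\<And>f x. Rep_endo S f x = Rep_endo T f x" for S T :: "'a endo"
    using that by (metis Rep_endo_inject ext)
  show "a * b * c = a * (b * c)" "1 * a = a" "a * 1 = a" "a + b + c = a + (b + c)" "a + b = b + a" "0 + a = a"
    "- a + a = 0" "a - b = a + - b" "(a + b) * c = a * c + b * c" "a * (b + c) = a * b + a * c"
    by (rule ext; simp add: Rep_endo_simps endo_add)+
  show "(0::'a endo) \<noteq> 1"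
  proof
    assume "(0::'a endo) = 1"
    then have "Rep_endo (0::'a endo) (\<lambda>_. 1) = Rep_endo 1 (\<lambda>_. 1)" by simp
    then show False by (simp add: Rep_endo_simps fun_eq_iff)
  qed
qed

end

lemma endo_eqI: "(\<And>f x. Rep_endo S f x = Rep_endo T f x) \<Longrightarrow> S = T"
  by (metis Rep_endo_inject ext)

lemma Rep_endo_sum: "Rep_endo (\<Sum>i\<in>A. S i) f x = (\<Sum>i\<in>A. Rep_endo (S i) f x)"
  by (induction A rule: infinite_finite_induct) (auto simp: Rep_endo_simps)

section \<open>The relations of the abstract shift, diagonal coefficients, and the Kesten
  measure\<close>

section \<open>The walk on the wreath product\<close>

context cayley_group
begin

abbreviation Wr :: "((int \<Rightarrow> 'a) \<times> int) monoid" where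
  "Wr \<equiv> wreath_int G"

lemma carrier_Wr: "(f, k) \<in> carrier Wr \<longleftrightarrow> (\<forall>i. f i \<in> carrier G) \<and> finite {i. f i \<noteq> \<one>}"
  by (simp add: wreath_int_def carrier_sum_group is_group PiE_UNIV_domain Pi_iff)

lemma mult_Wr: "(f, k) \<otimes>\<^bsub>Wr\<^esub> (h, l) = (\<lambda>i. f i \<otimes> h (i - k), k + l)"
  by (simp add: wreath_int_def restrict_def)

lemma one_Wr: "\<one>\<^bsub>Wr\<^esub> = (\<lambda>i. \<one>, 0)"
  by (simp add: wreath_int_def restrict_def)

text \<open>The Kesten measure is computed with these generators for arbitrary \<open>G\<close>;
  when \<open>G\<close> is abelian they correspond to the states of the Cayley machine.\<close>

definition wr_gen :: "'a \<Rightarrow> (int \<Rightarrow> 'a) \<times> int" where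
  "wr_gen g = (\<lambda>i. if i = 0 then g else \<one>, 1)"

definition wr_gen_inv :: "'a \<Rightarrow> (int \<Rightarrow> 'a) \<times> int" where
  "wr_gen_inv g = (\<lambda>i. if i = - 1 then inv g else \<one>, - 1)"

definition wr_gens :: "((int \<Rightarrow> 'a) \<times> int) set" where
  "wr_gens = wr_gen ` carrier G \<union> wr_gen_inv ` carrier G"

definition wr_shift :: "int \<Rightarrow> (int \<Rightarrow> 'a) \<times> int \<Rightarrow> (int \<Rightarrow> 'a) \<times> int" where
  "wr_shift d y = (\<lambda>i. fst y (i - d), snd y + d)"

definition wr_set :: "int \<Rightarrow> 'a \<Rightarrow> (int \<Rightarrow> 'a) \<times> int \<Rightarrow> (int \<Rightarrow> 'a) \<times> int" where
  "wr_set c g y = ((fst y)(c := g), snd y)"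

lemma wr_shift_add: "wr_shift d (wr_shift e y) = wr_shift (d + e) y"
  by (simp add: wr_shift_def algebra_simps)

lemma wr_shift_0 [simp]: "wr_shift 0 y = y"
  by (simp add: wr_shift_def)

lemma wr_shift_set: "wr_shift d (wr_set c g y) = wr_set (c + d) g (wr_shift d y)"
  by (auto simp: wr_shift_def wr_set_def fun_eq_iff)

lemma wr_set_set [simp]: "wr_set c g (wr_set c h y) = wr_set c g y"
  by (simp add: wr_set_def)

lemma wr_set_commute: "c \<noteq> d \<Longrightarrow> wr_set c g (wr_set d h y) = wr_set d h (wr_set c g y)"
  by (simp add: wr_set_def fun_upd_twist)

lemma wr_shift_carrier: assumes "y \<in> carrier Wr" shows "wr_shift d y \<in> carrier Wr"
proof (cases y)
  case (Pair f k)
  have "{i. f (i - d) \<noteq> \<one>} = (\<lambda>i. i + d) ` {i. f i \<noteq> \<one>}"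
    by (auto simp: image_iff) (metis diff_add_cancel)
  then show ?thesis using assms by (simp add: Pair wr_shift_def carrier_Wr)
qed

lemma wr_set_carrier: assumes "y \<in> carrier Wr" "g \<in> carrier G" shows "wr_set c g y \<in> carrier Wr"
proof (cases y)
  case (Pair f k)
  have "finite (insert c {i. f i \<noteq> \<one>})" using assms by (simp add: Pair carrier_Wr)
  then have "finite {i. (f(c := g)) i \<noteq> \<one>}" by (rule finite_subset[rotated]) auto
  then show ?thesis using assms by (simp add: Pair wr_set_def carrier_Wr)
qed

lemma wr_fst_carrier: "y \<in> carrier Wr \<Longrightarrow> fst y i \<in> carrier G"
  by (cases y) (simp add: carrier_Wr)

subsection \<open>Operators\<close>

definition Uop :: "((int \<Rightarrow> 'a) \<times> int) endo" where
  "Uop = Abs_endo (\<lambda>f y. f (wr_shift 1 y))"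

definition Vop :: "((int \<Rightarrow> 'a) \<times> int) endo" where
  "Vop = Abs_endo (\<lambda>f y. f (wr_shift (- 1) y))"

text \<open>
  The indices are shifted by one, so that a step of the walk refreshes the lamp with index \<open>0\<close>.
\<close>

definition Eop :: "int \<Rightarrow> ((int \<Rightarrow> 'a) \<times> int) endo" where
  "Eop i = Abs_endo (\<lambda>f y. (\<Sum>g\<in>carrier G. f (wr_set (i - 1) g y)) / of_nat N)"

definition scal :: "real \<Rightarrow> ((int \<Rightarrow> 'a) \<times> int) endo" where
  "scal a = Abs_endo (\<lambda>f y. complex_of_real a * f y)"

lemma Rep_Uop: "Rep_endo Uop f y = f (wr_shift 1 y)"
  unfolding Uop_def by (subst Abs_endo_inverse) auto

lemma Rep_Vop: "Rep_endo Vop f y = f (wr_shift (- 1) y)"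
  unfolding Vop_def by (subst Abs_endo_inverse) auto

lemma Rep_Eop: "Rep_endo (Eop i) f y = (\<Sum>g\<in>carrier G. f (wr_set (i - 1) g y)) / of_nat N"
  unfolding Eop_def
  by (subst Abs_endo_inverse) (auto simp: sum.distrib add_divide_distrib sum_distrib_left)

lemma Rep_scal: "Rep_endo (scal a) f y = complex_of_real a * f y"
  unfolding scal_def by (subst Abs_endo_inverse) (auto simp: algebra_simps)

sublocale wr: shift_projections Uop Vop Eop scal
proof
  have N: "(of_nat N :: complex) \<noteq> 0" using N_ge_2 by simp
  show "Uop * Vop = 1" "Vop * Uop = 1"
    by (rule endo_eqI; simp add: Rep_endo_simps Rep_Uop Rep_Vop wr_shift_add)+
  show "Eop i * Eop i = Eop i" for i
    using N by (intro endo_eqI) (simp add: Rep_endo_simps Rep_Eop)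
  show "Eop i * Eop j = Eop j * Eop i" for i j
  proof (cases "i = j")
    case False
    show ?thesis
    proof (rule endo_eqI)
      fix f :: "(int \<Rightarrow> 'a) \<times> int \<Rightarrow> complex" and x
      have "(\<Sum>g\<in>carrier G. \<Sum>h\<in>carrier G. f (wr_set (j - 1) h (wr_set (i - 1) g x))) =
          (\<Sum>h\<in>carrier G. \<Sum>g\<in>carrier G. f (wr_set (i - 1) g (wr_set (j - 1) h x)))"
        using False by (subst sum.swap) (simp add: wr_set_commute[of "i - 1" "j - 1"])
      then show "Rep_endo (Eop i * Eop j) f x = Rep_endo (Eop j * Eop i) f x"
        by (simp add: Rep_endo_simps Rep_Eop sum_divide_distrib[symmetric])
    qed
  qed simp
  show "Uop * Eop i = Eop (i - 1) * Uop" for i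
    by (intro endo_eqI) (simp add: Rep_endo_simps Rep_Eop Rep_Uop wr_shift_set)
  show "scal (a + b) = scal a + scal b" "scal (a * b) = scal a * scal b" for a b
    by (rule endo_eqI; simp add: Rep_endo_simps Rep_scal distrib_right)+
  show "scal 1 = 1" by (rule endo_eqI) (simp add: Rep_endo_simps Rep_scal)
  show "scal a * T = T * scal a" for a T
  proof (rule endo_eqI)
    fix f x
    have "Rep_endo (scal a) f = (\<lambda>y. complex_of_real a * f y)" by (rule ext) (rule Rep_scal)
    then show "Rep_endo (scal a * T) f x = Rep_endo (T * scal a) f x"
      by (simp add: Rep_endo_simps Rep_scal endo_cmult)
  qed
qed

abbreviation CW :: "((int \<Rightarrow> 'a) \<times> int) measure" where
  "CW \<equiv> count_space (carrier Wr)"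

text \<open>Formal adjoints on \<open>L2\<close>, stated for pairs because the two shifts are
  adjoint to each other. Closure under sums and products then yields the symmetry of the
  eigenprojections and of the walk.\<close>

definition adj :: "((int \<Rightarrow> 'a) \<times> int) endo \<Rightarrow> ((int \<Rightarrow> 'a) \<times> int) endo \<Rightarrow> bool" where
  "adj A B \<longleftrightarrow> (\<forall>f\<in>L2 CW. Rep_endo A f \<in> L2 CW \<and> Rep_endo B f \<in> L2 CW) \<and>
     (\<forall>f\<in>L2 CW. \<forall>h\<in>L2 CW. L2_inner CW (Rep_endo A f) h = L2_inner CW f (Rep_endo B h))"

lemma L2_inner_add_right:
  assumes "f \<in> L2 M" "g \<in> L2 M" "h \<in> L2 M"
  shows "L2_inner M h (\<lambda>x. f x + g x) = L2_inner M h f + L2_inner M h g"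
  using L2_inner_add_left[OF assms] L2_inner_commute[of M h "\<lambda>x. f x + g x"] L2_inner_commute[of M h f]
    L2_inner_commute[of M h g] by simp

lemma L2_inner_cmult_right: "L2_inner M h (\<lambda>x. a * f x) = cnj a * L2_inner M h f"
  using L2_inner_cmult_left[of M a f h] L2_inner_commute[of M h "\<lambda>x. a * f x"] L2_inner_commute[of M h f] by simp

lemma adj_mult: "adj A A' \<Longrightarrow> adj B B' \<Longrightarrow> adj (A * B) (B' * A')"
  unfolding adj_def by (simp add: Rep_endo_simps)

lemma adj_one: "adj 1 1"
  unfolding adj_def by (simp add: Rep_endo_simps)

lemma adj_add: "adj A A' \<Longrightarrow> adj B B' \<Longrightarrow> adj (A + B) (A' + B')"
  unfolding adj_def by (auto simp: Rep_endo_simps L2_add L2_inner_add_left L2_inner_add_right)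

lemma adj_scal: "adj (scal a) (scal a)"
proof -
  have "Rep_endo (scal a) f = (\<lambda>y. complex_of_real a * f y)" for f by (rule ext) (rule Rep_scal)
  then show ?thesis unfolding adj_def by (auto simp: L2_cmult L2_inner_cmult_left L2_inner_cmult_right)
qed

lemma adj_diff: assumes "adj A A'" "adj B B'" shows "adj (A - B) (A' - B')"
proof -
  have m: "scal (- 1) * T = - T" for T
    by (rule endo_eqI) (simp add: Rep_endo_simps Rep_scal)
  have "T * scal (- 1) = - T" for T using m[of T] by (simp add: wr.scal_comm)
  then have "adj (- B) (- B')" using adj_mult[OF adj_scal[of "- 1"] assms(2)] m by simp
  from adj_add[OF assms(1) this] show ?thesis by simp
qed

lemma adj_zero: "adj 0 0"
  using adj_diff[OF adj_one adj_one] by simp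

lemma adj_sum: "(\<And>i. i \<in> I \<Longrightarrow> adj (A i) (B i)) \<Longrightarrow> adj (\<Sum>i\<in>I. A i) (\<Sum>i\<in>I. B i)"
  by (induction I rule: infinite_finite_induct) (auto intro: adj_zero adj_add)

lemma adj_pow: assumes "adj A B" shows "adj (A ^ d) (B ^ d)"
proof (induction d)
  case (Suc d)
  then show ?case using adj_mult[OF assms Suc] by (simp add: power_commutes)
qed (simp add: adj_one)

lemma wr_perm:
  assumes "\<And>y. y \<in> carrier Wr \<Longrightarrow> \<tau> y \<in> carrier Wr" "\<And>y. y \<in> carrier Wr \<Longrightarrow> \<sigma> y \<in> carrier Wr"
    and "\<And>y. y \<in> carrier Wr \<Longrightarrow> \<sigma> (\<tau> y) = y" "\<And>y. y \<in> carrier Wr \<Longrightarrow> \<tau> (\<sigma> y) = y"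
  shows "distr CW CW \<tau> = CW" "\<tau> \<in> measurable CW CW"
proof -
  have "bij_betw \<tau> (carrier Wr) (carrier Wr)"
    using assms by (intro bij_betwI[where g = \<sigma>]) auto
  then show "distr CW CW \<tau> = CW" by (rule distr_bij_count_space)
qed (use assms in auto)

lemma adj_U_V: "adj Uop Vop"
proof -
  note perm = wr_perm[of "wr_shift 1" "wr_shift (- 1)", OF wr_shift_carrier wr_shift_carrier]
    wr_perm[of "wr_shift (- 1)" "wr_shift 1", OF wr_shift_carrier wr_shift_carrier]
  have R: "Rep_endo Uop f = (\<lambda>y. f (wr_shift 1 y))" "Rep_endo Vop f = (\<lambda>y. f (wr_shift (- 1) y))" for f
    by (rule ext, rule Rep_Uop, rule ext, rule Rep_Vop)
  show ?thesis unfolding adj_def R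
    using L2_comp_preserving(1)[OF perm(2) perm(1)] L2_comp_preserving(1)[OF perm(4) perm(3)]
      L2_inner_comp_preserving[OF perm(2) perm(4) perm(1)]
    by (simp add: wr_shift_add)
qed

lemma adj_V_U: "adj Vop Uop"
  using adj_U_V unfolding adj_def by (metis L2_inner_commute)

lemma bij_right_mult: "a \<in> carrier G \<Longrightarrow> bij_betw (\<lambda>g. g \<otimes> a) (carrier G) (carrier G)"
  by (intro bij_betwI[where g = "\<lambda>g. g \<otimes> inv a"]) (auto simp: m_assoc)

lemma bij_inv_right_mult: "a \<in> carrier G \<Longrightarrow> bij_betw (\<lambda>g. inv g \<otimes> a) (carrier G) (carrier G)"
  by (intro bij_betwI[where g = "\<lambda>g. a \<otimes> inv g"]) (auto simp: m_assoc inv_mult_group, simp add: m_assoc[symmetric])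

text \<open>Overwriting a lamp is not injective. The average over its values is therefore rewritten
  as an average over multiplications of the lamp, which permute the carrier and act
  unitarily.\<close>

definition wr_act :: "int \<Rightarrow> 'a \<Rightarrow> (int \<Rightarrow> 'a) \<times> int \<Rightarrow> (int \<Rightarrow> 'a) \<times> int" where
  "wr_act c g y = wr_set c (g \<otimes> fst y c) y"

lemma wr_act_carrier: "y \<in> carrier Wr \<Longrightarrow> g \<in> carrier G \<Longrightarrow> wr_act c g y \<in> carrier Wr"
  unfolding wr_act_def by (intro wr_set_carrier) (auto simp: wr_fst_carrier)

lemma wr_act_inv:
  "y \<in> carrier Wr \<Longrightarrow> g \<in> carrier G \<Longrightarrow> wr_act c (inv g) (wr_act c g y) = y"
  "y \<in> carrier Wr \<Longrightarrow> g \<in> carrier G \<Longrightarrow> wr_act c g (wr_act c (inv g) y) = y"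
  using wr_fst_carrier[of y c] by (auto simp: wr_act_def wr_set_def m_assoc[symmetric] prod_eq_iff)

lemma sum_wr_set: "y \<in> carrier Wr \<Longrightarrow> (\<Sum>g\<in>carrier G. f (wr_set c g y)) = (\<Sum>g\<in>carrier G. f (wr_act c g y))"
  unfolding wr_act_def
  by (rule sum.reindex_bij_betw[OF bij_right_mult[OF wr_fst_carrier], symmetric])

lemma Rep_Eop_act:
  "y \<in> carrier Wr \<Longrightarrow> Rep_endo (Eop i) f y = (1 / of_nat N) * (\<Sum>g\<in>carrier G. f (wr_act (i - 1) g y))"
  by (simp add: Rep_Eop sum_wr_set)

lemma adj_E: "adj (Eop i) (Eop i)"
proof -
  have perm: "distr CW CW (wr_act c g) = CW" "wr_act c g \<in> measurable CW CW" if "g \<in> carrier G" for c g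
    using wr_perm[of "wr_act c g" "wr_act c (inv g)"] that by (auto simp: wr_act_carrier wr_act_inv)
  let ?h = "\<lambda>f y. (1 / of_nat N) * (\<Sum>g\<in>carrier G. f (wr_act (i - 1) g y))"
  have L: "(\<lambda>y. f (wr_act (i - 1) g y)) \<in> L2 CW" if "f \<in> L2 CW" "g \<in> carrier G" for f g
    using L2_comp_preserving(1)[OF perm(2) perm(1)] that by blast
  have Lh: "?h f \<in> L2 CW" if "f \<in> L2 CW" for f by (intro L2_cmult L2_sum L that)
  have L2E: "Rep_endo (Eop i) f \<in> L2 CW" if "f \<in> L2 CW" for f
    by (rule L2_cong[OF _ Lh[OF that]]) (simp add: Rep_Eop_act)
  have inner: "L2_inner CW (Rep_endo (Eop i) f) h = (1 / of_nat N) * (\<Sum>g\<in>carrier G. L2_inner CW (\<lambda>y. f (wr_act (i - 1) g y)) h)"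
    if "f \<in> L2 CW" "h \<in> L2 CW" for f h
  proof -
    have "L2_inner CW (Rep_endo (Eop i) f) h = L2_inner CW (?h f) h"
      by (intro L2_inner_cong) (auto simp: Rep_Eop_act)
    also have "\<dots> = (1 / of_nat N) * L2_inner CW (\<lambda>y. \<Sum>g\<in>carrier G. f (wr_act (i - 1) g y)) h"
      by (rule L2_inner_cmult_left)
    also have "L2_inner CW (\<lambda>y. \<Sum>g\<in>carrier G. f (wr_act (i - 1) g y)) h = (\<Sum>g\<in>carrier G. L2_inner CW (\<lambda>y. f (wr_act (i - 1) g y)) h)"
      using that by (intro L2_inner_sum_left L)
    finally show ?thesis .
  qed
  have "L2_inner CW (Rep_endo (Eop i) f) h = L2_inner CW f (Rep_endo (Eop i) h)" if f: "f \<in> L2 CW" and h: "h \<in> L2 CW" for f h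
  proof -
    have "L2_inner CW (\<lambda>y. f (wr_act (i - 1) g y)) h = L2_inner CW f (\<lambda>y. h (wr_act (i - 1) (inv g) y))" if g: "g \<in> carrier G" for g
      using g perm f h by (intro L2_inner_comp_preserving) (auto simp: wr_act_inv)
    then have "(\<Sum>g\<in>carrier G. L2_inner CW (\<lambda>y. f (wr_act (i - 1) g y)) h) =
        (\<Sum>g\<in>carrier G. L2_inner CW f (\<lambda>y. h (wr_act (i - 1) (inv g) y)))" by simp
    also have "\<dots> = (\<Sum>g\<in>carrier G. L2_inner CW f (\<lambda>y. h (wr_act (i - 1) g y)))"
      by (rule sum.reindex_bij_betw[of "\<lambda>g. inv g" "carrier G" "carrier G" "\<lambda>g. L2_inner CW f (\<lambda>y. h (wr_act (i - 1) g y))"])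
        (auto intro!: bij_betwI[where g = "\<lambda>g. inv g"])
    finally have "L2_inner CW (Rep_endo (Eop i) f) h = (1 / of_nat N) * (\<Sum>g\<in>carrier G. L2_inner CW f (\<lambda>y. h (wr_act (i - 1) g y)))"
      by (simp add: inner[OF f h])
    also have "\<dots> = cnj (L2_inner CW (Rep_endo (Eop i) h) f)"
      by (simp add: inner[OF h f] flip: L2_inner_commute)
    finally show ?thesis by (simp flip: L2_inner_commute)
  qed
  then show ?thesis using L2E unfolding adj_def by blast
qed

lemma adj_Q: "adj (wr.Q m) (wr.Q m)"
proof (induction m)
  case (Suc m)
  show ?case using adj_mult[OF Suc adj_E[of "int m + 1"]] by (simp add: wr.E_Q)
qed (simp add: adj_one)

lemma adj_P: "adj (wr.P t) (wr.P t)"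
proof -
  have "adj ((1 - Eop 0) * wr.Q t * (1 - Eop (int t + 1))) ((1 - Eop (int t + 1)) * (wr.Q t * (1 - Eop 0)))"
    by (intro adj_mult adj_diff adj_one adj_E adj_Q)
  moreover have "(1 - Eop (int t + 1)) * (wr.Q t * (1 - Eop 0)) = wr.P t"
  proof -
    have c1: "(1 - Eop i) * wr.Q t = wr.Q t * (1 - Eop i)" for i by (simp add: algebra_simps wr.E_Q)
    have c2: "(1 - Eop i) * (1 - Eop j) = (1 - Eop j) * (1 - Eop i)" for i j by (simp add: algebra_simps wr.E_comm)
    have "(1 - Eop (int t + 1)) * (wr.Q t * (1 - Eop 0)) = wr.Q t * ((1 - Eop (int t + 1)) * (1 - Eop 0))"
      by (simp add: c1 flip: mult.assoc)
    also have "\<dots> = wr.Q t * (1 - Eop 0) * (1 - Eop (int t + 1))" by (simp add: c2[of "int t + 1" 0] mult.assoc)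
    also have "\<dots> = wr.P t" by (simp add: wr.P_def c1)
    finally show ?thesis .
  qed
  ultimately show ?thesis by (simp add: wr.P_def)
qed

lemma adj_eigenprojection: "adj (wr.eigenprojection t s) (wr.eigenprojection t s)"
proof -
  have term_adj: "adj (scal a * (Uop ^ i * wr.P t * Vop ^ k)) (scal a * (Uop ^ k * wr.P t * Vop ^ i))" for a i k
  proof -
    have "adj (scal a * (Uop ^ i * wr.P t * Vop ^ k)) (Uop ^ k * (wr.P t * Vop ^ i) * scal a)"
      by (intro adj_mult adj_scal adj_pow adj_U_V adj_V_U adj_P)
    then show ?thesis by (simp only: wr.scal_comm mult.assoc)
  qed
  have "adj (wr.eigenprojection t s) (\<Sum>i\<le>t. \<Sum>k\<le>t. scal (s i * s k) * (Uop ^ k * wr.P t * Vop ^ i))"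
    unfolding wr.eigenprojection_expand by (intro adj_sum term_adj)
  also have "(\<Sum>i\<le>t. \<Sum>k\<le>t. scal (s i * s k) * (Uop ^ k * wr.P t * Vop ^ i)) = wr.eigenprojection t s"
    unfolding wr.eigenprojection_expand by (subst sum.swap) (simp add: mult.commute)
  finally show ?thesis .
qed

lemma adj_walk: "adj wr.walk_element wr.walk_element"
proof -
  have "adj wr.walk_element ((Vop * Eop 0 + Eop 0 * Uop) * scal (1 / 2))"
    unfolding wr.walk_element_def
    by (intro adj_mult adj_add adj_scal adj_U_V adj_V_U adj_E)
  then show ?thesis by (simp add: wr.walk_element_def wr.scal_comm add.commute)
qed

lemma sum_wr_gens: "(\<Sum>s\<in>wr_gens. f s) = (\<Sum>g\<in>carrier G. f (wr_gen g) + f (wr_gen_inv g))"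
proof -
  have i1: "inj_on wr_gen (carrier G)"
  proof (rule inj_onI)
    fix g h assume "wr_gen g = wr_gen h"
    then have "fst (wr_gen g) 0 = fst (wr_gen h) 0" by simp
    then show "g = h" by (simp add: wr_gen_def)
  qed
  have i2: "inj_on wr_gen_inv (carrier G)"
  proof (rule inj_onI)
    fix g h assume gh: "g \<in> carrier G" "h \<in> carrier G" "wr_gen_inv g = wr_gen_inv h"
    then have "fst (wr_gen_inv g) (- 1) = fst (wr_gen_inv h) (- 1)" by simp
    then have "inv g = inv h" by (simp add: wr_gen_inv_def)
    then show "g = h" using gh by (metis inv_inv)
  qed
  have "(\<Sum>s\<in>wr_gens. f s) = (\<Sum>s\<in>wr_gen ` carrier G. f s) + (\<Sum>s\<in>wr_gen_inv ` carrier G. f s)"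
    unfolding wr_gens_def using finite_carrier
    by (intro sum.union_disjoint) (auto simp: wr_gen_def wr_gen_inv_def)
  then show ?thesis using i1 i2 by (simp add: sum.reindex sum.distrib)
qed

lemma card_wr_gens: "card wr_gens = 2 * N"
  using sum_wr_gens[of "\<lambda>_. 1 :: nat"] by simp

lemma cayley_markov_Wr:
  assumes y: "y \<in> carrier Wr"
  shows "cayley_markov Wr wr_gens f y = Rep_endo wr.walk_element f y"
proof -
  obtain h k where [simp]: "y = (h, k)" by (cases y)
  have hG: "h i \<in> carrier G" for i using y by (simp add: carrier_Wr)
  have "wr_gen g \<otimes>\<^bsub>Wr\<^esub> y = wr_shift 1 (wr_set (- 1) (g \<otimes> h (- 1)) y)" if "g \<in> carrier G" for g
    using that hG by (auto simp: wr_gen_def mult_Wr wr_shift_def wr_set_def fun_eq_iff)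
  then have "(\<Sum>g\<in>carrier G. f (wr_gen g \<otimes>\<^bsub>Wr\<^esub> y)) = (\<Sum>g\<in>carrier G. f (wr_shift 1 (wr_set (- 1) (g \<otimes> h (- 1)) y)))"
    by simp
  \<comment> \<open>Multiplying the lamp by all elements gives it each value once, so that the
    generators together average over it.\<close>
  also have "\<dots> = (\<Sum>g\<in>carrier G. f (wr_shift 1 (wr_set (- 1) g y)))"
    by (rule sum.reindex_bij_betw[OF bij_right_mult[OF hG]])
  also have "\<dots> = of_nat N * Rep_endo (Eop 0 * Uop) f y"
    using N_ge_2 by (simp add: Rep_endo_simps Rep_Eop Rep_Uop)
  finally have 1: "(\<Sum>g\<in>carrier G. f (wr_gen g \<otimes>\<^bsub>Wr\<^esub> y)) = of_nat N * Rep_endo (Eop 0 * Uop) f y" .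
  have "wr_gen_inv g \<otimes>\<^bsub>Wr\<^esub> y = wr_set (- 1) (inv g \<otimes> h 0) (wr_shift (- 1) y)" if "g \<in> carrier G" for g
    using that hG by (auto simp: wr_gen_inv_def mult_Wr wr_shift_def wr_set_def fun_eq_iff)
  then have "(\<Sum>g\<in>carrier G. f (wr_gen_inv g \<otimes>\<^bsub>Wr\<^esub> y)) = (\<Sum>g\<in>carrier G. f (wr_set (- 1) (inv g \<otimes> h 0) (wr_shift (- 1) y)))"
    by simp
  also have "\<dots> = (\<Sum>g\<in>carrier G. f (wr_set (- 1) g (wr_shift (- 1) y)))"
    by (rule sum.reindex_bij_betw[OF bij_inv_right_mult[OF hG]])
  also have "\<dots> = of_nat N * Rep_endo (Vop * Eop 0) f y"
    using N_ge_2 by (simp add: Rep_endo_simps Rep_Eop Rep_Vop)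
  finally have 2: "(\<Sum>g\<in>carrier G. f (wr_gen_inv g \<otimes>\<^bsub>Wr\<^esub> y)) = of_nat N * Rep_endo (Vop * Eop 0) f y" .
  have "cayley_markov Wr wr_gens f y = of_nat N * (Rep_endo (Eop 0 * Uop) f y + Rep_endo (Vop * Eop 0) f y) / of_nat (2 * N)"
    unfolding cayley_markov_def sum_wr_gens card_wr_gens sum.distrib 1 2 by (simp only: distrib_left)
  also have "\<dots> = (Rep_endo (Eop 0 * Uop) f y + Rep_endo (Vop * Eop 0) f y) / 2" using N_ge_2 by simp
  also have "\<dots> = Rep_endo wr.walk_element f y"
    unfolding wr.walk_element_def by (subst Rep_endo_simps(6)) (simp add: Rep_scal Rep_endo_simps(3))
  finally show ?thesis .
qed

subsection \<open>Diagonal coefficients\<close>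

text \<open>Averages spread a point mass uniformly over the configurations that are free on
  \<open>I\<close> and fixed elsewhere, and these indicators follow the computation. The index is
  shifted by one as for \<open>Eop\<close>.\<close>

definition agree_off :: "int set \<Rightarrow> (int \<Rightarrow> 'a) \<times> int \<Rightarrow> (int \<Rightarrow> 'a) \<times> int \<Rightarrow> complex" where
  "agree_off I z y = of_bool (snd y = snd z \<and> (\<forall>i. i \<notin> I \<longrightarrow> fst y (i - 1) = fst z (i - 1)))"

lemma point_mass_agree_off: "point_mass z = agree_off {} z"
proof -
  have "(\<forall>i. fst y (i - 1) = fst z (i - 1)) \<longleftrightarrow> fst y = fst z" for y :: "(int \<Rightarrow> 'a) \<times> int"
    by (metis add_diff_cancel_right' ext)
  then show ?thesis by (auto simp: point_mass_def agree_off_def fun_eq_iff prod_eq_iff)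
qed

lemma Eop_agree_off:
  assumes z: "z \<in> carrier Wr" and i: "i \<notin> I"
  shows "Rep_endo (Eop i) (agree_off I z) = (\<lambda>y. (1 / of_nat N) * agree_off (insert i I) z y)"
proof
  fix y
  have "agree_off I z (wr_set (i - 1) g y) = (if g = fst z (i - 1) then agree_off (insert i I) z y else 0)" for g
    using i by (auto simp: agree_off_def wr_set_def)
  then have "(\<Sum>g\<in>carrier G. agree_off I z (wr_set (i - 1) g y)) = agree_off (insert i I) z y"
    using finite_carrier wr_fst_carrier[OF z] by simp
  then show "Rep_endo (Eop i) (agree_off I z) y = (1 / of_nat N) * agree_off (insert i I) z y"
    by (simp add: Rep_Eop)
qed

lemma Q_agree_off:
  assumes z: "z \<in> carrier Wr" and I: "\<And>i. i \<in> I \<Longrightarrow> i < 1 \<or> int m < i"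
  shows "Rep_endo (wr.Q m) (agree_off I z) = (\<lambda>y. (1 / of_nat N ^ m) * agree_off (I \<union> {1..int m}) z y)"
  using I
proof (induction m arbitrary: I)
  case 0
  then show ?case by (simp add: Rep_endo_simps)
next
  case (Suc m)
  have "int m + 1 \<notin> I" using Suc.prems by force
  then have "Rep_endo (wr.Q (Suc m)) (agree_off I z) = Rep_endo (wr.Q m) (\<lambda>y. (1 / of_nat N) * agree_off (insert (int m + 1) I) z y)"
    by (simp add: Rep_endo_simps Eop_agree_off[OF z])
  also have "\<dots> = (\<lambda>y. (1 / of_nat N) * Rep_endo (wr.Q m) (agree_off (insert (int m + 1) I) z) y)"
    by (rule endo_cmult)
  also have "\<dots> = (\<lambda>y. (1 / of_nat N) * ((1 / of_nat N ^ m) * agree_off (insert (int m + 1) I \<union> {1..int m}) z y))"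
    using Suc.prems by (subst Suc.IH) force+
  also have "insert (int m + 1) I \<union> {1..int m} = I \<union> {1..int (Suc m)}" by auto
  finally show ?case by simp
qed

lemma P_point_mass:
  assumes z: "z \<in> carrier Wr"
  shows "Rep_endo (wr.P t) (point_mass z) y =
    (1 / of_nat N ^ t) * agree_off {1..int t} z y - (1 / of_nat N ^ (t + 1)) * agree_off {1..int t + 1} z y
    - (1 / of_nat N ^ (t + 1)) * agree_off {0..int t} z y + (1 / of_nat N ^ (t + 2)) * agree_off {0..int t + 1} z y"
proof -
  have s1: "insert (int t + 1) {1..int t} = {1..int t + 1}" "insert 0 {1..int t} = {0..int t}"
    "insert 0 {1..int t + 1} = {0..int t + 1}" by auto
  have diff: "Rep_endo T (\<lambda>x. f x - h x) = (\<lambda>x. Rep_endo T f x - Rep_endo T h x)" for T :: "((int \<Rightarrow> 'a) \<times> int) endo" and f h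
    using endo_add[of T f "\<lambda>x. (- 1) * h x"] endo_cmult[of T "- 1" h] by simp
  have a: "Rep_endo (1 - Eop (int t + 1)) (point_mass z) = (\<lambda>y. agree_off {} z y - (1 / of_nat N) * agree_off {int t + 1} z y)"
    by (simp add: Rep_endo_simps point_mass_agree_off Eop_agree_off[OF z])
  have "Rep_endo (wr.Q t) (agree_off {} z) = (\<lambda>y. (1 / of_nat N ^ t) * agree_off ({} \<union> {1..int t}) z y)"
    "Rep_endo (wr.Q t) (agree_off {int t + 1} z) = (\<lambda>y. (1 / of_nat N ^ t) * agree_off ({int t + 1} \<union> {1..int t}) z y)"
    by (rule Q_agree_off[OF z]; simp)+
  then have b: "Rep_endo (wr.Q t) (Rep_endo (1 - Eop (int t + 1)) (point_mass z)) =
      (\<lambda>y. (1 / of_nat N ^ t) * agree_off {1..int t} z y - (1 / of_nat N ^ (t + 1)) * agree_off {1..int t + 1} z y)"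
    unfolding a diff endo_cmult by (simp add: s1 mult.assoc)
  have "Rep_endo (wr.P t) (point_mass z) = Rep_endo (1 - Eop 0) (Rep_endo (wr.Q t) (Rep_endo (1 - Eop (int t + 1)) (point_mass z)))"
    by (simp only: wr.P_def Rep_endo_simps(6))
  note P = this[unfolded b]
  have c: "Rep_endo (Eop 0) (agree_off {1..int t} z) = (\<lambda>y. (1 / of_nat N) * agree_off {0..int t} z y)"
    "Rep_endo (Eop 0) (agree_off {1..int t + 1} z) = (\<lambda>y. (1 / of_nat N) * agree_off {0..int t + 1} z y)"
    using Eop_agree_off[OF z, of 0 "{1..int t}"] Eop_agree_off[OF z, of 0 "{1..int t + 1}"] by (simp_all only: s1) auto
  have "Rep_endo (wr.P t) (point_mass z) y =
    ((1 / of_nat N ^ t) * agree_off {1..int t} z y - (1 / of_nat N ^ (t + 1)) * agree_off {1..int t + 1} z y) -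
    ((1 / of_nat N ^ t) * ((1 / of_nat N) * agree_off {0..int t} z y) - (1 / of_nat N ^ (t + 1)) * ((1 / of_nat N) * agree_off {0..int t + 1} z y))"
    unfolding P Rep_endo_simps(2,4) diff endo_cmult c by (simp add: algebra_simps)
  then show ?thesis by (simp add: algebra_simps)
qed

text \<open>Expanding the two complementary factors gives n^-t - 2 n^-(t + 1) + n^-(t + 2), which is
  (n - 1)^2 / n^(t + 2).\<close>

lemma P_diagonal:
  assumes z: "z \<in> carrier Wr"
  shows "Rep_endo (wr.P t) (point_mass z) z = complex_of_real ((real N - 1)\<^sup>2 / real N ^ (t + 2))"
proof -
  have "Rep_endo (wr.P t) (point_mass z) z = complex_of_real (1 / real N ^ t - 1 / real N ^ (t + 1) - 1 / real N ^ (t + 1) + 1 / real N ^ (t + 2))"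
    unfolding P_point_mass[OF z] by (simp add: agree_off_def)
  also have "1 / real N ^ t - 1 / real N ^ (t + 1) - 1 / real N ^ (t + 1) + 1 / real N ^ (t + 2) = (real N - 1)\<^sup>2 / real N ^ (t + 2)"
    using N_ge_2 by (simp add: field_simps power2_eq_square)
  finally show ?thesis .
qed

lemma P_off_diagonal:
  assumes "z \<in> carrier Wr" "snd y \<noteq> snd z" shows "Rep_endo (wr.P t) (point_mass z) y = 0"
  unfolding P_point_mass[OF assms(1)] using assms(2) by (simp add: agree_off_def)

lemma Rep_U_pow: "Rep_endo (Uop ^ d) f y = f (wr_shift (int d) y)"
proof (induction d arbitrary: y)
  case (Suc d)
  then show ?case by (simp add: Rep_endo_simps Rep_Uop wr_shift_add add.commute)
qed (simp add: Rep_endo_simps)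

lemma Rep_V_pow: "Rep_endo (Vop ^ d) f y = f (wr_shift (- int d) y)"
proof (induction d arbitrary: y)
  case (Suc d)
  then show ?case by (simp add: Rep_endo_simps Rep_Vop wr_shift_add add.commute)
qed (simp add: Rep_endo_simps)

lemma V_pow_point_mass: "Rep_endo (Vop ^ d) (point_mass y) = point_mass (wr_shift (int d) y)"
proof
  fix x
  have "wr_shift (- int d) x = y \<longleftrightarrow> x = wr_shift (int d) y"
    by (metis add.left_inverse add.right_inverse wr_shift_0 wr_shift_add)
  then show "Rep_endo (Vop ^ d) (point_mass y) x = point_mass (wr_shift (int d) y) x"
    by (simp add: Rep_V_pow point_mass_def)
qed

text \<open>In the expansion, a term with i different from k compares configurations with the walker
  at different places and vanishes, as \<open>P t\<close> does not move the walker. The other terms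
  are one coefficient, weighted with the squares of the entries of a unit vector.\<close>

lemma eigenprojection_diagonal:
  assumes y: "y \<in> carrier Wr" and s: "(\<Sum>i\<le>t. s i * s i) = 1"
  shows "Rep_endo (wr.eigenprojection t s) (point_mass y) y = complex_of_real ((real N - 1)\<^sup>2 / real N ^ (t + 2))"
proof -
  let ?c = "complex_of_real ((real N - 1)\<^sup>2 / real N ^ (t + 2))"
  have "Rep_endo (scal a * (Uop ^ i * wr.P t * Vop ^ k)) (point_mass y) y = (if i = k then complex_of_real a * ?c else 0)" for a i k
  proof -
    have "Rep_endo (scal a * (Uop ^ i * wr.P t * Vop ^ k)) (point_mass y) y =
        complex_of_real a * Rep_endo (wr.P t) (point_mass (wr_shift (int k) y)) (wr_shift (int i) y)"
      by (simp add: Rep_endo_simps(6) Rep_scal Rep_U_pow V_pow_point_mass)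
    moreover have "snd (wr_shift (int i) y) \<noteq> snd (wr_shift (int k) y)" if "i \<noteq> k"
      using that by (simp add: wr_shift_def)
    ultimately show ?thesis
      using P_diagonal[OF wr_shift_carrier[OF y]] P_off_diagonal[OF wr_shift_carrier[OF y]] by auto
  qed
  then have "Rep_endo (wr.eigenprojection t s) (point_mass y) y = (\<Sum>i\<le>t. \<Sum>k\<le>t. if i = k then complex_of_real (s i * s k) * ?c else 0)"
    unfolding wr.eigenprojection_expand Rep_endo_sum by simp
  also have "\<dots> = complex_of_real (\<Sum>i\<le>t. s i * s i) * ?c"
    by (simp add: sum_distrib_right sum_divide_distrib)
  finally show ?thesis using s by simp
qed

subsection \<open>The Kesten measure of the wreath product\<close>

text \<open>The pairs (t, p) with 1 <= p <= t + 1 are enumerated through \<open>prod_decode\<close>,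
  with p = q + 1. Indices with q > t get the zero projection, and the eigenvalue 0 that
  \<open>proj_ev\<close> gives them is a placeholder.\<close>

definition proj_at :: "nat \<Rightarrow> ((int \<Rightarrow> 'a) \<times> int) endo" where
  "proj_at n = (case prod_decode n of (t, q) \<Rightarrow>
     if q \<le> t then wr.eigenprojection t (\<lambda>i. sine_vec t (angle t (Suc q)) (Suc i)) else 0)"

definition proj_ev :: "nat \<Rightarrow> real" where
  "proj_ev n = (case prod_decode n of (t, q) \<Rightarrow> if q \<le> t then cos (angle t (Suc q)) else 0)"

definition proj_weight :: "nat \<Rightarrow> real" where
  "proj_weight n = (case prod_decode n of (t, q) \<Rightarrow> if q \<le> t then (real N - 1)\<^sup>2 / real N ^ (t + 2) else 0)"

lemma angle_range: "q \<le> t \<Longrightarrow> 0 < angle t (Suc q)" "q \<le> t \<Longrightarrow> angle t (Suc q) < pi"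
  using angle_bounds[of t "Suc q" "Suc t"] by (auto simp: chain_index_def)

lemma proj_at_mult: "proj_at n * proj_at m = (if n = m then proj_at n else 0)"
proof -
  obtain t q where n: "prod_decode n = (t, q)" by (cases "prod_decode n")
  obtain t' q' where m: "prod_decode m = (t', q')" by (cases "prod_decode m")
  have nm: "n = m \<longleftrightarrow> t = t' \<and> q = q'" using n m by (metis prod.inject prod_decode_inverse)
  let ?s = "\<lambda>i. sine_vec t (angle t (Suc q)) (Suc i)" and ?r = "\<lambda>i. sine_vec t' (angle t' (Suc q')) (Suc i)"
  show ?thesis
  proof (cases "q \<le> t \<and> q' \<le> t'")
    case False
    then show ?thesis by (auto simp: proj_at_def n m nm)
  next
    case True
    have norm: "(\<Sum>i\<le>t. ?s i * ?s i) = 1" using True angle_range by (intro sine_vec_normalized) auto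
    have ip: "(\<Sum>i\<le>t. ?s i * ?r i) = of_bool (q = q')" if t: "t = t'"
    proof (cases "q = q'")
      case False
      have "cos (angle t (Suc q)) \<noteq> cos (angle t (Suc q'))"
      proof
        assume "cos (angle t (Suc q)) = cos (angle t (Suc q'))"
        then have "angle t (Suc q) = angle t (Suc q')"
          using angle_range[of q t] angle_range[of q' t] True t
          by (intro cos_inj_pi[of "angle t (Suc q)" "angle t (Suc q')"]) auto
        then show False using False by (simp add: angle_def)
      qed
      then show ?thesis using sine_vec_orthogonal[OF sin_angle sin_angle] t False by simp
    qed (use norm t in simp)
    \<comment> \<open>Different q give orthogonal unit vectors, so the vectors themselves can serve
      as labels of the projections.\<close>
    have eq: "?s = ?r \<longleftrightarrow> q = q'" if t: "t = t'"
    proof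
      assume "?s = ?r"
      then have "?r i = ?s i" for i by metis
      then have "(\<Sum>i\<le>t. ?s i * ?r i) = 1" using norm by simp
      then show "q = q'" using ip[OF t] by (auto split: if_splits)
    qed (simp add: t)
    have "wr.eigenprojection t ?s * wr.eigenprojection t' ?r = (if t = t' \<and> ?s = ?r then wr.eigenprojection t ?s else 0)"
    proof (rule wr.eigenprojection_mult)
      assume t: "t = t'"
      show "(\<Sum>i\<le>t. ?s i * ?r i) = of_bool (?s = ?r)" unfolding eq[OF t] by (rule ip[OF t])
    qed
    then show ?thesis using True eq by (auto simp: proj_at_def n m nm)
  qed
qed

lemma proj_at_walk: "wr.walk_element * proj_at n = scal (proj_ev n) * proj_at n"
proof -
  obtain t q where n: "prod_decode n = (t, q)" by (cases "prod_decode n")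
  let ?\<theta> = "angle t (Suc q)"
  let ?s = "\<lambda>i. sine_vec t ?\<theta> (Suc i)"
  have "wr.walk_element * wr.B t ?s = scal (cos ?\<theta>) * wr.B t ?s"
    using sin_angle[of t "Suc q"] by (intro wr.walk_element_B sine_vec_three_term) (auto simp: sine_vec_def)
  then have "wr.walk_element * wr.eigenprojection t ?s = scal (cos ?\<theta>) * wr.eigenprojection t ?s"
    by (simp add: wr.eigenprojection_def flip: mult.assoc)
  then show ?thesis by (simp add: proj_at_def proj_ev_def n)
qed

lemma adj_proj_at: "adj (proj_at n) (proj_at n)"
  by (auto simp: proj_at_def adj_eigenprojection adj_zero split: prod.split)

lemma proj_at_diagonal:
  assumes "y \<in> carrier Wr" shows "Rep_endo (proj_at n) (point_mass y) y = complex_of_real (proj_weight n)"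
  using eigenprojection_diagonal[OF assms sine_vec_normalized] angle_range
  by (auto simp: proj_at_def proj_weight_def Rep_endo_simps split: prod.split)

text \<open>Under L = t + 2 and p = q + 1 the diagonal coefficients are the weights of
  \<open>chain_measure\<close>. For \<open>B = UNIV\<close> this will be the completeness of the
  projections, for general \<open>B\<close> the Kesten measure.\<close>

lemma proj_weight_sums:
  assumes B: "B \<in> sets borel"
  shows "(\<lambda>n. of_bool (proj_ev n \<in> B) * proj_weight n) sums measure (chain_measure N) B"
proof -
  let ?I = "{(L, p). 1 \<le> p \<and> p < L} :: (nat \<times> nat) set"
  let ?valid = "{n. snd (prod_decode n) \<le> fst (prod_decode n)}"
  let ?h = "\<lambda>n. (fst (prod_decode n) + 2, Suc (snd (prod_decode n)))"
  let ?f = "\<lambda>(L, p). ennreal ((real N - 1)\<^sup>2 / real N ^ L) * indicator B (cos (real p / real L * pi))"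
  interpret prob_space "chain_measure N" by (rule prob_space_chain_measure[OF N_ge_2])
  have bij: "bij_betw ?h ?valid ?I"
    by (rule bij_betwI[where g = "\<lambda>(L, p). prod_encode (L - 2, p - 1)"]) auto
  have "emeasure (chain_measure N) B = (\<integral>\<^sup>+ i. ?f i \<partial>count_space ?I)"
    unfolding chain_measure_def emeasure_dirac_sum[OF B] by (intro nn_integral_cong) (auto simp: B)
  also have "\<dots> = (\<integral>\<^sup>+ n. ?f (?h n) \<partial>count_space ?valid)"
    by (rule nn_integral_bij_count_space[OF bij, symmetric])
  also have "\<dots> = (\<integral>\<^sup>+ n. ?f (?h n) * indicator ?valid n \<partial>count_space UNIV)"
    by (subst nn_integral_count_space_indicator) auto
  also have "\<dots> = (\<integral>\<^sup>+ n. ennreal (of_bool (proj_ev n \<in> B) * proj_weight n) \<partial>count_space UNIV)"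
  proof (intro nn_integral_cong)
    fix n
    obtain t q where n: "prod_decode n = (t, q)" by (cases "prod_decode n")
    have "cos (real (Suc q) / real (t + 2) * pi) = cos (angle t (Suc q))" by (simp only: angle_def)
    then show "?f (?h n) * indicator ?valid n = ennreal (of_bool (proj_ev n \<in> B) * proj_weight n)"
      by (simp add: n proj_ev_def proj_weight_def indicator_def del: of_nat_Suc of_nat_add power_Suc)
  qed
  also have "\<dots> = (\<Sum>n. ennreal (of_bool (proj_ev n \<in> B) * proj_weight n))"
    by (rule nn_integral_count_space_nat)
  finally have em: "emeasure (chain_measure N) B = (\<Sum>n. ennreal (of_bool (proj_ev n \<in> B) * proj_weight n))" .
  have nn: "0 \<le> of_bool (proj_ev n \<in> B) * proj_weight n" for n
    by (simp add: proj_weight_def split: prod.split)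
  have sm: "summable (\<lambda>n. of_bool (proj_ev n \<in> B) * proj_weight n)"
    using em emeasure_finite[of B] by (intro summable_suminf_not_top nn) auto
  have "emeasure (chain_measure N) B = ennreal (\<Sum>n. of_bool (proj_ev n \<in> B) * proj_weight n)"
    unfolding em by (rule suminf_ennreal2[OF nn sm])
  then have "measure (chain_measure N) B = (\<Sum>n. of_bool (proj_ev n \<in> B) * proj_weight n)"
    unfolding measure_def using suminf_nonneg[OF sm nn] by simp
  then show ?thesis using summable_sums[OF sm] by simp
qed

lemma wr_point_spectrum:
  "point_spectrum (carrier Wr) (\<lambda>n. Rep_endo (proj_at n)) proj_ev (cayley_markov Wr wr_gens)"
proof
  have walk: "adj wr.walk_element wr.walk_element" by (rule adj_walk)
  fix f :: "(int \<Rightarrow> 'a) \<times> int \<Rightarrow> complex" and n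
  show "\<bar>proj_ev n\<bar> \<le> 1" by (simp add: proj_ev_def split: prod.split)
  show "Rep_endo (proj_at n) (\<lambda>y. f y + g y) x = Rep_endo (proj_at n) f x + Rep_endo (proj_at n) g x" for g x
    by (simp add: endo_add)
  show "Rep_endo (proj_at n) (\<lambda>y. a * f y) x = a * Rep_endo (proj_at n) f x" for a x
    by (simp add: endo_cmult)
  show "Rep_endo (proj_at n) (Rep_endo (proj_at m) f) x = (if n = m then Rep_endo (proj_at n) f x else 0)" for m x
  proof -
    have "Rep_endo (proj_at n) (Rep_endo (proj_at m) f) x = Rep_endo (proj_at n * proj_at m) f x"
      by (simp only: Rep_endo_simps(6))
    then show ?thesis by (simp add: proj_at_mult Rep_endo_simps)
  qed
  show "(\<lambda>n. Rep_endo (proj_at n) (point_mass y) y) sums 1" if y: "y \<in> carrier Wr" for y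
  proof -
    interpret prob_space "chain_measure N" by (rule prob_space_chain_measure[OF N_ge_2])
    have "space (chain_measure N) = UNIV" by (simp add: chain_measure_def dirac_sum_def)
    then have "measure (chain_measure N) UNIV = 1" using prob_space by simp
    then have "proj_weight sums 1" using proj_weight_sums[of UNIV] by simp
    then have "(\<lambda>n. complex_of_real (proj_weight n)) sums complex_of_real 1" by (rule sums_of_real)
    then show ?thesis by (simp add: proj_at_diagonal[OF y])
  qed
  assume f: "f \<in> L2 CW"
  show "Rep_endo (proj_at n) f \<in> L2 CW" using adj_proj_at f unfolding adj_def by blast
  show "L2_inner CW (Rep_endo (proj_at n) f) g = L2_inner CW f (Rep_endo (proj_at n) g)" if "g \<in> L2 CW" for g
    using adj_proj_at f that unfolding adj_def by blast
  have WL: "Rep_endo wr.walk_element f \<in> L2 CW" using walk f unfolding adj_def by blast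
  show "cayley_markov Wr wr_gens f \<in> L2 CW"
    by (rule L2_cong[OF _ WL]) (simp add: cayley_markov_Wr)
  show "L2_inner CW (cayley_markov Wr wr_gens f) g = L2_inner CW f (cayley_markov Wr wr_gens g)" if g: "g \<in> L2 CW" for g
  proof -
    have "L2_inner CW (cayley_markov Wr wr_gens f) g = L2_inner CW (Rep_endo wr.walk_element f) g"
      by (intro L2_inner_cong) (auto simp: cayley_markov_Wr)
    also have "\<dots> = L2_inner CW f (Rep_endo wr.walk_element g)" using walk f g unfolding adj_def by blast
    also have "\<dots> = L2_inner CW f (cayley_markov Wr wr_gens g)"
      by (intro L2_inner_cong) (auto simp: cayley_markov_Wr)
    finally show ?thesis .
  qed
  show "cayley_markov Wr wr_gens (Rep_endo (proj_at n) f) x = complex_of_real (proj_ev n) * Rep_endo (proj_at n) f x"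
    if "x \<in> carrier Wr" for x
  proof -
    have "cayley_markov Wr wr_gens (Rep_endo (proj_at n) f) x = Rep_endo (wr.walk_element * proj_at n) f x"
      using that by (simp only: cayley_markov_Wr Rep_endo_simps(6))
    then show ?thesis by (simp only: proj_at_walk Rep_endo_simps(6) Rep_scal)
  qed
qed

lemma Kesten_wreath: "is_Kesten_spectral_measure Wr wr_gens (cayley_machine_measure N)"
proof -
  interpret ps: point_spectrum "carrier Wr" "\<lambda>n. Rep_endo (proj_at n)" proj_ev "cayley_markov Wr wr_gens"
    by (rule wr_point_spectrum)
  have one: "\<one>\<^bsub>Wr\<^esub> \<in> carrier Wr" by (simp add: one_Wr carrier_Wr)
  have \<delta>: "(\<lambda>x. if x = \<one>\<^bsub>Wr\<^esub> then 1 else 0) = point_mass \<one>\<^bsub>Wr\<^esub>" by (simp add: point_mass_def fun_eq_iff)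
  have "complex_of_real (measure (chain_measure N) B) = L2_inner CW (ps.spectral B (point_mass \<one>\<^bsub>Wr\<^esub>)) (point_mass \<one>\<^bsub>Wr\<^esub>)"
    if B: "B \<in> sets borel" for B
  proof -
    have "(\<lambda>n. complex_of_real (of_bool (proj_ev n \<in> B) * proj_weight n)) sums complex_of_real (measure (chain_measure N) B)"
      by (rule sums_of_real[OF proj_weight_sums[OF B]])
    moreover have "complex_of_real (of_bool (proj_ev n \<in> B) * proj_weight n) =
        of_bool (proj_ev n \<in> B) * Rep_endo (proj_at n) (point_mass \<one>\<^bsub>Wr\<^esub>) \<one>\<^bsub>Wr\<^esub>" for n
      by (auto simp: proj_at_diagonal[OF one] of_bool_def)
    ultimately show ?thesis using ps.spectral_point_mass[OF one, of B] by (simp only: sums_unique2)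
  qed
  moreover have "finite_measure (chain_measure N)"
    using prob_space_chain_measure[OF N_ge_2] by (simp add: prob_space_def)
  ultimately show ?thesis
    unfolding is_Kesten_spectral_measure_def chain_measure_eq[OF N_ge_2, symmetric] Let_def \<delta>
    using ps.is_spectral_measure_spectral by (auto simp: chain_measure_def)
qed

end

section \<open>Invariance of the Kesten measure under group isomorphisms\<close>

subsection \<open>Transport along isomorphisms\<close>

lemma L2_bij:
  assumes bij: "bij_betw \<theta> X Y"
  shows "f \<in> L2 (count_space Y) \<longleftrightarrow> (\<lambda>x. f (\<theta> x)) \<in> L2 (count_space X)"
    and "L2_inner (count_space Y) f g = L2_inner (count_space X) (\<lambda>x. f (\<theta> x)) (\<lambda>x. g (\<theta> x))"
    and "L2_norm (count_space Y) f = L2_norm (count_space X) (\<lambda>x. f (\<theta> x))"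
proof -
  have d: "distr (count_space X) (count_space Y) \<theta> = count_space Y" by (rule distr_bij_count_space[OF bij])
  have m: "\<theta> \<in> measurable (count_space X) (count_space Y)" using bij by (auto simp: bij_betw_def)
  have "integrable (distr (count_space X) (count_space Y) \<theta>) (\<lambda>x. (cmod (f x))\<^sup>2) \<longleftrightarrow>
      integrable (count_space X) (\<lambda>x. (cmod (f (\<theta> x)))\<^sup>2)"
    by (rule integrable_distr_eq[OF m]) simp
  then show "f \<in> L2 (count_space Y) \<longleftrightarrow> (\<lambda>x. f (\<theta> x)) \<in> L2 (count_space X)"
    unfolding d by (simp add: L2_def)
  have "(LINT x|distr (count_space X) (count_space Y) \<theta>. f x * cnj (g x)) = (LINT x|count_space X. f (\<theta> x) * cnj (g (\<theta> x)))"
    by (rule integral_distr[OF m]) simp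
  then show "L2_inner (count_space Y) f g = L2_inner (count_space X) (\<lambda>x. f (\<theta> x)) (\<lambda>x. g (\<theta> x))"
    unfolding d by (simp add: L2_inner_def)
  have "(LINT x|distr (count_space X) (count_space Y) \<theta>. (cmod (f x))\<^sup>2) = (LINT x|count_space X. (cmod (f (\<theta> x)))\<^sup>2)"
    by (rule integral_distr[OF m]) simp
  then show "L2_norm (count_space Y) f = L2_norm (count_space X) (\<lambda>x. f (\<theta> x))"
    unfolding d by (simp add: L2_norm_def)
qed

text \<open>The difference of the two functions has norm zero, hence so has its image, and under
  counting measure this means zero at every point. It bridges functions that agree on the carrier
  but may differ outside it.\<close>

lemma L2_operator_cong:
  assumes R: "L2_bounded_operator (count_space X) R" and h: "h \<in> L2 (count_space X)"
    and eq: "\<And>x. x \<in> X \<Longrightarrow> h x = h' x" and x: "x \<in> X"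
  shows "R h x = R h' x"
proof -
  have h': "h' \<in> L2 (count_space X)" using L2_cong[OF eq h] .
  let ?d = "\<lambda>y. h y - h' y"
  have d: "?d \<in> L2 (count_space X)" using h h' by (rule L2_diff)
  obtain K where K: "L2_norm (count_space X) (R ?d) \<le> K * L2_norm (count_space X) ?d"
    using R d unfolding L2_bounded_operator_def by blast
  have "L2_norm (count_space X) ?d = L2_norm (count_space X) (\<lambda>_. 0)"
    by (intro L2_norm_cong) (simp add: eq)
  moreover have "\<dots> = 0" by (simp add: L2_norm_def)
  ultimately have "L2_norm (count_space X) ?d = 0" by (rule trans)
  then have "L2_norm (count_space X) (R ?d) = 0"
    using K L2_norm_nonneg[of "count_space X" "R ?d"] by simp
  moreover have "R ?d \<in> L2 (count_space X)" using R d unfolding L2_bounded_operator_def by blast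
  ultimately have "R ?d x = 0" using x by (intro L2_norm_zero_imp)
  moreover have "\<forall>f\<in>L2 (count_space X). \<forall>g\<in>L2 (count_space X). \<forall>x\<in>X. R (\<lambda>y. f y + g y) x = R f x + R g x"
    using R unfolding L2_bounded_operator_def by (simp add: AE_count_space)
  note this[rule_format, OF h' d x]
  ultimately show ?thesis by simp
qed

text \<open>Composition with \<open>\<theta>\<close> is unitary, intertwines the two Markov
  operators and matches the point masses at the units. So the spectral measure can be carried over,
  and the Kesten measure with it.\<close>

lemma Kesten_transport:
  assumes K: "is_Kesten_spectral_measure \<Lambda> S \<mu>" and \<theta>: "\<theta> \<in> iso \<Lambda> \<Lambda>'" and "group \<Lambda>" "group \<Lambda>'"
    and S: "S \<subseteq> carrier \<Lambda>"
  shows "is_Kesten_spectral_measure \<Lambda>' (\<theta> ` S) \<mu>"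
proof -
  interpret L: group \<Lambda> by fact
  interpret L': group \<Lambda>' by fact
  let ?X = "carrier \<Lambda>" and ?Y = "carrier \<Lambda>'"
  let ?C = "count_space ?X" and ?D = "count_space ?Y"
  have bij: "bij_betw \<theta> ?X ?Y" and hom: "\<theta> \<in> hom \<Lambda> \<Lambda>'" using \<theta> by (auto simp: iso_def)
  define \<eta> where "\<eta> = inv_into ?X \<theta>"
  have \<eta>\<theta>: "\<eta> (\<theta> x) = x" if "x \<in> ?X" for x using bij that by (simp add: \<eta>_def bij_betw_def)
  have \<theta>\<eta>: "\<theta> (\<eta> y) = y" and \<eta>X: "\<eta> y \<in> ?X" if "y \<in> ?Y" for y
    using bij that by (auto simp: \<eta>_def bij_betw_def f_inv_into_f inv_into_into)
  note L2 = L2_bij[OF bij]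
  let ?\<delta> = "\<lambda>x. if x = \<one>\<^bsub>\<Lambda>\<^esub> then 1 else 0 :: complex" and ?\<delta>' = "\<lambda>x. if x = \<one>\<^bsub>\<Lambda>'\<^esub> then 1 else 0 :: complex"
  obtain E where E: "is_spectral_measure ?C (cayley_markov \<Lambda> S) E"
    and \<mu>: "\<And>B. B \<in> sets borel \<Longrightarrow> complex_of_real (measure \<mu> B) = L2_inner ?C (E B ?\<delta>) ?\<delta>"
    using K unfolding is_Kesten_spectral_measure_def Let_def by blast
  note E = E[unfolded is_spectral_measure_def]
  have E_op: "L2_bounded_operator ?C (E B)" if "B \<in> sets borel" for B using E that by blast
  have E_L2: "E B f \<in> L2 ?C" if "B \<in> sets borel" "f \<in> L2 ?C" for B f
    using E_op[OF that(1)] that(2) unfolding L2_bounded_operator_def by blast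
  define E' where "E' = (\<lambda>B f y. E B (\<lambda>x. f (\<theta> x)) (\<eta> y))"
  have E'\<theta>: "E' B f (\<theta> x) = E B (\<lambda>x. f (\<theta> x)) x" if "x \<in> ?X" for B f x by (simp add: E'_def \<eta>\<theta> that)
  have E'_L2: "(\<lambda>x. E' B f (\<theta> x)) \<in> L2 ?C" if "B \<in> sets borel" "f \<in> L2 ?D" for B f
  proof -
    have "(\<lambda>x. f (\<theta> x)) \<in> L2 ?C" using that(2) L2(1)[of f] by simp
    then show ?thesis by (rule L2_cong[OF _ E_L2[OF that(1)], rotated]) (simp add: E'\<theta>)
  qed
  have inner: "L2_inner ?D (E' B f) g = L2_inner ?C (E B (\<lambda>x. f (\<theta> x))) (\<lambda>x. g (\<theta> x))" for B f g
    unfolding L2(2)[of "E' B f" g] by (intro L2_inner_cong) (auto simp: E'\<theta>)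
  have T: "cayley_markov \<Lambda>' (\<theta> ` S) f (\<theta> x) = cayley_markov \<Lambda> S (\<lambda>x. f (\<theta> x)) x" if x: "x \<in> ?X" for f x
  proof -
    have inj: "inj_on \<theta> S" using bij S by (auto simp: bij_betw_def intro: inj_on_subset)
    have "(\<Sum>s\<in>\<theta> ` S. f (s \<otimes>\<^bsub>\<Lambda>'\<^esub> \<theta> x)) = (\<Sum>s\<in>S. f (\<theta> s \<otimes>\<^bsub>\<Lambda>'\<^esub> \<theta> x))" by (simp add: sum.reindex[OF inj])
    also have "\<dots> = (\<Sum>s\<in>S. f (\<theta> (s \<otimes>\<^bsub>\<Lambda>\<^esub> x)))"
      using hom S x by (intro sum.cong) (auto simp: hom_mult)
    finally show ?thesis by (simp add: cayley_markov_def card_image[OF inj])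
  qed
  have sp: "is_spectral_measure ?D (cayley_markov \<Lambda>' (\<theta> ` S)) E'"
    unfolding is_spectral_measure_def
  proof (intro conjI ballI)
    fix B :: "real set" assume B: "B \<in> sets borel"
    have add: "\<forall>f\<in>L2 ?C. \<forall>g\<in>L2 ?C. \<forall>x\<in>?X. E B (\<lambda>y. f y + g y) x = E B f x + E B g x"
      and cm: "\<forall>f\<in>L2 ?C. \<forall>a. \<forall>x\<in>?X. E B (\<lambda>y. a * f y) x = a * E B f x"
      using E_op[OF B] unfolding L2_bounded_operator_def by (simp_all add: AE_count_space)
    obtain K where K: "\<And>f. f \<in> L2 ?C \<Longrightarrow> L2_norm ?C (E B f) \<le> K * L2_norm ?C f"
      using E_op[OF B] unfolding L2_bounded_operator_def by blast
    show "L2_bounded_operator ?D (E' B)"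
      unfolding L2_bounded_operator_def
    proof (intro conjI ballI allI)
      fix f assume f: "f \<in> L2 ?D"
      then have f': "(\<lambda>x. f (\<theta> x)) \<in> L2 ?C" using L2(1)[of f] by simp
      show "E' B f \<in> L2 ?D" unfolding L2(1)[of "E' B f"] by (rule E'_L2[OF B f])
      show "AE x in ?D. E' B (\<lambda>y. a * f y) x = a * E' B f x" for a
        using cm f' by (intro AE_I2) (simp add: E'_def \<eta>X)
      show "AE x in ?D. E' B (\<lambda>y. f y + g y) x = E' B f x + E' B g x" if "g \<in> L2 ?D" for g
        using add f' that L2(1)[of g] by (intro AE_I2) (simp add: E'_def \<eta>X)
    next
      have "L2_norm ?D (E' B f) \<le> K * L2_norm ?D f" if f: "f \<in> L2 ?D" for f
      proof -
        have "L2_norm ?D (E' B f) = L2_norm ?C (E B (\<lambda>x. f (\<theta> x)))"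
          unfolding L2(3)[of "E' B f"] by (intro L2_norm_cong) (simp add: E'\<theta>)
        then show ?thesis using K[of "\<lambda>x. f (\<theta> x)"] f L2(1)[of f] L2(3)[of f] by simp
      qed
      then show "\<exists>K. \<forall>f\<in>L2 ?D. L2_norm ?D (E' B f) \<le> K * L2_norm ?D f" by blast
    qed
    show "L2_inner ?D (E' B f) g = L2_inner ?D f (E' B g)" if f: "f \<in> L2 ?D" and g: "g \<in> L2 ?D" for f g
    proof -
      have "L2_inner ?D (E' B f) g = L2_inner ?C (\<lambda>x. f (\<theta> x)) (E B (\<lambda>x. g (\<theta> x)))"
        unfolding inner using E B f g L2(1)[of f] L2(1)[of g] by blast
      also have "\<dots> = L2_inner ?D f (E' B g)" unfolding L2(2)[of f "E' B g"] by (intro L2_inner_cong) (auto simp: E'\<theta>)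
      finally show ?thesis .
    qed
  next
    fix A B :: "real set" and f assume A: "A \<in> sets borel" and B: "B \<in> sets borel" and f: "f \<in> L2 ?D"
    have f': "(\<lambda>x. f (\<theta> x)) \<in> L2 ?C" using f L2(1)[of f] by simp
    show "AE x in ?D. E' (A \<inter> B) f x = E' A (E' B f) x"
    proof (rule AE_I2)
      fix y assume "y \<in> space ?D"
      then have y: "\<eta> y \<in> ?X" by (simp add: \<eta>X)
      have "E' A (E' B f) y = E A (\<lambda>x. E' B f (\<theta> x)) (\<eta> y)" by (simp add: E'_def)
      also have "\<dots> = E A (E B (\<lambda>x. f (\<theta> x))) (\<eta> y)"
        by (rule L2_operator_cong[OF E_op[OF A] E'_L2[OF B f] _ y]) (simp add: E'\<theta>)
      also have "\<dots> = E (A \<inter> B) (\<lambda>x. f (\<theta> x)) (\<eta> y)"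
        using E A B f' y by (auto simp: AE_count_space)
      finally show "E' (A \<inter> B) f y = E' A (E' B f) y" by (simp add: E'_def)
    qed
  next
    fix f assume f: "f \<in> L2 ?D"
    have f': "(\<lambda>x. f (\<theta> x)) \<in> L2 ?C" using f L2(1)[of f] by simp
    show "AE x in ?D. E' UNIV f x = f x"
    proof (rule AE_I2)
      fix y assume "y \<in> space ?D"
      then have y: "y \<in> ?Y" by simp
      have "E UNIV (\<lambda>x. f (\<theta> x)) (\<eta> y) = f (\<theta> (\<eta> y))"
        using E f' \<eta>X[OF y] by (auto simp: AE_count_space)
      then show "E' UNIV f y = f y" by (simp add: E'_def \<theta>\<eta>[OF y])
    qed
    obtain m where m: "finite_measure m" "sets m = sets borel" "integrable m (\<lambda>t. t)"
        "\<And>B. B \<in> sets borel \<Longrightarrow> L2_inner ?C (E B (\<lambda>x. f (\<theta> x))) (\<lambda>x. f (\<theta> x)) = complex_of_real (measure m B)"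
        "L2_inner ?C (cayley_markov \<Lambda> S (\<lambda>x. f (\<theta> x))) (\<lambda>x. f (\<theta> x)) = complex_of_real (LINT t|m. t)"
      using E f' by blast
    have "L2_inner ?D (cayley_markov \<Lambda>' (\<theta> ` S) f) f = L2_inner ?C (cayley_markov \<Lambda> S (\<lambda>x. f (\<theta> x))) (\<lambda>x. f (\<theta> x))"
      unfolding L2(2)[of _ f] by (intro L2_inner_cong) (auto simp: T)
    then show "\<exists>m. finite_measure m \<and> sets m = sets borel \<and>
        (\<forall>B\<in>sets borel. L2_inner ?D (E' B f) f = complex_of_real (measure m B)) \<and> integrable m (\<lambda>t. t) \<and>
        L2_inner ?D (cayley_markov \<Lambda>' (\<theta> ` S) f) f = complex_of_real (LINT t|m. t)"
      using m by (intro exI[of _ m]) (simp add: inner)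
  qed
  have one: "\<theta> x = \<one>\<^bsub>\<Lambda>'\<^esub> \<longleftrightarrow> x = \<one>\<^bsub>\<Lambda>\<^esub>" if "x \<in> ?X" for x
    using bij that hom_one[OF hom \<open>group \<Lambda>\<close> \<open>group \<Lambda>'\<close>] by (metis L.one_closed \<eta>\<theta>)
  have "?\<delta> = point_mass \<one>\<^bsub>\<Lambda>\<^esub>" by (simp add: point_mass_def fun_eq_iff)
  then have \<delta>L: "?\<delta> \<in> L2 ?C" using point_mass_L2[of "\<one>\<^bsub>\<Lambda>\<^esub>" ?X] by simp
  have "complex_of_real (measure \<mu> B) = L2_inner ?D (E' B ?\<delta>') ?\<delta>'" if B: "B \<in> sets borel" for B
  proof -
    have "L2_inner ?D (E' B ?\<delta>') ?\<delta>' = L2_inner ?C (E B ?\<delta>) ?\<delta>"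
      unfolding inner
    proof (rule L2_inner_cong)
      fix x assume "x \<in> space ?C"
      then have x: "x \<in> ?X" by simp
      show "?\<delta>' (\<theta> x) = ?\<delta> x" by (simp add: one[OF x])
      show "E B (\<lambda>x. ?\<delta>' (\<theta> x)) x = E B ?\<delta> x"
        by (rule L2_operator_cong[OF E_op[OF B] \<delta>L _ x, symmetric]) (simp add: one)
    qed
    then show ?thesis using \<mu>[OF B] by simp
  qed
  then show ?thesis
    using K sp unfolding is_Kesten_spectral_measure_def Let_def by blast
qed

section \<open>Translations, lamps, and the isomorphism with the wreath product\<close>

section \<open>The abelian case\<close>

locale abelian_cayley_group = cayley_group G + comm_group G for G (structure)
begin

abbreviation pmult :: "'a list \<Rightarrow> 'a list \<Rightarrow> 'a list" where
  "pmult \<equiv> map2 (\<otimes>)"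

abbreviation ones :: "nat \<Rightarrow> 'a list" where
  "ones m \<equiv> replicate m \<one>"

lemma ones_words: "ones m \<in> words"
  by (simp add: replicate_words)

lemma pmult_words: "u \<in> words \<Longrightarrow> v \<in> words \<Longrightarrow> pmult u v \<in> words"
  by (auto simp: in_lists_conv_set dest: set_zip_leftD set_zip_rightD)

lemma pmult_ones: "u \<in> words \<Longrightarrow> length u = m \<Longrightarrow> pmult (ones m) u = u" "u \<in> words \<Longrightarrow> length u = m \<Longrightarrow> pmult u (ones m) = u"
  by (rule nth_equalityI; auto simp: in_lists_conv_set)+

lemma pmult_assoc:
  assumes "u \<in> words" "v \<in> words" "w \<in> words" "length u = length v" "length v = length w"
  shows "pmult (pmult u v) w = pmult u (pmult v w)"
  using assms by (intro nth_equalityI) (auto simp: in_lists_conv_set m_assoc)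

lemma pmult_commute:
  assumes "u \<in> words" "v \<in> words" "length u = length v"
  shows "pmult u v = pmult v u"
  using assms by (intro nth_equalityI) (auto simp: in_lists_conv_set m_comm)

text \<open>Partial products are multiplicative in a commutative group. For g = h = 1 this makes
  \<open>X\<close> an automorphism of the words of each length under pointwise multiplication, so
  that conjugation by it preserves translations.\<close>

lemma fwd_pmult:
  assumes "g \<in> carrier G" "h \<in> carrier G" "u \<in> words" "v \<in> words" "length u = length v"
  shows "fwd (g \<otimes> h) (pmult u v) = pmult (fwd g u) (fwd h v)"
  using assms(5,1-4)
proof (induction u v arbitrary: g h rule: list_induct2)
  case (Cons x xs y ys)
  then have "(g \<otimes> h) \<otimes> (x \<otimes> y) = (g \<otimes> x) \<otimes> (h \<otimes> y)" by (simp add: m_ac)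
  then show ?case using Cons by simp
qed simp

lemma bwd_pmult:
  assumes "g \<in> carrier G" "h \<in> carrier G" "u \<in> words" "v \<in> words" "length u = length v"
  shows "bwd (g \<otimes> h) (pmult u v) = pmult (bwd g u) (bwd h v)"
  using assms(5,1-4) by (induction u v arbitrary: g h rule: list_induct2) (auto simp: m_ac inv_mult)

lemma fwd_ones: "g \<in> carrier G \<Longrightarrow> fwd g (ones m) = replicate m g"
  by (induction m) auto

lemma bwd_ones: "bwd \<one> (ones m) = ones m"
  by (induction m) auto

subsection \<open>Translations\<close>

text \<open>Multiplication by a fixed sequence; the sequence is read off from the images of the
  trivial words, so that no separate parameter has to be carried along.\<close>

definition translation_set :: "('a list \<Rightarrow> 'a list) set" where
  "translation_set = {\<gamma> \<in> carrier \<Gamma>. \<forall>u\<in>words. \<gamma> u = pmult (\<gamma> (ones (length u))) u}"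

lemma translations_\<Gamma>: "\<gamma> \<in> translation_set \<Longrightarrow> \<gamma> \<in> carrier \<Gamma>"
  by (simp add: translation_set_def)

lemma translation_apply: "\<gamma> \<in> translation_set \<Longrightarrow> u \<in> words \<Longrightarrow> length u = m \<Longrightarrow> \<gamma> u = pmult (\<gamma> (ones m)) u"
  by (auto simp: translation_set_def)

lemma translation_mult_ones:
  assumes "\<gamma> \<in> translation_set" "\<delta> \<in> carrier \<Gamma>"
  shows "(\<gamma> \<otimes>\<^bsub>\<Gamma>\<^esub> \<delta>) (ones m) = pmult (\<gamma> (ones m)) (\<delta> (ones m))"
  using assms translation_apply[OF assms(1), of "\<delta> (ones m)" m]
  by (simp add: \<Gamma>_mult_apply translations_\<Gamma> ones_words \<Gamma>_words)

lemma translation_eqI: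
  assumes "\<gamma> \<in> translation_set" "\<delta> \<in> translation_set" "\<And>m. \<gamma> (ones m) = \<delta> (ones m)"
  shows "\<gamma> = \<delta>"
proof (rule \<Gamma>_eqI)
  show "\<gamma> u = \<delta> u" if "u \<in> words" for u
    using translation_apply[OF assms(1) that refl] translation_apply[OF assms(2) that refl] assms(3) by simp
qed (use assms translations_\<Gamma> in auto)

lemma subgroup_translations: "subgroup translation_set \<Gamma>"
proof (rule \<Gamma>.subgroupI)
  have "\<one>\<^bsub>\<Gamma>\<^esub> \<in> translation_set" by (simp add: translation_set_def \<Gamma>_one_apply ones_words pmult_ones)
  then show "translation_set \<noteq> {}" by blast
  fix \<gamma> assume \<gamma>: "\<gamma> \<in> translation_set"
  note G = translations_\<Gamma>[OF \<gamma>]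
  show "inv\<^bsub>\<Gamma>\<^esub> \<gamma> \<in> translation_set"
    unfolding translation_set_def
  proof (intro CollectI conjI ballI)
    fix u assume u: "u \<in> words"
    let ?m = "length u"
    let ?v = "(inv\<^bsub>\<Gamma>\<^esub> \<gamma>) (ones ?m)"
    have v: "?v \<in> words" "length ?v = ?m" using G by (auto simp: \<Gamma>_words ones_words)
    have c: "\<gamma> (ones ?m) \<in> words" "length (\<gamma> (ones ?m)) = ?m" using G by (auto simp: \<Gamma>_words ones_words)
    have "\<gamma> (pmult ?v u) = pmult (\<gamma> (ones ?m)) (pmult ?v u)"
      using v u by (intro translation_apply[OF \<gamma>]) (auto simp: pmult_words)
    also have "\<dots> = pmult (pmult (\<gamma> (ones ?m)) ?v) u" using c v u by (subst pmult_assoc) auto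
    also have "pmult (\<gamma> (ones ?m)) ?v = \<gamma> ?v" using translation_apply[OF \<gamma> v] by simp
    also have "\<gamma> ?v = ones ?m" using G by (simp add: ones_words)
    finally have "\<gamma> (pmult ?v u) = u" using u by (simp add: pmult_ones)
    then have "(inv\<^bsub>\<Gamma>\<^esub> \<gamma>) u = (inv\<^bsub>\<Gamma>\<^esub> \<gamma>) (\<gamma> (pmult ?v u))" by simp
    also have "\<dots> = pmult ?v u" using G v u by (intro \<Gamma>_inv_apply) (auto simp: pmult_words)
    finally show "(inv\<^bsub>\<Gamma>\<^esub> \<gamma>) u = pmult ?v u" .
  qed (use G in simp)
  fix \<delta> assume \<delta>: "\<delta> \<in> translation_set"
  note D = translations_\<Gamma>[OF \<delta>]
  show "\<gamma> \<otimes>\<^bsub>\<Gamma>\<^esub> \<delta> \<in> translation_set"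
    unfolding translation_set_def
  proof (intro CollectI conjI ballI)
    fix u assume u: "u \<in> words"
    let ?m = "length u"
    have c: "\<gamma> (ones ?m) \<in> words" "length (\<gamma> (ones ?m)) = ?m" "\<delta> (ones ?m) \<in> words" "length (\<delta> (ones ?m)) = ?m"
      using G D by (auto simp: \<Gamma>_words ones_words)
    have "(\<gamma> \<otimes>\<^bsub>\<Gamma>\<^esub> \<delta>) u = \<gamma> (\<delta> u)" using G D u by (simp add: \<Gamma>_mult_apply)
    also have "\<dots> = pmult (\<gamma> (ones ?m)) (\<delta> u)"
      using D u by (intro translation_apply[OF \<gamma>]) (auto simp: \<Gamma>_words)
    also have "\<delta> u = pmult (\<delta> (ones ?m)) u" by (rule translation_apply[OF \<delta> u refl])
    also have "pmult (\<gamma> (ones ?m)) \<dots> = pmult (pmult (\<gamma> (ones ?m)) (\<delta> (ones ?m))) u"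
      using c u by (subst pmult_assoc) auto
    also have "\<dots> = pmult ((\<gamma> \<otimes>\<^bsub>\<Gamma>\<^esub> \<delta>) (ones ?m)) u" by (simp only: translation_mult_ones[OF \<gamma> D])
    finally show "(\<gamma> \<otimes>\<^bsub>\<Gamma>\<^esub> \<delta>) u = pmult ((\<gamma> \<otimes>\<^bsub>\<Gamma>\<^esub> \<delta>) (ones ?m)) u" .
  qed (use G D in simp)
qed (auto simp: translations_\<Gamma>)

abbreviation Trans :: "('a list \<Rightarrow> 'a list) monoid" where
  "Trans \<equiv> \<Gamma>\<lparr>carrier := translation_set\<rparr>"

sublocale Trans: comm_group Trans
proof -
  interpret T: group Trans
    by (rule subgroup.subgroup_is_group[OF subgroup_translations]) (rule \<Gamma>.is_group)
  show "comm_group Trans"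
  proof (rule T.group_comm_groupI)
    fix \<gamma> \<delta> assume *: "\<gamma> \<in> carrier Trans" "\<delta> \<in> carrier Trans"
    then have "\<gamma> \<otimes>\<^bsub>\<Gamma>\<^esub> \<delta> = \<delta> \<otimes>\<^bsub>\<Gamma>\<^esub> \<gamma>"
    proof (intro translation_eqI)
      show "(\<gamma> \<otimes>\<^bsub>\<Gamma>\<^esub> \<delta>) (ones m) = (\<delta> \<otimes>\<^bsub>\<Gamma>\<^esub> \<gamma>) (ones m)" for m
        using * translations_\<Gamma>
        by (simp add: translation_mult_ones) (intro pmult_commute, auto simp: \<Gamma>_words ones_words)
    qed (auto intro: subgroup.m_closed[OF subgroup_translations])
    then show "\<gamma> \<otimes>\<^bsub>Trans\<^esub> \<delta> = \<delta> \<otimes>\<^bsub>Trans\<^esub> \<gamma>" by simp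
  qed
qed

lemma translations_conj_X:
  assumes \<gamma>: "\<gamma> \<in> translation_set"
  shows "X \<otimes>\<^bsub>\<Gamma>\<^esub> \<gamma> \<otimes>\<^bsub>\<Gamma>\<^esub> inv\<^bsub>\<Gamma>\<^esub> X \<in> translation_set" "inv\<^bsub>\<Gamma>\<^esub> X \<otimes>\<^bsub>\<Gamma>\<^esub> \<gamma> \<otimes>\<^bsub>\<Gamma>\<^esub> X \<in> translation_set"
proof -
  note G = translations_\<Gamma>[OF \<gamma>]
  let ?a = "X \<otimes>\<^bsub>\<Gamma>\<^esub> \<gamma> \<otimes>\<^bsub>\<Gamma>\<^esub> inv\<^bsub>\<Gamma>\<^esub> X" and ?b = "inv\<^bsub>\<Gamma>\<^esub> X \<otimes>\<^bsub>\<Gamma>\<^esub> \<gamma> \<otimes>\<^bsub>\<Gamma>\<^esub> X"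
  have a: "?a u = fwd \<one> (\<gamma> (bwd \<one> u))" if "u \<in> words" for u
    using G that by (simp add: \<Gamma>_mult_apply \<Gamma>_words inv_cay_apply cay_apply bwd_words)
  have b: "?b u = bwd \<one> (\<gamma> (fwd \<one> u))" if "u \<in> words" for u
    using G that by (simp add: \<Gamma>_mult_apply \<Gamma>_words inv_cay_apply cay_apply fwd_words)
  have "?a u = pmult (?a (ones (length u))) u" "?b u = pmult (?b (ones (length u))) u" if u: "u \<in> words" for u
  proof -
    let ?c = "\<gamma> (ones (length u))"
    have c: "?c \<in> words" "length ?c = length u" using G by (auto simp: \<Gamma>_words ones_words)
    have "\<gamma> (bwd \<one> u) = pmult ?c (bwd \<one> u)" "\<gamma> (fwd \<one> u) = pmult ?c (fwd \<one> u)"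
      using u by (auto intro!: translation_apply[OF \<gamma>] simp: bwd_words fwd_words)
    then show "?a u = pmult (?a (ones (length u))) u" "?b u = pmult (?b (ones (length u))) u"
      using u c fwd_pmult[of \<one> \<one> ?c "bwd \<one> u"] bwd_pmult[of \<one> \<one> ?c "fwd \<one> u"]
      by (simp_all add: a b ones_words bwd_ones fwd_ones bwd_words fwd_words bwd_fwd fwd_bwd)
  qed
  then show "?a \<in> translation_set" "?b \<in> translation_set" using G by (auto simp: translation_set_def)
qed

definition conjX :: "int \<Rightarrow> ('a list \<Rightarrow> 'a list) \<Rightarrow> 'a list \<Rightarrow> 'a list" where
  "conjX k \<gamma> = X [^]\<^bsub>\<Gamma>\<^esub> k \<otimes>\<^bsub>\<Gamma>\<^esub> \<gamma> \<otimes>\<^bsub>\<Gamma>\<^esub> X [^]\<^bsub>\<Gamma>\<^esub> (- k)"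

lemma X_\<Gamma>: "X \<in> carrier \<Gamma>" by simp

lemma conjX_0: "\<gamma> \<in> carrier \<Gamma> \<Longrightarrow> conjX 0 \<gamma> = \<gamma>"
  by (simp add: conjX_def)

lemma conjX_add:
  assumes "\<gamma> \<in> carrier \<Gamma>"
  shows "conjX (k + l) \<gamma> = conjX k (conjX l \<gamma>)"
proof -
  have "X [^]\<^bsub>\<Gamma>\<^esub> (- (k + l)) = X [^]\<^bsub>\<Gamma>\<^esub> (- l) \<otimes>\<^bsub>\<Gamma>\<^esub> X [^]\<^bsub>\<Gamma>\<^esub> (- k)"
    using \<Gamma>.int_pow_mult[OF X_\<Gamma>, of "- l" "- k"] by (simp add: add.commute)
  then show ?thesis using assms \<Gamma>.int_pow_mult[OF X_\<Gamma>, of k l]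
    by (simp add: conjX_def \<Gamma>.m_assoc)
qed

lemma conjX_mult:
  assumes "\<gamma> \<in> carrier \<Gamma>" "\<delta> \<in> carrier \<Gamma>"
  shows "conjX k (\<gamma> \<otimes>\<^bsub>\<Gamma>\<^esub> \<delta>) = conjX k \<gamma> \<otimes>\<^bsub>\<Gamma>\<^esub> conjX k \<delta>"
proof -
  have "X [^]\<^bsub>\<Gamma>\<^esub> (- k) \<otimes>\<^bsub>\<Gamma>\<^esub> (X [^]\<^bsub>\<Gamma>\<^esub> k \<otimes>\<^bsub>\<Gamma>\<^esub> (\<delta> \<otimes>\<^bsub>\<Gamma>\<^esub> X [^]\<^bsub>\<Gamma>\<^esub> (- k))) = \<delta> \<otimes>\<^bsub>\<Gamma>\<^esub> X [^]\<^bsub>\<Gamma>\<^esub> (- k)"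
    using assms by (simp add: \<Gamma>.int_pow_neg \<Gamma>.inv_solve_left')
  then show ?thesis using assms by (simp add: conjX_def \<Gamma>.m_assoc)
qed

lemma conjX_one: "conjX k \<one>\<^bsub>\<Gamma>\<^esub> = \<one>\<^bsub>\<Gamma>\<^esub>"
  by (simp add: conjX_def \<Gamma>.int_pow_neg)

lemma conjX_translations: assumes \<gamma>: "\<gamma> \<in> translation_set" shows "conjX k \<gamma> \<in> translation_set"
proof (induction k rule: int_induct[where k = 0])
  case base
  show ?case using \<gamma> by (simp add: conjX_0 translations_\<Gamma>)
next
  case (step1 i)
  have "conjX (1 + i) \<gamma> = X \<otimes>\<^bsub>\<Gamma>\<^esub> conjX i \<gamma> \<otimes>\<^bsub>\<Gamma>\<^esub> inv\<^bsub>\<Gamma>\<^esub> X"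
    using \<gamma> translations_\<Gamma> by (simp add: conjX_add conjX_def[of 1] \<Gamma>.int_pow_neg)
  then show ?case using translations_conj_X(1)[OF step1(2)] by (simp add: add.commute)
next
  case (step2 i)
  have "conjX (- 1 + i) \<gamma> = inv\<^bsub>\<Gamma>\<^esub> X \<otimes>\<^bsub>\<Gamma>\<^esub> conjX i \<gamma> \<otimes>\<^bsub>\<Gamma>\<^esub> X"
    using \<gamma> translations_\<Gamma> by (simp only: conjX_add conjX_def[of "- 1"]) (simp add: \<Gamma>.int_pow_neg)
  then show ?case using translations_conj_X(2)[OF step2(2)] by simp
qed

subsection \<open>Lamps\<close>

definition lamp :: "int \<Rightarrow> 'a \<Rightarrow> 'a list \<Rightarrow> 'a list" where
  "lamp i g = conjX i (cay g \<otimes>\<^bsub>\<Gamma>\<^esub> inv\<^bsub>\<Gamma>\<^esub> X)"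

lemma base_lamp_ones: "g \<in> carrier G \<Longrightarrow> (cay g \<otimes>\<^bsub>\<Gamma>\<^esub> inv\<^bsub>\<Gamma>\<^esub> X) (ones m) = replicate m g"
  by (simp add: \<Gamma>_mult_apply ones_words inv_cay_apply bwd_ones cay_apply fwd_ones)

lemma base_lamp_translations: assumes g: "g \<in> carrier G" shows "cay g \<otimes>\<^bsub>\<Gamma>\<^esub> inv\<^bsub>\<Gamma>\<^esub> X \<in> translation_set"
proof -
  have "(cay g \<otimes>\<^bsub>\<Gamma>\<^esub> inv\<^bsub>\<Gamma>\<^esub> X) u = pmult (replicate (length u) g) u" if u: "u \<in> words" for u
    using fwd_pmult[of g \<one> "ones (length u)" "bwd \<one> u"] u g
    by (simp add: \<Gamma>_mult_apply inv_cay_apply cay_apply bwd_words fwd_ones fwd_bwd ones_words pmult_ones)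
  then show ?thesis using g by (simp add: translation_set_def base_lamp_ones)
qed

lemma lamp_translations: "g \<in> carrier G \<Longrightarrow> lamp i g \<in> translation_set"
  by (simp add: lamp_def conjX_translations base_lamp_translations)

lemma lamp_\<Gamma>: "g \<in> carrier G \<Longrightarrow> lamp i g \<in> carrier \<Gamma>"
  by (simp add: lamp_translations translations_\<Gamma>)

lemma lamp_mult:
  assumes "g \<in> carrier G" "h \<in> carrier G"
  shows "lamp i (g \<otimes> h) = lamp i g \<otimes>\<^bsub>\<Gamma>\<^esub> lamp i h"
proof -
  let ?\<alpha> = "\<lambda>g. cay g \<otimes>\<^bsub>\<Gamma>\<^esub> inv\<^bsub>\<Gamma>\<^esub> X"
  have "?\<alpha> (g \<otimes> h) = ?\<alpha> g \<otimes>\<^bsub>\<Gamma>\<^esub> ?\<alpha> h"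
  proof (rule translation_eqI)
    show "?\<alpha> g \<otimes>\<^bsub>\<Gamma>\<^esub> ?\<alpha> h \<in> translation_set"
      using assms by (intro subgroup.m_closed[OF subgroup_translations] base_lamp_translations)
    have "(?\<alpha> g \<otimes>\<^bsub>\<Gamma>\<^esub> ?\<alpha> h) (ones m) = pmult (?\<alpha> g (ones m)) (?\<alpha> h (ones m))" for m
      using assms by (intro translation_mult_ones base_lamp_translations) auto
    then show "?\<alpha> (g \<otimes> h) (ones m) = (?\<alpha> g \<otimes>\<^bsub>\<Gamma>\<^esub> ?\<alpha> h) (ones m)" for m
      using assms by (simp add: base_lamp_ones zip_replicate)
  qed (use assms base_lamp_translations in auto)
  then show ?thesis using assms by (simp add: lamp_def conjX_mult)
qed

lemma lamp_one: "lamp i \<one> = \<one>\<^bsub>\<Gamma>\<^esub>"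
  by (simp add: lamp_def conjX_one)

lemma conjX_lamp: "g \<in> carrier G \<Longrightarrow> conjX k (lamp i g) = lamp (i + k) g"
  by (simp add: lamp_def add.commute[of i] conjX_add)

definition lamps :: "(int \<Rightarrow> 'a) \<Rightarrow> 'a list \<Rightarrow> 'a list" where
  "lamps f = finprod Trans (\<lambda>i. lamp i (f i)) {i. f i \<noteq> \<one>}"

abbreviation configs :: "(int \<Rightarrow> 'a) set" where
  "configs \<equiv> {f. (\<forall>i. f i \<in> carrier G) \<and> finite {i. f i \<noteq> \<one>}}"

lemma finprod_lamps_closed:
  assumes "\<And>i. f i \<in> carrier G" shows "finprod Trans (\<lambda>i. lamp (s i) (f i)) I \<in> translation_set"
  using Trans.finprod_closed[of "\<lambda>i. lamp (s i) (f i)" I] assms by (simp add: Pi_iff lamp_translations)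

lemma lamps_superset:
  assumes f: "\<And>i. f i \<in> carrier G" and I: "finite I" "{i. f i \<noteq> \<one>} \<subseteq> I"
  shows "lamps f = finprod Trans (\<lambda>i. lamp i (f i)) I"
  unfolding lamps_def using assms
  by (intro Trans.finprod_mono_neutral_cong_left) (auto simp: lamp_one lamp_translations)

lemma lamps_translations: "f \<in> configs \<Longrightarrow> lamps f \<in> translation_set"
  unfolding lamps_def by (intro finprod_lamps_closed) auto

lemma lamps_mult:
  assumes f: "f \<in> configs" and h: "h \<in> configs"
  shows "lamps (\<lambda>i. f i \<otimes> h i) = lamps f \<otimes>\<^bsub>\<Gamma>\<^esub> lamps h"
proof -
  let ?I = "{i. f i \<noteq> \<one>} \<union> {i. h i \<noteq> \<one>}"
  have "lamps (\<lambda>i. f i \<otimes> h i) = finprod Trans (\<lambda>i. lamp i (f i \<otimes> h i)) ?I"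
    using f h by (intro lamps_superset) auto
  also have "\<dots> = finprod Trans (\<lambda>i. lamp i (f i) \<otimes>\<^bsub>Trans\<^esub> lamp i (h i)) ?I"
    using f h by (intro Trans.finprod_cong) (auto simp: lamp_mult simp_implies_def lamp_translations
      intro!: subgroup.m_closed[OF subgroup_translations])
  also have "\<dots> = finprod Trans (\<lambda>i. lamp i (f i)) ?I \<otimes>\<^bsub>Trans\<^esub> finprod Trans (\<lambda>i. lamp i (h i)) ?I"
    using f h by (intro Trans.finprod_multf) (auto simp: lamp_translations)
  also have "\<dots> = lamps f \<otimes>\<^bsub>\<Gamma>\<^esub> lamps h"
    using f h lamps_superset[of f ?I] lamps_superset[of h ?I] by simp
  finally show ?thesis .
qed

lemma conjX_finprod:
  assumes "finite I" "\<And>i. f i \<in> carrier G"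
  shows "conjX k (finprod Trans (\<lambda>i. lamp i (f i)) I) = finprod Trans (\<lambda>i. lamp (i + k) (f i)) I"
  using assms(1)
proof induction
  case empty
  then show ?case by (simp add: conjX_one)
next
  case (insert i I)
  let ?F = "finprod Trans (\<lambda>i. lamp i (f i)) I"
  have F: "?F \<in> carrier \<Gamma>"
    by (rule translations_\<Gamma>[OF finprod_lamps_closed[OF assms(2), where s = "\<lambda>i. i"]])
  have c: "lamp l (f i) \<in> carrier Trans" for l i by (simp add: lamp_translations assms(2))
  have "finprod Trans (\<lambda>i. lamp i (f i)) (insert i I) = lamp i (f i) \<otimes>\<^bsub>Trans\<^esub> ?F"
    by (rule Trans.finprod_insert[OF insert.hyps]) (use c in auto)
  then have "conjX k (finprod Trans (\<lambda>i. lamp i (f i)) (insert i I)) = conjX k (lamp i (f i)) \<otimes>\<^bsub>\<Gamma>\<^esub> conjX k ?F"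
    using conjX_mult[OF lamp_\<Gamma>[OF assms(2)] F] by simp
  also have "\<dots> = lamp (i + k) (f i) \<otimes>\<^bsub>Trans\<^esub> finprod Trans (\<lambda>i. lamp (i + k) (f i)) I"
    by (simp only: conjX_lamp[OF assms(2)] insert.IH) simp
  also have "\<dots> = finprod Trans (\<lambda>i. lamp (i + k) (f i)) (insert i I)"
    by (rule Trans.finprod_insert[OF insert.hyps, symmetric]) (use c in auto)
  finally show ?case .
qed

lemma configs_shift:
  assumes "f \<in> configs" shows "(\<lambda>i. f (i - k)) \<in> configs"
proof -
  have "{i. f (i - k) \<noteq> \<one>} = (\<lambda>i. i + k) ` {i. f i \<noteq> \<one>}"
    by (auto simp: image_iff) (metis diff_add_cancel)
  then show ?thesis using assms by simp
qed

text \<open>Each lamp moves by k under conjugation, so reindexing the product turns the shift of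
  configurations, the action in the semidirect product, into conjugation by a power of
  \<open>X\<close>.\<close>

lemma lamps_shift:
  assumes f: "f \<in> configs"
  shows "lamps (\<lambda>i. f (i - k)) = conjX k (lamps f)"
proof -
  let ?I = "{i. f i \<noteq> \<one>}"
  have "{i. f (i - k) \<noteq> \<one>} = (\<lambda>i. i + k) ` ?I"
    by (auto simp: image_iff) (metis diff_add_cancel)
  then have "lamps (\<lambda>i. f (i - k)) = finprod Trans (\<lambda>i. lamp i (f (i - k))) ((\<lambda>i. i + k) ` ?I)"
    by (simp add: lamps_def)
  also have "\<dots> = finprod Trans (\<lambda>i. lamp (i + k) (f i)) ?I"
    using f by (subst Trans.finprod_reindex) (auto simp: lamp_translations inj_on_def)
  also have "\<dots> = conjX k (lamps f)"
    using f unfolding lamps_def by (intro conjX_finprod[symmetric]) auto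
  finally show ?thesis .
qed

lemma lamps_single: assumes "g \<in> carrier G" shows "lamps (\<lambda>i. if i = j then g else \<one>) = lamp j g"
proof -
  have "lamps (\<lambda>i. if i = j then g else \<one>) = finprod Trans (\<lambda>i. lamp i (if i = j then g else \<one>)) {j}"
    using assms by (intro lamps_superset) auto
  also have "\<dots> = lamp j g \<otimes>\<^bsub>\<Gamma>\<^esub> \<one>\<^bsub>\<Gamma>\<^esub>" using assms by (subst Trans.finprod_insert) (auto simp: lamp_translations)
  finally show ?thesis using assms by (simp add: lamp_\<Gamma>)
qed

subsection \<open>The isomorphism\<close>

definition wreath_map :: "(int \<Rightarrow> 'a) \<times> int \<Rightarrow> 'a list \<Rightarrow> 'a list" where
  "wreath_map y = lamps (fst y) \<otimes>\<^bsub>\<Gamma>\<^esub> X [^]\<^bsub>\<Gamma>\<^esub> snd y"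

lemma carrier_Wr': "y \<in> carrier Wr \<longleftrightarrow> fst y \<in> configs"
  by (cases y) (simp add: carrier_Wr)

lemma group_Wr: "group Wr"
proof (rule groupI)
  fix x y assume x: "x \<in> carrier Wr" and y: "y \<in> carrier Wr"
  obtain f k h l where [simp]: "x = (f, k)" "y = (h, l)" by (metis surj_pair)
  have f: "f \<in> configs" and h: "h \<in> configs" using x y by (auto simp: carrier_Wr)
  have "finite ({i. f i \<noteq> \<one>} \<union> {i. h (i - k) \<noteq> \<one>})" using f configs_shift[OF h] by simp
  then have "finite {i. f i \<otimes> h (i - k) \<noteq> \<one>}" by (rule finite_subset[rotated]) auto
  then show "x \<otimes>\<^bsub>Wr\<^esub> y \<in> carrier Wr" using f h by (simp add: mult_Wr carrier_Wr)
  show "x \<otimes>\<^bsub>Wr\<^esub> y \<otimes>\<^bsub>Wr\<^esub> z = x \<otimes>\<^bsub>Wr\<^esub> (y \<otimes>\<^bsub>Wr\<^esub> z)" if "z \<in> carrier Wr" for z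
    using that f h by (cases z) (simp add: mult_Wr carrier_Wr m_assoc fun_eq_iff algebra_simps)
next
  fix x assume x: "x \<in> carrier Wr"
  obtain f k where [simp]: "x = (f, k)" by (metis surj_pair)
  have f: "f \<in> configs" using x by (auto simp: carrier_Wr)
  show "\<one>\<^bsub>Wr\<^esub> \<otimes>\<^bsub>Wr\<^esub> x = x" using f by (simp add: one_Wr mult_Wr)
  let ?y = "(\<lambda>i. inv f (i + k), - k)"
  have "{i. inv f (i + k) \<noteq> \<one>} = {i. f (i + k) \<noteq> \<one>}" using f by auto
  then have "?y \<in> carrier Wr" using configs_shift[OF f, of "- k"] f by (simp add: carrier_Wr)
  moreover have "?y \<otimes>\<^bsub>Wr\<^esub> x = \<one>\<^bsub>Wr\<^esub>" using f by (simp add: one_Wr mult_Wr)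
  ultimately show "\<exists>y\<in>carrier Wr. y \<otimes>\<^bsub>Wr\<^esub> x = \<one>\<^bsub>Wr\<^esub>" by blast
qed (simp add: one_Wr carrier_Wr)

lemma wreath_map_\<Gamma>: "y \<in> carrier Wr \<Longrightarrow> wreath_map y \<in> carrier \<Gamma>"
  unfolding wreath_map_def carrier_Wr' by (simp add: lamps_translations translations_\<Gamma>)

lemma wreath_map_hom: "wreath_map \<in> hom Wr \<Gamma>"
proof (rule homI)
  fix x y assume x: "x \<in> carrier Wr" and y: "y \<in> carrier Wr"
  obtain f k h l where [simp]: "x = (f, k)" "y = (h, l)" by (metis surj_pair)
  have f: "f \<in> configs" and h: "h \<in> configs" using x y by (auto simp: carrier_Wr)
  have L: "lamps f \<in> carrier \<Gamma>" "lamps h \<in> carrier \<Gamma>" using lamps_translations f h translations_\<Gamma> by auto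
  have "wreath_map (x \<otimes>\<^bsub>Wr\<^esub> y) = lamps f \<otimes>\<^bsub>\<Gamma>\<^esub> conjX k (lamps h) \<otimes>\<^bsub>\<Gamma>\<^esub> X [^]\<^bsub>\<Gamma>\<^esub> (k + l)"
    using lamps_mult[OF f configs_shift[OF h]] lamps_shift[OF h] by (simp add: wreath_map_def mult_Wr)
  also have "\<dots> = lamps f \<otimes>\<^bsub>\<Gamma>\<^esub> (X [^]\<^bsub>\<Gamma>\<^esub> k \<otimes>\<^bsub>\<Gamma>\<^esub> (lamps h \<otimes>\<^bsub>\<Gamma>\<^esub> (X [^]\<^bsub>\<Gamma>\<^esub> (- k) \<otimes>\<^bsub>\<Gamma>\<^esub> X [^]\<^bsub>\<Gamma>\<^esub> (k + l))))"
    using L by (simp add: conjX_def \<Gamma>.m_assoc)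
  also have "X [^]\<^bsub>\<Gamma>\<^esub> (- k) \<otimes>\<^bsub>\<Gamma>\<^esub> X [^]\<^bsub>\<Gamma>\<^esub> (k + l) = X [^]\<^bsub>\<Gamma>\<^esub> l"
    using \<Gamma>.int_pow_mult[OF X_\<Gamma>, of "- k" "k + l"] by simp
  finally show "wreath_map (x \<otimes>\<^bsub>Wr\<^esub> y) = wreath_map x \<otimes>\<^bsub>\<Gamma>\<^esub> wreath_map y"
    using L by (simp add: wreath_map_def \<Gamma>.m_assoc)
qed (rule wreath_map_\<Gamma>)

lemma wr_gen_Wr: "g \<in> carrier G \<Longrightarrow> wr_gen g \<in> carrier Wr" "g \<in> carrier G \<Longrightarrow> wr_gen_inv g \<in> carrier Wr"
  by (auto simp: wr_gen_def wr_gen_inv_def carrier_Wr)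

lemma wr_gen_inv: "g \<in> carrier G \<Longrightarrow> wr_gen_inv g = inv\<^bsub>Wr\<^esub> (wr_gen g)"
  using group_Wr wr_gen_Wr by (intro group.inv_equality[symmetric])
    (auto simp: wr_gen_def wr_gen_inv_def mult_Wr one_Wr fun_eq_iff)

lemma wreath_map_gen: assumes "g \<in> carrier G" shows "wreath_map (wr_gen g) = cay g"
proof -
  have "lamp 0 g = cay g \<otimes>\<^bsub>\<Gamma>\<^esub> inv\<^bsub>\<Gamma>\<^esub> X" using assms by (simp add: lamp_def conjX_0)
  then show ?thesis using assms by (simp add: wreath_map_def wr_gen_def lamps_single \<Gamma>.m_assoc)
qed

lemma wreath_map_gen_inv: "g \<in> carrier G \<Longrightarrow> wreath_map (wr_gen_inv g) = inv\<^bsub>\<Gamma>\<^esub> (cay g)"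
proof -
  interpret W: group_hom Wr \<Gamma> wreath_map
    by (intro group_hom.intro group_hom_axioms.intro group_Wr wreath_map_hom \<Gamma>.is_group)
  assume g: "g \<in> carrier G"
  then show ?thesis using W.hom_inv[OF wr_gen_Wr(1)[OF g]] by (simp add: wr_gen_inv wreath_map_gen)
qed

lemma wreath_map_gens: "wreath_map ` wr_gens = S"
  by (auto simp: wr_gens_def automaton_gens_def image_Un image_image wreath_map_gen wreath_map_gen_inv
    cong: image_cong)

lemma wreath_map_surj: "wreath_map ` carrier Wr = carrier \<Gamma>"
proof
  interpret W: group_hom Wr \<Gamma> wreath_map
    by (intro group_hom.intro group_hom_axioms.intro group_Wr wreath_map_hom \<Gamma>.is_group)
  have I: "subgroup (wreath_map ` carrier Wr) \<Gamma>" by (rule W.img_is_subgroup)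
  have gen: "cay g \<in> wreath_map ` carrier Wr" if "g \<in> carrier G" for g
    using wreath_map_gen[OF that] wr_gen_Wr(1)[OF that] by (metis image_eqI)
  show "carrier \<Gamma> \<subseteq> wreath_map ` carrier Wr"
  proof
    fix \<gamma> assume "\<gamma> \<in> carrier \<Gamma>"
    then have "\<gamma> \<in> generate (BijGroup words) (cay ` carrier G)" by (simp add: carrier_\<Gamma>)
    then show "\<gamma> \<in> wreath_map ` carrier Wr"
    proof induction
      case one
      then show ?case using subgroup.one_closed[OF I] by (simp add: \<Gamma>_def')
    next
      case (incl h)
      then show ?case using gen by auto
    next
      case (inv h)
      then obtain g where g: "g \<in> carrier G" "h = cay g" by auto
      then have "inv\<^bsub>BijGroup words\<^esub> h = inv\<^bsub>\<Gamma>\<^esub> (cay g)"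
        using cay_\<Gamma>[OF g(1)] unfolding \<Gamma>_def' by (simp add: B.inv_subgroup_generated)
      then show ?case using subgroup.m_inv_closed[OF I gen[OF g(1)]] by simp
    next
      case (eng h1 h2)
      then show ?case using subgroup.m_closed[OF I] by (simp add: \<Gamma>_def')
    qed
  qed
qed (auto simp: wreath_map_\<Gamma>)

lemma X_pow_ones: "(X [^]\<^bsub>\<Gamma>\<^esub> (k :: int)) (ones m) = ones m"
proof -
  have n: "(X [^]\<^bsub>\<Gamma>\<^esub> (j :: nat)) (ones m) = ones m" for j
    by (induction j) (auto simp: \<Gamma>_one_apply ones_words \<Gamma>_mult_apply cay_apply fwd_ones)
  then have i: "(inv\<^bsub>\<Gamma>\<^esub> (X [^]\<^bsub>\<Gamma>\<^esub> (j :: nat))) (ones m) = ones m" for j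
    using \<Gamma>_inv_apply[of "X [^]\<^bsub>\<Gamma>\<^esub> j" "ones m"] by (simp add: ones_words)
  obtain j where "k = int j \<or> k = - int j" by (cases k rule: int_cases2) auto
  then show ?thesis by (auto simp: \<Gamma>.int_pow_neg int_pow_int n i)
qed

text \<open>Powers of \<open>X\<close> fix the trivial words, so a power that is a translation must
  be the identity. But the d-th power of the inverse of \<open>X\<close> moves the non-trivial
  letter of g, 1, ..., 1 to position d.\<close>

lemma X_pow_translation:
  assumes "X [^]\<^bsub>\<Gamma>\<^esub> (k :: int) \<in> translation_set" shows "k = 0"
proof (rule ccontr)
  assume k: "k \<noteq> 0"
  define d where "d = nat \<bar>k\<bar>"
  have id: "X [^]\<^bsub>\<Gamma>\<^esub> k = \<one>\<^bsub>\<Gamma>\<^esub>"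
    using assms subgroup.one_closed[OF subgroup_translations]
    by (rule translation_eqI) (simp add: X_pow_ones \<Gamma>_one_apply ones_words)
  have "X [^]\<^bsub>\<Gamma>\<^esub> d = \<one>\<^bsub>\<Gamma>\<^esub>"
  proof (cases "0 \<le> k")
    case True
    then show ?thesis using id by (simp add: d_def int_pow_int[symmetric])
  next
    case False
    then have "X [^]\<^bsub>\<Gamma>\<^esub> (- int d) = \<one>\<^bsub>\<Gamma>\<^esub>" using id by (simp add: d_def)
    then show ?thesis by (simp add: \<Gamma>.int_pow_neg int_pow_int)
  qed
  then have id': "(inv\<^bsub>\<Gamma>\<^esub> X) [^]\<^bsub>\<Gamma>\<^esub> d = \<one>\<^bsub>\<Gamma>\<^esub>" by (simp add: \<Gamma>.nat_pow_inv)
  obtain g where g: "g \<in> carrier G" "g \<noteq> \<one>" using nontrivial by blast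
  let ?u = "g # ones d"
  have "(bwd \<one> ^^ d) ?u ! (0 + d) \<noteq> \<one>"
    using g bwd_pow_support[of ?u 0 d] by (auto simp: ones_words nth_Cons')
  moreover have "(bwd \<one> ^^ d) ?u = ?u"
    using inv_X_pow_apply[of ?u d] g by (simp add: id' \<Gamma>_one_apply ones_words)
  ultimately show False using k by (simp add: nth_Cons' d_def)
qed

text \<open>The inverse of \<open>X\<close> turns the constant sequence g into g followed by units,
  and each further application moves the last non-trivial letter on by one place. Lamps with
  negative indices are therefore triangular with respect to the position of this letter.\<close>

lemma lamp_ones_letter:
  assumes g: "g \<in> carrier G" "g \<noteq> \<one>" and j: "j < m"
  shows "lamp (- 1 - int j) g (ones m) ! j \<noteq> \<one>"
    and "j < i \<Longrightarrow> i < m \<Longrightarrow> lamp (- 1 - int j) g (ones m) ! i = \<one>"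
proof -
  have rep: "bwd \<one> (replicate m g) = g # ones (m - 1)"
  proof -
    have "bwd g (replicate i g) = ones i" for i using g(1) by (induction i) auto
    then show ?thesis using j g(1) by (cases m) auto
  qed
  let ?k = "- int (Suc j)" and ?\<alpha> = "cay g \<otimes>\<^bsub>\<Gamma>\<^esub> inv\<^bsub>\<Gamma>\<^esub> X"
  have k: "- 1 - int j = ?k" by simp
  have \<alpha>: "?\<alpha> \<in> carrier \<Gamma>" using g(1) by simp
  have "lamp ?k g (ones m) = (X [^]\<^bsub>\<Gamma>\<^esub> ?k \<otimes>\<^bsub>\<Gamma>\<^esub> ?\<alpha>) ((X [^]\<^bsub>\<Gamma>\<^esub> (- ?k)) (ones m))"
    unfolding lamp_def conjX_def using \<alpha> by (intro \<Gamma>_mult_apply) (auto simp: ones_words)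
  also have "\<dots> = (X [^]\<^bsub>\<Gamma>\<^esub> ?k) (?\<alpha> (ones m))"
    unfolding X_pow_ones using \<alpha> by (intro \<Gamma>_mult_apply) (auto simp: ones_words)
  also have "?\<alpha> (ones m) = replicate m g" by (rule base_lamp_ones[OF g(1)])
  also have "X [^]\<^bsub>\<Gamma>\<^esub> (- int (Suc j)) = (inv\<^bsub>\<Gamma>\<^esub> X) [^]\<^bsub>\<Gamma>\<^esub> Suc j"
    by (simp only: \<Gamma>.int_pow_neg[OF X_\<Gamma>] int_pow_int \<Gamma>.nat_pow_inv[OF X_\<Gamma>])
  also have "\<dots> (replicate m g) = (bwd \<one> ^^ j) (g # ones (m - 1))"
    using inv_X_pow_apply[of "replicate m g" "Suc j"] g(1) rep by (simp add: replicate_words funpow_Suc_right del: funpow.simps)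
  finally have eq: "lamp (- 1 - int j) g (ones m) = (bwd \<one> ^^ j) (g # ones (m - 1))" unfolding k .
  note sup = bwd_pow_support[of "g # ones (m - 1)" 0 j]
  show "lamp (- 1 - int j) g (ones m) ! j \<noteq> \<one>"
    using sup g j unfolding eq by (auto simp: ones_words nth_Cons')
  show "lamp (- 1 - int j) g (ones m) ! i = \<one>" if "j < i" "i < m"
    using sup g j that unfolding eq by (auto simp: ones_words nth_Cons')
qed

lemma lamps_eq_one:
  assumes f: "f \<in> configs" and 1: "lamps f = \<one>\<^bsub>\<Gamma>\<^esub>"
  shows "f = (\<lambda>i. \<one>)"
proof (rule ccontr)
  assume ne: "f \<noteq> (\<lambda>i. \<one>)"
  \<comment> \<open>Conjugation by a power of \<open>X\<close> moves the largest index of the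
    support to -1, so that all lamps translate by sequences with a last non-trivial letter. The
    lowest index i0 reaches furthest, and its letter at j cannot be cancelled by the others.\<close>
  define b where "b = Max {i. f i \<noteq> \<one>}"
  define h where "h = (\<lambda>i. f (i - (- 1 - b)))"
  have hc: "h \<in> configs" unfolding h_def by (rule configs_shift[OF f])
  have h1: "lamps h = \<one>\<^bsub>\<Gamma>\<^esub>" unfolding h_def lamps_shift[OF f] 1 by (rule conjX_one)
  let ?I = "{i. h i \<noteq> \<one>}"
  have neg: "i \<le> - 1" if "i \<in> ?I" for i
  proof -
    have "i + 1 + b \<le> b" unfolding b_def using f that
      by (intro Max_ge) (auto simp: h_def b_def algebra_simps)
    then show ?thesis by simp
  qed
  obtain i where "f i \<noteq> \<one>" using ne by auto
  then have "i + (- 1 - b) \<in> ?I" by (simp add: h_def)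
  then have ne': "?I \<noteq> {}" by blast
  define i0 where "i0 = Min ?I"
  have fin: "finite ?I" using hc by simp
  have i0: "i0 \<in> ?I" unfolding i0_def using fin ne' by (rule Min_in)
  define j where "j = nat (- 1 - i0)"
  have ij: "i0 = - 1 - int j" using neg[OF i0] by (simp add: j_def)
  let ?m = "Suc j"
  have len: "length (\<gamma> (ones ?m)) = ?m" if "\<gamma> \<in> translation_set" for \<gamma>
    using that translations_\<Gamma> by (simp add: ones_words del: replicate_Suc)
  have letter: "finprod Trans (\<lambda>i. lamp i (h i)) J (ones ?m) ! j = \<one>" if "finite J" "J \<subseteq> ?I - {i0}" for J
    using that
  proof induction
    case empty
    have "ones ?m ! j = \<one>" by (simp del: replicate_Suc)
    then show ?case by (simp add: \<Gamma>_one_apply ones_words del: replicate_Suc)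
  next
    case (insert i J)
    let ?F = "finprod Trans (\<lambda>i. lamp i (h i)) J"
    have F: "?F \<in> translation_set" using finprod_lamps_closed[of h "\<lambda>i. i"] hc by simp
    have L: "lamp i (h i) \<in> translation_set" using hc by (simp add: lamp_translations)
    have "i0 \<le> i" unfolding i0_def using fin insert.prems by (intro Min_le) auto
    then have "i0 < i" using insert.prems by auto
    define j' where "j' = nat (- 1 - i)"
    have ij': "i = - 1 - int j'" using neg[of i] insert.prems by (simp add: j'_def)
    have "lamp (- 1 - int j') (h i) (ones ?m) ! j = \<one>"
      using insert.prems hc \<open>i0 < i\<close> ij ij' by (intro lamp_ones_letter(2)) auto
    then have l: "lamp i (h i) (ones ?m) ! j = \<one>" using ij' by simp
    have "finprod Trans (\<lambda>i. lamp i (h i)) (insert i J) = lamp i (h i) \<otimes>\<^bsub>\<Gamma>\<^esub> ?F"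
      using insert.hyps hc by (subst Trans.finprod_insert) (auto simp: lamp_translations)
    then show ?case using translation_mult_ones[OF L translations_\<Gamma>[OF F], of ?m] insert l len[OF L] len[OF F]
      by (simp del: replicate_Suc)
  qed
  let ?F = "finprod Trans (\<lambda>i. lamp i (h i)) (?I - {i0})"
  have F: "?F \<in> translation_set" using finprod_lamps_closed[of h "\<lambda>i. i"] hc by simp
  have L: "lamp i0 (h i0) \<in> translation_set" using hc by (simp add: lamp_translations)
  have "?I = insert i0 (?I - {i0})" using i0 by blast
  then have "lamps h = finprod Trans (\<lambda>i. lamp i (h i)) (insert i0 (?I - {i0}))" by (simp add: lamps_def)
  also have "\<dots> = lamp i0 (h i0) \<otimes>\<^bsub>\<Gamma>\<^esub> ?F"
    using fin hc by (subst Trans.finprod_insert) (auto simp: lamp_translations)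
  finally have eq: "lamp i0 (h i0) \<otimes>\<^bsub>\<Gamma>\<^esub> ?F = \<one>\<^bsub>\<Gamma>\<^esub>" unfolding h1 by (rule sym)
  have "pmult (lamp i0 (h i0) (ones ?m)) (?F (ones ?m)) = ones ?m"
    unfolding translation_mult_ones[OF L translations_\<Gamma>[OF F], symmetric] eq
    by (rule \<Gamma>_one_apply[OF ones_words])
  then have "pmult (lamp i0 (h i0) (ones ?m)) (?F (ones ?m)) ! j = ones ?m ! j" by (simp only:)
  then have "lamp i0 (h i0) (ones ?m) ! j \<otimes> ?F (ones ?m) ! j = \<one>"
    using len[OF L] len[OF F] by (simp del: replicate_Suc)
  moreover have "?F (ones ?m) ! j = \<one>" using fin by (intro letter) auto
  moreover have "lamp i0 (h i0) (ones ?m) ! j \<in> carrier G"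
  proof -
    have "lamp i0 (h i0) (ones ?m) \<in> words" using L translations_\<Gamma> \<Gamma>_words ones_words by blast
    then show ?thesis using len[OF L] by (simp add: in_lists_conv_set del: replicate_Suc)
  qed
  ultimately have "lamp i0 (h i0) (ones ?m) ! j = \<one>" by simp
  moreover have "lamp i0 (h i0) (ones ?m) ! j \<noteq> \<one>"
    unfolding ij using i0 hc ij by (intro lamp_ones_letter(1)) auto
  ultimately show False by simp
qed

lemma wreath_map_iso: "wreath_map \<in> iso Wr \<Gamma>"
proof -
  interpret W: group_hom Wr \<Gamma> wreath_map
    by (intro group_hom.intro group_hom_axioms.intro group_Wr wreath_map_hom \<Gamma>.is_group)
  have "y = \<one>\<^bsub>Wr\<^esub>" if y: "y \<in> carrier Wr" and 1: "wreath_map y = \<one>\<^bsub>\<Gamma>\<^esub>" for y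
  proof -
    obtain f k where [simp]: "y = (f, k)" by (metis surj_pair)
    have f: "f \<in> configs" using y by (simp add: carrier_Wr)
    note L = lamps_translations[OF f]
    have "lamps f \<otimes>\<^bsub>\<Gamma>\<^esub> X [^]\<^bsub>\<Gamma>\<^esub> k = \<one>\<^bsub>\<Gamma>\<^esub>" using 1 by (simp add: wreath_map_def)
    \<comment> \<open>A power of \<open>X\<close> that is a translation is trivial, and this
      separates the two factors of the semidirect product.\<close>
    then have "X [^]\<^bsub>\<Gamma>\<^esub> k = inv\<^bsub>\<Gamma>\<^esub> (lamps f)"
      using translations_\<Gamma>[OF L] by (metis \<Gamma>.int_pow_closed \<Gamma>.inv_equality \<Gamma>.inv_inv X_\<Gamma>)
    then have "X [^]\<^bsub>\<Gamma>\<^esub> k \<in> translation_set" using subgroup.m_inv_closed[OF subgroup_translations L] by simp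
    then have "k = 0" by (rule X_pow_translation)
    then have "lamps f = \<one>\<^bsub>\<Gamma>\<^esub>" using 1 translations_\<Gamma>[OF L] by (simp add: wreath_map_def)
    then show ?thesis using lamps_eq_one[OF f] \<open>k = 0\<close> by (simp add: one_Wr)
  qed
  then have "inj_on wreath_map (carrier Wr)" by (intro W.inj_iff_trivial_ker[THEN iffD2]) (auto simp: kernel_def)
  then show ?thesis using wreath_map_hom wreath_map_surj by (auto simp: iso_def bij_betw_def)
qed

end

theorem theorem5p11:
  fixes G :: "('g, 'm) monoid_scheme"
    and n :: nat
    and \<Gamma> :: "('g list \<Rightarrow> 'g list) monoid"
    and S P :: "('g list \<Rightarrow> 'g list) set"
    and w :: "nat \<Rightarrow> 'g"
  assumes "group G" and "finite (carrier G)" and "carrier G \<noteq> {\<one>\<^bsub>G\<^esub>}" and "n = Coset.order G"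
    and "\<Gamma> = automaton_group (cayley_machine G)"
    and "S = automaton_gens (cayley_machine G)"
    and "w \<in> UNIV \<rightarrow> carrier G" and "P = parabolic \<Gamma> w"
  shows
    "is_KNS_spectral_measure n \<Gamma> (prefix_stabilizer \<Gamma> w) S (cayley_machine_measure n) \<and>
    L2_spectrum (uniform_word_measure (carrier G)) (hecke S (word_rep \<Gamma>))
           = complex_of_real ` {-1..1} \<and>
    L2_spectrum (count_space (lcosets\<^bsub>\<Gamma>\<^esub> P)) (hecke S (quasi_regular_rep \<Gamma>))
           = complex_of_real ` {-1..1} \<and>
    L2_spectrum (count_space (carrier \<Gamma>)) (hecke S (left_regular_rep \<Gamma>))
           = complex_of_real ` {-1..1} \<and>
    L2_spectrum (count_space (carrier \<Gamma>)) (cayley_markov \<Gamma> S)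
           = complex_of_real ` {-1..1} \<and>
    (comm_group G \<longrightarrow>
           \<Gamma> \<cong> wreath_int G \<and>
           (\<forall>\<phi> \<in> iso \<Gamma> (wreath_int G).
              is_Kesten_spectral_measure (wreath_int G) (\<phi> ` S) (cayley_machine_measure n)))"
proof -
  interpret cayley_group G
    by (intro cayley_group.intro cayley_group_axioms.intro assms(1-3))
  have n: "n = N" using assms(4) by (simp add: Coset.order_def)
  have w: "w \<in> seqs" by (rule assms(7))
  have "wreath_int G \<cong> automaton_group (cayley_machine G) \<and>
      (\<forall>\<phi>\<in>iso (automaton_group (cayley_machine G)) (wreath_int G).
        is_Kesten_spectral_measure (wreath_int G) (\<phi> ` automaton_gens (cayley_machine G)) (cayley_machine_measure N))"
    if "comm_group G"
  proof -
    interpret comm_group G by (rule that)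
    interpret abelian_cayley_group G ..
    show ?thesis
    proof (intro conjI ballI)
      show "wreath_int G \<cong> automaton_group (cayley_machine G)"
        using wreath_map_iso by (auto simp: is_iso_def)
      fix \<phi> assume \<phi>: "\<phi> \<in> iso (automaton_group (cayley_machine G)) (wreath_int G)"
      have "wr_gens \<subseteq> carrier (wreath_int G)" using wr_gen_Wr by (auto simp: wr_gens_def)
      \<comment> \<open>The isomorphism \<open>\<phi>\<close> is arbitrary, but composed with
        \<open>wreath_map\<close> it is an automorphism of the wreath product, along which the
        Kesten measure is transported from \<open>wr_gens\<close> to the image of
        \<open>S\<close>.\<close>
      with Kesten_wreath iso_set_trans[OF wreath_map_iso \<phi>] group_Wr group_Wr
      have "is_Kesten_spectral_measure (wreath_int G) ((\<phi> \<circ> wreath_map) ` wr_gens) (cayley_machine_measure N)"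
        by (rule Kesten_transport)
      then show "is_Kesten_spectral_measure (wreath_int G) (\<phi> ` automaton_gens (cayley_machine G)) (cayley_machine_measure N)"
        by (simp only: image_comp[symmetric] wreath_map_gens)
    qed
  qed
  moreover have "automaton_group (cayley_machine G) \<cong> wreath_int G"
    if "comm_group G" "wreath_int G \<cong> automaton_group (cayley_machine G)"
  proof -
    interpret comm_group G by (rule that)
    interpret abelian_cayley_group G ..
    show ?thesis by (rule group.iso_sym[OF group_Wr that(2)])
  qed
  ultimately show ?thesis
    unfolding assms(5,6,8) n
    using KNS[OF w] boundary_spectrum quasi_regular_spectrum[OF w] group_walk_spectrum
    by (simp add: hecke_left_regular cayley_markov_walk)
qed

end
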